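(* Let $X$ and $Y$ be two (connected) strata in $\mathbb{R}^n$, with $X\subset\mathrm{cl}(Y)\setminus Y$, which are definable in an o-minimal structure. Assume that $\dim Y=\dim X+1$ and that $(Y,X)$ satisfies $(a)$ and $(r_{\int})$. Then $X\cup Y$ is a $C^1$ manifold with boundary.
   Context: Strata are differentiable submanifolds of $\mathbb{R}^n$ of class $C^k$, $k\ge 2$. The o-minimal structure is arbitrary (not necessarily polynomially bounded). For linear subspaces $E,F$ of $\mathbb{R}^n$ set $\delta(E,F)=\sup_{u\in E,|u|=1}d(u,F)$. Condition $(a)$ at $x_0\in X$: $\delta(T_{\pi(y)}X,T_yY)\to 0$ as $y\to x_0$, $y\in Y$, where $\pi$ is a local retraction onto $X$. Condition $(r_{\int})$ at $x_0\in X$: working in a local coordinate system at $x_0$, identify $x_0$ with the origin and $X$ with a neighbourhood of the origin in $\mathbb{R}^k\times 0$, $k=\dim X$, and let $\pi:\mathbb{R}^n\to\mathbb{R}^k$ be the orthogonal projection. For small $t>0$ set $$r(t)=\sup_{|\pi(y)|=t}\frac{\delta(X,T_yY)}{|y-\pi(y)|},$$ the supremum being over $y\in Y$ near the origin, where $X$ is identified with its tangent space $\mathbb{R}^k\times 0$. Then $(r_{\int})$ holds at $x_0$ if $\int_{[0,\varepsilon]}r(t)\,dt<\infty$ for some $\varepsilon>0$. The pair $(Y,X)$ satisfies $(a)$ (resp. $(r_{\int})$) if it does so at every point of $X$.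
   Formalization: Two hypotheses are added, without which the claim fails: the germ of Y at each point of X is connected (else a teardrop with a corner at X is a counterexample), and X is open in cl(Y)\Y (else Y={0<s<|x|^2} over X=R^2 is one). O-minimal structures expand the real field. *)

theory Defs
  imports "HOL-Analysis.Analysis"
begin

section \<open>O-minimal structures\<close>

text \<open>
  O-minimal structures expanding the ordered real field.  A point of \<open>\<real>\<close>-to-the-\<open>n\<close> is a list of
  length \<open>n\<close>, since all \<open>n\<close> have to be treated at once.  Singletons, hence all real
  parameters, are definable by the last axiom.
\<close>

locale o_minimal_structure =
  fixes S :: "nat \<Rightarrow> real list set set"
  assumes length_definable: "A \<in> S n \<Longrightarrow> xs \<in> A \<Longrightarrow> length xs = n"
    and space_definable: "{xs. length xs = n} \<in> S n"
    and Un_definable: "A \<in> S n \<Longrightarrow> B \<in> S n \<Longrightarrow> A \<union> B \<in> S n"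
    and Diff_definable: "A \<in> S n \<Longrightarrow> B \<in> S n \<Longrightarrow> A - B \<in> S n"
    and Cons_definable: "A \<in> S n \<Longrightarrow> {x # xs | x xs. xs \<in> A} \<in> S (Suc n)"
    and snoc_definable: "A \<in> S n \<Longrightarrow> {xs @ [x] | xs x. xs \<in> A} \<in> S (Suc n)"
    and diagonal_definable:
      "i < j \<Longrightarrow> j < n \<Longrightarrow> {xs. length xs = n \<and> xs ! i = xs ! j} \<in> S n"
    and projection_definable: "A \<in> S (Suc n) \<Longrightarrow> butlast ` A \<in> S n"
    and add_definable: "{[x, y, x + y] | x y. True} \<in> S 3"
    and mult_definable: "{[x, y, x * y] | x y. True} \<in> S 3"
    and o_minimal: "(\<lambda>x. [x]) ` J \<in> S 1 \<longleftrightarrow>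
      (\<exists>F. finite F \<and> (\<forall>I\<in>F. is_interval I) \<and> J = \<Union>F)"

text \<open>
  The index type \<open>'n\<close> carries no order, so coordinates are enumerated by some bijection \<open>e\<close>.
  The choice is immaterial, as structures are closed under permutation of coordinates.
\<close>

definition definable :: "(nat \<Rightarrow> real list set set) \<Rightarrow> (real ^ 'n) set \<Rightarrow> bool" where
  "definable S A \<longleftrightarrow> (\<exists>e. bij_betw e {..<CARD('n)} (UNIV :: 'n set) \<and>
     (\<lambda>x. map (\<lambda>i. x $ e i) [0..<CARD('n)]) ` A \<in> S CARD('n))"


section \<open>Submanifolds\<close>

fun C_k_on :: "nat \<Rightarrow> ('a::real_normed_vector \<Rightarrow> 'b::real_normed_vector) \<Rightarrow> 'a set \<Rightarrow> bool" where
  "C_k_on 0 f U \<longleftrightarrow> continuous_on U f"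
| "C_k_on (Suc k) f U \<longleftrightarrow> (\<forall>x\<in>U. f differentiable (at x)) \<and>
     (\<forall>v. C_k_on k (\<lambda>x. frechet_derivative f (at x) v) U)"

definition C_k_diffeo ::
  "nat \<Rightarrow> 'a::real_normed_vector set \<Rightarrow> 'b::real_normed_vector set \<Rightarrow> ('a \<Rightarrow> 'b) \<Rightarrow> ('b \<Rightarrow> 'a) \<Rightarrow> bool"
where
  "C_k_diffeo k U V f g \<longleftrightarrow>
     open U \<and> open V \<and> homeomorphism U V f g \<and> C_k_on k f U \<and> C_k_on k g V"

text \<open>\<open>coord_plane I\<close> is the coordinate subspace written \<open>\<real>\<close>-to-the-\<open>d\<close> times \<open>0\<close> (up to a
  permutation of the coordinates), where \<open>d = card I\<close>.\<close>

definition coord_plane :: "'n set \<Rightarrow> (real ^ 'n) set" where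
  "coord_plane I = {x. \<forall>i. i \<notin> I \<longrightarrow> x $ i = 0}"

definition coord_proj :: "'n set \<Rightarrow> real ^ 'n \<Rightarrow> real ^ 'n" where
  "coord_proj I x = (\<chi> i. if i \<in> I then x $ i else 0)"

definition coord_half_plane :: "'n set \<Rightarrow> 'n \<Rightarrow> (real ^ 'n) set" where
  "coord_half_plane I j = {x \<in> coord_plane I. 0 \<le> x $ j}"

text \<open>Local coordinates of the ambient space in which \<open>M\<close> becomes the model set \<open>E\<close>.\<close>

definition flattens ::
  "nat \<Rightarrow> (real ^ 'n) set \<Rightarrow> (real ^ 'n) set \<Rightarrow> (real ^ 'n) set \<Rightarrow> (real ^ 'n) set
    \<Rightarrow> (real ^ 'n \<Rightarrow> real ^ 'n) \<Rightarrow> (real ^ 'n \<Rightarrow> real ^ 'n) \<Rightarrow> bool"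
where
  "flattens k M E U V f g \<longleftrightarrow> C_k_diffeo k U V f g \<and> f ` (U \<inter> M) = V \<inter> E"

definition submanifold :: "nat \<Rightarrow> nat \<Rightarrow> (real ^ 'n) set \<Rightarrow> bool" where
  "submanifold k d M \<longleftrightarrow>
     (\<forall>p\<in>M. \<exists>I U V f g. card I = d \<and> p \<in> U \<and> flattens k M (coord_plane I) U V f g)"

text \<open>
  Interior points are covered as well: their charts may be taken with \<open>V\<close> disjoint from the
  hyperplane where the \<open>j\<close>-th coordinate vanishes.
\<close>

definition submanifold_with_boundary :: "nat \<Rightarrow> nat \<Rightarrow> (real ^ 'n) set \<Rightarrow> bool" where
  "submanifold_with_boundary k d M \<longleftrightarrow>
     (\<forall>p\<in>M. \<exists>I j U V f g. card I = d \<and> j \<in> I \<and> p \<in> U \<and>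
        flattens k M (coord_half_plane I j) U V f g)"

definition tangent_space :: "'a::real_normed_vector set \<Rightarrow> 'a \<Rightarrow> 'a set" where
  "tangent_space M x = {v. \<exists>\<gamma> e. 0 < e \<and> \<gamma> ` {-e<..<e} \<subseteq> M \<and> \<gamma> 0 = x \<and>
     (\<gamma> has_vector_derivative v) (at 0)}"


section \<open>Regularity conditions\<close>

text \<open>
  The gap between two subspaces, the supremum of the distances to \<open>F\<close> of the unit vectors of \<open>E\<close>.
  Inserting \<open>0\<close> only makes the supremum equal to \<open>0\<close> when \<open>E\<close> is the zero space.
\<close>

definition gap :: "'a::real_normed_vector set \<Rightarrow> 'a set \<Rightarrow> real" where
  "gap E F = Sup (insert 0 ((\<lambda>u. infdist u F) ` {u \<in> E. norm u = 1}))"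

definition cond_a_at :: "(real ^ 'n) set \<Rightarrow> (real ^ 'n) set \<Rightarrow> real ^ 'n \<Rightarrow> bool" where
  "cond_a_at Y X x0 \<longleftrightarrow> (\<exists>U p. open U \<and> x0 \<in> U \<and> retraction U (U \<inter> X) p \<and>
     ((\<lambda>y. gap (tangent_space X (p y)) (tangent_space Y y)) \<longlongrightarrow> 0) (at x0 within Y))"

definition cond_a :: "(real ^ 'n) set \<Rightarrow> (real ^ 'n) set \<Rightarrow> bool" where
  "cond_a Y X \<longleftrightarrow> (\<forall>x0\<in>X. cond_a_at Y X x0)"

text \<open>
  The function \<open>r\<close>, for \<open>Z\<close> in coordinates where the small stratum is \<open>coord_plane I\<close>.
  It may take the value \<open>\<infinity>\<close>, and it is \<open>0\<close> if no \<open>y \<in> Z\<close> projects to norm \<open>t\<close>.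
\<close>

definition gap_ratio :: "'n set \<Rightarrow> (real ^ 'n) set \<Rightarrow> real \<Rightarrow> ennreal" where
  "gap_ratio I Z t = (SUP y \<in> {y \<in> Z. norm (coord_proj I y) = t}.
     ennreal (gap (coord_plane I) (tangent_space Z y) / norm (y - coord_proj I y)))"

text \<open>
  Local coordinates are of the class \<open>k\<close> of the strata.  Only the part of \<open>Y\<close> inside the
  coordinate domain \<open>U\<close>, which may be arbitrarily small, enters the supremum.
\<close>

definition cond_r_int_at ::
  "nat \<Rightarrow> (real ^ 'n) set \<Rightarrow> (real ^ 'n) set \<Rightarrow> real ^ 'n \<Rightarrow> bool" where
  "cond_r_int_at k Y X x0 \<longleftrightarrow>
     (\<exists>I U V f g. x0 \<in> U \<and> f x0 = 0 \<and> flattens k X (coord_plane I) U V f g \<and>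
        (\<exists>e>0. (\<integral>\<^sup>+ t \<in> {0..e}. gap_ratio I (f ` (U \<inter> Y)) t \<partial>lborel) < \<infinity>))"

definition cond_r_int :: "nat \<Rightarrow> (real ^ 'n) set \<Rightarrow> (real ^ 'n) set \<Rightarrow> bool" where
  "cond_r_int k Y X \<longleftrightarrow> (\<forall>x0\<in>X. cond_r_int_at k Y X x0)"


section \<open>Connectedness along a stratum\<close>

text \<open>The germ of \<open>Y\<close> at every point of \<open>X\<close> is connected.\<close>

definition connected_along :: "'a::topological_space set \<Rightarrow> 'a set \<Rightarrow> bool" where
  "connected_along X Y \<longleftrightarrow> (\<forall>x\<in>X. \<forall>U. open U \<and> x \<in> U \<longrightarrow>
     (\<exists>V. open V \<and> x \<in> V \<and> V \<subseteq> U \<and> connected (V \<inter> Y)))"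

end

theory Submission
  imports Defs
begin

text \<open>In coordinates at a point of \<open>X\<close> that make \<open>X\<close> flat, write the points of \<open>Y\<close> as pairs \<open>(x, z)\<close>.
  If the direction of \<open>z\<close> stayed away from the tangent spaces of \<open>Y\<close>, then \<open>r\<close> would be at least \<open>c / (s |x'(s)|)\<close>
  along a definable curve with \<open>|z| = s\<close>, and its integral would diverge like that of \<open>1 / s\<close>.  So \<open>(x, |z|)\<close>
  is a proper local diffeomorphism on \<open>Y\<close> and, the germ of \<open>Y\<close> being connected, \<open>Y\<close> is a graph over a half space.
  Integrating \<open>r\<close> along rays in \<open>X\<close> shows that \<open>z / |z|\<close> converges at the chosen point, hence so do the tangent
  spaces of \<open>Y\<close>.  As this holds at all points of \<open>X\<close>, the derivative of the graph over \<open>(x, z\<^sub>j)\<close>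
  extends continuously to the boundary; its odd extension is then of class \<open>C\<close>-to-the-\<open>1\<close>, and shearing along it
  flattens \<open>X \<union> Y\<close>.\<close>

section \<open>Definable sets, maps and predicates\<close>

context o_minimal_structure
begin

definition definable_lpred :: "nat \<Rightarrow> (real list \<Rightarrow> bool) \<Rightarrow> bool" where
  "definable_lpred n P \<longleftrightarrow> {xs. length xs = n \<and> P xs} \<in> S n"

lemma definable_lpred_cong:
  assumes "definable_lpred n P" "\<And>xs. length xs = n ==> P xs = Q xs"
  shows "definable_lpred n Q"
proof -
  have "{xs. length xs = n \<and> P xs} = {xs. length xs = n \<and> Q xs}"
    using assms(2) by auto
  then show ?thesis using assms(1) unfolding definable_lpred_def by simp
qed

lemma definable_lpred_True: "definable_lpred n (\<lambda>_. True)"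
  using space_definable by (simp add: definable_lpred_def)

lemma definable_lpred_not:
  assumes "definable_lpred n P" shows "definable_lpred n (\<lambda>xs. \<not> P xs)"
proof -
  have "{xs. length xs = n \<and> \<not> P xs} = {xs. length xs = n} - {xs. length xs = n \<and> P xs}" by auto
  then show ?thesis
    using assms Diff_definable space_definable unfolding definable_lpred_def by simp
qed

lemma definable_lpred_disj:
  assumes "definable_lpred n P" "definable_lpred n Q"
  shows "definable_lpred n (\<lambda>xs. P xs \<or> Q xs)"
proof -
  have "{xs. length xs = n \<and> (P xs \<or> Q xs)}
    = {xs. length xs = n \<and> P xs} \<union> {xs. length xs = n \<and> Q xs}" by auto
  then show ?thesis
    using assms Un_definable unfolding definable_lpred_def by simp
qed

lemma definable_lpred_conj:
  assumes "definable_lpred n P" "definable_lpred n Q"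
  shows "definable_lpred n (\<lambda>xs. P xs \<and> Q xs)"
  using definable_lpred_not[OF definable_lpred_disj[OF assms[THEN definable_lpred_not]]] by simp

lemma definable_lpred_ball_less:
  fixes k :: nat
  assumes "\<And>i. i < k ==> definable_lpred n (P i)"
  shows "definable_lpred n (\<lambda>xs. \<forall>i<k. P i xs)"
  using assms
proof (induction k)
  case 0
  then show ?case using definable_lpred_True by simp
next
  case (Suc k)
  have "definable_lpred n (\<lambda>xs. (\<forall>i<k. P i xs) \<and> P k xs)"
    using Suc by (intro definable_lpred_conj) auto
  then show ?case
    by (rule definable_lpred_cong) (auto simp: less_Suc_eq)
qed

lemma prepend_cylinder_definable:
  assumes "A \<in> S n" shows "{xs @ ys | xs ys. ys \<in> A \<and> length xs = m} \<in> S (m + n)"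
proof (induction m)
  case 0
  then show ?case using assms by simp
next
  case (Suc m)
  have "{xs @ ys | xs ys. ys \<in> A \<and> length xs = Suc m}
    = {z # zs | z zs. zs \<in> {xs @ ys | xs ys. ys \<in> A \<and> length xs = m}}"
  proof (intro set_eqI iffI)
    fix w assume "w \<in> {xs @ ys | xs ys. ys \<in> A \<and> length xs = Suc m}"
    then obtain xs ys where w: "w = xs @ ys" "ys \<in> A" "length xs = Suc m" by auto
    then obtain x xs' where "xs = x # xs'" by (auto simp: length_Suc_conv)
    with w show "w \<in> {z # zs | z zs. zs \<in> {xs @ ys | xs ys. ys \<in> A \<and> length xs = m}}"
      by - (rule CollectI, rule exI[of _ x], rule exI[of _ "xs' @ ys"], auto)
  next
    fix w assume "w \<in> {z # zs | z zs. zs \<in> {xs @ ys | xs ys. ys \<in> A \<and> length xs = m}}"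
    then obtain xs ys z where w: "w = z # (xs @ ys)" "ys \<in> A" "length xs = m" by auto
    then show "w \<in> {xs @ ys | xs ys. ys \<in> A \<and> length xs = Suc m}"
      by - (rule CollectI, rule exI[of _ "z # xs"], rule exI[of _ ys], auto)
  qed
  then show ?case using Cons_definable[OF Suc.IH] by simp
qed

lemma definable_lpred_drop:
  assumes "definable_lpred n P" shows "definable_lpred (m + n) (\<lambda>zs. P (drop m zs))"
proof -
  have "{zs. length zs = m + n \<and> P (drop m zs)}
    = {xs @ ys | xs ys. ys \<in> {xs. length xs = n \<and> P xs} \<and> length xs = m}"
  proof (intro set_eqI iffI)
    fix zs assume "zs \<in> {zs. length zs = m + n \<and> P (drop m zs)}"
    then show "zs \<in> {xs @ ys | xs ys. ys \<in> {xs. length xs = n \<and> P xs} \<and> length xs = m}"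
      by - (rule CollectI, rule exI[of _ "take m zs"], rule exI[of _ "drop m zs"], auto)
  qed auto
  then show ?thesis
    using prepend_cylinder_definable[of "{xs. length xs = n \<and> P xs}" n m] assms unfolding definable_lpred_def by simp
qed

lemma definable_lpred_ex1:
  assumes "definable_lpred (Suc n) P" shows "definable_lpred n (\<lambda>xs. \<exists>x. P (xs @ [x]))"
proof -
  have "{xs. length xs = n \<and> (\<exists>x. P (xs @ [x]))} = butlast ` {xs. length xs = Suc n \<and> P xs}"
  proof (intro set_eqI iffI)
    fix xs assume "xs \<in> butlast ` {xs. length xs = Suc n \<and> P xs}"
    then obtain ys where ys: "length ys = Suc n" "P ys" "xs = butlast ys" by auto
    then have "ys = xs @ [last ys]" using append_butlast_last_id[of ys] by fastforce
    then have "P (xs @ [last ys])" using ys(2) by simp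
    moreover have "length xs = n" using ys by simp
    ultimately show "xs \<in> {xs. length xs = n \<and> (\<exists>x. P (xs @ [x]))}" by blast
  next
    fix xs assume "xs \<in> {xs. length xs = n \<and> (\<exists>x. P (xs @ [x]))}"
    then obtain x where "length xs = n" "P (xs @ [x])" by auto
    then show "xs \<in> butlast ` {xs. length xs = Suc n \<and> P xs}"
      by (intro image_eqI[where x = "xs @ [x]"]) auto
  qed
  then show ?thesis
    using projection_definable assms unfolding definable_lpred_def by simp
qed

lemma definable_lpred_ex:
  assumes "definable_lpred (n + k) P"
  shows "definable_lpred n (\<lambda>xs. \<exists>ys. length ys = k \<and> P (xs @ ys))"
  using assms
proof (induction k arbitrary: P)
  case 0
  then show ?case by simp
next
  case (Suc k)
  have "definable_lpred (n + k) (\<lambda>xs. \<exists>x. P (xs @ [x]))"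
    using Suc.prems by (intro definable_lpred_ex1) simp
  from Suc.IH[OF this]
  show ?case
  proof (rule definable_lpred_cong, intro iffI)
    fix xs assume "\<exists>ys. length ys = k \<and> (\<exists>x. P ((xs @ ys) @ [x]))"
    then obtain ys x where "length ys = k" "P ((xs @ ys) @ [x])" by auto
    then show "\<exists>ys. length ys = Suc k \<and> P (xs @ ys)" by (intro exI[of _ "ys @ [x]"]) auto
  next
    fix xs assume "\<exists>ys. length ys = Suc k \<and> P (xs @ ys)"
    then obtain ys where ys: "length ys = Suc k" "P (xs @ ys)" by auto
    then obtain y ys' where "ys = ys' @ [y]" by (auto simp: length_Suc_conv_rev)
    then show "\<exists>ys. length ys = k \<and> (\<exists>x. P ((xs @ ys) @ [x]))"
      using ys by (intro exI[of _ ys'] conjI exI[of _ y]) auto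
  qed
qed

lemma definable_lpred_nth_eq:
  assumes "i < n" "j < n" shows "definable_lpred n (\<lambda>xs. xs ! i = xs ! j)"
proof -
  consider "i = j" | "i < j" | "j < i" by linarith
  then show ?thesis
  proof cases
    case 1
    then show ?thesis using definable_lpred_True by simp
  next
    case 2
    then show ?thesis using diagonal_definable assms unfolding definable_lpred_def by blast
  next
    case 3
    then have "definable_lpred n (\<lambda>xs. xs ! j = xs ! i)"
      using diagonal_definable assms unfolding definable_lpred_def by blast
    then show ?thesis by (rule definable_lpred_cong) auto
  qed
qed

lemma definable_lpred_reindex:
  assumes "definable_lpred n P" "\<And>i. i < n ==> \<sigma> i < m"
  shows "definable_lpred m (\<lambda>xs. P (map (\<lambda>i. xs ! \<sigma> i) [0..<n]))"
proof -
  have "definable_lpred m (\<lambda>xs. \<exists>ys. length ys = n \<and> (\<lambda>zs. (\<forall>i<n. zs ! \<sigma> i = zs ! (m + i)) \<and> P (drop m zs)) (xs @ ys))"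
    using assms(2)
    by (intro definable_lpred_ex definable_lpred_conj definable_lpred_ball_less
        definable_lpred_nth_eq definable_lpred_drop assms) (auto simp: trans_less_add1)
  then show ?thesis
  proof (rule definable_lpred_cong)
    fix xs :: "real list" assume l: "length xs = m"
    have "length ys = n \<and> (\<forall>i<n. (xs @ ys) ! \<sigma> i = (xs @ ys) ! (m + i)) \<longleftrightarrow> ys = map (\<lambda>i. xs ! \<sigma> i) [0..<n]" for ys
      using l assms(2) by (auto simp: nth_append intro!: nth_equalityI)
    then have "length ys = n \<and> (\<lambda>zs. (\<forall>i<n. zs ! \<sigma> i = zs ! (m + i)) \<and> P (drop m zs)) (xs @ ys)
      \<longleftrightarrow> ys = map (\<lambda>i. xs ! \<sigma> i) [0..<n] \<and> P ys" for ys
    proof -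
      have d: "drop m (xs @ ys) = ys" using l by simp
      show ?thesis using \<open>\<And>ys. _ = (ys = _)\<close>[of ys] unfolding d by blast
    qed
    then show "(\<exists>ys. length ys = n \<and> (\<lambda>zs. (\<forall>i<n. zs ! \<sigma> i = zs ! (m + i)) \<and> P (drop m zs)) (xs @ ys))
      = P (map (\<lambda>i. xs ! \<sigma> i) [0..<n])" by (simp only: simp_thms)
  qed
qed

definition definable_lterm :: "nat \<Rightarrow> (real list \<Rightarrow> real) \<Rightarrow> bool" where
  "definable_lterm n t \<longleftrightarrow> definable_lpred (Suc n) (\<lambda>zs. zs ! n = t (take n zs))"

lemma definable_lterm_cong:
  assumes "definable_lterm n t" "\<And>xs. length xs = n ==> t xs = u xs"
  shows "definable_lterm n u"
  using assms(1) unfolding definable_lterm_def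
  by (rule definable_lpred_cong) (simp add: assms(2))

lemma definable_lterm_nth: "i < n ==> definable_lterm n (\<lambda>xs. xs ! i)"
  unfolding definable_lterm_def
  by (rule definable_lpred_cong[OF definable_lpred_nth_eq[of n "Suc n" i]]) auto

lemma definable_lterm_eq_nth:
  assumes "definable_lterm m t" "m \<le> m'" "k < m'"
  shows "definable_lpred m' (\<lambda>zs. zs ! k = t (take m zs))"
proof -
  have "definable_lpred m' (\<lambda>xs. (\<lambda>zs. zs ! m = t (take m zs)) (map (\<lambda>i. xs ! (if i < m then i else k)) [0..<Suc m]))"
    using assms unfolding definable_lterm_def by (intro definable_lpred_reindex) auto
  then show ?thesis
  proof (rule definable_lpred_cong)
    fix xs :: "real list" assume l: "length xs = m'"
    have "map (\<lambda>i. xs ! (if i < m then i else k)) [0..<m] = take m xs"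
      using l assms by (auto simp: list_eq_iff_nth_eq)
    moreover have "take m (map (\<lambda>i. xs ! (if i < m then i else k)) [0..<Suc m])
      = map (\<lambda>i. xs ! (if i < m then i else k)) [0..<m]" by simp
    ultimately show "(\<lambda>zs. zs ! m = t (take m zs)) (map (\<lambda>i. xs ! (if i < m then i else k)) [0..<Suc m])
      = (xs ! k = t (take m xs))"
      by (simp add: nth_append del: upt_Suc)
  qed
qed

lemma definable_lpred_subst:
  assumes "definable_lpred n P" "\<And>i. i < n ==> definable_lterm m (t i)"
  shows "definable_lpred m (\<lambda>xs. P (map (\<lambda>i. t i xs) [0..<n]))"
proof -
  have "definable_lpred m (\<lambda>xs. \<exists>ys. length ys = n \<and>
      (\<lambda>zs. (\<forall>i<n. zs ! (m + i) = t i (take m zs)) \<and> P (drop m zs)) (xs @ ys))"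
    using assms(2)
    by (intro definable_lpred_ex definable_lpred_conj definable_lpred_ball_less
        definable_lterm_eq_nth definable_lpred_drop assms) auto
  then show ?thesis
  proof (rule definable_lpred_cong)
    fix xs :: "real list" assume l: "length xs = m"
    have "length ys = n \<and> (\<forall>i<n. (xs @ ys) ! (m + i) = t i (take m (xs @ ys))) \<longleftrightarrow> ys = map (\<lambda>i. t i xs) [0..<n]" for ys
      using l by (auto simp: nth_append intro!: nth_equalityI)
    then have "length ys = n \<and> (\<lambda>zs. (\<forall>i<n. zs ! (m + i) = t i (take m zs)) \<and> P (drop m zs)) (xs @ ys)
      \<longleftrightarrow> ys = map (\<lambda>i. t i xs) [0..<n] \<and> P ys" for ys
    proof -
      have d: "drop m (xs @ ys) = ys" using l by simp
      show ?thesis using \<open>\<And>ys. _ = (ys = _)\<close>[of ys] unfolding d by blast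
    qed
    then show "(\<exists>ys. length ys = n \<and> (\<lambda>zs. (\<forall>i<n. zs ! (m + i) = t i (take m zs)) \<and> P (drop m zs)) (xs @ ys))
      = P (map (\<lambda>i. t i xs) [0..<n])" by (simp only: simp_thms)
  qed
qed

lemma definable_lterm_take:
  assumes "definable_lterm m t" "m \<le> m'"
  shows "definable_lterm m' (\<lambda>xs. t (take m xs))"
  unfolding definable_lterm_def
  by (rule definable_lpred_cong[OF definable_lterm_eq_nth[OF assms(1), of "Suc m'" m']])
     (use assms in \<open>auto simp: min_def\<close>)

lemma definable_lterm_subst:
  assumes "definable_lterm n u" "\<And>i. i < n ==> definable_lterm m (t i)"
  shows "definable_lterm m (\<lambda>xs. u (map (\<lambda>i. t i xs) [0..<n]))"
proof -
  have "definable_lpred (Suc m) (\<lambda>xs. (\<lambda>zs. zs ! n = u (take n zs))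
      (map (\<lambda>i. (if i < n then t i (take m xs) else xs ! m)) [0..<Suc n]))"
  proof (intro definable_lpred_subst assms(1)[unfolded definable_lterm_def])
    fix i assume "i < Suc n"
    then show "definable_lterm (Suc m) (\<lambda>xs. if i < n then t i (take m xs) else xs ! m)"
      using definable_lterm_take[OF assms(2), of i "Suc m"] definable_lterm_nth[of m "Suc m"]
      by (cases "i < n") auto
  qed
  then show ?thesis unfolding definable_lterm_def
  proof (rule definable_lpred_cong)
    fix xs :: "real list"
    have "take n (map (\<lambda>i. (if i < n then t i (take m xs) else xs ! m)) [0..<Suc n])
       = map (\<lambda>i. t i (take m xs)) [0..<n]"
      by (auto simp: list_eq_iff_nth_eq)
    then show "(\<lambda>zs. zs ! n = u (take n zs))
      (map (\<lambda>i. (if i < n then t i (take m xs) else xs ! m)) [0..<Suc n])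
      = (xs ! m = u (map (\<lambda>i. t i (take m xs)) [0..<n]))"
      by (simp add: nth_append del: upt_Suc)
  qed
qed

lemma definable_lpred_interval:
  assumes "is_interval J" shows "definable_lpred 1 (\<lambda>xs. xs ! 0 \<in> J)"
proof -
  have "(\<lambda>x. [x]) ` J \<in> S 1"
    using assms by (subst o_minimal) (auto intro!: exI[of _ "{J}"])
  moreover have "{xs. length xs = 1 \<and> xs ! 0 \<in> J} = (\<lambda>x. [x]) ` J"
    by (auto simp: length_Suc_conv)
  ultimately show ?thesis unfolding definable_lpred_def by simp
qed

lemma definable_lterm_const: "definable_lterm n (\<lambda>_. c)"
proof -
  have "definable_lpred (Suc n) (\<lambda>xs. (\<lambda>ys. ys ! 0 \<in> {c}) (map (\<lambda>i. xs ! n) [0..<1]))"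
    by (intro definable_lpred_reindex definable_lpred_interval) (auto simp: is_interval_1)
  then show ?thesis unfolding definable_lterm_def by (rule definable_lpred_cong) auto
qed

lemma definable_lterm_plus2: "definable_lterm 2 (\<lambda>xs. xs ! 0 + xs ! 1)"
proof -
  have 3: "Suc 2 = 3" by simp
  have eq: "{xs. length xs = 3 \<and> xs ! 2 = take 2 xs ! 0 + take 2 xs ! 1} = {[x, y, x + y] | x y. True}"
    by (auto simp: length_Suc_conv numeral_2_eq_2 numeral_3_eq_3)
  show ?thesis using add_definable unfolding definable_lterm_def definable_lpred_def 3 eq .
qed

lemma definable_lterm_times2: "definable_lterm 2 (\<lambda>xs. xs ! 0 * xs ! 1)"
proof -
  have 3: "Suc 2 = 3" by simp
  have eq: "{xs. length xs = 3 \<and> xs ! 2 = take 2 xs ! 0 * take 2 xs ! 1} = {[x, y, x * y] | x y. True}"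
    by (auto simp: length_Suc_conv numeral_2_eq_2 numeral_3_eq_3)
  show ?thesis using mult_definable unfolding definable_lterm_def definable_lpred_def 3 eq .
qed

lemma definable_lterm_add:
  assumes "definable_lterm n t" "definable_lterm n u"
  shows "definable_lterm n (\<lambda>xs. t xs + u xs)"
  by (rule definable_lterm_cong[OF definable_lterm_subst[OF definable_lterm_plus2,
        where t = "\<lambda>i. if i = 0 then t else u"]]) (use assms in \<open>auto simp: numeral_2_eq_2\<close>)

lemma definable_lterm_mult:
  assumes "definable_lterm n t" "definable_lterm n u"
  shows "definable_lterm n (\<lambda>xs. t xs * u xs)"
  by (rule definable_lterm_cong[OF definable_lterm_subst[OF definable_lterm_times2,
        where t = "\<lambda>i. if i = 0 then t else u"]]) (use assms in \<open>auto simp: numeral_2_eq_2\<close>)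

lemma definable_lpred_in_interval:
  assumes "definable_lterm n t" "is_interval J"
  shows "definable_lpred n (\<lambda>xs. t xs \<in> J)"
proof -
  have "definable_lpred n (\<lambda>xs. (\<lambda>ys. ys ! 0 \<in> J) (map (\<lambda>i. t xs) [0..<1]))"
    by (rule definable_lpred_subst[OF definable_lpred_interval]) (use assms in auto)
  then show ?thesis by simp
qed

text \<open>A point of a Euclidean space is encoded by its coordinates with respect to an enumeration of
  the basis.  All product types of Euclidean spaces are available as contexts of free variables.\<close>

definition basis_list :: "'a::euclidean_space list" where
  "basis_list = (SOME bs. distinct bs \<and> set bs = Basis)"

lemma basis_list: "distinct (basis_list :: 'a::euclidean_space list)"
  "set (basis_list :: 'a list) = Basis" "length (basis_list :: 'a list) = DIM('a)"
proof -
  have "\<exists>bs :: 'a list. distinct bs \<and> set bs = Basis"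
    using finite_distinct_list[OF finite_Basis] by blast
  then have *: "distinct (basis_list :: 'a list) \<and> set (basis_list :: 'a list) = Basis"
    unfolding basis_list_def by (rule someI_ex)
  then show "distinct (basis_list :: 'a list)" "set (basis_list :: 'a list) = Basis" by auto
  then show "length (basis_list :: 'a list) = DIM('a)" using * distinct_card by fastforce
qed

definition of_coords :: "real list \<Rightarrow> 'a::euclidean_space" where
  "of_coords xs = (\<Sum>i<DIM('a). (xs ! i) *\<^sub>R (basis_list ! i))"

definition coords :: "'a::euclidean_space \<Rightarrow> real list" where
  "coords x = map (\<lambda>b. x \<bullet> b) basis_list"

lemma length_coords [simp]: "length (coords (x :: 'a::euclidean_space)) = DIM('a)"
  by (simp add: coords_def basis_list)

lemma basis_list_nth [simp]: "i < DIM('a) ==> (basis_list :: 'a::euclidean_space list) ! i \<in> Basis"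
  using nth_mem[of i "basis_list :: 'a list"] basis_list(2,3)[where 'a='a] by simp

lemma of_coords_inner:
  assumes "i < DIM('a)" shows "(of_coords xs :: 'a::euclidean_space) \<bullet> (basis_list ! i) = xs ! i"
proof -
  have "(of_coords xs :: 'a) \<bullet> (basis_list ! i) = (\<Sum>j<DIM('a). (xs ! j) * (if j = i then 1 else 0))"
    unfolding of_coords_def inner_sum_left
    using assms basis_list(1,3)[where 'a='a]
    by (intro sum.cong) (auto simp: inner_Basis nth_eq_iff_index_eq)
  then show ?thesis using assms by (simp add: if_distrib cong: if_cong)
qed

lemma Basis_nthE:
  assumes "b \<in> (Basis :: 'a::euclidean_space set)"
  obtains i where "i < DIM('a)" "b = basis_list ! i"
proof -
  have "b \<in> set basis_list" using assms basis_list(2)[where 'a='a] by simp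
  then obtain i where "i < length (basis_list :: 'a list)" "basis_list ! i = b"
    by (auto simp: in_set_conv_nth)
  then show thesis using that basis_list(3)[where 'a='a] by simp
qed

lemma of_coords_coords [simp]: "of_coords (coords x) = x"
  by (rule euclidean_eqI) (auto elim!: Basis_nthE simp: of_coords_inner coords_def basis_list)

lemma of_coords_map_inner: "of_coords (map (\<lambda>i. x \<bullet> (basis_list ! i)) [0..<DIM('a)]) = (x :: 'a::euclidean_space)"
  by (rule euclidean_eqI) (auto elim!: Basis_nthE simp: of_coords_inner)

definition definable_pred :: "('a::euclidean_space \<Rightarrow> bool) \<Rightarrow> bool" where
  "definable_pred P \<longleftrightarrow> definable_lpred DIM('a) (\<lambda>xs. P (of_coords xs))"

definition definable_map :: "('a::euclidean_space \<Rightarrow> 'b::euclidean_space) \<Rightarrow> bool" where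
  "definable_map f \<longleftrightarrow> (\<forall>b\<in>Basis. definable_lterm DIM('a) (\<lambda>xs. f (of_coords xs) \<bullet> b))"

lemma definable_map_real:
  "definable_map (f :: 'a::euclidean_space \<Rightarrow> real) \<longleftrightarrow> definable_lterm DIM('a) (\<lambda>xs. f (of_coords xs))"
  by (simp add: definable_map_def)

lemma definable_pred_True: "definable_pred (\<lambda>_. True)"
  and definable_pred_not: "definable_pred P ==> definable_pred (\<lambda>x. \<not> P x)"
  and definable_pred_disj: "definable_pred P ==> definable_pred Q ==> definable_pred (\<lambda>x. P x \<or> Q x)"
  and definable_pred_conj: "definable_pred P ==> definable_pred Q ==> definable_pred (\<lambda>x. P x \<and> Q x)"
  unfolding definable_pred_def
  by (fact definable_lpred_True definable_lpred_not definable_lpred_disj definable_lpred_conj)+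

lemma definable_pred_imp: "definable_pred P ==> definable_pred Q ==> definable_pred (\<lambda>x. P x --> Q x)"
  unfolding imp_conv_disj by (intro definable_pred_disj definable_pred_not)

lemma definable_map_id: "definable_map (\<lambda>x. x)"
  unfolding definable_map_def
  by (auto elim!: Basis_nthE simp: of_coords_inner intro!: definable_lterm_nth)

lemma definable_map_const: "definable_map (\<lambda>x. c)"
  unfolding definable_map_def by (auto intro!: definable_lterm_const)

lemma definable_map_inner_Basis: "definable_map f ==> b \<in> Basis ==> definable_map (\<lambda>x. f x \<bullet> b)"
  unfolding definable_map_def by auto

lemma definable_map_componentwise:
  "(\<And>b. b \<in> Basis ==> definable_map (\<lambda>x. f x \<bullet> b)) ==> definable_map f"
  unfolding definable_map_def by auto

lemma definable_map_fst: "definable_map f ==> definable_map (\<lambda>x. fst (f x))"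
  unfolding definable_map_def
proof
  fix b :: 'b assume *: "\<forall>b\<in>Basis. definable_lterm DIM('a) (\<lambda>xs. f (of_coords xs) \<bullet> b)" "b \<in> Basis"
  then have "definable_lterm DIM('a) (\<lambda>xs. f (of_coords xs) \<bullet> (b, 0))" by (simp add: Basis_prod_def)
  then show "definable_lterm DIM('a) (\<lambda>xs. fst (f (of_coords xs)) \<bullet> b)"
    by (rule definable_lterm_cong) (simp add: inner_prod_def)
qed

lemma definable_map_snd: "definable_map f ==> definable_map (\<lambda>x. snd (f x))"
  unfolding definable_map_def
proof
  fix b :: 'c assume *: "\<forall>b\<in>Basis. definable_lterm DIM('a) (\<lambda>xs. f (of_coords xs) \<bullet> b)" "b \<in> Basis"
  then have "definable_lterm DIM('a) (\<lambda>xs. f (of_coords xs) \<bullet> (0, b))" by (simp add: Basis_prod_def)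
  then show "definable_lterm DIM('a) (\<lambda>xs. snd (f (of_coords xs)) \<bullet> b)"
    by (rule definable_lterm_cong) (simp add: inner_prod_def)
qed

lemma definable_map_Pair:
  "definable_map f ==> definable_map g ==> definable_map (\<lambda>x. (f x, g x))"
  unfolding definable_map_def by (auto simp: Basis_prod_def inner_prod_def)

lemma definable_map_add:
  "definable_map f ==> definable_map g ==> definable_map (\<lambda>x. f x + g x)"
  unfolding definable_map_def by (auto simp: inner_add_left intro!: definable_lterm_add)

lemma definable_map_scaleR:
  "definable_map f ==> definable_map g ==> definable_map (\<lambda>x. f x *\<^sub>R g x)"
  unfolding definable_map_def by (auto intro!: definable_lterm_mult)

lemma definable_map_mult:
  fixes f g :: "'a::euclidean_space \<Rightarrow> real"
  shows "definable_map f ==> definable_map g ==> definable_map (\<lambda>x. f x * g x)"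
  using definable_map_scaleR[of f g] by simp

lemma definable_map_uminus: "definable_map f ==> definable_map (\<lambda>x. - f x)"
  using definable_map_scaleR[OF definable_map_const[of "-1"], of f] by simp

lemma definable_map_diff:
  "definable_map f ==> definable_map g ==> definable_map (\<lambda>x. f x - g x)"
  using definable_map_add[OF _ definable_map_uminus, of f g] by simp

lemma definable_map_sum:
  "(\<And>i. i \<in> A ==> definable_map (f i)) ==> definable_map (\<lambda>x. \<Sum>i\<in>A. f i x)"
  by (induction A rule: infinite_finite_induct)
     (auto intro: definable_map_const definable_map_add)

lemma definable_map_inner:
  "definable_map f ==> definable_map g ==> definable_map (\<lambda>x. f x \<bullet> g x)"
  by (subst euclidean_inner)
     (intro definable_map_sum definable_map_mult definable_map_inner_Basis; assumption)

lemma definable_pred_compose: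
  fixes f :: "'a::euclidean_space \<Rightarrow> 'b::euclidean_space"
  assumes "definable_pred P" "definable_map f" shows "definable_pred (\<lambda>x. P (f x))"
proof -
  have "definable_lpred DIM('a) (\<lambda>xs. P (of_coords
      (map (\<lambda>i. f (of_coords xs) \<bullet> (basis_list ! i)) [0..<DIM('b)])))"
    using assms unfolding definable_pred_def definable_map_def
    by (intro definable_lpred_subst) auto
  then show ?thesis unfolding definable_pred_def of_coords_map_inner .
qed

lemma definable_map_compose:
  fixes f :: "'a::euclidean_space \<Rightarrow> 'b::euclidean_space" and g :: "'b \<Rightarrow> 'c::euclidean_space"
  assumes "definable_map g" "definable_map f" shows "definable_map (\<lambda>x. g (f x))"
  unfolding definable_map_def
proof
  fix b :: 'c assume b: "b \<in> Basis"
  have "definable_lterm DIM('a) (\<lambda>xs. g (of_coords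
      (map (\<lambda>i. f (of_coords xs) \<bullet> (basis_list ! i)) [0..<DIM('b)])) \<bullet> b)"
    using assms b unfolding definable_map_def
    by (intro definable_lterm_subst[where u = "\<lambda>ys. g (of_coords ys) \<bullet> b"]) auto
  then show "definable_lterm DIM('a) (\<lambda>xs. g (f (of_coords xs)) \<bullet> b)" unfolding of_coords_map_inner .
qed

lemma definable_pred_ex:
  fixes P :: "'a::euclidean_space \<Rightarrow> 'b::euclidean_space \<Rightarrow> bool"
  assumes "definable_pred (\<lambda>z. P (fst z) (snd z))" shows "definable_pred (\<lambda>x. \<exists>y. P x y)"
proof -
  let ?f = "\<lambda>zs. (of_coords (take DIM('a) zs) :: 'a, of_coords (drop DIM('a) zs) :: 'b)"
  have t: "definable_lterm (DIM('a) + DIM('b)) (\<lambda>zs. ?f zs \<bullet> (basis_list ! i))"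
    if i: "i < DIM('a \<times> 'b)" for i
  proof -
    have "basis_list ! i \<in> (Basis :: ('a \<times> 'b) set)" using i by (rule basis_list_nth)
    then consider u :: 'a where "u \<in> Basis" "basis_list ! i = (u, 0 :: 'b)"
      | v :: 'b where "v \<in> Basis" "basis_list ! i = (0 :: 'a, v)" unfolding Basis_prod_def by auto
    then show ?thesis
    proof cases
      case 1
      then obtain j where j: "j < DIM('a)" "u = basis_list ! j" by (auto elim: Basis_nthE)
      show ?thesis
        by (rule definable_lterm_cong[OF definable_lterm_nth[of j]])
           (use j 1 in \<open>auto simp: inner_prod_def of_coords_inner\<close>)
    next
      case 2
      then obtain j where j: "j < DIM('b)" "v = basis_list ! j" by (auto elim: Basis_nthE)
      show ?thesis
        by (rule definable_lterm_cong[OF definable_lterm_nth[of "DIM('a) + j"]])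
           (use j 2 in \<open>auto simp: inner_prod_def of_coords_inner\<close>)
    qed
  qed
  have "definable_lpred (DIM('a) + DIM('b)) (\<lambda>zs. (\<lambda>z. P (fst z) (snd z)) (of_coords
      (map (\<lambda>i. ?f zs \<bullet> (basis_list ! i)) [0..<DIM('a \<times> 'b)])))"
    by (rule definable_lpred_subst[OF assms[unfolded definable_pred_def] t])
  then have *: "definable_lpred (DIM('a) + DIM('b)) (\<lambda>zs. P (fst (?f zs)) (snd (?f zs)))"
    unfolding of_coords_map_inner .
  show ?thesis unfolding definable_pred_def
  proof (rule definable_lpred_cong[OF definable_lpred_ex[OF *]], intro iffI)
    fix xs :: "real list" assume l: "length xs = DIM('a)" and "\<exists>y. P (of_coords xs) y"
    then obtain y where "P (of_coords xs) y" by auto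
    then show "\<exists>ys. length ys = DIM('b) \<and> P (fst (?f (xs @ ys))) (snd (?f (xs @ ys)))"
      using l by (intro exI[of _ "coords y"]) auto
  qed auto
qed

lemma definable_pred_all:
  fixes P :: "'a::euclidean_space \<Rightarrow> 'b::euclidean_space \<Rightarrow> bool"
  assumes "definable_pred (\<lambda>z. P (fst z) (snd z))" shows "definable_pred (\<lambda>x. \<forall>y. P x y)"
  using definable_pred_not[OF definable_pred_ex[of "\<lambda>x y. \<not> P x y", OF definable_pred_not[OF assms]]] by simp

lemma definable_pred_in_interval:
  "definable_map f ==> is_interval J ==> definable_pred (\<lambda>x. f x \<in> (J :: real set))"
  unfolding definable_pred_def definable_map_real by (rule definable_lpred_in_interval)

lemma definable_pred_less:
  fixes f g :: "'a::euclidean_space \<Rightarrow> real"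
  assumes "definable_map f" "definable_map g" shows "definable_pred (\<lambda>x. f x < g x)"
  using definable_pred_in_interval[OF definable_map_diff[OF assms(2,1)], of "{0<..}"]
  by simp

lemma definable_pred_le:
  fixes f g :: "'a::euclidean_space \<Rightarrow> real"
  assumes "definable_map f" "definable_map g" shows "definable_pred (\<lambda>x. f x \<le> g x)"
  using definable_pred_not[OF definable_pred_less[OF assms(2,1)]] by (simp add: not_less)

lemma definable_pred_finite_ball:
  "finite A ==> (\<And>i. i \<in> A ==> definable_pred (P i)) ==> definable_pred (\<lambda>x. \<forall>i\<in>A. P i x)"
  by (induction A rule: finite_induct) (auto intro: definable_pred_True definable_pred_conj)

lemma definable_pred_eq:
  assumes "definable_map f" "definable_map g" shows "definable_pred (\<lambda>x. f x = g x)"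
proof -
  have "definable_pred (\<lambda>x. \<forall>b\<in>Basis. f x \<bullet> b \<le> g x \<bullet> b \<and> g x \<bullet> b \<le> f x \<bullet> b)"
  proof (rule definable_pred_finite_ball[OF finite_Basis])
    fix b :: 'b assume "b \<in> Basis"
    then have *: "definable_map (\<lambda>x. f x \<bullet> b)" "definable_map (\<lambda>x. g x \<bullet> b)"
      by (rule definable_map_inner_Basis[OF assms(1)], rule definable_map_inner_Basis[OF assms(2)])
    show "definable_pred (\<lambda>x. f x \<bullet> b \<le> g x \<bullet> b \<and> g x \<bullet> b \<le> f x \<bullet> b)"
      by (rule definable_pred_conj[OF definable_pred_le[OF *] definable_pred_le[OF *(2,1)]])
  qed
  moreover have "(\<lambda>x. \<forall>b\<in>Basis. f x \<bullet> b \<le> g x \<bullet> b \<and> g x \<bullet> b \<le> f x \<bullet> b) = (\<lambda>x. f x = g x)"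
    by (rule ext, subst euclidean_eq_iff[where 'a='b]) (auto intro: antisym)
  ultimately show ?thesis by simp
qed

lemma definable_map_graph:
  fixes f :: "'a::euclidean_space \<Rightarrow> real"
  assumes "definable_pred (\<lambda>z. snd z = f (fst z))" shows "definable_map f"
proof -
  have "definable_lpred (Suc DIM('a)) (\<lambda>xs. (\<lambda>z. snd z = f (fst z))
      (of_coords (map (\<lambda>i. (of_coords (take DIM('a) xs) :: 'a, xs ! DIM('a)) \<bullet> (basis_list ! i)) [0..<DIM('a \<times> real)])))"
  proof (rule definable_lpred_subst[OF assms[unfolded definable_pred_def]])
    fix i assume i: "i < DIM('a \<times> real)"
    have "basis_list ! i \<in> (Basis :: ('a \<times> real) set)" using i by (rule basis_list_nth)
    then consider u :: 'a where "u \<in> Basis" "basis_list ! i = (u, 0 :: real)"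
      | "basis_list ! i = (0 :: 'a, 1 :: real)" unfolding Basis_prod_def by auto
    then show "definable_lterm (Suc DIM('a)) (\<lambda>xs. (of_coords (take DIM('a) xs) :: 'a, xs ! DIM('a)) \<bullet> (basis_list ! i))"
    proof cases
      case 1
      then obtain j where j: "j < DIM('a)" "u = basis_list ! j" by (auto elim: Basis_nthE)
      show ?thesis
        by (rule definable_lterm_cong[OF definable_lterm_nth[of j]])
           (use j 1 in \<open>auto simp: inner_prod_def of_coords_inner\<close>)
    next
      case 2
      show ?thesis
        by (rule definable_lterm_cong[OF definable_lterm_nth[of "DIM('a)"]])
           (use 2 in \<open>auto simp: inner_prod_def of_coords_inner\<close>)
    qed
  qed
  then show ?thesis unfolding of_coords_map_inner definable_map_real definable_lterm_def by simp
qed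

lemma definable_map_norm:
  assumes "definable_map f" shows "definable_map (\<lambda>x. norm (f x))"
proof (rule definable_map_graph)
  have "definable_pred (\<lambda>z. (0 \<le> snd z) \<and> snd z * snd z = f (fst z) \<bullet> f (fst z))"
    by (intro definable_pred_conj definable_pred_le definable_pred_eq definable_map_mult definable_map_inner
        definable_map_const definable_map_snd definable_map_id
        definable_map_compose[OF assms] definable_map_fst)
  moreover have "(\<lambda>z. (0 \<le> snd z) \<and> snd z * snd z = f (fst z) \<bullet> f (fst z)) = (\<lambda>z. snd z = norm (f (fst z)))"
    by (rule ext) (metis norm_eq_square power2_eq_square)
  ultimately show "definable_pred (\<lambda>z. snd z = norm (f (fst z)))" by simp
qed

lemma definable_imp_definable_pred:
  fixes A :: "(real ^ 'n) set"
  assumes "definable S A" shows "definable_pred (\<lambda>x. x \<in> A)"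
proof -
  let ?N = "CARD('n)"
  obtain e where e: "bij_betw e {..<?N} (UNIV :: 'n set)"
    and A: "(\<lambda>x. map (\<lambda>i. x $ e i) [0..<?N]) ` A \<in> S ?N"
    using assms unfolding definable_def by auto
  have inj: "x = y" if "map (\<lambda>i. x $ e i) [0..<?N] = map (\<lambda>i. y $ e i) [0..<?N]" for x y :: "real ^ 'n"
  proof -
    have "x $ e i = y $ e i" if "i < ?N" for i
      using that \<open>map _ _ = _\<close> by (auto simp: list_eq_iff_nth_eq)
    moreover have "e ` {..<?N} = UNIV" using e by (simp add: bij_betw_def)
    ultimately show ?thesis unfolding vec_eq_iff by (metis (no_types, lifting) UNIV_I imageE lessThan_iff)
  qed
  have "definable_lpred ?N (\<lambda>xs. xs \<in> (\<lambda>x. map (\<lambda>i. x $ e i) [0..<?N]) ` A)"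
  proof -
    have "{xs. length xs = ?N \<and> xs \<in> (\<lambda>x. map (\<lambda>i. x $ e i) [0..<?N]) ` A} = (\<lambda>x. map (\<lambda>i. x $ e i) [0..<?N]) ` A"
      by auto
    then show ?thesis using A unfolding definable_lpred_def by simp
  qed
  then have "definable_lpred DIM(real ^ 'n) (\<lambda>xs. map (\<lambda>i. (\<lambda>xs. (of_coords xs :: real ^ 'n) \<bullet> axis (e i) 1) xs) [0..<?N]
     \<in> (\<lambda>x. map (\<lambda>i. x $ e i) [0..<?N]) ` A)"
    using definable_map_id[where 'a="real ^ 'n"] unfolding definable_map_def
    by (intro definable_lpred_subst) (auto simp: axis_in_Basis_iff)
  then show ?thesis unfolding definable_pred_def
  proof (rule definable_lpred_cong)
    fix xs :: "real list"
    have "map (\<lambda>i. y $ e i) [0..<?N] \<in> (\<lambda>x. map (\<lambda>i. x $ e i) [0..<?N]) ` A \<longleftrightarrow> y \<in> A" for y :: "real ^ 'n"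
      using inj by blast
    then show "(map (\<lambda>i. (of_coords xs :: real ^ 'n) \<bullet> axis (e i) 1) [0..<?N]
      \<in> (\<lambda>x. map (\<lambda>i. x $ e i) [0..<?N]) ` A) = (of_coords xs \<in> A)" by (simp add: inner_axis)
  qed
qed

lemmas definable_intros =
  definable_pred_not definable_pred_conj definable_pred_disj definable_pred_imp
  definable_pred_ex definable_pred_all definable_pred_less definable_pred_le definable_pred_eq
  definable_map_id definable_map_const definable_map_Pair definable_map_add definable_map_diff
  definable_map_mult definable_map_scaleR definable_map_norm
  definable_map_fst definable_map_snd

end

context o_minimal_structure
begin

section \<open>Definable functions of one variable\<close>

lemma definable_pred_eventually_right:
  fixes P :: "'a::euclidean_space \<Rightarrow> real \<Rightarrow> bool"
  assumes P: "definable_pred (\<lambda>z. P (fst z) (snd z))" and c: "definable_map c"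
  shows "definable_pred (\<lambda>x. eventually (P x) (at_right (c x)))"
proof -
  have "definable_pred (\<lambda>x. \<exists>b. c x < b \<and> (\<forall>y. c x < y --> y < b --> P x y))"
    by (intro definable_pred_ex definable_pred_all definable_pred_conj definable_pred_imp definable_pred_less
        definable_map_compose[OF c] definable_map_fst definable_map_snd definable_map_id
        definable_pred_compose[OF P, of "\<lambda>z. (fst (fst z), snd z)", simplified fst_conv snd_conv]
        definable_map_Pair)
  then show ?thesis unfolding eventually_at_right_field by simp
qed

lemma definable_pred_eventually_left:
  fixes P :: "'a::euclidean_space \<Rightarrow> real \<Rightarrow> bool"
  assumes P: "definable_pred (\<lambda>z. P (fst z) (snd z))" and c: "definable_map c"
  shows "definable_pred (\<lambda>x. eventually (P x) (at_left (c x)))"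
proof -
  have "definable_pred (\<lambda>x. \<exists>b. b < c x \<and> (\<forall>y. b < y --> y < c x --> P x y))"
    by (intro definable_pred_ex definable_pred_all definable_pred_conj definable_pred_imp definable_pred_less
        definable_map_compose[OF c] definable_map_fst definable_map_snd definable_map_id
        definable_pred_compose[OF P, of "\<lambda>z. (fst (fst z), snd z)", simplified fst_conv snd_conv]
        definable_map_Pair)
  then show ?thesis unfolding eventually_at_left_field by simp
qed

lemma eventually_right_dichotomy:
  assumes "definable_pred P"
  shows "eventually P (at_right (c::real)) \<or> (\<forall>\<^sub>F x in at_right c. \<not> P x)"
proof -
  have one: "(basis_list :: real list) ! 0 = 1" using basis_list_nth[of 0, where 'a=real] by simp
  have "{xs. length xs = 1 \<and> P (of_coords xs)} = (\<lambda>x. [x]) ` {x. P x}"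
  proof (intro set_eqI iffI)
    fix xs assume "xs \<in> {xs. length xs = 1 \<and> P (of_coords xs)}"
    then obtain x where x: "xs = [x]" "P (of_coords [x])" by (auto simp: length_Suc_conv)
    then show "xs \<in> (\<lambda>x. [x]) ` {x. P x}" by (simp add: of_coords_def one)
  qed (auto simp: of_coords_def one)
  then have "(\<lambda>x. [x]) ` {x. P x} \<in> S 1"
    using assms unfolding definable_pred_def definable_lpred_def by simp
  then obtain F where F: "finite F" "\<forall>I\<in>F. is_interval I" "{x. P x} = \<Union>F"
    using o_minimal[of "{x. P x}"] by auto
  have I: "(\<forall>\<^sub>F x in at_right c. x \<in> I) \<or> (\<forall>\<^sub>F x in at_right c. x \<notin> I)" if "I \<in> F" for I
  proof (rule disjCI)
    assume "\<not> (\<forall>\<^sub>F x in at_right c. x \<notin> I)"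
    then have *: "\<And>b. b > c ==> \<exists>y>c. y < b \<and> y \<in> I" unfolding eventually_at_right_field by auto
    obtain y where y: "y > c" "y \<in> I" using *[of "c + 1"] by auto
    have "x \<in> I" if "x > c" "x < y" for x
    proof -
      obtain z where "z > c" "z < x" "z \<in> I" using *[OF \<open>x > c\<close>] by auto
      then show ?thesis using F(2) \<open>I \<in> F\<close> y that unfolding is_interval_1 by (meson less_imp_le)
    qed
    then show "\<forall>\<^sub>F x in at_right c. x \<in> I" unfolding eventually_at_right_field using y by blast
  qed
  show ?thesis
  proof (cases "\<exists>I\<in>F. \<forall>\<^sub>F x in at_right c. x \<in> I")
    case True
    then obtain I where "I \<in> F" and ev: "\<forall>\<^sub>F x in at_right c. x \<in> I" by blast
    from ev have "eventually P (at_right c)" by eventually_elim (use F(3) \<open>I \<in> F\<close> in blast)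
    then show ?thesis ..
  next
    case False
    with I have "\<forall>I\<in>F. \<forall>\<^sub>F x in at_right c. x \<notin> I" by blast
    then have "\<forall>\<^sub>F x in at_right c. \<forall>I\<in>F. x \<notin> I" by (rule eventually_ball_finite[OF F(1)])
    then have "\<forall>\<^sub>F x in at_right c. \<not> P x" by eventually_elim (use F(3) in blast)
    then show ?thesis ..
  qed
qed

lemma eventually_left_dichotomy:
  assumes "definable_pred P"
  shows "eventually P (at_left (c::real)) \<or> (\<forall>\<^sub>F x in at_left c. \<not> P x)"
proof -
  have "definable_pred (\<lambda>x. P (- x))"
    by (rule definable_pred_compose[OF assms definable_map_uminus[OF definable_map_id]])
  from eventually_right_dichotomy[OF this, of "- c"] show ?thesis
    unfolding at_left_minus[of c] eventually_filtermap by simp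
qed

lemma local_trans_rel_imp_global:
  fixes f :: "real \<Rightarrow> real"
  assumes r: "\<And>x y z. r x y ==> r y z ==> r x z"
    and R: "\<And>x. x \<in> {a<..<b} ==> \<forall>\<^sub>F y in at_right x. r (f x) (f y)"
    and L: "\<And>x. x \<in> {a<..<b} ==> \<forall>\<^sub>F y in at_left x. r (f y) (f x)"
    and xy: "a < x" "x < y" "y < b"
  shows "r (f x) (f y)"
proof -
  have "x \<le> y" using xy by simp
  then have "x < y --> r (f x) (f y)"
  proof (induction rule: Bolzano)
    case (trans a b c)
    then show ?case using r by (cases "a = b"; cases "b = c") auto
  next
    case (local z)
    then have z: "z \<in> {a<..<b}" using xy by auto
    obtain c where c: "c > z" "\<And>y. z < y ==> y < c ==> r (f z) (f y)"
      using R[OF z] unfolding eventually_at_right_field by blast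
    obtain d where d: "d < z" "\<And>y. d < y ==> y < z ==> r (f y) (f z)"
      using L[OF z] unfolding eventually_at_left_field by blast
    show ?case
    proof (rule exI[of _ "min (c - z) (z - d)"], intro conjI allI impI)
      fix u v assume "u \<le> z \<and> z \<le> v \<and> v - u < min (c - z) (z - d)" "u < v"
      then show "r (f u) (f v)"
        using c(2)[of v] d(2)[of u] r[of "f u" "f z" "f v"] by (cases "u = z"; cases "v = z") auto
    qed (use c d in auto)
  qed
  then show ?thesis using xy by blast
qed

lemma not_all_strict_local_min:
  fixes f :: "real \<Rightarrow> real"
  assumes "a < b"
    and R: "\<And>x. x \<in> {a<..<b} ==> \<forall>\<^sub>F y in at_right x. f x < f y"
    and L: "\<And>x. x \<in> {a<..<b} ==> \<forall>\<^sub>F y in at_left x. f x < f y"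
  shows False
proof -
  have "\<exists>pq::rat \<times> rat. of_rat (fst pq) < x \<and> x < of_rat (snd pq) \<and>
      (\<forall>y. of_rat (fst pq) < y --> y < of_rat (snd pq) --> y \<noteq> x --> f x < f y)"
    if x: "x \<in> {a<..<b}" for x
  proof -
    obtain c where c: "c > x" "\<And>y. x < y ==> y < c ==> f x < f y"
      using R[OF x] unfolding eventually_at_right_field by blast
    obtain d where d: "d < x" "\<And>y. d < y ==> y < x ==> f x < f y"
      using L[OF x] unfolding eventually_at_left_field by blast
    obtain p where p: "d < of_rat p" "of_rat p < x" using of_rat_dense[OF d(1)] by blast
    obtain q where q: "x < of_rat q" "of_rat q < c" using of_rat_dense[OF c(1)] by blast
    show ?thesis
    proof (rule exI[of _ "(p, q)"], unfold fst_conv snd_conv, intro conjI allI impI)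
      fix y assume "of_rat p < y" "y < of_rat q" "y \<noteq> x"
      then show "f x < f y" using c(2)[of y] d(2)[of y] p q by linarith
    qed (use p q in auto)
  qed
  then obtain h :: "real \<Rightarrow> rat \<times> rat" where h: "\<And>x. x \<in> {a<..<b} ==>
      of_rat (fst (h x)) < x \<and> x < of_rat (snd (h x)) \<and>
      (\<forall>y. of_rat (fst (h x)) < y --> y < of_rat (snd (h x)) --> y \<noteq> x --> f x < f y)"
    by metis
  have "inj_on h {a<..<b}"
  proof (rule inj_onI, rule ccontr)
    fix x y assume xy: "x \<in> {a<..<b}" "y \<in> {a<..<b}" "h x = h y" "x \<noteq> y"
    have "f x < f y" using h[OF xy(1)] h[OF xy(2)] xy(3,4) by auto
    moreover have "f y < f x" using h[OF xy(1)] h[OF xy(2)] xy(3,4) by auto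
    ultimately show False by simp
  qed
  then have "countable {a<..<b}" by (rule countableI')
  then show False using \<open>a < b\<close> uncountable_open_interval by blast
qed

lemma eventually_trichotomy:
  fixes f g :: "real \<Rightarrow> real"
  assumes "definable_pred (\<lambda>x. P x)" "definable_pred (\<lambda>x. Q x)" "\<And>x. P x \<or> Q x \<or> R x"
  shows "eventually P (at_right (0::real)) \<or> eventually Q (at_right 0) \<or> eventually R (at_right 0)"
proof -
  consider "eventually P (at_right 0)" | "eventually Q (at_right 0)"
    | "\<forall>\<^sub>F x in at_right 0. \<not> P x" "\<forall>\<^sub>F x in at_right 0. \<not> Q x"
    using eventually_right_dichotomy[OF assms(1), of 0] eventually_right_dichotomy[OF assms(2), of 0] by blast
  then show ?thesis
  proof cases
    case 3
    then have "eventually R (at_right 0)" by eventually_elim (use assms(3) in blast)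
    then show ?thesis by blast
  qed blast+
qed

lemma definable_monotone:
  fixes f :: "real \<Rightarrow> real"
  assumes f: "definable_map f"
  obtains e where "e > 0" "mono_on {0<..<e} f \<or> mono_on {0<..<e} (\<lambda>x. - f x)"
proof -
  have cmp: "definable_pred (\<lambda>z. f (fst z) < f (snd z))" "definable_pred (\<lambda>z. f (fst z) = f (snd z))"
     "definable_pred (\<lambda>z. f (snd z) < f (fst z))"
    by (intro definable_intros definable_map_compose[OF f])+
  have cR: "(\<forall>\<^sub>F y in at_right x. f x < f y) \<or> (\<forall>\<^sub>F y in at_right x. f x = f y) \<or> (\<forall>\<^sub>F y in at_right x. f y < f x)"
    for x
  proof -
    have d: "definable_pred (\<lambda>y. f x < f y)" "definable_pred (\<lambda>y. f x = f y)"
      by (intro definable_intros definable_map_compose[OF f])+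
    consider "\<forall>\<^sub>F y in at_right x. f x < f y" | "\<forall>\<^sub>F y in at_right x. f x = f y"
      | "\<forall>\<^sub>F y in at_right x. \<not> f x < f y" "\<forall>\<^sub>F y in at_right x. f x \<noteq> f y"
      using eventually_right_dichotomy[OF d(1), of x] eventually_right_dichotomy[OF d(2), of x] by blast
    then show ?thesis
    proof cases
      case 3
      then have "\<forall>\<^sub>F y in at_right x. f y < f x" by eventually_elim linarith
      then show ?thesis by blast
    qed blast+
  qed
  have cL: "(\<forall>\<^sub>F y in at_left x. f x < f y) \<or> (\<forall>\<^sub>F y in at_left x. f x = f y) \<or> (\<forall>\<^sub>F y in at_left x. f y < f x)"
    for x
  proof -
    have d: "definable_pred (\<lambda>y. f x < f y)" "definable_pred (\<lambda>y. f x = f y)"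
      by (intro definable_intros definable_map_compose[OF f])+
    consider "\<forall>\<^sub>F y in at_left x. f x < f y" | "\<forall>\<^sub>F y in at_left x. f x = f y"
      | "\<forall>\<^sub>F y in at_left x. \<not> f x < f y" "\<forall>\<^sub>F y in at_left x. f x \<noteq> f y"
      using eventually_left_dichotomy[OF d(1), of x] eventually_left_dichotomy[OF d(2), of x] by blast
    then show ?thesis
    proof cases
      case 3
      then have "\<forall>\<^sub>F y in at_left x. f y < f x" by eventually_elim linarith
      then show ?thesis by blast
    qed blast+
  qed
  have tR: "(\<forall>\<^sub>F x in at_right 0. \<forall>\<^sub>F y in at_right x. f x < f y) \<or>
    (\<forall>\<^sub>F x in at_right 0. \<forall>\<^sub>F y in at_right x. f x = f y) \<or>
    (\<forall>\<^sub>F x in at_right 0. \<forall>\<^sub>F y in at_right x. f y < f x)"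
    by (rule eventually_trichotomy[OF _ _ cR])
       (rule definable_pred_eventually_right[OF _ definable_map_id], rule cmp)+
  have tL: "(\<forall>\<^sub>F x in at_right 0. \<forall>\<^sub>F y in at_left x. f x < f y) \<or>
    (\<forall>\<^sub>F x in at_right 0. \<forall>\<^sub>F y in at_left x. f x = f y) \<or>
    (\<forall>\<^sub>F x in at_right 0. \<forall>\<^sub>F y in at_left x. f y < f x)"
    by (rule eventually_trichotomy[OF _ _ cL])
       (rule definable_pred_eventually_left[OF _ definable_map_id], rule cmp)+
  have ev2: "\<exists>e>0. \<forall>x\<in>{0<..<e}. A x \<and> B x"
    if "\<forall>\<^sub>F x in at_right 0. A x" "\<forall>\<^sub>F x in at_right 0. B x" for A B :: "real \<Rightarrow> bool"
    using eventually_conj[OF that] unfolding eventually_at_right_field by auto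
  have constR: False if e: "e > 0" and h: "\<forall>x\<in>{0<..<e}. (\<forall>\<^sub>F y in at_right x. f x = f y) \<and> (\<forall>\<^sub>F y in at_left x. f x \<noteq> f y)" for e
  proof -
    obtain b where b: "b > e/2" "\<And>y. e/2 < y ==> y < b ==> f (e/2) = f y"
      using h[rule_format, of "e/2"] e unfolding eventually_at_right_field by auto
    define c where "c = (e/2 + min b e)/2"
    have c: "e/2 < c" "c < b" "c < e" using b(1) e unfolding c_def by (auto simp: min_def)
    then have "c \<in> {0<..<e}" using e by auto
    then obtain d where d: "d < c" "\<And>y. d < y ==> y < c ==> f c \<noteq> f y"
      using h unfolding eventually_at_left_field by blast
    define y where "y = (max d (e/2) + c)/2"
    have "d < y" "e/2 < y" "y < c" using d(1) c unfolding y_def by (auto simp: max_def)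
    then show False using d(2)[of y] b(2)[of y] b(2)[of c] c by simp
  qed
  have constL: False if e: "e > 0" and h: "\<forall>x\<in>{0<..<e}. (\<forall>\<^sub>F y in at_left x. f x = f y) \<and> (\<forall>\<^sub>F y in at_right x. f x \<noteq> f y)" for e
  proof -
    obtain b where b: "b < e/2" "\<And>y. b < y ==> y < e/2 ==> f (e/2) = f y"
      using h[rule_format, of "e/2"] e unfolding eventually_at_left_field by auto
    define c where "c = (e/2 + max b 0)/2"
    have c: "c < e/2" "b < c" "0 < c" using b(1) e unfolding c_def by (auto simp: max_def)
    then have "c \<in> {0<..<e}" using e by auto
    then obtain d where d: "d > c" "\<And>y. c < y ==> y < d ==> f c \<noteq> f y"
      using h unfolding eventually_at_right_field by blast
    define y where "y = (min d (e/2) + c)/2"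
    have "y < d" "y < e/2" "c < y" using d(1) c unfolding y_def by (auto simp: min_def)
    then show False using d(2)[of y] b(2)[of y] b(2)[of c] c by simp
  qed
  have neqI: "\<forall>\<^sub>F y in F. f x \<noteq> f y" if "(\<forall>\<^sub>F y in F. f x < f y) \<or> (\<forall>\<^sub>F y in F. f y < f x)" for F x
    using that by (elim disjE) (auto elim: eventually_mono)
  obtain A where A: "A \<in> {(<), (=), (>)}" and evA: "\<forall>\<^sub>F x in at_right 0. \<forall>\<^sub>F y in at_right x. A (f x) (f y)"
  proof -
    note 1 = that[of "(<)"] and 2 = that[of "(=)"] and 3 = that[of "(>)"]
    show thesis by (rule disjE[OF tR], rule 1) (simp, assumption, elim disjE, (rule 2, simp, assumption), rule 3, simp_all)
  qed
  obtain B where B: "B \<in> {(<), (=), (>)}" and evB: "\<forall>\<^sub>F x in at_right 0. \<forall>\<^sub>F y in at_left x. B (f x) (f y)"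
  proof -
    note 1 = that[of "(<)"] and 2 = that[of "(=)"] and 3 = that[of "(>)"]
    show thesis by (rule disjE[OF tL], rule 1) (simp, assumption, elim disjE, (rule 2, simp, assumption), rule 3, simp_all)
  qed
  obtain e where e: "e > 0" and RA: "\<And>x. x \<in> {0<..<e} ==> \<forall>\<^sub>F y in at_right x. A (f x) (f y)"
    and LB: "\<And>x. x \<in> {0<..<e} ==> \<forall>\<^sub>F y in at_left x. B (f x) (f y)"
    using ev2[OF evA evB] by blast
  consider "A = (=)" "B = (=)" | "A = (=)" "B = (<) \<or> B = (>)" | "B = (=)" "A = (<) \<or> A = (>)"
    | "A = (<)" "B = (<)" | "A = (>)" "B = (>)" | "A = (<)" "B = (>)" | "A = (>)" "B = (<)"
    using A B by blast
  then show thesis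
  proof cases
    case 1
    have "f x = f y" if "0 < x" "x < y" "y < e" for x y
      by (rule local_trans_rel_imp_global[where r = "(=)", OF _ _ _ that])
         (use RA LB 1 in \<open>auto simp: eq_commute elim!: eventually_mono\<close>)
    then have "mono_on {0<..<e} f" by (intro mono_onI) (metis greaterThanLessThan_iff less_eq_real_def)
    then show thesis using that e by blast
  next
    case 2
    have "\<forall>x\<in>{0<..<e}. (\<forall>\<^sub>F y in at_right x. f x = f y) \<and> (\<forall>\<^sub>F y in at_left x. f x \<noteq> f y)"
      using RA LB 2 neqI by auto
    then show thesis using constR e by blast
  next
    case 3
    have "\<forall>x\<in>{0<..<e}. (\<forall>\<^sub>F y in at_left x. f x = f y) \<and> (\<forall>\<^sub>F y in at_right x. f x \<noteq> f y)"
      using RA LB 3 neqI by auto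
    then show thesis using constL e by blast
  next
    case 4
    then show thesis using not_all_strict_local_min[OF e, of f] RA LB by blast
  next
    case 5
    then show thesis using not_all_strict_local_min[OF e, of "\<lambda>x. - f x"] RA LB by simp
  next
    case 6
    have "f x < f y" if "0 < x" "x < y" "y < e" for x y
      by (rule local_trans_rel_imp_global[where r = "(<)", OF _ _ _ that])
         (use RA LB 6 in auto)
    then have "mono_on {0<..<e} f" by (intro mono_onI) (metis greaterThanLessThan_iff less_eq_real_def)
    then show thesis using that e by blast
  next
    case 7
    have "f x > f y" if "0 < x" "x < y" "y < e" for x y
      by (rule local_trans_rel_imp_global[where r = "(>)", OF _ _ _ that])
         (use RA LB 7 in auto)
    then have "mono_on {0<..<e} (\<lambda>x. - f x)" by (intro mono_onI) (metis greaterThanLessThan_iff less_eq_real_def neg_le_iff_le)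
    then show thesis using that e by blast
  qed
qed

lemma definable_eventually_isCont:
  fixes f :: "real \<Rightarrow> real"
  assumes f: "definable_map f"
  shows "\<forall>\<^sub>F x in at_right 0. isCont f x"
proof -
  have "definable_pred (\<lambda>x. \<forall>\<epsilon>. 0 < \<epsilon> --> (\<exists>d. 0 < d \<and> (\<forall>y. norm (y - x) < d --> norm (f y - f x) < \<epsilon>)))"
    by (intro definable_intros definable_map_compose[OF f])
  moreover have "(\<lambda>x. \<forall>\<epsilon>. 0 < \<epsilon> --> (\<exists>d. 0 < d \<and> (\<forall>y. norm (y - x) < d --> norm (f y - f x) < \<epsilon>))) = (\<lambda>x. isCont f x)"
    by (rule ext) (simp add: continuous_at_eps_delta dist_norm)
  ultimately have d: "definable_pred (\<lambda>x. isCont f x)" by simp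
  show ?thesis
  proof (rule ccontr)
    assume "\<not> ?thesis"
    then have "\<forall>\<^sub>F x in at_right 0. \<not> isCont f x" using eventually_right_dichotomy[OF d, of 0] by blast
    then obtain b where b: "b > 0" "\<And>x. 0 < x ==> x < b ==> \<not> isCont f x"
      unfolding eventually_at_right_field by blast
    obtain e where e: "e > 0" "mono_on {0<..<e} f \<or> mono_on {0<..<e} (\<lambda>x. - f x)"
      using definable_monotone[OF f] by blast
    have "isCont f x" if "isCont (\<lambda>x. - f x) x" for x
      using isCont_minus[OF that] by simp
    then have "countable {a\<in>{0<..<e}. \<not> isCont f a}"
      using e(2) mono_on_ctble_discont_open[of "{0<..<e}" f] mono_on_ctble_discont_open[of "{0<..<e}" "\<lambda>x. - f x"]
      by (elim disjE) (auto elim!: countable_subset[rotated])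
    moreover have "{0<..<min b e} \<subseteq> {a\<in>{0<..<e}. \<not> isCont f a}" using b(2) by auto
    ultimately have "countable {0<..<min b e}" by (rule countable_subset[rotated])
    then show False using uncountable_open_interval[of 0 "min b e"] b(1) e(1) by simp
  qed
qed

lemma nondecreasing_of_right_local:
  fixes f :: "real \<Rightarrow> real"
  assumes "u \<le> v" "continuous_on {u..v} f"
    and R: "\<And>x. u \<le> x ==> x < v ==> \<forall>\<^sub>F y in at_right x. f x \<le> f y"
  shows "f u \<le> f v"
proof -
  let ?A = "{u..v} \<inter> f -` {f u..}"
  have "closed ?A" by (rule continuous_closed_preimage[OF assms(2)]) auto
  moreover have "bounded ?A" by (rule bounded_subset[of "{u..v}"]) auto
  ultimately have "compact ?A" by (simp add: compact_eq_bounded_closed)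
  moreover have "u \<in> ?A" using assms(1) by simp
  ultimately obtain s where s: "s \<in> ?A" "\<And>t. t \<in> ?A ==> t \<le> s"
    using compact_attains_sup[of ?A] by blast
  have "s = v"
  proof (rule ccontr)
    assume "s \<noteq> v"
    then have sv: "u \<le> s" "s < v" using s(1) by auto
    then obtain b where b: "b > s" "\<And>y. s < y ==> y < b ==> f s \<le> f y"
      using R unfolding eventually_at_right_field by blast
    define y where "y = (s + min b v) / 2"
    have "s < y" "y < b" "y < v" using b(1) sv unfolding y_def by (auto simp: min_def)
    then have "y \<in> ?A" using b(2)[of y] s(1) sv by auto
    then show False using s(2) \<open>s < y\<close> by force
  qed
  then show ?thesis using s(1) by simp
qed

end

context o_minimal_structure
begin

lemma increment_ge_of_right_local:
  fixes f :: "real \<Rightarrow> real"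
  assumes "u \<le> v" "continuous_on {u..v} f"
    and R: "\<And>x. u \<le> x ==> x < v ==> \<forall>\<^sub>F h in at_right 0. a * h \<le> f (x + h) - f x"
  shows "a * (v - u) \<le> f v - f u"
proof -
  have "f u - a * u \<le> f v - a * v"
  proof (rule nondecreasing_of_right_local[OF assms(1)])
    show "continuous_on {u..v} (\<lambda>x. f x - a * x)" using assms(2) by (intro continuous_intros)
    fix x assume "u \<le> x" "x < v"
    from R[OF this] have "\<forall>\<^sub>F y in at_right x. a * (y - x) \<le> f (x + (y - x)) - f x"
      by (subst eventually_at_right_to_0) (simp add: add.commute)
    then show "\<forall>\<^sub>F y in at_right x. f x - a * x \<le> f y - a * y"
      by eventually_elim (simp add: algebra_simps)
  qed
  then show ?thesis by (simp add: algebra_simps)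
qed

lemma definable_map_if:
  fixes f g :: "'a::euclidean_space \<Rightarrow> real"
  assumes "definable_pred P" "definable_map f" "definable_map g"
  shows "definable_map (\<lambda>x. if P x then f x else g x)"
proof (rule definable_map_graph)
  have "definable_pred (\<lambda>z. (P (fst z) \<and> snd z = f (fst z)) \<or> (\<not> P (fst z) \<and> snd z = g (fst z)))"
    by (intro definable_intros definable_map_compose[OF assms(2)] definable_map_compose[OF assms(3)]
        definable_pred_compose[OF assms(1)])
  moreover have "(\<lambda>z. (P (fst z) \<and> snd z = f (fst z)) \<or> (\<not> P (fst z) \<and> snd z = g (fst z)))
    = (\<lambda>z. snd z = (if P (fst z) then f (fst z) else g (fst z)))" by (rule ext) auto
  ultimately show "definable_pred (\<lambda>z. snd z = (if P (fst z) then f (fst z) else g (fst z)))" by simp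
qed

lemma definable_map_the:
  fixes P :: "'a::euclidean_space \<Rightarrow> real \<Rightarrow> bool"
  assumes "definable_pred (\<lambda>z. P (fst z) (snd z))" "\<forall>x u v. P x u --> P x v --> u = v"
  shows "\<exists>g. definable_map g \<and> (\<forall>x u. P x u --> g x = u)"
proof -
  define g where "g x = (if \<exists>u. P x u then (THE u. P x u) else 0)" for x
  have g: "g x = u" if "P x u" for x u
    unfolding g_def using that assms(2) by auto
  have "definable_map g"
  proof (rule definable_map_graph)
    have "definable_pred (\<lambda>z. P (fst z) (snd z) \<or> (\<not> (\<exists>u. P (fst z) u) \<and> snd z = 0))"
      by (intro definable_intros assms(1)
          definable_pred_compose[OF assms(1), of "\<lambda>z. (fst (fst z), snd z)", simplified fst_conv snd_conv])
    moreover have "(\<lambda>z. P (fst z) (snd z) \<or> (\<not> (\<exists>u. P (fst z) u) \<and> snd z = 0)) = (\<lambda>z. snd z = g (fst z))"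
    proof (rule ext)
      fix z :: "'a \<times> real"
      show "(P (fst z) (snd z) \<or> (\<not> (\<exists>u. P (fst z) u) \<and> snd z = 0)) = (snd z = g (fst z))"
      proof (cases "\<exists>u. P (fst z) u")
        case True
        then obtain u where "P (fst z) u" by blast
        with g[OF this] assms(2)[rule_format, of "fst z" u "snd z"] show ?thesis by auto
      next
        case False
        then show ?thesis by (simp add: g_def)
      qed
    qed
    ultimately show "definable_pred (\<lambda>z. snd z = g (fst z))" by simp
  qed
  with g show ?thesis by blast
qed

lemma definable_Sup:
  fixes B :: "'a::euclidean_space \<Rightarrow> real \<Rightarrow> bool"
  assumes "definable_pred (\<lambda>z. B (fst z) (snd z))"
  obtains s where "definable_map s"
    "\<And>x w u. B x w ==> (\<And>w. B x w ==> w \<le> u) ==> s x = Sup {w. B x w}"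
proof -
  define P where "P x v \<longleftrightarrow> (\<forall>w. B x w --> w \<le> v) \<and> (\<forall>u. (\<forall>w. B x w --> w \<le> u) --> v \<le> u)" for x v
  have dP: "definable_pred (\<lambda>z. P (fst z) (snd z))" unfolding P_def
    by (intro definable_intros
        definable_pred_compose[OF assms(1), of "\<lambda>z. (fst (fst z), snd z)", simplified fst_conv snd_conv]
        definable_pred_compose[OF assms(1), of "\<lambda>z. (fst (fst (fst z)), snd z)", simplified fst_conv snd_conv])
  have uP: "\<forall>x u v. P x u --> P x v --> u = v"
    unfolding P_def by (meson order_antisym)
  from definable_map_the[of P, OF dP uP]
  obtain s where s: "definable_map s" "\<And>x u. P x u ==> s x = u" by blast
  have "s x = Sup {w. B x w}" if "B x w" "\<And>w. B x w ==> w \<le> u" for x w u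
  proof (rule s(2))
    have "bdd_above {w. B x w}" "{w. B x w} \<noteq> {}" using that by (auto intro!: bdd_aboveI)
    then show "P x (Sup {w. B x w})" unfolding P_def by (auto intro: cSup_upper cSup_least)
  qed
  then show thesis using that s(1) by blast
qed

lemma definable_choice_real:
  fixes J :: "'a::euclidean_space \<Rightarrow> real \<Rightarrow> bool"
  assumes J: "definable_pred (\<lambda>z. J (fst z) (snd z))" and K': "\<forall>x v. J x v --> \<bar>v\<bar> \<le> K"
  obtains t where "definable_map t" "\<And>x v. J x v ==> J x (t x)"
proof -
  note K = K'[rule_format]
  note Jc = definable_pred_compose[OF J, of "\<lambda>z. (_ z, _ z)", simplified fst_conv snd_conv]
  have "definable_pred (\<lambda>z. (\<lambda>x w. J x (- w)) (fst z) (snd z))"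
    by (intro Jc definable_intros definable_map_uminus)
  then obtain s where s: "definable_map s"
    "\<And>x w u. J x (- w) ==> (\<And>w. J x (- w) ==> w \<le> u) ==> s x = Sup {w. J x (- w)}"
    by (rule definable_Sup) blast
  define a where "a x = - s x" for x
  have da: "definable_map a" unfolding a_def by (intro definable_map_uminus s(1))
  have sx: "s x = Sup {w. J x (- w)}" if "J x v" for x v
    by (rule s(2)[of x "- v" K]) (use that K in \<open>auto dest: K\<close>)
  have bdd: "bdd_above {w. J x (- w)}" for x
    by (rule bdd_aboveI[of _ K]) (auto dest: K)
  have a_le: "a x \<le> v" if "J x v" for x v
    using cSup_upper[OF _ bdd, of "- v" x] that sx[OF that] unfolding a_def by simp
  have a_approx: "\<exists>w. J x w \<and> w < a x + d" if "J x v" "d > 0" for x v d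
  proof (rule ccontr)
    assume "\<not> ?thesis"
    then have "\<And>w. J x w ==> a x + d \<le> w" by force
    note h = this
    have "Sup {w. J x (- w)} \<le> - (a x + d)"
    proof (rule cSup_least)
      have "- v \<in> {w. J x (- w)}" using that by simp
      then show "{w. J x (- w)} \<noteq> {}" by blast
      fix w assume "w \<in> {w. J x (- w)}"
      then show "w \<le> - (a x + d)" using h[of "- w"] by simp
    qed
    then show False using sx[OF that(1)] \<open>d > 0\<close> unfolding a_def by simp
  qed
  let ?B = "\<lambda>x b. b \<le> a x + 1 \<and> (\<forall>w. a x < w \<and> w < b --> J x w)"
  have "definable_pred (\<lambda>z. ?B (fst z) (snd z))"
    by (intro definable_intros definable_map_compose[OF da] Jc)
  then obtain b where b: "definable_map b"
    "\<And>x w u. ?B x w ==> (\<And>w. ?B x w ==> w \<le> u) ==> b x = Sup {w. ?B x w}"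
    by (rule definable_Sup) blast
  define t where "t x = (if J x (a x) then a x else (a x + b x) * (1/2))" for x
  have "definable_map t" unfolding t_def
    by (intro definable_map_if definable_intros da b(1) Jc)
  moreover have "J x (t x)" if v: "J x v" for x v
  proof (cases "J x (a x)")
    case False
    have "definable_pred (\<lambda>w. J x w)" by (intro Jc definable_intros)
    from eventually_right_dichotomy[OF this, of "a x"]
    have "\<forall>\<^sub>F w in at_right (a x). J x w"
    proof
      assume "\<forall>\<^sub>F w in at_right (a x). \<not> J x w"
      then obtain c where c: "c > a x" "\<And>w. a x < w ==> w < c ==> \<not> J x w"
        unfolding eventually_at_right_field by blast
      obtain w where "J x w" "w < a x + (c - a x)" using a_approx[OF v, of "c - a x"] c(1) by auto
      then show ?thesis using c(2)[of w] a_le[of x w] False by (cases "w = a x") auto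
    qed
    then obtain c where c: "c > a x" "\<And>w. a x < w ==> w < c ==> J x w"
      unfolding eventually_at_right_field by blast
    have Bc: "?B x (min c (a x + 1))" using c by auto
    have bx: "b x = Sup {w. ?B x w}" by (rule b(2)[OF Bc, of "a x + 1"]) simp
    have bd: "bdd_above {w. ?B x w}" by (rule bdd_aboveI[of _ "a x + 1"]) auto
    have "min c (a x + 1) \<le> b x" unfolding bx by (rule cSup_upper[OF _ bd]) (use Bc in simp)
    then have ab: "a x < b x" using c(1) by auto
    then have "(a x + b x) * (1/2) < b x" by simp
    then obtain w where "?B x w" "(a x + b x) * (1/2) < w" unfolding bx
      using less_cSup_iff[OF _ bd] Bc by blast
    moreover have "a x < (a x + b x) * (1/2)" using ab by simp
    ultimately have "J x ((a x + b x) * (1/2))" by blast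
    then show ?thesis using False by (simp add: t_def)
  qed (simp add: t_def)
  ultimately show thesis using that by blast
qed

lemma definable_choice:
  fixes C :: "'a::euclidean_space \<Rightarrow> 'b::euclidean_space \<Rightarrow> bool"
  assumes C: "definable_pred (\<lambda>z. C (fst z) (snd z))" and K: "\<forall>x y. C x y --> norm y \<le> K"
  obtains t where "definable_map t" "\<And>x y. C x y ==> C x (t x)"
proof -
  have "\<exists>t::'a \<Rightarrow> 'b. definable_map t \<and> (\<forall>x. (\<exists>y. C x y) --> (\<exists>y. C x y \<and> (\<forall>b\<in>B. y \<bullet> b = t x \<bullet> b)))"
    if "finite B" "B \<subseteq> Basis" for B
    using that
  proof (induction B rule: finite_induct)
    case empty
    then show ?case by (intro exI[of _ "\<lambda>_. 0"]) (auto intro: definable_map_const)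
  next
    case (insert b B)
    then obtain t :: "'a \<Rightarrow> 'b" where t: "definable_map t"
      "\<forall>x. (\<exists>y. C x y) --> (\<exists>y. C x y \<and> (\<forall>b\<in>B. y \<bullet> b = t x \<bullet> b))" by auto
    define J where "J x v \<longleftrightarrow> (\<exists>y. C x y \<and> (\<forall>b\<in>B. y \<bullet> b = t x \<bullet> b) \<and> y \<bullet> b = v)" for x v
    have d: "definable_pred (\<lambda>z. J (fst z) (snd z))"
      unfolding J_def using insert.prems
      by (intro definable_intros definable_pred_finite_ball[OF insert.hyps(1)] definable_map_inner
          definable_map_compose[OF t(1)]
          definable_pred_compose[OF C, of "\<lambda>z. (fst (fst z), snd z)", simplified fst_conv snd_conv])
    have bnd: "\<bar>v\<bar> \<le> K" if J: "J x v" for x v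
    proof -
      obtain y where y: "C x y" "y \<bullet> b = v" using J unfolding J_def by blast
      have "norm b = 1" using insert.prems by simp
      then have "\<bar>y \<bullet> b\<bar> \<le> norm y" using Cauchy_Schwarz_ineq2[of y b] by simp
      then show ?thesis using K y by force
    qed
    obtain t1 where t1: "definable_map t1" "\<And>x v. J x v ==> J x (t1 x)"
      using definable_choice_real[of J K] d bnd by blast
    define t' where "t' x = t x + (t1 x - t x \<bullet> b) *\<^sub>R b" for x
    have "definable_map t'" unfolding t'_def
      by (intro definable_intros definable_map_inner t(1) t1(1))
    moreover have "\<exists>y. C x y \<and> (\<forall>b\<in>insert b B. y \<bullet> b = t' x \<bullet> b)" if C1: "C x y" for x y
    proof -
      obtain y1 where "C x y1" "\<forall>b\<in>B. y1 \<bullet> b = t x \<bullet> b" using t(2) C1 by blast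
      then have "J x (y1 \<bullet> b)" unfolding J_def by blast
      from t1(2)[OF this] J_def obtain y2 where y2: "C x y2" "\<forall>b\<in>B. y2 \<bullet> b = t x \<bullet> b" "y2 \<bullet> b = t1 x" by blast
      have "y2 \<bullet> b' = t' x \<bullet> b'" if "b' \<in> insert b B" for b'
      proof (cases "b' = b")
        case True
        then show ?thesis using y2(3) insert.prems by (simp add: t'_def inner_add_left)
      next
        case False
        then have "b \<bullet> b' = 0" using insert.prems that by (auto intro: inner_not_same_Basis)
        then show ?thesis using y2(2) that False by (simp add: t'_def inner_add_left)
      qed
      then show ?thesis using y2(1) by blast
    qed
    ultimately show ?case by blast
  qed
  from this[OF finite_Basis subset_refl] obtain t :: "'a \<Rightarrow> 'b" where t: "definable_map t"
    "\<And>x y. C x y ==> \<exists>y. C x y \<and> (\<forall>b\<in>Basis. y \<bullet> b = t x \<bullet> b)" by blast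
  have "C x (t x)" if "C x y" for x y
    using t(2)[OF that] by (metis euclidean_eqI)
  then show thesis using that t(1) by blast
qed

lemma definable_curve_selection:
  fixes B :: "'a::euclidean_space \<Rightarrow> 'a \<Rightarrow> bool"
  assumes B: "definable_pred (\<lambda>z. B (fst z) (snd z))"
    and Bn': "\<forall>y p. B y p --> y \<noteq> p \<and> norm (y - p) \<le> norm (y - x0)"
    and Bx': "\<forall>\<epsilon>>0. \<exists>y p. B y p \<and> norm (y - x0) < \<epsilon>"
  obtains \<gamma> p where "definable_map \<gamma>" "definable_map p"
    "\<forall>\<^sub>F s in at_right 0. B (\<gamma> s) (p s) \<and> norm (\<gamma> s - p s) = s"
    "(\<gamma> \<longlongrightarrow> x0) (at_right 0)"
proof -
  note Bn = Bn'[rule_format] and Bx = Bx'[rule_format]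
  define D where "D s z \<longleftrightarrow> B (fst z) (snd z) \<and> norm (fst z - x0) \<le> 1 \<and> norm (fst z - snd z) = s" for s z
  define C where "C s z \<longleftrightarrow> D s z \<and> (\<forall>z'. D s z' --> norm (fst z - x0) < norm (fst z' - x0) + s)" for s z
  have dD: "definable_pred (\<lambda>w. D (t w) (z w))" if "definable_map t" "definable_map z"
    for t :: "'w::euclidean_space \<Rightarrow> real" and z
    unfolding D_def
    by (intro definable_intros that definable_pred_compose[OF B that(2)])
  have dC: "definable_pred (\<lambda>w. C (fst w) (snd w))"
    unfolding C_def D_def
    by (intro definable_intros definable_pred_compose[OF B])
  have bnd: "norm z \<le> (norm x0 + 1) + (norm x0 + 2)" if "C s z" for s z
  proof -
    have z: "B (fst z) (snd z)" "norm (fst z - x0) \<le> 1" using that unfolding C_def D_def by auto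
    have "norm (fst z - snd z) \<le> 1" using Bn[OF z(1)] z(2) by simp
    then have "norm (snd z) \<le> norm x0 + 2"
      using z(2) norm_triangle_ineq2[of "snd z" "fst z"] norm_triangle_ineq2[of "fst z" x0]
      by (simp add: norm_minus_commute)
    moreover have "norm (fst z) \<le> norm x0 + 1"
      using z(2) norm_triangle_ineq2[of "fst z" x0] by simp
    moreover have "norm z \<le> norm (fst z) + norm (snd z)"
      by (cases z) (simp add: norm_Pair sqrt_sum_squares_le_sum)
    ultimately show ?thesis by linarith
  qed
  have Cex: "\<exists>z. C s z" if Dw: "D s w" and s0: "s > 0" for s w
  proof -
    have ne: "(\<lambda>z. norm (fst z - x0)) ` {z. D s z} \<noteq> {}" using Dw by blast
    have bb: "bdd_below ((\<lambda>z. norm (fst z - x0)) ` {z. D s z})" by (rule bdd_belowI[of _ 0]) auto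
    let ?i = "Inf ((\<lambda>z. norm (fst z - x0)) ` {z. D s z})"
    obtain v where "v \<in> (\<lambda>z. norm (fst z - x0)) ` {z. D s z}" "v < ?i + s"
    proof -
      have "?i < ?i + s" using s0 by simp
      from cInf_lessD[OF ne this] show thesis using that by blast
    qed
    then obtain z where z: "D s z" "norm (fst z - x0) < ?i + s" by auto
    have "?i \<le> norm (fst z' - x0)" if "D s z'" for z'
      by (rule cInf_lower[OF _ bb]) (use that in auto)
    then have "C s z" unfolding C_def using z by (meson add_right_mono order_less_le_trans)
    then show ?thesis by blast
  qed
  have small: "\<exists>z s. D s z \<and> 0 < s \<and> s < \<epsilon> \<and> norm (fst z - x0) < \<epsilon>" if "\<epsilon> > 0" for \<epsilon>
  proof -
    obtain y p where "B y p" "norm (y - x0) < min \<epsilon> 1" using Bx[of "min \<epsilon> 1"] \<open>\<epsilon> > 0\<close> by (meson min_less_iff_conj zero_less_one)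
    then show ?thesis using Bn[of y p]
      by (intro exI[of _ "(y, p)"] exI[of _ "norm (y - p)"]) (auto simp: D_def)
  qed
  obtain t where t: "definable_map t" "\<And>s z. C s z ==> C s (t s)"
    using definable_choice[of C, OF dC] bnd by blast
  have "definable_pred (\<lambda>s. C s (t s))"
    by (rule definable_pred_compose[OF dC, of "\<lambda>s. (s, t s)", simplified fst_conv snd_conv])
       (intro definable_intros t(1))
  from eventually_right_dichotomy[OF this, of 0] have evC: "\<forall>\<^sub>F s in at_right 0. C s (t s)"
  proof
    assume "\<forall>\<^sub>F s in at_right 0. \<not> C s (t s)"
    then obtain b where b: "b > 0" "\<And>s. 0 < s ==> s < b ==> \<not> C s (t s)"
      unfolding eventually_at_right_field by blast
    obtain z s where "D s z" "0 < s" "s < b" using small[OF b(1)] by blast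
    then show ?thesis using Cex[of s z] t(2) b(2) by blast
  qed
  have dt: "definable_map (\<lambda>s. norm (fst (t s) - x0))"
    by (intro definable_intros t(1))
  have "((\<lambda>s. fst (t s)) \<longlongrightarrow> x0) (at_right 0)"
    unfolding tendsto_iff
  proof (intro allI impI)
    fix \<epsilon> :: real assume "\<epsilon> > 0"
    have "definable_pred (\<lambda>s. norm (fst (t s) - x0) < \<epsilon>)"
      by (rule definable_pred_less[OF dt definable_map_const])
    from eventually_right_dichotomy[OF this, of 0]
    show "\<forall>\<^sub>F s in at_right 0. dist (fst (t s)) x0 < \<epsilon>"
    proof
      assume "\<forall>\<^sub>F s in at_right 0. \<not> norm (fst (t s) - x0) < \<epsilon>"
      with evC have "\<forall>\<^sub>F s in at_right 0. C s (t s) \<and> \<not> norm (fst (t s) - x0) < \<epsilon>" by eventually_elim simp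
      then obtain b where b: "b > 0" "\<And>s. 0 < s ==> s < b ==> C s (t s) \<and> \<not> norm (fst (t s) - x0) < \<epsilon>"
        unfolding eventually_at_right_field by blast
      obtain z s where z: "D s z" "0 < s" "s < min b (\<epsilon>/2)" "norm (fst z - x0) < min b (\<epsilon>/2)"
        using small[of "min b (\<epsilon>/2)"] b(1) \<open>\<epsilon> > 0\<close> by auto
      then have *: "C s (t s)" "\<not> norm (fst (t s) - x0) < \<epsilon>" using b(2)[of s] by auto
      then have "norm (fst (t s) - x0) < norm (fst z - x0) + s" using z(1) unfolding C_def by blast
      then have False using z *(2) by simp
      then show ?thesis ..
    qed (simp add: dist_norm)
  qed
  moreover have "\<forall>\<^sub>F s in at_right 0. B (fst (t s)) (snd (t s)) \<and> norm (fst (t s) - snd (t s)) = s"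
    using evC by eventually_elim (simp add: C_def D_def)
  ultimately show thesis
    by (intro that[of "\<lambda>s. fst (t s)" "\<lambda>s. snd (t s)"] definable_map_fst definable_map_snd t(1))
qed

lemma definable_derivative:
  fixes f :: "real \<Rightarrow> real"
  assumes f: "definable_map f"
  shows "\<exists>e>0. \<exists>g. definable_map g \<and> continuous_on {0<..<e} g \<and>
    (\<forall>x\<in>{0<..<e}. (f has_real_derivative g x) (at x))"
proof -
  note df = definable_map_compose[OF f]
  have dinc: "definable_pred (\<lambda>z. \<forall>\<^sub>F h in at_right 0. a z * h \<le> f (x z + h) - f (x z))"
    "definable_pred (\<lambda>z. \<forall>\<^sub>F h in at_right 0. f (x z + h) - f (x z) \<le> a z * h)"
    if "definable_map a" "definable_map x" for a x :: "'w::euclidean_space \<Rightarrow> real"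
    by (intro definable_pred_eventually_right definable_intros df definable_map_compose[OF that(1)]
        definable_map_compose[OF that(2)])+
  obtain e1 where e1: "e1 > 0" "\<And>x. x \<in> {0<..<e1} ==> isCont f x"
    using definable_eventually_isCont[OF f] unfolding eventually_at_right_field by auto
  have not_inf: False
    if "e > 0" "e \<le> e1" "\<And>x a. x \<in> {0<..<e} ==> \<forall>\<^sub>F h in at_right 0. a * h \<le> s * (f (x + h) - f x)"
    for e s :: real
  proof -
    have c: "continuous_on {e/3..e/2} (\<lambda>x. s * f x)"
      by (intro continuous_intros continuous_at_imp_continuous_on ballI e1(2)) (use that(1,2) in auto)
    have "a * (e/2 - e/3) \<le> s * f (e/2) - s * f (e/3)" for a
      by (rule increment_ge_of_right_local[OF _ c])
         (use that(1) that(3) in \<open>auto simp: right_diff_distrib[symmetric]\<close>)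
    from this[of "(s * f (e/2) - s * f (e/3) + 1) * (6/e)"] show False
      using that(1) by (simp add: field_simps)
  qed
  have d1: "definable_pred (\<lambda>x. \<forall>a. \<forall>\<^sub>F h in at_right 0. a * h \<le> f (x + h) - f x)"
    by (intro definable_pred_all dinc definable_intros)
  have d2: "definable_pred (\<lambda>x. \<forall>a. \<forall>\<^sub>F h in at_right 0. f (x + h) - f x \<le> a * h)"
    by (intro definable_pred_all dinc definable_intros)
  have n1: "\<forall>\<^sub>F x in at_right 0. \<not> (\<forall>a. \<forall>\<^sub>F h in at_right 0. a * h \<le> f (x + h) - f x)"
  proof (rule ccontr)
    assume "\<not> ?thesis"
    then have "\<forall>\<^sub>F x in at_right 0. \<forall>a. \<forall>\<^sub>F h in at_right 0. a * h \<le> f (x + h) - f x"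
      using eventually_right_dichotomy[OF d1, of 0] by blast
    then obtain b where b: "b > 0" "\<And>x. 0 < x ==> x < b ==> \<forall>a. \<forall>\<^sub>F h in at_right 0. a * h \<le> f (x + h) - f x"
      unfolding eventually_at_right_field by blast
    show False using not_inf[of "min b e1" 1] b e1(1) by auto
  qed
  have n2: "\<forall>\<^sub>F x in at_right 0. \<not> (\<forall>a. \<forall>\<^sub>F h in at_right 0. f (x + h) - f x \<le> a * h)"
  proof (rule ccontr)
    assume "\<not> ?thesis"
    then have "\<forall>\<^sub>F x in at_right 0. \<forall>a. \<forall>\<^sub>F h in at_right 0. f (x + h) - f x \<le> a * h"
      using eventually_right_dichotomy[OF d2, of 0] by blast
    then obtain b where b: "b > 0" "\<And>x. 0 < x ==> x < b ==> \<forall>a. \<forall>\<^sub>F h in at_right 0. f (x + h) - f x \<le> a * h"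
      unfolding eventually_at_right_field by blast
    have "\<forall>\<^sub>F h in at_right 0. a * h \<le> - 1 * (f (x + h) - f x)" if "x \<in> {0<..<min b e1}" for x a
      using b(2)[of x, THEN spec, of "- a"] that by (auto elim!: eventually_mono)
    then show False using not_inf[of "min b e1" "-1"] b(1) e1(1) by simp
  qed
  define L where "L x r \<longleftrightarrow> (\<forall>\<epsilon>>0. (\<forall>\<^sub>F h in at_right 0. (r - \<epsilon>) * h \<le> f (x + h) - f x) \<and>
      (\<forall>\<^sub>F h in at_right 0. f (x + h) - f x \<le> (r + \<epsilon>) * h))" for x r
  have dL: "definable_pred (\<lambda>z. L (fst z) (snd z))" unfolding L_def
    by (intro definable_intros dinc)
  have uL: "u \<le> v" if "L x u" "L x v" for x u v
  proof (rule ccontr)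
    assume "\<not> u \<le> v"
    define \<epsilon> where "\<epsilon> = (u - v)/3"
    have "\<epsilon> > 0" using \<open>\<not> u \<le> v\<close> by (simp add: \<epsilon>_def)
    then have "\<forall>\<^sub>F h in at_right 0. (u - \<epsilon>) * h \<le> f (x + h) - f x" "\<forall>\<^sub>F h in at_right 0. f (x + h) - f x \<le> (v + \<epsilon>) * h"
      using that unfolding L_def by blast+
    moreover have "\<forall>\<^sub>F h in at_right 0. (0::real) < h" by (rule eventually_at_right_less)
    ultimately have "\<forall>\<^sub>F h in at_right (0::real). False"
    proof eventually_elim
      case (elim h)
      then have "(u - \<epsilon>) * h \<le> (v + \<epsilon>) * h" by linarith
      then have "u - \<epsilon> \<le> v + \<epsilon>" using elim(3) by (simp add: mult_le_cancel_right)
      moreover have "3 * \<epsilon> = u - v" by (simp add: \<epsilon>_def)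
      ultimately show False using \<open>\<epsilon> > 0\<close> by linarith
    qed
    then show False by simp
  qed
  have exL: "\<exists>r. L x r" if n: "\<not> (\<forall>a. \<forall>\<^sub>F h in at_right 0. a * h \<le> f (x + h) - f x)"
      "\<not> (\<forall>a. \<forall>\<^sub>F h in at_right 0. f (x + h) - f x \<le> a * h)" for x
  proof -
    let ?A = "{a. \<forall>\<^sub>F h in at_right 0. a * h \<le> f (x + h) - f x}"
    have dich: "a \<in> ?A \<or> (\<forall>\<^sub>F h in at_right 0. f (x + h) - f x \<le> a * h)" for a
    proof -
      have "definable_pred (\<lambda>h. a * h \<le> f (x + h) - f x)" by (intro definable_intros df)
      from eventually_right_dichotomy[OF this, of 0] show ?thesis
      proof
        assume "\<forall>\<^sub>F h in at_right 0. \<not> a * h \<le> f (x + h) - f x"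
        then have "\<forall>\<^sub>F h in at_right 0. f (x + h) - f x \<le> a * h" by eventually_elim linarith
        then show ?thesis ..
      qed simp
    qed
    have pos: "\<forall>\<^sub>F h in at_right 0. (0::real) < h" by (rule eventually_at_right_less)
    have dn: "b \<in> ?A" if "a \<in> ?A" "b \<le> a" for a b
    proof -
      from that(1) have "\<forall>\<^sub>F h in at_right 0. a * h \<le> f (x + h) - f x" by simp
      with pos have "\<forall>\<^sub>F h in at_right 0. b * h \<le> f (x + h) - f x"
        by eventually_elim (use that(2) in \<open>meson mult_right_mono less_imp_le order_trans\<close>)
      then show ?thesis by simp
    qed
    obtain u where u: "u \<notin> ?A" using n(1) by blast
    have bd: "bdd_above ?A"
      by (rule bdd_aboveI[of _ u]) (use dn u in \<open>meson nle_le\<close>)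
    obtain v where "\<not> (\<forall>\<^sub>F h in at_right 0. f (x + h) - f x \<le> v * h)" using n(2) by blast
    then have v: "v \<in> ?A" using dich by blast
    have "L x (Sup ?A)" unfolding L_def
    proof (intro allI impI conjI)
      fix \<epsilon> :: real assume "\<epsilon> > 0"
      then have "Sup ?A - \<epsilon> < Sup ?A" by simp
      then obtain a where "a \<in> ?A" "Sup ?A - \<epsilon> < a" using less_cSup_iff[OF _ bd] v by blast
      then have "Sup ?A - \<epsilon> \<in> ?A" using dn[of a "Sup ?A - \<epsilon>"] by linarith
      then show "\<forall>\<^sub>F h in at_right 0. (Sup ?A - \<epsilon>) * h \<le> f (x + h) - f x" by simp
      have "Sup ?A + \<epsilon> \<notin> ?A" using cSup_upper[OF _ bd, of "Sup ?A + \<epsilon>"] \<open>\<epsilon> > 0\<close> by auto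
      then show "\<forall>\<^sub>F h in at_right 0. f (x + h) - f x \<le> (Sup ?A + \<epsilon>) * h" using dich by blast
    qed
    then show ?thesis by blast
  qed
  have uL': "\<forall>x u v. L x u --> L x v --> u = v"
    using uL by (meson order_antisym)
  from definable_map_the[of L, OF dL uL']
  obtain g where g: "definable_map g" "\<And>x r. L x r ==> g x = r" by blast
  have "\<forall>\<^sub>F x in at_right 0. L x (g x)"
    using n1 n2
  proof eventually_elim
    case (elim x)
    then obtain r where "L x r" using exL[of x] by blast
    then show ?case using g(2) by metis
  qed
  then obtain e2 where e2: "e2 > 0" "\<And>x. x \<in> {0<..<e2} ==> L x (g x)"
    unfolding eventually_at_right_field by auto
  obtain e3 where e3: "e3 > 0" "\<And>x. x \<in> {0<..<e3} ==> isCont g x"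
    using definable_eventually_isCont[OF g(1)] unfolding eventually_at_right_field by auto
  define e where "e = min e1 (min e2 e3)"
  have "e > 0" using e1 e2 e3 by (simp add: e_def)
  moreover have "continuous_on {0<..<e} g"
    by (rule continuous_at_imp_continuous_on) (use e3(2) in \<open>auto simp: e_def\<close>)
  moreover have "(f has_real_derivative g x) (at x)" if x: "x \<in> {0<..<e}" for x
  proof -
    have bd: "\<exists>d>0. \<forall>u v. x - d < u --> u \<le> v --> v < x + d --> \<bar>f v - f u - g x * (v - u)\<bar> \<le> \<epsilon> * (v - u)"
      if "\<epsilon> > 0" for \<epsilon>
    proof -
      have "isCont g x" using x e3(2) by (simp add: e_def)
      then obtain d0 where d0: "d0 > 0" "\<And>y. \<bar>y - x\<bar> < d0 ==> \<bar>g y - g x\<bar> < \<epsilon>/2"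
        unfolding continuous_at_eps_delta using \<open>\<epsilon> > 0\<close> by (metis dist_real_def half_gt_zero)
      define d where "d = min d0 (min x (e - x))"
      have "d > 0" using d0(1) x by (simp add: d_def)
      moreover have "\<bar>f v - f u - g x * (v - u)\<bar> \<le> \<epsilon> * (v - u)" if uv: "x - d < u" "u \<le> v" "v < x + d" for u v
      proof -
        have in_e: "y \<in> {0<..<e}" "\<bar>g y - g x\<bar> < \<epsilon>/2" if "u \<le> y" "y \<le> v" for y
          using that uv d0(2)[of y] by (auto simp: d_def min_def split: if_splits)
        have c: "continuous_on {u..v} f"
          by (rule continuous_at_imp_continuous_on) (use in_e(1) e1(2) in \<open>auto simp: e_def\<close>)
        have inc: "\<forall>\<^sub>F h in at_right 0. (g x - \<epsilon>) * h \<le> f (y + h) - f y"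
          "\<forall>\<^sub>F h in at_right 0. - (g x + \<epsilon>) * h \<le> - f (y + h) - - f y" if y: "u \<le> y" "y < v" for y
        proof -
          have "L y (g y)" using e2(2) in_e(1)[of y] y by (simp add: e_def)
          then have l: "\<forall>\<^sub>F h in at_right 0. (g y - \<epsilon>/2) * h \<le> f (y + h) - f y"
            "\<forall>\<^sub>F h in at_right 0. f (y + h) - f y \<le> (g y + \<epsilon>/2) * h"
            unfolding L_def using \<open>\<epsilon> > 0\<close> half_gt_zero by blast+
          have gy: "\<bar>g y - g x\<bar> < \<epsilon>/2" using in_e(2)[of y] y by simp
          have pos: "\<forall>\<^sub>F h in at_right 0. (0::real) < h" by (rule eventually_at_right_less)
          show "\<forall>\<^sub>F h in at_right 0. (g x - \<epsilon>) * h \<le> f (y + h) - f y"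
            using l(1) pos
          proof eventually_elim
            case (elim h)
            have "(g x - \<epsilon>) * h \<le> (g y - \<epsilon>/2) * h" using gy elim(2) by (intro mult_right_mono; linarith)
            then show ?case using elim(1) by linarith
          qed
          show "\<forall>\<^sub>F h in at_right 0. - (g x + \<epsilon>) * h \<le> - f (y + h) - - f y"
            using l(2) pos
          proof eventually_elim
            case (elim h)
            have "(g y + \<epsilon>/2) * h \<le> (g x + \<epsilon>) * h" using gy elim(2) by (intro mult_right_mono; linarith)
            then show ?case using elim(1) unfolding mult_minus_left by linarith
          qed
        qed
        have "(g x - \<epsilon>) * (v - u) \<le> f v - f u"
          by (rule increment_ge_of_right_local[OF uv(2) c inc(1)])
        moreover have "- (g x + \<epsilon>) * (v - u) \<le> - f v - - f u"
          by (rule increment_ge_of_right_local[OF uv(2) continuous_on_minus[OF c] inc(2)])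
        ultimately show ?thesis by (simp add: abs_le_iff algebra_simps)
      qed
      ultimately show ?thesis by blast
    qed
    show ?thesis unfolding has_field_derivative_def has_derivative_at_alt
    proof (intro conjI allI impI)
      show "bounded_linear ((*) (g x))" by (rule bounded_linear_mult_right)
      fix \<epsilon> :: real assume "\<epsilon> > 0"
      from bd[OF this] obtain d where d: "d > 0"
        "\<And>u v. x - d < u ==> u \<le> v ==> v < x + d ==> \<bar>f v - f u - g x * (v - u)\<bar> \<le> \<epsilon> * (v - u)" by blast
      have "norm (f y - f x - g x * (y - x)) \<le> \<epsilon> * norm (y - x)" if "norm (y - x) < d" for y
      proof (cases "x \<le> y")
        case True
        then show ?thesis using d(2)[of x y] d(1) that by auto
      next
        case False
        then have "\<bar>f x - f y - g x * (x - y)\<bar> \<le> \<epsilon> * (x - y)" using d(2)[of y x] d(1) that by auto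
        moreover have "f y - f x - g x * (y - x) = - (f x - f y - g x * (x - y))" by (simp add: algebra_simps)
        ultimately show ?thesis using False by (simp only: real_norm_def abs_minus_cancel) (simp add: abs_minus_commute)
      qed
      then show "\<exists>d>0. \<forall>y. norm (y - x) < d --> norm (f y - f x - g x * (y - x)) \<le> \<epsilon> * norm (y - x)"
        using d(1) by blast
    qed
  qed
  ultimately show ?thesis using g(1) by blast
qed

end

context o_minimal_structure
begin

lemma definable_map_inverse:
  fixes f :: "'a::euclidean_space \<Rightarrow> real"
  assumes f: "definable_map f" shows "definable_map (\<lambda>x. inverse (f x))"
proof (rule definable_map_graph)
  have "definable_pred (\<lambda>z. (f (fst z) = 0 \<and> snd z = 0) \<or> f (fst z) * snd z = 1)"
    by (intro definable_intros definable_map_compose[OF f])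
  moreover have "(\<lambda>z. (f (fst z) = 0 \<and> snd z = 0) \<or> f (fst z) * snd z = 1) = (\<lambda>z. snd z = inverse (f (fst z)))"
  proof (rule ext)
    fix z show "((f (fst z) = 0 \<and> snd z = 0) \<or> f (fst z) * snd z = 1) = (snd z = inverse (f (fst z)))"
      by (cases "f (fst z) = 0") (auto simp: inverse_eq_divide eq_divide_eq mult.commute)
  qed
  ultimately show "definable_pred (\<lambda>z. snd z = inverse (f (fst z)))" by simp
qed

lemma definable_vector_derivative:
  fixes u :: "real \<Rightarrow> 'a::euclidean_space"
  assumes u: "definable_map u"
  obtains e g where "e > 0" "definable_map g" "continuous_on {0<..<e} g"
    "\<And>x. x \<in> {0<..<e} ==> (u has_vector_derivative g x) (at x)"
proof -
  have "\<exists>e>0. \<exists>g. definable_map g \<and> continuous_on {0<..<e} g \<and>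
      (\<forall>x\<in>{0<..<e}. ((\<lambda>x. u x \<bullet> b) has_real_derivative g x) (at x))" if "b \<in> Basis" for b
    by (rule definable_derivative[OF definable_map_inner_Basis[OF u that]])
  then obtain e g where eg: "\<And>b. b \<in> Basis ==> e b > (0::real) \<and> definable_map (g b) \<and> continuous_on {0<..<e b} (g b) \<and>
      (\<forall>x\<in>{0<..<e b}. ((\<lambda>x. u x \<bullet> b) has_real_derivative g b x) (at x))" by metis
  define G where "G x = (\<Sum>b\<in>Basis. g b x *\<^sub>R b)" for x
  have Gb: "G x \<bullet> b = g b x" if "b \<in> Basis" for x b
    unfolding G_def by (rule inner_sum_left_Basis[OF that])
  define d where "d = Min (e ` Basis)"
  have d: "d > 0" "\<And>b. b \<in> Basis ==> d \<le> e b"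
    unfolding d_def using eg by (auto simp: Min_gr_iff)
  show thesis
  proof (rule that[of d G])
    show "definable_map G"
      by (rule definable_map_componentwise) (simp add: Gb eg)
    show "continuous_on {0<..<d} G" unfolding G_def
    proof (intro continuous_intros)
      fix b :: 'a assume "b \<in> Basis"
      then have "continuous_on {0<..<e b} (g b)" "{0<..<d} \<subseteq> {0<..<e b}" using eg[of b] d(2)[of b] by auto
      then show "continuous_on {0<..<d} (g b)" by (rule continuous_on_subset)
    qed
    fix x assume x: "x \<in> {0<..<d}"
    show "(u has_vector_derivative G x) (at x)"
      unfolding has_vector_derivative_def
    proof (subst has_derivative_componentwise_within, intro ballI)
      fix b :: 'a assume b: "b \<in> Basis"
      then have "((\<lambda>x. u x \<bullet> b) has_real_derivative g b x) (at x)" using eg[of b] d(2)[of b] x by auto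
      then show "((\<lambda>x. u x \<bullet> b) has_derivative (\<lambda>h. h *\<^sub>R G x \<bullet> b)) (at x)"
        unfolding has_field_derivative_def by (simp add: Gb[OF b] mult_commute_abs)
    qed
  qed (rule d)
qed

lemma definable_bounded_limit_real:
  fixes u :: "real \<Rightarrow> real"
  assumes u: "definable_map u" and K: "\<forall>\<^sub>F s in at_right 0. \<bar>u s\<bar> \<le> K"
  shows "\<exists>w. (u \<longlongrightarrow> w) (at_right 0)"
proof -
  let ?A = "{a. \<forall>\<^sub>F s in at_right 0. a \<le> u s}"
  have "- K \<in> ?A" using K by (auto elim!: eventually_mono)
  have upper: "a \<le> K" if "a \<in> ?A" for a
  proof -
    from that have "\<forall>\<^sub>F s in at_right 0. a \<le> u s" by simp
    with K have "\<forall>\<^sub>F s in at_right (0::real). a \<le> K" by eventually_elim linarith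
    then show ?thesis by simp
  qed
  have bd: "bdd_above ?A" by (rule bdd_aboveI[of _ K]) (rule upper)
  have "(u \<longlongrightarrow> Sup ?A) (at_right 0)"
  proof (rule order_tendstoI)
    fix a assume "a < Sup ?A"
    then obtain c where "c \<in> ?A" "a < c" using less_cSup_iff[OF _ bd] \<open>- K \<in> ?A\<close> by blast
    then show "\<forall>\<^sub>F s in at_right 0. a < u s" by (auto elim!: eventually_mono)
  next
    fix a assume "Sup ?A < a"
    then have "a \<notin> ?A" using cSup_upper[OF _ bd, of a] by auto
    moreover have "definable_pred (\<lambda>s. a \<le> u s)" by (intro definable_intros u)
    ultimately have "\<forall>\<^sub>F s in at_right 0. \<not> a \<le> u s" using eventually_right_dichotomy by blast
    then show "\<forall>\<^sub>F s in at_right 0. u s < a" by eventually_elim linarith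
  qed
  then show ?thesis by blast
qed

lemma definable_bounded_limit:
  fixes u :: "real \<Rightarrow> 'a::euclidean_space"
  assumes u: "definable_map u" and K: "\<forall>\<^sub>F s in at_right 0. norm (u s) \<le> K"
  shows "\<exists>w. (u \<longlongrightarrow> w) (at_right 0)"
proof -
  have "\<exists>w. ((\<lambda>s. u s \<bullet> b) \<longlongrightarrow> w) (at_right 0)" if b: "b \<in> Basis" for b
  proof (rule definable_bounded_limit_real[OF definable_map_inner_Basis[OF u b]])
    from K show "\<forall>\<^sub>F s in at_right 0. \<bar>u s \<bullet> b\<bar> \<le> K"
      by eventually_elim (use Basis_le_norm[OF b] order_trans in blast)
  qed
  then obtain w where w: "\<And>b. b \<in> Basis ==> ((\<lambda>s. u s \<bullet> b) \<longlongrightarrow> w b) (at_right 0)" by metis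
  have "(u \<longlongrightarrow> (\<Sum>b\<in>Basis. w b *\<^sub>R b)) (at_right 0)"
    by (subst tendsto_componentwise_iff) (simp add: w)
  then show ?thesis by blast
qed

lemma eventually_at_right_0E:
  assumes "\<forall>\<^sub>F s in at_right 0. P s"
  obtains e :: real where "e > 0" "\<And>s. s \<in> {0<..<e} ==> P s"
  using assms unfolding eventually_at_right_field by auto

lemma derivative_eventually_greater:
  fixes f g :: "real \<Rightarrow> real"
  assumes g: "definable_map g" and f0: "(f \<longlongrightarrow> 0) (at_right 0)"
    and fg: "\<And>x. x \<in> {0<..<e} ==> (f has_real_derivative g x) (at x)" "e > 0"
    and w: "((\<lambda>s. f s / s) \<longlongrightarrow> w) (at_right 0)" "a < w"
  shows "\<forall>\<^sub>F s in at_right 0. a < g s"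
proof (rule ccontr)
  assume "\<not> ?thesis"
  moreover have "definable_pred (\<lambda>s. a < g s)" by (intro definable_intros g)
  ultimately have "\<forall>\<^sub>F s in at_right 0. \<not> a < g s" using eventually_right_dichotomy by blast
  then obtain d where d: "d > 0" "\<And>s. s \<in> {0<..<d} ==> \<not> a < g s" by (rule eventually_at_right_0E) blast
  have fs: "f s \<le> a * s" if s: "s \<in> {0<..<min d e}" for s
  proof -
    have mono: "a * t - f t \<le> a * s - f s" if t: "t \<in> {0<..<s}" for t
    proof (rule DERIV_nonneg_imp_nondecreasing[of t s "\<lambda>x. a * x - f x"])
      fix x assume "t \<le> x" "x \<le> s"
      then have x: "x \<in> {0<..<d}" "x \<in> {0<..<e}" using s t by auto
      show "\<exists>y. ((\<lambda>x. a * x - f x) has_real_derivative y) (at x) \<and> 0 \<le> y"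
        using d(2)[OF x(1)] by (intro exI[of _ "a - g x"]) (auto intro!: derivative_eq_intros fg x)
    qed (use t in auto)
    have "\<forall>\<^sub>F t in at_right 0. t \<in> {0<..<s}"
      using s by (intro eventually_at_right_real) auto
    then have ev: "\<forall>\<^sub>F t in at_right 0. a * t - f t \<le> a * s - f s" by eventually_elim (rule mono)
    have "((\<lambda>t. a * t - f t) \<longlongrightarrow> a * 0 - 0) (at_right 0)"
      by (intro tendsto_intros f0)
    from tendsto_upperbound[OF this ev] show ?thesis by simp
  qed
  have "\<forall>\<^sub>F s in at_right 0. s \<in> {0<..<min d e}"
    using d fg(2) by (intro eventually_at_right_real) auto
  then have "\<forall>\<^sub>F s in at_right 0. f s / s \<le> a"
    by eventually_elim (use fs in \<open>auto simp: divide_le_eq mult.commute\<close>)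
  from tendsto_upperbound[OF w(1) this] show False using w(2) by simp
qed

lemma derivative_tendsto_quotient_limit:
  fixes f g :: "real \<Rightarrow> real"
  assumes g: "definable_map g" and f0: "(f \<longlongrightarrow> 0) (at_right 0)"
    and fg: "\<And>x. x \<in> {0<..<e} ==> (f has_real_derivative g x) (at x)" "e > 0"
    and w: "((\<lambda>s. f s / s) \<longlongrightarrow> w) (at_right 0)"
  shows "(g \<longlongrightarrow> w) (at_right 0)"
proof (rule order_tendstoI)
  fix a assume "a < w"
  then show "\<forall>\<^sub>F s in at_right 0. a < g s"
    using derivative_eventually_greater[OF g f0 fg w] by blast
next
  fix a assume "w < a"
  have "\<forall>\<^sub>F s in at_right 0. - a < - g s"
  proof (rule derivative_eventually_greater)
    show "definable_map (\<lambda>s. - g s)" by (rule definable_map_uminus[OF g])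
    show "((\<lambda>s. - f s) \<longlongrightarrow> 0) (at_right 0)" using tendsto_minus[OF f0] by simp
    show "((\<lambda>s. - f s / s) \<longlongrightarrow> - w) (at_right 0)" using tendsto_minus[OF w] by simp
    show "((\<lambda>s. - f s) has_real_derivative - g x) (at x)" if "x \<in> {0<..<e}" for x
      using fg(1)[OF that] by (rule DERIV_minus)
  qed (use fg \<open>w < a\<close> in auto)
  then show "\<forall>\<^sub>F s in at_right 0. g s < a" by simp
qed

lemma scaled_derivative_eventually_less:
  fixes f g :: "real \<Rightarrow> real"
  assumes g: "definable_map g" and fK: "\<forall>\<^sub>F s in at_right 0. \<bar>f s\<bar> \<le> K"
    and fg: "\<And>x. x \<in> {0<..<e} ==> (f has_real_derivative g x) (at x)" "e > 0" and "a > 0"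
  shows "\<forall>\<^sub>F s in at_right 0. s * g s < a"
proof (rule ccontr)
  assume "\<not> ?thesis"
  moreover have "definable_pred (\<lambda>s. s * g s < a)" by (intro definable_intros g)
  ultimately have "\<forall>\<^sub>F s in at_right 0. \<not> s * g s < a" using eventually_right_dichotomy by blast
  then obtain d where d: "d > 0" "\<And>s. s \<in> {0<..<d} ==> \<not> s * g s < a" by (rule eventually_at_right_0E) blast
  define s where "s = min d e / 2"
  have s: "0 < s" "s < d" "s < e" using d(1) fg(2) by (auto simp: s_def min_def)
  have mono: "f t - a * ln t \<le> f s - a * ln s" if t: "t \<in> {0<..<s}" for t
  proof (rule DERIV_nonneg_imp_nondecreasing[of t s "\<lambda>x. f x - a * ln x"])
    fix x assume "t \<le> x" "x \<le> s"
    then have x: "x \<in> {0<..<d}" "x \<in> {0<..<e}" using s t by auto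
    have "a / x \<le> g x" using d(2)[OF x(1)] x(1) by (simp add: divide_le_eq mult.commute)
    then show "\<exists>y. ((\<lambda>x. f x - a * ln x) has_real_derivative y) (at x) \<and> 0 \<le> y"
      using x(1) by (intro exI[of _ "g x - a / x"]) (auto intro!: derivative_eq_intros fg x)
  qed (use t in auto)
  have "\<forall>\<^sub>F t in at_right 0. t \<in> {0<..<s}"
    using s by (intro eventually_at_right_real) auto
  moreover have "\<forall>\<^sub>F t in at_right 0. ln t < (- K - (f s - a * ln s)) / a"
    using ln_at_0 unfolding filterlim_at_bot_dense by blast
  ultimately have "\<forall>\<^sub>F t in at_right (0::real). False"
    using fK
  proof eventually_elim
    case (elim t)
    have "a * ln t < - K - (f s - a * ln s)" using elim(2) \<open>a > 0\<close> by (simp add: less_divide_eq mult.commute)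
    then show ?case using mono[OF elim(1)] elim(3) by linarith
  qed
  then show False by simp
qed

lemma scaled_derivative_tendsto_0:
  fixes f g :: "real \<Rightarrow> real"
  assumes g: "definable_map g" and fK: "\<forall>\<^sub>F s in at_right 0. \<bar>f s\<bar> \<le> K"
    and fg: "\<And>x. x \<in> {0<..<e} ==> (f has_real_derivative g x) (at x)" "e > 0"
  shows "((\<lambda>s. s * g s) \<longlongrightarrow> 0) (at_right 0)"
proof (rule order_tendstoI)
  fix a :: real assume "a > 0"
  then show "\<forall>\<^sub>F s in at_right 0. s * g s < a"
    using scaled_derivative_eventually_less[OF g fK fg] by blast
next
  fix a :: real assume "a < 0"
  have "\<forall>\<^sub>F s in at_right 0. s * - g s < - a"
  proof (rule scaled_derivative_eventually_less)
    show "definable_map (\<lambda>s. - g s)" by (rule definable_map_uminus[OF g])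
    show "\<forall>\<^sub>F s in at_right 0. \<bar>- f s\<bar> \<le> K" using fK by simp
    show "((\<lambda>s. - f s) has_real_derivative - g x) (at x)" if "x \<in> {0<..<e}" for x
      using fg(1)[OF that] by (rule DERIV_minus)
  qed (use fg \<open>a < 0\<close> in auto)
  then show "\<forall>\<^sub>F s in at_right 0. a < s * g s" by eventually_elim simp
qed

lemma has_vector_derivative_inner_component:
  "(u has_vector_derivative v) (at x) ==> ((\<lambda>x. u x \<bullet> b) has_real_derivative v \<bullet> b) (at x)"
  unfolding has_vector_derivative_def has_field_derivative_def
  by (drule has_derivative_inner_left[of _ _ _ b]) (simp add: mult_commute_abs)

lemma definable_curve_asymptotics:
  fixes \<gamma> p :: "real \<Rightarrow> 'a::euclidean_space"
  assumes \<gamma>: "definable_map \<gamma>" and p: "definable_map p"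
    and s: "\<forall>\<^sub>F s in at_right 0. norm (\<gamma> s - p s) = s" and lim: "(\<gamma> \<longlongrightarrow> x0) (at_right 0)"
  obtains e \<gamma>' p' w q where "e > 0" "continuous_on {0<..<e} \<gamma>'" "continuous_on {0<..<e} p'"
    "\<forall>x\<in>{0<..<e}. (\<gamma> has_vector_derivative \<gamma>' x) (at x)"
    "\<forall>x\<in>{0<..<e}. (p has_vector_derivative p' x) (at x)"
    "((\<lambda>s. (\<gamma> s - p s) /\<^sub>R s) \<longlongrightarrow> w) (at_right 0)" "((\<lambda>s. \<gamma>' s - p' s) \<longlongrightarrow> w) (at_right 0)"
    "((\<lambda>s. s *\<^sub>R p' s) \<longlongrightarrow> 0) (at_right 0)" "((\<lambda>s. sgn (p' s)) \<longlongrightarrow> q) (at_right 0)"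
proof -
  obtain e1 \<gamma>' where e1: "e1 > 0" "definable_map \<gamma>'" "continuous_on {0<..<e1} \<gamma>'"
    "\<And>x. x \<in> {0<..<e1} ==> (\<gamma> has_vector_derivative \<gamma>' x) (at x)"
    using definable_vector_derivative[OF \<gamma>] by blast
  obtain e2 p' where e2: "e2 > 0" "definable_map p'" "continuous_on {0<..<e2} p'"
    "\<And>x. x \<in> {0<..<e2} ==> (p has_vector_derivative p' x) (at x)"
    using definable_vector_derivative[OF p] by blast
  define e where "e = min e1 e2"
  have e: "e > 0" "{0<..<e} \<subseteq> {0<..<e1}" "{0<..<e} \<subseteq> {0<..<e2}" using e1(1) e2(1) by (auto simp: e_def)
  have pos: "\<forall>\<^sub>F s in at_right 0. (0::real) < s" by (rule eventually_at_right_less)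
  have d: "definable_map (\<lambda>s. (\<gamma> s - p s) /\<^sub>R s)"
    by (intro definable_intros definable_map_inverse \<gamma> p)
  have "\<forall>\<^sub>F s in at_right 0. norm ((\<gamma> s - p s) /\<^sub>R s) \<le> 1"
    using s pos by eventually_elim simp
  from definable_bounded_limit[OF d this] obtain w
    where w: "((\<lambda>s. (\<gamma> s - p s) /\<^sub>R s) \<longlongrightarrow> w) (at_right 0)" by blast
  have dsgn: "definable_map (\<lambda>s. sgn (p' s))" unfolding sgn_div_norm
    by (intro definable_intros definable_map_inverse e2)
  have "\<forall>\<^sub>F s in at_right 0. norm (sgn (p' s)) \<le> 1" by (simp add: norm_sgn)
  from definable_bounded_limit[OF dsgn this] obtain q
    where q: "((\<lambda>s. sgn (p' s)) \<longlongrightarrow> q) (at_right 0)" by blast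
  have "((\<lambda>s. norm (\<gamma> s - p s)) \<longlongrightarrow> 0) (at_right 0)"
  proof (rule tendsto_cong[THEN iffD2])
    show "\<forall>\<^sub>F s in at_right 0. norm (\<gamma> s - p s) = s" by (rule s)
    show "((\<lambda>s. s) \<longlongrightarrow> 0) (at_right (0::real))" by (rule tendsto_ident_at)
  qed
  then have u0: "((\<lambda>s. \<gamma> s - p s) \<longlongrightarrow> 0) (at_right 0)" by (rule tendsto_norm_zero_cancel)
  have p0: "(p \<longlongrightarrow> x0) (at_right 0)" using tendsto_diff[OF lim u0] by simp
  have u': "((\<lambda>s. \<gamma>' s - p' s) \<longlongrightarrow> w) (at_right 0)"
  proof (subst tendsto_componentwise_iff, intro ballI)
    fix b :: 'a assume b: "b \<in> Basis"
    show "((\<lambda>s. (\<gamma>' s - p' s) \<bullet> b) \<longlongrightarrow> w \<bullet> b) (at_right 0)"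
    proof (rule derivative_tendsto_quotient_limit[where f = "\<lambda>s. (\<gamma> s - p s) \<bullet> b" and e = e])
      show "definable_map (\<lambda>s. (\<gamma>' s - p' s) \<bullet> b)"
        by (intro definable_map_inner_Basis[OF _ b] definable_intros e1 e2)
      show "((\<lambda>s. (\<gamma> s - p s) \<bullet> b) \<longlongrightarrow> 0) (at_right 0)"
        using tendsto_inner[OF u0 tendsto_const, of b] by simp
      show "((\<lambda>s. (\<gamma> s - p s) \<bullet> b / s) \<longlongrightarrow> w \<bullet> b) (at_right 0)"
        using tendsto_inner[OF w tendsto_const, of b] by (simp add: divide_inverse mult.commute)
      show "((\<lambda>s. (\<gamma> s - p s) \<bullet> b) has_real_derivative (\<gamma>' x - p' x) \<bullet> b) (at x)" if "x \<in> {0<..<e}" for x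
        using that e by (intro has_vector_derivative_inner_component has_vector_derivative_diff e1 e2) auto
    qed (rule e)
  qed
  have sp: "((\<lambda>s. s *\<^sub>R p' s) \<longlongrightarrow> 0) (at_right 0)"
  proof (subst tendsto_componentwise_iff, intro ballI)
    fix b :: 'a assume b: "b \<in> Basis"
    have "((\<lambda>s. s * (p' s \<bullet> b)) \<longlongrightarrow> 0) (at_right 0)"
    proof (rule scaled_derivative_tendsto_0[where f = "\<lambda>s. p s \<bullet> b" and e = e])
      show "definable_map (\<lambda>s. p' s \<bullet> b)" by (intro definable_map_inner_Basis[OF _ b] e2)
      have "((\<lambda>s. \<bar>p s \<bullet> b\<bar>) \<longlongrightarrow> \<bar>x0 \<bullet> b\<bar>) (at_right 0)"
        by (intro tendsto_intros p0)
      from order_tendstoD(2)[OF this, of "\<bar>x0 \<bullet> b\<bar> + 1"]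
      show "\<forall>\<^sub>F s in at_right 0. \<bar>p s \<bullet> b\<bar> \<le> \<bar>x0 \<bullet> b\<bar> + 1" by (auto elim!: eventually_mono)
      show "((\<lambda>s. p s \<bullet> b) has_real_derivative p' x \<bullet> b) (at x)" if "x \<in> {0<..<e}" for x
        using that e by (intro has_vector_derivative_inner_component e2) auto
    qed (rule e)
    then show "((\<lambda>s. s *\<^sub>R p' s \<bullet> b) \<longlongrightarrow> 0 \<bullet> b) (at_right 0)" by simp
  qed
  show thesis
  proof (rule that[OF e(1) _ _ _ _ w u' sp q])
    show "continuous_on {0<..<e} \<gamma>'" "continuous_on {0<..<e} p'"
      by (rule continuous_on_subset[OF e1(3) e(2)], rule continuous_on_subset[OF e2(3) e(3)])
    show "\<forall>x\<in>{0<..<e}. (\<gamma> has_vector_derivative \<gamma>' x) (at x)"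
      "\<forall>x\<in>{0<..<e}. (p has_vector_derivative p' x) (at x)"
      using e(2,3) e1(4) e2(4) by blast+
  qed
qed

end

section \<open>Maps of class \<open>C\<close>-to-the-\<open>k\<close>\<close>

lemma C_k_on_Suc_imp: "C_k_on (Suc k) f U ==> C_k_on k f U"
proof (induction k arbitrary: f)
  case 0
  then show ?case
    by (auto intro!: continuous_at_imp_continuous_on differentiable_imp_continuous_within)
next
  case (Suc k)
  then show ?case by (metis C_k_on.simps(2))
qed

lemma C_k_on_le: "j \<le> k ==> C_k_on k f U ==> C_k_on j f U"
  by (induction k rule: dec_induct) (use C_k_on_Suc_imp in blast)+

lemma C_1_on_iff: "C_k_on 1 f U \<longleftrightarrow> (\<forall>x\<in>U. f differentiable (at x)) \<and>
    (\<forall>v. continuous_on U (\<lambda>x. frechet_derivative f (at x) v))"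
  by simp

lemma C_1_onI:
  assumes "\<And>x. x \<in> U ==> (f has_derivative f' x) (at x)" "\<And>v. continuous_on U (\<lambda>x. f' x v)"
  shows "C_k_on 1 f U"
  unfolding C_1_on_iff
proof (intro conjI ballI allI)
  fix v
  have "continuous_on U (\<lambda>x. f' x v) \<longleftrightarrow> continuous_on U (\<lambda>x. frechet_derivative f (at x) v)"
    by (rule continuous_on_cong) (use assms(1) frechet_derivative_at in fastforce)+
  then show "continuous_on U (\<lambda>x. frechet_derivative f (at x) v)" using assms(2) by simp
qed (use assms(1) in \<open>auto simp: differentiable_def\<close>)

lemma C_1_has_derivative:
  "C_k_on 1 f U ==> x \<in> U ==> (f has_derivative frechet_derivative f (at x)) (at x)"
  unfolding C_1_on_iff using frechet_derivative_works by blast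

lemma C_1_linear: "C_k_on 1 f U ==> x \<in> U ==> linear (frechet_derivative f (at x))"
  using C_1_has_derivative has_derivative_linear by blast

lemma linear_bound_Basis:
  fixes D :: "'a::euclidean_space \<Rightarrow> 'b::real_normed_vector"
  assumes "linear D" "\<And>b. b \<in> Basis ==> norm (D b) \<le> B b"
  shows "norm (D v) \<le> (\<Sum>b\<in>Basis. B b) * norm v"
proof -
  have "D v = D (\<Sum>b\<in>Basis. (v \<bullet> b) *\<^sub>R b)" by (simp add: euclidean_representation)
  also have "\<dots> = (\<Sum>b\<in>Basis. (v \<bullet> b) *\<^sub>R D b)"
    using assms(1) by (simp add: linear_sum linear_scale)
  also have "norm \<dots> \<le> (\<Sum>b\<in>Basis. norm v * B b)"
    by (rule sum_norm_le) (auto intro!: mult_mono assms(2) Basis_le_norm)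
  finally show ?thesis by (simp add: sum_distrib_left mult.commute)
qed

lemma C_1_local_bounds:
  fixes f :: "'a::euclidean_space \<Rightarrow> 'b::real_normed_vector"
  assumes "open U" "C_k_on 1 f U" "p \<in> U"
  shows "\<exists>L r. r > 0 \<and> cball p r \<subseteq> U \<and>
    (\<forall>x\<in>cball p r. \<forall>v. norm (frechet_derivative f (at x) v) \<le> L * norm v) \<and>
    (\<forall>x\<in>cball p r. \<forall>y\<in>cball p r. norm (f x - f y) \<le> L * norm (x - y))"
proof -
  obtain r where r: "r > 0" "cball p r \<subseteq> U" using assms open_contains_cball by blast
  have "\<exists>B. \<forall>x\<in>cball p r. norm (frechet_derivative f (at x) b) \<le> B" for b
  proof -
    have "continuous_on (cball p r) (\<lambda>x. frechet_derivative f (at x) b)"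
      using assms(2) r(2) unfolding C_1_on_iff by (blast intro: continuous_on_subset)
    then have "compact ((\<lambda>x. frechet_derivative f (at x) b) ` cball p r)"
      by (intro compact_continuous_image compact_cball)
    from compact_imp_bounded[OF this] obtain B
      where "\<forall>z\<in>(\<lambda>x. frechet_derivative f (at x) b) ` cball p r. norm z \<le> B"
      unfolding bounded_iff by blast
    then show ?thesis by blast
  qed
  then obtain B where B: "\<And>b x. x \<in> cball p r ==> norm (frechet_derivative f (at x) b) \<le> B b" by metis
  have B0: "0 \<le> B b" for b by (rule order_trans[OF norm_ge_zero B[of p]]) (use r(1) in simp)
  let ?L = "\<Sum>b\<in>Basis. B b"
  have d: "norm (frechet_derivative f (at x) v) \<le> ?L * norm v" if "x \<in> cball p r" for x v
    by (rule linear_bound_Basis) (use C_1_linear[OF assms(2)] B that r in auto)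
  have "norm (f x - f y) \<le> ?L * norm (x - y)" if "x \<in> cball p r" "y \<in> cball p r" for x y
  proof (rule differentiable_bound[OF convex_cball _ _ that])
    fix z assume z: "z \<in> cball p r"
    then show "(f has_derivative frechet_derivative f (at z)) (at z within cball p r)"
      using C_1_has_derivative[OF assms(2)] r by (blast intro: has_derivative_at_withinI)
    show "onorm (frechet_derivative f (at z)) \<le> ?L" by (rule onorm_bound[OF sum_nonneg[OF B0] d[OF z]])
  qed
  with r d show ?thesis by blast
qed

lemma C_2_local_bounds:
  fixes f :: "'a::euclidean_space \<Rightarrow> 'b::real_normed_vector"
  assumes "open U" "C_k_on 2 f U" "p \<in> U"
  shows "\<exists>L r. r > 0 \<and> L > 0 \<and> cball p r \<subseteq> U \<and>
    (\<forall>x\<in>cball p r. \<forall>v. norm (frechet_derivative f (at x) v) \<le> L * norm v) \<and>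
    (\<forall>x\<in>cball p r. \<forall>y\<in>cball p r. norm (f x - f y) \<le> L * norm (x - y)) \<and>
    (\<forall>x\<in>cball p r. \<forall>y\<in>cball p r. \<forall>v.
       norm (frechet_derivative f (at x) v - frechet_derivative f (at y) v) \<le> L * norm (x - y) * norm v) \<and>
    (\<forall>x\<in>cball p r. \<forall>y\<in>cball p r.
       norm (f x - f y - frechet_derivative f (at y) (x - y)) \<le> L * norm (x - y) * norm (x - y))"
proof -
  let ?D = "\<lambda>x. frechet_derivative f (at x)"
  have C1: "C_k_on 1 f U" by (rule C_k_on_le[OF _ assms(2)]) simp
  have C1D: "C_k_on 1 (\<lambda>x. ?D x b) U" for b using assms(2) by (simp add: numeral_2_eq_2)
  obtain L0 r0 where 0: "r0 > 0" "cball p r0 \<subseteq> U"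
    "\<And>x v. x \<in> cball p r0 ==> norm (?D x v) \<le> L0 * norm v"
    "\<And>x y. x \<in> cball p r0 ==> y \<in> cball p r0 ==> norm (f x - f y) \<le> L0 * norm (x - y)"
    using C_1_local_bounds[OF assms(1) C1 assms(3)] by fast
  have "\<exists>L r. r > 0 \<and> (\<forall>x\<in>cball p r. \<forall>y\<in>cball p r. norm (?D x b - ?D y b) \<le> L * norm (x - y))" for b
    using C_1_local_bounds[OF assms(1) C1D[of b] assms(3)] by fast
  then obtain L r where Lr: "\<And>b. r b > (0::real)"
    "\<And>b x y. x \<in> cball p (r b) ==> y \<in> cball p (r b) ==> norm (?D x b - ?D y b) \<le> L b * norm (x - y)" by metis
  define R where "R = min r0 (Min (r ` Basis))"
  have R: "R > 0" "R \<le> r0" "\<And>b. b \<in> Basis ==> R \<le> r b"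
    using 0(1) Lr(1) by (auto simp: R_def Min_gr_iff min_le_iff_disj)
  define M where "M = \<bar>L0\<bar> + \<bar>\<Sum>b\<in>Basis. L b\<bar> + 1"
  have RU: "cball p R \<subseteq> U" using R(2) 0(2) by (meson order_trans subset_cball)
  have M0: "L0 \<le> M" "(\<Sum>b\<in>Basis. L b) \<le> M" "M > 0" by (auto simp: M_def)
  have in0: "x \<in> cball p r0" if "x \<in> cball p R" for x using that R(2) by auto
  have lin: "linear (?D x)" if "x \<in> cball p R" for x using C_1_linear[OF C1] that RU by blast
  have D2: "norm (?D x v - ?D y v) \<le> M * norm (x - y) * norm v" if xy: "x \<in> cball p R" "y \<in> cball p R" for x y v
  proof -
    have "norm (?D x v - ?D y v) \<le> (\<Sum>b\<in>Basis. L b * norm (x - y)) * norm v"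
    proof (rule linear_bound_Basis[of "\<lambda>v. ?D x v - ?D y v"])
      show "linear (\<lambda>v. ?D x v - ?D y v)" using lin xy by (intro linear_compose_sub) auto
      show "norm (?D x b - ?D y b) \<le> L b * norm (x - y)" if "b \<in> Basis" for b
        using xy R(3)[OF that] by (intro Lr(2)) auto
    qed
    also have "\<dots> \<le> M * norm (x - y) * norm v"
      unfolding sum_distrib_right[symmetric] by (intro mult_right_mono M0) auto
    finally show ?thesis .
  qed
  have T: "norm (f x - f y - ?D y (x - y)) \<le> M * norm (x - y) * norm (x - y)"
    if xy: "x \<in> cball p R" "y \<in> cball p R" for x y
  proof -
    have seg: "closed_segment y x \<subseteq> cball p R" using xy by (simp add: closed_segment_subset)
    have "norm ((f x - ?D y x) - (f y - ?D y y)) \<le> (M * norm (x - y)) * norm (x - y)"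
    proof (rule differentiable_bound[of "closed_segment y x" _ "\<lambda>z v. ?D z v - ?D y v"])
      fix z assume z: "z \<in> closed_segment y x"
      then have zR: "z \<in> cball p R" using seg by blast
      have 1: "(f has_derivative ?D z) (at z within closed_segment y x)"
        by (rule has_derivative_at_withinI[OF C_1_has_derivative[OF C1]]) (use zR RU in blast)
      have 2: "bounded_linear (?D y)" using lin[OF xy(2)] by (simp add: linear_conv_bounded_linear)
      show "((\<lambda>x. f x - ?D y x) has_derivative (\<lambda>v. ?D z v - ?D y v)) (at z within closed_segment y x)"
        by (rule has_derivative_diff[OF 1 bounded_linear_imp_has_derivative[OF 2]])
      show "onorm (\<lambda>v. ?D z v - ?D y v) \<le> M * norm (x - y)"
      proof (rule onorm_bound)
        fix v :: 'a
        have "norm (z - y) \<le> norm (x - y)" using segment_bound1[OF z] by (simp add: norm_minus_commute)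
        then have "M * norm (z - y) * norm v \<le> M * norm (x - y) * norm v"
          using M0(3) by (intro mult_right_mono mult_left_mono) auto
        then show "norm (?D z v - ?D y v) \<le> M * norm (x - y) * norm v"
          using D2[OF zR xy(2), of v] by linarith
      qed (use M0(3) in auto)
    qed auto
    then show ?thesis using lin[OF xy(2)] by (simp add: linear_diff algebra_simps)
  qed
  show ?thesis
  proof (rule exI[of _ M], rule exI[of _ R], intro conjI ballI allI R(1) M0(3) RU D2 T)
    show "norm (?D x v) \<le> M * norm v" if "x \<in> cball p R" for x v
      using 0(3)[OF in0[OF that], of v] mult_right_mono[OF M0(1) norm_ge_zero[of v]] by linarith
    show "norm (f x - f y) \<le> M * norm (x - y)" if "x \<in> cball p R" "y \<in> cball p R" for x y
      using 0(4)[OF that[THEN in0]] mult_right_mono[OF M0(1) norm_ge_zero[of "x - y"]] by linarith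
  qed
qed

lemma C_k_diffeo_derivatives:
  assumes "C_k_diffeo k U V f g" "1 \<le> k" "x \<in> U"
  shows "(f has_derivative frechet_derivative f (at x)) (at x)"
    "(g has_derivative frechet_derivative g (at (f x))) (at (f x))"
    "frechet_derivative g (at (f x)) (frechet_derivative f (at x) v) = v"
    "frechet_derivative f (at x) (frechet_derivative g (at (f x)) w) = w"
proof -
  have o: "open U" "open V" and h: "homeomorphism U V f g" and C: "C_k_on 1 f U" "C_k_on 1 g V"
    using assms C_k_on_le[OF assms(2)] unfolding C_k_diffeo_def by auto
  have fx: "f x \<in> V" "g (f x) = x" using h assms(3) by (auto simp: homeomorphism_def)
  show f: "(f has_derivative frechet_derivative f (at x)) (at x)"
    by (rule C_1_has_derivative[OF C(1) assms(3)])
  show g: "(g has_derivative frechet_derivative g (at (f x))) (at (f x))"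
    by (rule C_1_has_derivative[OF C(2) fx(1)])
  have "((\<lambda>x. g (f x)) has_derivative (\<lambda>v. frechet_derivative g (at (f x)) (frechet_derivative f (at x) v))) (at x)"
    by (rule has_derivative_compose[OF f g])
  then have "((\<lambda>x. x) has_derivative (\<lambda>v. frechet_derivative g (at (f x)) (frechet_derivative f (at x) v))) (at x)"
    by (rule has_derivative_transform_within_open[OF _ o(1) assms(3)]) (use h in \<open>auto simp: homeomorphism_def\<close>)
  from has_derivative_unique[OF this has_derivative_ident]
  show "frechet_derivative g (at (f x)) (frechet_derivative f (at x) v) = v" by (rule fun_cong)
  have f': "(f has_derivative frechet_derivative f (at x)) (at (g (f x)))" using f fx by simp
  have "((\<lambda>y. f (g y)) has_derivative (\<lambda>v. frechet_derivative f (at x) (frechet_derivative g (at (f x)) v))) (at (f x))"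
    by (rule has_derivative_compose[OF g f'])
  then have "((\<lambda>y. y) has_derivative (\<lambda>v. frechet_derivative f (at x) (frechet_derivative g (at (f x)) v))) (at (f x))"
    by (rule has_derivative_transform_within_open[OF _ o(2) fx(1)]) (use h in \<open>auto simp: homeomorphism_def\<close>)
  from has_derivative_unique[OF this has_derivative_ident]
  show "frechet_derivative f (at x) (frechet_derivative g (at (f x)) w) = w" by (rule fun_cong)
qed

section \<open>Tangent spaces\<close>

lemma tangent_space_image:
  assumes "open U" "x \<in> U" "(f has_derivative D) (at x)" "f ` (U \<inter> M) \<subseteq> N" "v \<in> tangent_space M x"
  shows "D v \<in> tangent_space N (f x)"
proof -
  obtain \<gamma> e where \<gamma>: "0 < e" "\<gamma> ` {-e<..<e} \<subseteq> M" "\<gamma> 0 = x" "(\<gamma> has_vector_derivative v) (at 0)"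
    using assms(5) unfolding tangent_space_def by auto
  have "isCont \<gamma> 0" using \<gamma>(4) has_vector_derivative_continuous by blast
  obtain \<epsilon> where \<epsilon>: "\<epsilon> > 0" "ball x \<epsilon> \<subseteq> U" using assms(1,2) open_contains_ball by blast
  obtain d where d: "d > 0" "\<And>t. \<bar>t\<bar> < d ==> dist (\<gamma> t) (\<gamma> 0) < \<epsilon>"
    using \<open>isCont \<gamma> 0\<close> \<epsilon>(1) unfolding continuous_at_eps_delta by (auto simp: dist_real_def)
  have dU: "\<gamma> t \<in> U" if "\<bar>t\<bar> < d" for t
    using d(2)[OF that] \<epsilon>(2) \<gamma>(3) by (auto simp: dist_commute)
  have "((f \<circ> \<gamma>) has_vector_derivative D v) (at 0)"
    by (rule vector_derivative_diff_chain_within[OF \<gamma>(4)]) (use assms(3) \<gamma>(3) in \<open>auto intro: has_derivative_at_withinI\<close>)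
  moreover have "(f \<circ> \<gamma>) ` {- min d e<..<min d e} \<subseteq> N"
  proof
    fix y assume "y \<in> (f \<circ> \<gamma>) ` {- min d e<..<min d e}"
    then obtain t where t: "y = f (\<gamma> t)" "- min d e < t" "t < min d e" by auto
    then have "\<gamma> t \<in> U" "\<gamma> t \<in> M" using dU[of t] \<gamma>(2) by auto
    then show "y \<in> N" using assms(4) t(1) by blast
  qed
  ultimately show ?thesis unfolding tangent_space_def
    using \<gamma>(1,3) d(1) by (intro CollectI exI[of _ "f \<circ> \<gamma>"] exI[of _ "min d e"]) auto
qed

lemma subspace_coord_plane: "subspace (coord_plane I)"
  by (auto simp: subspace_def coord_plane_def)

lemma dim_coord_plane: "dim (coord_plane I :: (real ^ 'n) set) = card I"
  unfolding coord_plane_def dim_vec_eq[symmetric] by (rule dim_substandard_cart)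

lemma tangent_space_coord_plane_subset: "tangent_space (coord_plane I) a \<subseteq> (coord_plane I :: (real ^ 'n) set)"
proof
  fix v :: "real ^ 'n" assume "v \<in> tangent_space (coord_plane I) a"
  then obtain \<gamma> e where \<gamma>: "0 < e" "\<gamma> ` {-e<..<e} \<subseteq> coord_plane I" "(\<gamma> has_vector_derivative v) (at 0)"
    unfolding tangent_space_def by auto
  have "v $ i = 0" if "i \<notin> I" for i
  proof -
    have "((\<lambda>t. \<gamma> t $ i) has_vector_derivative v $ i) (at 0)"
      using bounded_linear.has_vector_derivative[OF bounded_linear_vec_nth \<gamma>(3)] .
    then have "((\<lambda>t. 0) has_vector_derivative v $ i) (at 0)"
      by (rule has_vector_derivative_transform_within_open[of _ _ _ "{-e<..<e}"])
         (use \<gamma>(1,2) that in \<open>auto simp: coord_plane_def image_subset_iff\<close>)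
    then show ?thesis using vector_derivative_unique_at has_vector_derivative_const by blast
  qed
  then show "v \<in> coord_plane I" by (simp add: coord_plane_def)
qed

lemma coord_plane_subset_tangent_space:
  assumes "open V" "a \<in> V" "a \<in> coord_plane I" "v \<in> coord_plane I"
  shows "v \<in> tangent_space (V \<inter> coord_plane I) a"
proof -
  obtain e where e: "e > 0" "ball a e \<subseteq> V" using assms(1,2) open_contains_ball by blast
  define d where "d = e / (norm v + 1)"
  have d: "d > 0" using e(1) by (simp add: d_def add_nonneg_pos)
  have "a + t *\<^sub>R v \<in> V \<inter> coord_plane I" if "t \<in> {-d<..<d}" for t
  proof -
    have "\<bar>t\<bar> * norm v \<le> d * norm v" using that by (intro mult_right_mono) auto
    also have "\<dots> < d * (norm v + 1)" using d by simp
    also have "\<dots> = e" using add_nonneg_pos[OF norm_ge_zero zero_less_one, of v] by (simp add: d_def)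
    finally have "a + t *\<^sub>R v \<in> ball a e" by (simp add: dist_norm)
    then show ?thesis using e(2) assms(3,4) subspace_coord_plane[of I] by (auto simp: subspace_def)
  qed
  moreover have "((\<lambda>t. a + t *\<^sub>R v) has_vector_derivative v) (at 0)"
    by (auto intro!: derivative_eq_intros)
  ultimately show ?thesis unfolding tangent_space_def
    using d by (intro CollectI exI[of _ "\<lambda>t. a + t *\<^sub>R v"] exI[of _ d]) auto
qed

lemma flattens_memD:
  assumes "flattens k M E U V f g" "x \<in> U"
  shows "x \<in> M \<longleftrightarrow> f x \<in> E" "f x \<in> V" "g (f x) = x"
proof -
  have h: "homeomorphism U V f g" and i: "f ` (U \<inter> M) = V \<inter> E"
    using assms(1) unfolding flattens_def C_k_diffeo_def by auto
  show fx: "f x \<in> V" "g (f x) = x" using h assms(2) by (auto simp: homeomorphism_def)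
  show "x \<in> M \<longleftrightarrow> f x \<in> E"
  proof
    assume "f x \<in> E"
    then have "f x \<in> f ` (U \<inter> M)" using i fx(1) by simp
    then obtain y where y: "y \<in> U" "y \<in> M" "f x = f y" by auto
    have "g (f y) = y" using h y(1) by (auto simp: homeomorphism_def)
    then show "x \<in> M" using fx(2) y by simp
  qed (use i assms(2) in blast)
qed

lemma flattens_inverse:
  assumes "flattens k M E U V f g" "a \<in> V"
  shows "g a \<in> U" "f (g a) = a" "g a \<in> M \<longleftrightarrow> a \<in> E"
proof -
  have h: "homeomorphism U V f g" using assms(1) unfolding flattens_def C_k_diffeo_def by auto
  show 1: "g a \<in> U" "f (g a) = a" using h assms(2) by (auto simp: homeomorphism_def)
  show "g a \<in> M \<longleftrightarrow> a \<in> E" using flattens_memD(1)[OF assms(1) 1(1)] 1(2) by simp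
qed

lemma tangent_space_flattens:
  assumes fl: "flattens k M (coord_plane I) U V f g" and "1 \<le> k" "x \<in> U" "x \<in> M"
  shows "tangent_space M x = {v. frechet_derivative f (at x) v \<in> coord_plane I}"
proof -
  have cd: "C_k_diffeo k U V f g" and o: "open U" "open V" and im: "f ` (U \<inter> M) = V \<inter> coord_plane I"
    using fl unfolding flattens_def C_k_diffeo_def by auto
  note d = C_k_diffeo_derivatives[OF cd assms(2,3)]
  show ?thesis
  proof (intro equalityI subsetI)
    fix v assume "v \<in> tangent_space M x"
    from tangent_space_image[OF o(1) assms(3) d(1) _ this, of "coord_plane I"] im
    show "v \<in> {v. frechet_derivative f (at x) v \<in> coord_plane I}"
      using tangent_space_coord_plane_subset by blast
  next
    fix v assume v: "v \<in> {v. frechet_derivative f (at x) v \<in> coord_plane I}"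
    have fx: "f x \<in> V" "f x \<in> coord_plane I" "g (f x) = x"
      using flattens_memD[OF fl assms(3)] assms(4) by auto
    have "frechet_derivative f (at x) v \<in> tangent_space (V \<inter> coord_plane I) (f x)"
      using v fx o by (intro coord_plane_subset_tangent_space) auto
    from tangent_space_image[OF o(2) fx(1) d(2) _ this, of M]
    show "v \<in> tangent_space M x"
      using d(3) fx(3) flattens_inverse(3)[OF fl] by auto
  qed
qed

lemma tangent_space_submanifold:
  fixes M :: "(real ^ 'n) set"
  assumes "submanifold k d M" "1 \<le> k" "x \<in> M"
  shows "subspace (tangent_space M x)" "dim (tangent_space M x) = d"
    and "\<And>I U V f g. flattens k M (coord_plane I) U V f g ==> x \<in> U ==> card I = d"
proof -
  have *: "subspace (tangent_space M x) \<and> dim (tangent_space M x) = card I"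
    if fl: "flattens k M (coord_plane I) U V f g" and xU: "x \<in> U" for I U V f g
  proof -
    have cd: "C_k_diffeo k U V f g" using fl unfolding flattens_def by auto
    note d = C_k_diffeo_derivatives[OF cd assms(2) xU]
    let ?f = "frechet_derivative f (at x)" and ?g = "frechet_derivative g (at (f x))"
    have lf: "linear ?f" and lg: "linear ?g" using d(1,2) has_derivative_linear by blast+
    have eq: "tangent_space M x = ?g ` coord_plane I"
      unfolding tangent_space_flattens[OF fl assms(2) xU assms(3)]
    proof (intro equalityI subsetI)
      fix v assume "v \<in> {v. ?f v \<in> coord_plane I}"
      then show "v \<in> ?g ` coord_plane I" using d(3)[of v] by (intro image_eqI[of _ _ "?f v"]) auto
    qed (auto simp: d(4))
    have "inj_on ?g (span (coord_plane I))" by (rule inj_on_inverseI[of _ ?f]) (rule d(4))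
    from dim_image_eq[OF lg this] have "dim (tangent_space M x) = card I"
      using eq dim_coord_plane[of I] by simp
    moreover have "subspace (tangent_space M x)"
      unfolding eq by (rule linear_subspace_image[OF lg subspace_coord_plane])
    ultimately show ?thesis by simp
  qed
  obtain I U V f g where "card I = d" "x \<in> U" "flattens k M (coord_plane I) U V f g"
    using assms unfolding submanifold_def by blast
  with *[of I U V f g] show s: "subspace (tangent_space M x)" and dm: "dim (tangent_space M x) = d" by auto
  show "card I' = d" if "flattens k M (coord_plane I') U' V' f' g'" "x \<in> U'" for I' U' V' f' g'
    using *[OF that] dm by simp
qed

lemma gap_bounds:
  assumes "0 \<in> F" shows "bdd_above (insert 0 ((\<lambda>u. infdist u F) ` {u \<in> E. norm u = 1}))" "0 \<le> gap E F"
proof -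
  show b: "bdd_above (insert 0 ((\<lambda>u. infdist u F) ` {u \<in> E. norm u = 1}))"
  proof (rule bdd_aboveI[of _ 1])
    fix t assume "t \<in> insert 0 ((\<lambda>u. infdist u F) ` {u \<in> E. norm u = 1})"
    then consider "t = 0" | u where "norm u = 1" "t = infdist u F" by auto
    then show "t \<le> 1"
    proof cases
      case 2
      then show ?thesis using infdist_le[OF assms, of u] by simp
    qed simp
  qed
  show "0 \<le> gap E F" unfolding gap_def by (rule cSup_upper[OF _ b]) simp
qed

lemma subspace_near:
  fixes F :: "'a::euclidean_space set"
  assumes "subspace F" obtains v where "v \<in> F" "norm (u - v) = infdist u F"
proof -
  have ne: "F \<noteq> {}" and cl: "closed F" using assms subspace_0 closed_subspace by blast+
  obtain v where v: "v \<in> F" "\<And>w. w \<in> F ==> dist u v \<le> dist u w"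
    using distance_attains_inf[OF cl ne, of u] by blast
  have "dist u v \<le> infdist u F" unfolding infdist_notempty[OF ne] by (rule cINF_greatest[OF ne v(2)])
  then have "norm (u - v) = infdist u F" using infdist_le[OF v(1), of u] by (simp add: dist_norm)
  with v(1) that show thesis by blast
qed

lemma gap_near:
  fixes E F :: "'a::euclidean_space set"
  assumes "subspace E" "subspace F" "u \<in> E"
  obtains v where "v \<in> F" "norm (u - v) \<le> gap E F * norm u"
proof (cases "u = 0")
  case True
  then show thesis using that[of 0] subspace_0[OF assms(2)] by simp
next
  case False
  let ?u = "u /\<^sub>R norm u"
  have "?u \<in> E" "norm ?u = 1" using False assms(1,3) by (auto intro: subspace_scale)
  then have "infdist ?u F \<le> gap E F" unfolding gap_def
    by (intro cSup_upper gap_bounds subspace_0 assms) auto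
  moreover obtain v where v: "v \<in> F" "norm (?u - v) = infdist ?u F" using subspace_near[OF assms(2)] .
  ultimately have "norm (?u - v) \<le> gap E F" by linarith
  then have "norm u * norm (?u - v) \<le> gap E F * norm u"
    by (subst mult.commute) (rule mult_right_mono, auto)
  moreover have "norm u * norm (?u - v) = norm (u - norm u *\<^sub>R v)"
  proof -
    have "norm u *\<^sub>R (?u - v) = u - norm u *\<^sub>R v" using False by (simp add: scaleR_right_diff_distrib)
    then show ?thesis by (metis norm_scaleR abs_norm_cancel)
  qed
  ultimately show thesis using that[of "norm u *\<^sub>R v"] v(1) assms(2) by (simp add: subspace_scale)
qed

section \<open>Coordinate projections\<close>

lemma coord_proj_in [simp]: "coord_proj I a \<in> coord_plane I"
  by (simp add: coord_proj_def coord_plane_def)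

lemma coord_proj_id: "a \<in> coord_plane I ==> coord_proj I a = a"
  by (auto simp: coord_proj_def coord_plane_def vec_eq_iff)

lemma linear_coord_proj: "linear (coord_proj I)"
  by (rule linearI) (auto simp: coord_proj_def vec_eq_iff)

lemma coord_proj_orthogonal:
  assumes "b \<in> coord_plane I" shows "(a - coord_proj I a) \<bullet> b = 0"
  using assms by (auto simp: inner_vec_def coord_proj_def coord_plane_def intro!: sum.neutral)

lemma norm_minus_coord_proj_le:
  assumes "b \<in> coord_plane I" shows "norm (a - coord_proj I a) \<le> norm (a - b)"
proof -
  have "coord_proj I a - b \<in> coord_plane I"
    using subspace_diff[OF subspace_coord_plane coord_proj_in assms] .
  then have "orthogonal (a - coord_proj I a) (coord_proj I a - b)"
    unfolding orthogonal_def by (rule coord_proj_orthogonal)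
  from norm_add_Pythagorean[OF this]
  have "(norm (a - coord_proj I a))\<^sup>2 \<le> (norm (a - b))\<^sup>2" by simp
  then show ?thesis by (rule power2_le_imp_le) simp
qed

lemma norm_coord_proj_le: "norm (coord_proj I a) \<le> norm a"
proof -
  have "orthogonal (coord_proj I a) (a - coord_proj I a)"
    unfolding orthogonal_def by (subst inner_commute) (rule coord_proj_orthogonal, simp)
  from norm_add_Pythagorean[OF this]
  have "(norm (coord_proj I a))\<^sup>2 \<le> (norm a)\<^sup>2" by simp
  then show ?thesis by (rule power2_le_imp_le) simp
qed

lemma bounded_linear_coord_proj: "bounded_linear (coord_proj I)"
  using linear_coord_proj by (simp add: linear_conv_bounded_linear)

section \<open>Secants of a submanifold\<close>

lemma secant_near_tangent_space:
  fixes M :: "(real ^ 'n) set"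
  assumes "submanifold k d M" "1 \<le> k" "x \<in> M" "\<kappa> > 0"
  shows "\<exists>\<delta>>0. \<forall>y\<in>M. norm (y - x) < \<delta> --> (\<exists>v\<in>tangent_space M x. norm (y - x - v) \<le> \<kappa> * norm (y - x))"
proof -
  obtain I U V f g where fl: "flattens k M (coord_plane I) U V f g" and xU: "x \<in> U"
    using assms(1,3) unfolding submanifold_def by blast
  have cd: "C_k_diffeo k U V f g" and oU: "open U" using fl unfolding flattens_def C_k_diffeo_def by auto
  note d = C_k_diffeo_derivatives[OF cd assms(2) xU]
  let ?f = "frechet_derivative f (at x)" and ?g = "frechet_derivative g (at (f x))"
  have "bounded_linear ?f" using d(1) has_derivative_bounded_linear by blast
  then obtain K where K: "K > 0" "\<And>v. norm (?f v) \<le> norm v * K" using bounded_linear.pos_bounded by blast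
  obtain d1 where d1: "d1 > 0" "\<And>y. norm (y - x) < d1 ==> norm (f y - f x - ?f (y - x)) \<le> 1 * norm (y - x)"
    using d(1) unfolding has_derivative_at_alt by (metis zero_less_one)
  have "\<kappa> / (K + 1) > 0" using assms(4) K(1) by simp
  then obtain d2 where d2: "d2 > 0"
    "\<And>b. norm (b - f x) < d2 ==> norm (g b - g (f x) - ?g (b - f x)) \<le> \<kappa> / (K + 1) * norm (b - f x)"
    using d(2) unfolding has_derivative_at_alt by metis
  obtain d3 where d3: "d3 > 0" "ball x d3 \<subseteq> U" using oU xU open_contains_ball by blast
  define \<delta> where "\<delta> = min d3 (min d1 (d2 / (K + 1)))"
  have "\<delta> > 0" using d1(1) d2(1) d3(1) K(1) by (simp add: \<delta>_def)
  moreover have "\<exists>v\<in>tangent_space M x. norm (y - x - v) \<le> \<kappa> * norm (y - x)"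
    if y: "y \<in> M" "norm (y - x) < \<delta>" for y
  proof -
    have yU: "y \<in> U" using d3(2) y(2) by (auto simp: \<delta>_def dist_norm norm_minus_commute)
    have "norm (f y - f x - ?f (y - x)) \<le> norm (y - x)" using d1(2)[of y] y(2) by (simp add: \<delta>_def)
    then have w: "norm (f y - f x) \<le> (K + 1) * norm (y - x)"
      using K(2)[of "y - x"] norm_triangle_ineq2[of "f y - f x" "?f (y - x)"] by (simp add: algebra_simps)
    also have "\<dots> < d2"
    proof -
      have "norm (y - x) < d2 / (K + 1)" using y(2) by (simp add: \<delta>_def)
      then show ?thesis using K(1) by (simp add: less_divide_eq mult.commute)
    qed
    finally have "norm (g (f y) - g (f x) - ?g (f y - f x)) \<le> \<kappa> / (K + 1) * norm (f y - f x)" by (rule d2(2))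
    also have "\<dots> \<le> \<kappa> / (K + 1) * ((K + 1) * norm (y - x))"
      using w assms(4) K(1) by (intro mult_left_mono) auto
    also have "\<dots> = \<kappa> * norm (y - x)" using K(1) by simp
    finally have "norm (y - x - ?g (f y - f x)) \<le> \<kappa> * norm (y - x)"
      using flattens_memD(3)[OF fl] yU xU by simp
    moreover have "f y - f x \<in> coord_plane I"
      using flattens_memD(1)[OF fl] yU xU y(1) assms(3) by (intro subspace_diff subspace_coord_plane) auto
    then have "?g (f y - f x) \<in> tangent_space M x"
      unfolding tangent_space_flattens[OF fl assms(2) xU assms(3)] by (simp add: d(4))
    ultimately show ?thesis by blast
  qed
  ultimately show ?thesis by blast
qed

section \<open>Curves\<close>

lemma norm_le_of_derivative_le:
  fixes F :: "real \<Rightarrow> 'a::euclidean_space" and \<phi> :: "real \<Rightarrow> real"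
  assumes F: "\<And>t. t \<in> {0<..<e} ==> (F has_vector_derivative F' t) (at t)" "(F \<longlongrightarrow> 0) (at_right 0)"
    and \<phi>: "\<And>t. t \<in> {0<..<e} ==> (\<phi> has_real_derivative \<phi>' t) (at t)" "(\<phi> \<longlongrightarrow> 0) (at_right 0)"
    and le: "\<And>t. t \<in> {0<..<e} ==> norm (F' t) \<le> \<phi>' t" and s: "s \<in> {0<..<e}"
  shows "norm (F s) \<le> \<phi> s"
proof -
  define b where "b = sgn (F s)"
  have nb: "norm b \<le> 1" by (simp add: b_def norm_sgn)
  have dF: "((\<lambda>x. F x \<bullet> b) has_real_derivative F' t \<bullet> b) (at t)" if "t \<in> {0<..<e}" for t
    using has_derivative_inner_left[OF F(1)[OF that, unfolded has_vector_derivative_def], of b]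
    unfolding has_field_derivative_def by (simp add: mult_commute_abs)
  have mono: "\<phi> t - F t \<bullet> b \<le> \<phi> s - F s \<bullet> b" if t: "t \<in> {0<..<s}" for t
  proof (rule DERIV_nonneg_imp_nondecreasing[of t s "\<lambda>x. \<phi> x - F x \<bullet> b"])
    fix x assume "t \<le> x" "x \<le> s"
    then have x: "x \<in> {0<..<e}" using s t by auto
    have "F' x \<bullet> b \<le> norm (F' x) * norm b" by (rule norm_cauchy_schwarz)
    also have "\<dots> \<le> norm (F' x)" using nb by (simp add: mult_left_le)
    finally have "0 \<le> \<phi>' x - F' x \<bullet> b" using le[OF x] by simp
    moreover have "((\<lambda>x. \<phi> x - F x \<bullet> b) has_real_derivative \<phi>' x - F' x \<bullet> b) (at x)"
      by (rule DERIV_diff[OF \<phi>(1)[OF x] dF[OF x]])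
    ultimately show "\<exists>y. ((\<lambda>x. \<phi> x - F x \<bullet> b) has_real_derivative y) (at x) \<and> 0 \<le> y" by blast
  qed (use t in auto)
  have "\<forall>\<^sub>F t in at_right 0. t \<in> {0<..<s}" using s by (intro eventually_at_right_real) auto
  then have ev: "\<forall>\<^sub>F t in at_right 0. \<phi> t - F t \<bullet> b \<le> \<phi> s - F s \<bullet> b" by eventually_elim (rule mono)
  have "((\<lambda>t. \<phi> t - F t \<bullet> b) \<longlongrightarrow> 0 - 0 \<bullet> b) (at_right 0)"
    by (intro tendsto_intros F(2) \<phi>(2))
  from tendsto_upperbound[OF this ev] have "F s \<bullet> b \<le> \<phi> s" by simp
  moreover have "F s \<bullet> b = norm (F s)"
    by (cases "F s = 0") (simp_all add: b_def sgn_div_norm power2_norm_eq_inner[symmetric] power2_eq_square)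
  ultimately show ?thesis by simp
qed

lemma cone_curve:
  fixes x :: "real \<Rightarrow> 'a::euclidean_space"
  assumes x: "\<And>t. t \<in> {0<..<e} ==> (x has_vector_derivative x' t) (at t)" "(x \<longlongrightarrow> 0) (at_right 0)"
    and Q: "Q \<noteq> 0" and m: "\<And>t. t \<in> {0<..<e} ==> m t > 0"
    and cone: "\<And>t. t \<in> {0<..<e} ==> norm (x' t - m t *\<^sub>R Q) \<le> m t * norm Q / 8" and s: "s \<in> {0<..<e}"
  shows "x s \<noteq> 0" "norm Q / 2 * m s * norm (x s) \<le> x s \<bullet> x' s"
proof -
  define n where "n = Q /\<^sub>R norm Q"
  have "norm n = 1" using Q by (simp add: n_def)
  then have nn: "norm n = 1" "n \<bullet> n = 1" by (simp_all add: norm_eq_1)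
  have Qn: "norm Q *\<^sub>R n = Q" using Q by (simp add: n_def)
  define N where "N t = x t \<bullet> n" for t
  define N' where "N' t = x' t \<bullet> n" for t
  have dN: "(N has_real_derivative N' t) (at t)" if "t \<in> {0<..<e}" for t
    using has_derivative_inner_left[OF x(1)[OF that, unfolded has_vector_derivative_def], of n]
    unfolding has_field_derivative_def N_def N'_def by (simp add: mult_commute_abs)
  have N0: "(N \<longlongrightarrow> 0) (at_right 0)" unfolding N_def using tendsto_inner[OF x(2) tendsto_const, of n] by simp
  have N': "7/8 * (m t * norm Q) \<le> N' t" "norm (x' t - N' t *\<^sub>R n) \<le> 2/7 * N' t" if t: "t \<in> {0<..<e}" for t
  proof -
    let ?h = "x' t - m t *\<^sub>R Q"
    have 1: "\<bar>?h \<bullet> n\<bar> \<le> m t * norm Q / 8"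
      using Cauchy_Schwarz_ineq2[of ?h n] cone[OF t] nn(1) by simp
    have mQ: "(m t * norm Q) *\<^sub>R n = m t *\<^sub>R Q" unfolding scaleR_scaleR[symmetric] Qn ..
    have "m t *\<^sub>R Q \<bullet> n = m t * norm Q" unfolding mQ[symmetric] by (simp add: nn(2))
    then have 2: "?h \<bullet> n = N' t - m t * norm Q" unfolding N'_def inner_diff_left by simp
    show 3: "7/8 * (m t * norm Q) \<le> N' t" using abs_le_D2[OF 1] 2 by linarith
    have "x' t - N' t *\<^sub>R n = ?h - (?h \<bullet> n) *\<^sub>R n"
      unfolding 2 by (simp add: scaleR_diff_left mQ)
    also have "norm \<dots> \<le> norm ?h + \<bar>?h \<bullet> n\<bar>" using norm_triangle_ineq4[of ?h "(?h \<bullet> n) *\<^sub>R n"] nn(1) by simp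
    also have "\<dots> \<le> m t * norm Q / 4" using 1 cone[OF t] by simp
    also have "\<dots> \<le> 2/7 * N' t" using 3 by simp
    finally show "norm (x' t - N' t *\<^sub>R n) \<le> 2/7 * N' t" .
  qed
  define F where "F t = x t - N t *\<^sub>R n" for t
  have F: "norm (F s) \<le> 2/7 * N s"
  proof (rule norm_le_of_derivative_le[where F' = "\<lambda>t. x' t - N' t *\<^sub>R n" and \<phi>' = "\<lambda>t. 2/7 * N' t", OF _ _ _ _ _ s])
    fix t assume t: "t \<in> {0<..<e}"
    show "(F has_vector_derivative x' t - N' t *\<^sub>R n) (at t)" unfolding F_def
      using has_vector_derivative_diff[OF x(1)[OF t] has_vector_derivative_scaleR[OF dN[OF t] has_vector_derivative_const[of n]]]
      by simp
    show "((\<lambda>t. 2/7 * N t) has_real_derivative 2/7 * N' t) (at t)" by (rule DERIV_cmult[OF dN[OF t]])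
    show "norm (x' t - N' t *\<^sub>R n) \<le> 2/7 * N' t" by (rule N'(2)[OF t])
  next
    show "(F \<longlongrightarrow> 0) (at_right 0)" unfolding F_def
      using tendsto_diff[OF x(2) tendsto_scaleR[OF N0 tendsto_const[of n]]] by simp
    show "((\<lambda>t. 2/7 * N t) \<longlongrightarrow> 0) (at_right 0)" using tendsto_mult_left[OF N0, of "2/7"] by simp
  qed
  have pos: "0 < N' t" if "t \<in> {0<..<e}" for t
    using N'(1)[OF that] mult_pos_pos[OF m[OF that], of "norm Q"] Q by simp
  have Npos: "0 < N s"
  proof -
    have incr: "N t < N u" if t: "0 < t" "t < u" "u < e" for t u
    proof (rule DERIV_pos_imp_increasing[OF t(2)])
      fix x assume "t \<le> x" "x \<le> u"
      then have "x \<in> {0<..<e}" using t by auto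
      then show "\<exists>y. (N has_real_derivative y) (at x) \<and> 0 < y" using dN pos by blast
    qed
    have "\<forall>\<^sub>F t in at_right 0. t \<in> {0<..<s/2}" using s by (intro eventually_at_right_real) auto
    then have "\<forall>\<^sub>F t in at_right 0. N t \<le> N (s/2)"
    proof eventually_elim
      case (elim t)
      then show ?case using incr[of t "s/2"] s by simp
    qed
    from tendsto_upperbound[OF N0 this] have "0 \<le> N (s/2)" by simp
    then show ?thesis using incr[of "s/2" s] s by auto
  qed
  then show "x s \<noteq> 0" by (auto simp: N_def)
  have Fn: "F s \<bullet> n = 0" unfolding F_def N_def using nn(2) by (simp add: inner_diff_left)
  let ?F' = "x' s - N' s *\<^sub>R n"
  have Fn': "?F' \<bullet> n = 0" unfolding N'_def using nn(2) by (simp add: inner_diff_left)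
  have xs: "x s = N s *\<^sub>R n + F s" by (simp add: F_def)
  have "x s \<bullet> x' s = (N s *\<^sub>R n + F s) \<bullet> (N' s *\<^sub>R n + ?F')" using xs by simp
  also have "\<dots> = N s * N' s + F s \<bullet> ?F'"
    using Fn Fn' nn(2) by (simp only: inner_add_left inner_add_right inner_scaleR_left inner_scaleR_right inner_commute[of n "?F'"]) simp
  finally have eq: "x s \<bullet> x' s = N s * N' s + F s \<bullet> ?F'" .
  have "\<bar>F s \<bullet> ?F'\<bar> \<le> norm (F s) * norm ?F'" by (rule Cauchy_Schwarz_ineq2)
  also have "\<dots> \<le> (2/7 * N s) * (2/7 * N' s)" by (intro mult_mono F N'(2)[OF s]) (use Npos in auto)
  finally have "\<bar>F s \<bullet> ?F'\<bar> \<le> 4/49 * (N s * N' s)" by simp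
  from abs_le_D2[OF this] have ge: "45/49 * (N s * N' s) \<le> x s \<bullet> x' s" unfolding eq by linarith
  have "norm (x s) \<le> norm (N s *\<^sub>R n) + norm (F s)" by (subst xs) (rule norm_triangle_ineq)
  then have nx: "norm (x s) \<le> 9/7 * N s" using F Npos nn(1) by simp
  have "norm Q / 2 * m s * norm (x s) \<le> (4/7 * N' s) * (9/7 * N s)"
  proof (rule mult_mono[OF _ nx])
    have "norm Q / 2 * m s = 4/7 * (7/8 * (m s * norm Q))" by simp
    then show "norm Q / 2 * m s \<le> 4/7 * N' s" using N'(1)[OF s] by linarith
  qed (use pos[OF s] in auto)
  also have "\<dots> \<le> 45/49 * (N s * N' s)" using Npos pos[OF s] by (simp add: mult.commute)
  finally show "norm Q / 2 * m s * norm (x s) \<le> x s \<bullet> x' s" using ge by simp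
qed

text \<open>The substitution \<open>t = \<tau> s\<close> turns the lower bound on \<open>R\<close> into the divergent integral of \<open>C / s\<close>.\<close>

lemma nn_integral_eq_infinity_along_curve:
  fixes R :: "real \<Rightarrow> ennreal"
  assumes "e > 0" and \<tau>: "\<And>s. s \<in> {0<..<e} ==> (\<tau> has_real_derivative \<tau>' s) (at s)" "continuous_on {0<..<e} \<tau>'"
    "\<And>s. s \<in> {0<..<e} ==> 0 < \<tau>' s" "\<And>s. s \<in> {0<..<e} ==> 0 < \<tau> s" "(\<tau> \<longlongrightarrow> 0) (at_right 0)"
    and C: "C > 0" "\<And>s. s \<in> {0<..<e} ==> ennreal (C / (s * \<tau>' s)) \<le> R (\<tau> s)" and "e' > 0"
  shows "(\<integral>\<^sup>+ t \<in> {0..e'}. R t \<partial>lborel) = \<infinity>"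
proof (rule ccontr)
  assume "\<not> ?thesis"
  then obtain M where M: "(\<integral>\<^sup>+ t \<in> {0..e'}. R t \<partial>lborel) = ennreal M" "M \<ge> 0"
    by (metis ennreal_cases infinity_ennreal_def)
  have "\<forall>\<^sub>F s in at_right 0. \<tau> s < e'" using order_tendstoD(2)[OF \<tau>(5)] \<open>e' > 0\<close> by simp
  then obtain b where b: "b > 0" "\<And>s. 0 < s ==> s < b ==> \<tau> s < e'" unfolding eventually_at_right_field by blast
  define s1 where "s1 = min b e / 2"
  have s1: "0 < s1" "s1 < b" "s1 < e" using b(1) \<open>e > 0\<close> by (auto simp: s1_def min_def)
  define s0 where "s0 = s1 * exp (- (M + 1) / C)"
  have "- (M + 1) / C < 0" using M(2) C(1) by (intro divide_neg_pos) auto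
  then have s0: "0 < s0" "s0 < s1" "s0 \<le> s1" using s1(1) by (auto simp: s0_def simp del: minus_add_distrib)
  have sub: "{s0..s1} \<subseteq> {0<..<e}" using s0 s1 by auto
  have inc: "\<tau> s < \<tau> t" if "s \<in> {0<..<e}" "t \<in> {0<..<e}" "s < t" for s t
  proof (rule DERIV_pos_imp_increasing[OF that(3)])
    fix x assume "s \<le> x" "x \<le> t"
    then have "x \<in> {0<..<e}" using that by auto
    then show "\<exists>y. (\<tau> has_real_derivative y) (at x) \<and> 0 < y" using \<tau>(1,3) by blast
  qed
  define \<theta> where "\<theta> = the_inv_into {s0..s1} \<tau>"
  have inj: "inj_on \<tau> {s0..s1}" using inc sub by (intro inj_onI) (metis less_irrefl linorder_neqE_linordered_idom subsetD)
  have \<theta>: "\<theta> (\<tau> s) = s" if "s \<in> {s0..s1}" for s unfolding \<theta>_def by (rule the_inv_into_f_f[OF inj that])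
  have c\<tau>: "continuous_on {s0..s1} \<tau>"
    by (rule continuous_at_imp_continuous_on) (use \<tau>(1) sub in \<open>blast intro: DERIV_isCont\<close>)
  have c\<tau>': "continuous_on {s0..s1} \<tau>'" by (rule continuous_on_subset[OF \<tau>(2) sub])
  have im: "\<tau> ` {s0..s1} = {\<tau> s0..\<tau> s1}"
  proof (intro equalityI subsetI)
    fix y assume "y \<in> \<tau> ` {s0..s1}"
    then obtain s where s: "s \<in> {s0..s1}" "y = \<tau> s" by blast
    have "s0 \<in> {0<..<e}" "s1 \<in> {0<..<e}" "s \<in> {0<..<e}" using s(1) s0 s1 by auto
    then show "y \<in> {\<tau> s0..\<tau> s1}" using inc[of s0 s] inc[of s s1] s by (cases "s = s0"; cases "s = s1") auto
  next
    fix y assume "y \<in> {\<tau> s0..\<tau> s1}"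
    then show "y \<in> \<tau> ` {s0..s1}" using IVT'[of \<tau> s0 y s1] c\<tau> s0(3) by auto
  qed
  have c\<theta>: "continuous_on {\<tau> s0..\<tau> s1} \<theta>"
    using continuous_on_inv[OF c\<tau> compact_Icc] \<theta> unfolding im by simp
  have \<theta>im: "\<theta> ` {\<tau> s0..\<tau> s1} = {s0..s1}" unfolding im[symmetric] using \<theta> by (force simp: image_iff)
  define h where "h t = C / (\<theta> t * \<tau>' (\<theta> t))" for t
  have "continuous_on {\<tau> s0..\<tau> s1} (\<lambda>t. \<tau>' (\<theta> t))"
    by (rule continuous_on_compose2[OF c\<tau>' c\<theta>]) (simp add: \<theta>im)
  then have "continuous_on {\<tau> s0..\<tau> s1} h" unfolding h_def
  proof (intro continuous_intros c\<theta> ballI)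
    fix t assume "t \<in> {\<tau> s0..\<tau> s1}"
    then have "\<theta> t \<in> {s0..s1}" using \<theta>im by blast
    then show "\<theta> t * \<tau>' (\<theta> t) \<noteq> 0" using \<tau>(3)[of "\<theta> t"] sub by fastforce
  qed
  then have hm: "set_borel_measurable borel {\<tau> s0..\<tau> s1} h"
    unfolding set_borel_measurable_def by (intro borel_measurable_continuous_on_indicator) auto
  have "ennreal (M + 1) = ennreal (C * ln s1 - C * ln s0)"
  proof -
    have "C * ln s0 = C * ln s1 + C * (- (M + 1) / C)"
      using s1(1) unfolding s0_def by (simp only: ln_mult_pos[OF s1(1) exp_gt_zero] ln_exp distrib_left)
    also have "C * (- (M + 1) / C) = - (M + 1)" using C(1) by simp
    finally show ?thesis by simp
  qed
  also have "\<dots> = (\<integral>\<^sup>+ s. ennreal (C / s) * indicator {s0..s1} s \<partial>lborel)"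
    by (rule nn_integral_FTC_Icc[symmetric]) (use s0 C(1) in \<open>auto intro!: derivative_eq_intros\<close>)
  also have "\<dots> = (\<integral>\<^sup>+ s. h (\<tau> s) * \<tau>' s * indicator {s0..s1} s \<partial>lborel)"
  proof (rule nn_integral_cong)
    fix s
    show "ennreal (C / s) * indicator {s0..s1} s = ennreal (h (\<tau> s) * \<tau>' s * indicator {s0..s1} s)"
    proof (cases "s \<in> {s0..s1}")
      case True
      then have "\<tau>' s > 0" using \<tau>(3)[of s] sub by blast
      then show ?thesis using True \<theta>[OF True] by (simp add: h_def)
    qed simp
  qed
  also have "\<dots> = (\<integral>\<^sup>+ t. h t * indicator {\<tau> s0..\<tau> s1} t \<partial>lborel)"
  proof (rule nn_integral_substitution[symmetric, OF hm _ c\<tau>' _ s0(3)])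
    fix x assume "x \<in> {s0..s1}"
    then have "x \<in> {0<..<e}" using sub by blast
    then show "(\<tau> has_real_derivative \<tau>' x) (at x)" "0 \<le> \<tau>' x" using \<tau>(1,3)[of x] by auto
  qed
  also have "\<dots> \<le> (\<integral>\<^sup>+ t \<in> {0..e'}. R t \<partial>lborel)"
  proof (rule nn_integral_mono)
    fix t
    show "ennreal (h t * indicator {\<tau> s0..\<tau> s1} t) \<le> R t * indicator {0..e'} t"
    proof (cases "t \<in> {\<tau> s0..\<tau> s1}")
      case True
      then obtain s where s: "s \<in> {s0..s1}" "t = \<tau> s" using im by blast
      then have s': "s \<in> {0<..<e}" "s < b" using sub s1 by auto
      have "t \<in> {0..e'}" using \<tau>(4)[OF s'(1)] b(2)[of s] s' s(2) by auto
      moreover have "ennreal (h t) \<le> R t" unfolding h_def s(2) \<theta>[OF s(1)] by (rule C(2)[OF s'(1)])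
      ultimately show ?thesis using True by simp
    qed simp
  qed
  finally have "ennreal (M + 1) \<le> ennreal M" using M(1) by simp
  then show False using M(2) by (simp add: ennreal_le_iff)
qed

section \<open>Secants and tangent spaces of the large stratum\<close>

locale wing_chart = o_minimal_structure S
  for S :: "nat \<Rightarrow> real list set set" +
  fixes X Y :: "(real ^ 'n) set" and k d :: nat and x0 :: "real ^ 'n"
    and I :: "'n set" and U V :: "(real ^ 'n) set" and f g :: "real ^ 'n \<Rightarrow> real ^ 'n"
    and L r :: real
  assumes definable_X: "definable S X" and definable_Y: "definable S Y"
    and k2: "2 \<le> k"
    and submanifold_X: "submanifold k d X" and submanifold_Y: "submanifold k (d + 1) Y"
    and disjoint: "X \<inter> Y = {}" and x0_closure: "x0 \<in> closure Y"
    and cond_a: "cond_a_at Y X x0"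
    and r_int: "\<exists>e>0. (\<integral>\<^sup>+ t \<in> {0..e}. gap_ratio I (f ` (U \<inter> Y)) t \<partial>lborel) < \<infinity>"
    and x0: "x0 \<in> X" "x0 \<in> U" "f x0 = 0" and flat: "flattens k X (coord_plane I) U V f g"
    and r: "0 < r" "cball x0 r \<subseteq> U" "cball 0 r \<subseteq> V" and L: "1 \<le> L"
    and f_bound: "\<And>x v. x \<in> cball x0 r ==> norm (frechet_derivative f (at x) v) \<le> L * norm v"
    and f_lipschitz: "\<And>x y. x \<in> cball x0 r ==> y \<in> cball x0 r ==> norm (f x - f y) \<le> L * norm (x - y)"
    and Df_lipschitz: "\<And>x y v. x \<in> cball x0 r ==> y \<in> cball x0 r ==>
       norm (frechet_derivative f (at x) v - frechet_derivative f (at y) v) \<le> L * norm (x - y) * norm v"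
    and f_taylor: "\<And>x y. x \<in> cball x0 r ==> y \<in> cball x0 r ==>
       norm (f x - f y - frechet_derivative f (at y) (x - y)) \<le> L * norm (x - y) * norm (x - y)"
    and g_bound: "\<And>a v. a \<in> cball 0 r ==> norm (frechet_derivative g (at a) v) \<le> L * norm v"
    and g_lipschitz: "\<And>a b. a \<in> cball 0 r ==> b \<in> cball 0 r ==> norm (g a - g b) \<le> L * norm (a - b)"
    and near_closure: "\<And>y. y \<in> closure Y ==> norm (y - x0) \<le> r ==> y \<in> X \<union> Y"
    and connected_germ: "\<And>W. open W ==> x0 \<in> W ==> \<exists>W'. open W' \<and> x0 \<in> W' \<and> W' \<subseteq> W \<and> connected (W' \<inter> Y)"
begin

abbreviation Df where "Df x \<equiv> frechet_derivative f (at x)"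
abbreviation Dg where "Dg a \<equiv> frechet_derivative g (at a)"
abbreviation E where "E \<equiv> (coord_plane I :: (real ^ 'n) set)"
abbreviation \<pi> where "\<pi> \<equiv> (coord_proj I :: real ^ 'n \<Rightarrow> real ^ 'n)"
abbreviation Z where "Z \<equiv> f ` (U \<inter> Y)"
abbreviation T where "T a \<equiv> tangent_space Z a"
abbreviation G where "G y \<equiv> gap E (T (f y))"

lemma k1: "1 \<le> k" using k2 by simp

lemma diffeo: "C_k_diffeo k U V f g" using flat by (simp add: flattens_def)

lemma opens: "open U" "open V" using diffeo by (auto simp: C_k_diffeo_def)

lemmas Dfg = C_k_diffeo_derivatives[OF diffeo k1]

lemma fg: "x \<in> U ==> f x \<in> V" "x \<in> U ==> g (f x) = x" "a \<in> V ==> g a \<in> U" "a \<in> V ==> f (g a) = a"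
  using flattens_memD[OF flat] flattens_inverse[OF flat] by auto

lemma linear_Df: "x \<in> U ==> linear (Df x)" and linear_Dg: "x \<in> U ==> linear (Dg (f x))"
  using Dfg has_derivative_linear by blast+

lemma ball_U: "norm (y - x0) \<le> r ==> y \<in> U" "norm (y - x0) \<le> r ==> y \<in> cball x0 r"
  using r(2) by (auto simp: dist_norm norm_minus_commute)

lemma f_plane: "x \<in> U ==> x \<in> X \<longleftrightarrow> f x \<in> E" using flattens_memD(1)[OF flat] by blast

lemma g_plane: "a \<in> V ==> g a \<in> X \<longleftrightarrow> a \<in> E" using flattens_inverse(3)[OF flat] by blast

lemma card_I: "card I = d"
  by (rule tangent_space_submanifold(3)[OF submanifold_X k1 x0(1) flat x0(2)])

lemma tangent_X: "x \<in> U ==> x \<in> X ==> tangent_space X x = {v. Df x v \<in> E}"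
  by (rule tangent_space_flattens[OF flat k1])

lemma T_image:
  assumes "y \<in> U" "y \<in> Y" shows "T (f y) = Df y ` tangent_space Y y"
proof (intro equalityI subsetI)
  fix w assume w: "w \<in> T (f y)"
  have "g ` (V \<inter> Z) \<subseteq> Y" using fg(2) by auto
  from tangent_space_image[OF opens(2) fg(1)[OF assms(1)] Dfg(2)[OF assms(1)] this w]
  have "Dg (f y) w \<in> tangent_space Y y" using fg(2)[OF assms(1)] by simp
  then show "w \<in> Df y ` tangent_space Y y"
    by (rule image_eqI[rotated]) (simp add: Dfg(4)[OF assms(1)])
next
  fix w assume "w \<in> Df y ` tangent_space Y y"
  then show "w \<in> T (f y)"
    using tangent_space_image[OF opens(1) assms(1) Dfg(1)[OF assms(1)], of Y Z] by blast
qed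

lemma subspace_TY: "y \<in> Y ==> subspace (tangent_space Y y)"
  and dim_TY: "y \<in> Y ==> dim (tangent_space Y y) = d + 1"
  using tangent_space_submanifold[OF submanifold_Y k1] by auto

lemma subspace_T:
  assumes "y \<in> U" "y \<in> Y" shows "subspace (T (f y))" "dim (T (f y)) = d + 1"
proof -
  show "subspace (T (f y))" unfolding T_image[OF assms]
    by (rule linear_subspace_image[OF linear_Df[OF assms(1)] subspace_TY[OF assms(2)]])
  have "inj_on (Df y) (span (tangent_space Y y))"
    by (rule inj_on_inverseI[of _ "Dg (f y)"]) (rule Dfg(3)[OF assms(1)])
  from dim_image_eq[OF linear_Df[OF assms(1)] this]
  show "dim (T (f y)) = d + 1" unfolding T_image[OF assms] using dim_TY[OF assms(2)] by simp
qed

lemma gap_nonneg: "y \<in> U ==> y \<in> Y ==> 0 \<le> G y"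
  by (rule gap_bounds(2)[OF subspace_0[OF subspace_T(1)]])

lemma plane_near_T:
  assumes "y \<in> U" "y \<in> Y" "e \<in> E"
  shows "\<exists>w\<in>T (f y). norm (e - w) \<le> G y * norm e"
  by (rule gap_near[OF subspace_coord_plane subspace_T(1)[OF assms(1,2)] assms(3)]) blast

lemma gap_tendsto_0:
  assumes "\<epsilon> > 0"
  shows "\<exists>\<delta>>0. \<forall>y\<in>Y. norm (y - x0) < \<delta> --> G y \<le> \<epsilon>"
proof -
  obtain U1 p where U1: "open U1" "x0 \<in> U1" and p: "retraction U1 (U1 \<inter> X) p"
    and lim: "((\<lambda>y. gap (tangent_space X (p y)) (tangent_space Y y)) \<longlongrightarrow> 0) (at x0 within Y)"
    using cond_a unfolding cond_a_at_def by blast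
  have p0: "p x0 = x0" and pX: "\<And>y. y \<in> U1 ==> p y \<in> X" and cp: "isCont p x0"
    using p U1 x0(1) unfolding retraction_def by (auto simp: continuous_on_eq_continuous_at)
  define \<eta> where "\<eta> = min (r / L) (\<epsilon> / (2 * L * L))"
  have \<eta>: "\<eta> > 0" "2 * L * L * \<eta> \<le> \<epsilon>" "\<eta> \<le> r" "L * \<eta> \<le> r"
  proof -
    show "\<eta> > 0" using r(1) L assms by (simp add: \<eta>_def)
    have "2 * L * L * \<eta> \<le> 2 * L * L * (\<epsilon> / (2 * L * L))" using L by (intro mult_left_mono) (auto simp: \<eta>_def)
    then show "2 * L * L * \<eta> \<le> \<epsilon>" using L by simp
    have "L * \<eta> \<le> L * (r / L)" using L by (intro mult_left_mono) (auto simp: \<eta>_def)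
    then show Lr: "L * \<eta> \<le> r" using L by simp
    have "1 * \<eta> \<le> L * \<eta>" using L \<open>\<eta> > 0\<close> by (intro mult_right_mono) auto
    then show "\<eta> \<le> r" using Lr by linarith
  qed
  obtain d1 where d1: "d1 > 0" "\<And>y. y \<in> Y ==> y \<noteq> x0 ==> dist y x0 < d1 ==>
      gap (tangent_space X (p y)) (tangent_space Y y) < \<eta>"
    using order_tendstoD(2)[OF lim \<eta>(1)] unfolding eventually_at by blast
  obtain d2 where d2: "d2 > 0" "\<And>y. dist y x0 < d2 ==> dist (p y) x0 < \<eta>/2"
    using cp \<eta>(1) unfolding continuous_at_eps_delta p0 by (meson half_gt_zero)
  obtain d3 where d3: "d3 > 0" "ball x0 d3 \<subseteq> U1" using U1 open_contains_ball by blast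
  define \<delta> where "\<delta> = min (min d1 d2) (min d3 (\<eta>/2))"
  have "\<delta> > 0" using d1 d2 d3 \<eta> by (simp add: \<delta>_def)
  moreover have "G y \<le> \<epsilon>" if y: "y \<in> Y" "norm (y - x0) < \<delta>" for y
  proof -
    have dy: "dist y x0 < d1" "dist y x0 < d2" "dist y x0 < d3" "norm (y - x0) < \<eta>/2"
      using y(2) by (auto simp: \<delta>_def dist_norm)
    have y0: "y \<noteq> x0" using y(1) x0(1) disjoint by blast
    have "y \<in> U1" using d3(2) dy(3) by (auto simp: dist_commute)
    then have py: "p y \<in> X" "norm (p y - x0) < \<eta>/2" using pX[of y] d2(2)[OF dy(2)] by (simp_all add: dist_norm)
    have in_ball: "y \<in> cball x0 r" "p y \<in> cball x0 r" "y \<in> U" "p y \<in> U"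
      using dy(4) py(2) \<eta>(3) r(1) ball_U by auto
    have pyy: "norm (p y - y) \<le> \<eta>" using py(2) dy(4) norm_triangle_ineq4[of "p y - x0" "y - x0"] by simp
    have "norm (f (p y)) \<le> L * norm (p y - x0)"
      using f_lipschitz[OF in_ball(2), of x0] r(1) x0(3) by simp
    also have "\<dots> \<le> L * \<eta>" using py(2) L \<eta>(1) by (intro mult_left_mono) auto
    finally have fpy: "f (p y) \<in> cball 0 r" using \<eta>(4) by simp
    have "infdist e (T (f y)) \<le> \<epsilon>" if e: "e \<in> E" "norm e = 1" for e
    proof -
      define v where "v = Dg (f (p y)) e"
      have Dv: "Df (p y) v = e" unfolding v_def by (rule Dfg(4)[OF in_ball(4)])
      have vX: "v \<in> tangent_space X (p y)" unfolding tangent_X[OF in_ball(4) py(1)] using Dv e(1) by simp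
      obtain v' where v': "v' \<in> tangent_space Y y" "norm (v - v') \<le> gap (tangent_space X (p y)) (tangent_space Y y) * norm v"
        using gap_near[OF tangent_space_submanifold(1)[OF submanifold_X k1 py(1)] subspace_TY[OF y(1)] vX] by blast
      have nv: "norm v \<le> L" using g_bound[OF fpy, of e] e(2) by (simp add: v_def)
      show ?thesis
      proof -
        have "norm (v - v') \<le> \<eta> * norm v"
          using v'(2) d1(2)[OF y(1) y0 dy(1)] by (meson less_imp_le mult_right_mono norm_ge_zero order_trans)
        also have "\<dots> \<le> \<eta> * L" using nv \<eta>(1) by (intro mult_left_mono) auto
        finally have vv: "norm (v - v') \<le> \<eta> * L" .
        have "e - Df y v' = (Df (p y) v - Df y v) + Df y (v - v')"
          using Dv linear_Df[OF in_ball(3)] by (simp add: linear_diff)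
        then have "norm (e - Df y v') \<le> norm (Df (p y) v - Df y v) + norm (Df y (v - v'))"
          by (metis norm_triangle_ineq)
        also have "\<dots> \<le> L * norm (p y - y) * norm v + L * norm (v - v')"
          by (intro add_mono Df_lipschitz f_bound in_ball)
        also have "\<dots> \<le> L * \<eta> * L + L * (\<eta> * L)"
          using pyy nv vv L \<eta>(1) by (intro add_mono mult_mono) auto
        also have "\<dots> = 2 * L * L * \<eta>" by simp
        also have "\<dots> \<le> \<epsilon>" by (rule \<eta>(2))
        finally have "dist e (Df y v') \<le> \<epsilon>" by (simp add: dist_norm)
        moreover have "Df y v' \<in> T (f y)" unfolding T_image[OF in_ball(3) y(1)] using v'(1) by blast
        ultimately show ?thesis by (metis infdist_le2)
      qed
    qed
    then show ?thesis unfolding gap_def using assms by (intro cSup_least) auto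
  qed
  ultimately show ?thesis by blast
qed

definition near :: "real ^ 'n \<Rightarrow> real ^ 'n \<Rightarrow> bool" where
  "near y p \<longleftrightarrow> p \<in> X \<and> (\<forall>p'. p' \<in> X --> norm (y - p) \<le> norm (y - p'))"

lemma near_exists:
  assumes "2 * norm (y - x0) < r" shows "\<exists>p. near y p"
proof -
  have "continuous_on (cball x0 r) f"
    using diffeo r(2) unfolding C_k_diffeo_def homeomorphism_def by (blast intro: continuous_on_subset)
  from continuous_closed_preimage[OF this closed_cball closed_subspace[OF subspace_coord_plane[of I]]]
  have cl: "closed (cball x0 r \<inter> f -` E)" .
  have x0K: "x0 \<in> cball x0 r \<inter> f -` E" using r(1) f_plane[OF x0(2)] x0(1) by auto
  then obtain p where p: "p \<in> cball x0 r \<inter> f -` E" "\<And>p'. p' \<in> cball x0 r \<inter> f -` E ==> dist y p \<le> dist y p'"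
    using distance_attains_inf[OF cl, of y] by blast
  have "norm (y - p) \<le> norm (y - p')" if "p' \<in> X" for p'
  proof (cases "p' \<in> cball x0 r")
    case True
    then have "p' \<in> cball x0 r \<inter> f -` E" using f_plane[of p'] that r(2) by auto
    then show ?thesis using p(2) by (simp add: dist_norm)
  next
    case False
    then have "r < norm (x0 - p')" by (simp add: dist_norm)
    moreover have "norm (x0 - p') \<le> norm (y - p') + norm (y - x0)"
      using norm_triangle_ineq4[of "y - p'" "y - x0"] by simp
    moreover have "norm (y - p) \<le> norm (y - x0)" using p(2)[OF x0K] by (simp add: dist_norm)
    ultimately show ?thesis using assms by linarith
  qed
  moreover have "p \<in> X" using p(1) f_plane[of p] r(2) by auto
  ultimately show ?thesis unfolding near_def by blast
qed

lemma near_le: "near y p ==> norm (y - p) \<le> norm (y - x0)"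
  using x0(1) by (simp add: near_def)

lemma f_small:
  assumes "norm (y - x0) \<le> r" shows "norm (f y) \<le> L * norm (y - x0)"
  using f_lipschitz[of y x0] ball_U(2)[OF assms] r(1) x0(3) by simp

lemma near_bounds:
  assumes y: "y \<in> Y" "2 * L * norm (y - x0) \<le> r" and p: "near y p"
  shows "norm (y - x0) \<le> r" "norm (p - x0) \<le> r" "norm (f y) \<le> r" "y \<noteq> p"
    "norm (f y - \<pi> (f y)) \<le> L * norm (y - p)" "norm (y - p) \<le> L * norm (f y - \<pi> (f y))"
    "norm (f y - f p) \<le> L * norm (y - p)" "f p \<in> E"
proof -
  have pX: "p \<in> X" and yp: "norm (y - p) \<le> norm (y - x0)" using p near_le[OF p] by (auto simp: near_def)
  have "1 * norm (y - x0) \<le> L * norm (y - x0)" using L by (intro mult_right_mono) auto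
  moreover have "2 * (L * norm (y - x0)) \<le> r" using y(2) by (simp add: mult.assoc)
  moreover have "norm (p - x0) \<le> norm (y - x0) + norm (y - p)"
    using norm_triangle_ineq4[of "y - x0" "y - p"] by simp
  ultimately show yr: "norm (y - x0) \<le> r" and "norm (p - x0) \<le> r"
    using yp norm_ge_zero[of "y - x0"] by linarith+
  then have b: "y \<in> cball x0 r" "p \<in> cball x0 r" "y \<in> U" "p \<in> U" using ball_U by auto
  show ne: "y \<noteq> p" using y(1) pX disjoint by blast
  show fp: "f p \<in> E" using f_plane[OF b(4)] pX by blast
  show fl: "norm (f y - f p) \<le> L * norm (y - p)" by (rule f_lipschitz[OF b(1,2)])
  show "norm (f y - \<pi> (f y)) \<le> L * norm (y - p)"
    using norm_minus_coord_proj_le[OF fp, of "f y"] fl by simp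
  have "0 \<le> L * norm (y - x0)" "2 * (L * norm (y - x0)) \<le> r" using L y(2) by (simp_all add: mult.assoc)
  then show fr: "norm (f y) \<le> r" using f_small[OF yr] by linarith
  then have fy: "f y \<in> cball 0 r" "\<pi> (f y) \<in> cball 0 r" using norm_coord_proj_le[of I "f y"] by auto
  then have "g (\<pi> (f y)) \<in> X" using g_plane[of "\<pi> (f y)"] r(3) by auto
  then have "norm (y - p) \<le> norm (g (f y) - g (\<pi> (f y)))" using p fg(2)[OF b(3)] by (simp add: near_def)
  also have "\<dots> \<le> L * norm (f y - \<pi> (f y))" by (rule g_lipschitz[OF fy])
  finally show "norm (y - p) \<le> L * norm (f y - \<pi> (f y))" .
qed

definition bad :: "real \<Rightarrow> real ^ 'n \<Rightarrow> real ^ 'n \<Rightarrow> bool" where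
  "bad \<epsilon> y p \<longleftrightarrow> y \<in> Y \<and> near y p \<and> (\<exists>\<delta>. 0 < \<delta> \<and> (\<forall>y'. y' \<in> Y \<and> norm (y' - y) < \<delta> -->
     (\<forall>c::real. \<epsilon> * norm (y - p) \<le> norm (y - p - c *\<^sub>R (y' - y)))))"

lemma definable_bad: "definable_pred (\<lambda>z. bad \<epsilon> (fst z) (snd z))"
  unfolding bad_def near_def
  by (intro definable_intros definable_pred_compose[OF definable_imp_definable_pred[OF definable_X]]
      definable_pred_compose[OF definable_imp_definable_pred[OF definable_Y]])

lemma bad_tangent:
  assumes b: "bad \<epsilon> y p" and v: "v \<in> tangent_space Y y"
  shows "\<epsilon> * norm (y - p) \<le> norm (y - p - v)"
proof (rule field_le_epsilon)
  fix \<kappa> :: real assume \<kappa>: "\<kappa> > 0"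
  obtain \<delta> where \<delta>: "\<delta> > 0" "\<And>y' c. y' \<in> Y ==> norm (y' - y) < \<delta> ==>
      \<epsilon> * norm (y - p) \<le> norm (y - p - c *\<^sub>R (y' - y))" using b unfolding bad_def by blast
  obtain \<gamma> e where \<gamma>: "0 < e" "\<gamma> ` {-e<..<e} \<subseteq> Y" "\<gamma> 0 = y" "(\<gamma> has_vector_derivative v) (at 0)"
    using v unfolding tangent_space_def by auto
  obtain d where d: "d > 0" "\<And>t. norm (t - 0) < d ==> norm (\<gamma> t - \<gamma> 0 - (t - 0) *\<^sub>R v) \<le> \<kappa> * norm (t - 0)"
    using \<gamma>(4) \<kappa> unfolding has_vector_derivative_def has_derivative_at_alt by blast
  have nk: "norm v + \<kappa> > 0" using \<kappa> by (simp add: add_nonneg_pos)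
  define D where "D = \<delta> / (norm v + \<kappa>)"
  define t where "t = min (min d e) D / 2"
  have "D > 0" using \<delta>(1) nk by (simp add: D_def)
  then have "0 < t" "t < d" "t < e" "t < D"
    using d(1) \<gamma>(1) by (auto simp: t_def min_def)
  then have t: "0 < t" "t < d" "t < e" "t < \<delta> / (norm v + \<kappa>)" by (simp_all add: D_def)
  have h: "norm (\<gamma> t - y - t *\<^sub>R v) \<le> \<kappa> * t" using d(2)[of t] t \<gamma>(3) by simp
  have "norm (\<gamma> t - y) \<le> norm (\<gamma> t - y - t *\<^sub>R v) + norm (t *\<^sub>R v)"
    using norm_triangle_ineq[of "\<gamma> t - y - t *\<^sub>R v" "t *\<^sub>R v"] by simp
  also have "\<dots> \<le> (norm v + \<kappa>) * t" using h t(1) by (simp add: algebra_simps)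
  also have "\<dots> < \<delta>" using t(4) nk by (simp add: less_divide_eq mult.commute)
  finally have "\<epsilon> * norm (y - p) \<le> norm (y - p - (1/t) *\<^sub>R (\<gamma> t - y))"
    using \<gamma>(1,2) t by (intro \<delta>(2)) (auto simp: image_subset_iff)
  also have "y - p - (1/t) *\<^sub>R (\<gamma> t - y) = (y - p - v) - (1/t) *\<^sub>R (\<gamma> t - y - t *\<^sub>R v)"
    using t(1) by (simp add: scaleR_diff_right)
  also have "norm \<dots> \<le> norm (y - p - v) + norm ((1/t) *\<^sub>R (\<gamma> t - y - t *\<^sub>R v))" by (rule norm_triangle_ineq4)
  also have "norm ((1/t) *\<^sub>R (\<gamma> t - y - t *\<^sub>R v)) \<le> \<kappa>"
    using h t(1) by (simp add: divide_le_eq)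
  finally show "\<epsilon> * norm (y - p) \<le> norm (y - p - v) + \<kappa>" by simp
qed

lemma tangent_bad:
  assumes y: "y \<in> Y" "near y p" and \<epsilon>: "0 < \<epsilon>" "\<epsilon> \<le> 1"
    and v: "\<And>v. v \<in> tangent_space Y y ==> \<epsilon> * norm (y - p) \<le> norm (y - p - v)"
  shows "bad (\<epsilon> / 2) y p"
proof -
  obtain \<delta> where \<delta>: "\<delta> > 0" "\<And>y'. y' \<in> Y ==> norm (y' - y) < \<delta> ==>
      \<exists>v\<in>tangent_space Y y. norm (y' - y - v) \<le> \<epsilon> / 4 * norm (y' - y)"
    using secant_near_tangent_space[OF submanifold_Y k1 y(1), of "\<epsilon> / 4"] \<epsilon>(1) by auto
  have "\<epsilon> / 2 * norm (y - p) \<le> norm (y - p - c *\<^sub>R (y' - y))" if y': "y' \<in> Y" "norm (y' - y) < \<delta>" for y' c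
  proof (cases "2 * norm (y - p) \<le> norm (c *\<^sub>R (y' - y))")
    case True
    then have "norm (y - p) \<le> norm (y - p - c *\<^sub>R (y' - y))"
      using norm_triangle_ineq3[of "y - p" "c *\<^sub>R (y' - y)"] by linarith
    moreover have "\<epsilon> / 2 * norm (y - p) \<le> 1 * norm (y - p)" using \<epsilon> by (intro mult_right_mono) auto
    ultimately show ?thesis by simp
  next
    case False
    obtain w where w: "w \<in> tangent_space Y y" "norm (y' - y - w) \<le> \<epsilon> / 4 * norm (y' - y)" using \<delta>(2)[OF y'] by blast
    have "\<epsilon> * norm (y - p) \<le> norm (y - p - c *\<^sub>R w)"
      by (rule v) (rule subspace_scale[OF subspace_TY[OF y(1)] w(1)])
    also have "y - p - c *\<^sub>R w = (y - p - c *\<^sub>R (y' - y)) + c *\<^sub>R (y' - y - w)"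
      by (simp add: scaleR_diff_right)
    also have "norm \<dots> \<le> norm (y - p - c *\<^sub>R (y' - y)) + norm (c *\<^sub>R (y' - y - w))" by (rule norm_triangle_ineq)
    also have "norm (c *\<^sub>R (y' - y - w)) \<le> \<bar>c\<bar> * (\<epsilon> / 4 * norm (y' - y))"
      unfolding norm_scaleR by (rule mult_left_mono[OF w(2)]) simp
    also have "\<dots> = \<epsilon> / 4 * norm (c *\<^sub>R (y' - y))" by simp
    also have "\<dots> \<le> \<epsilon> / 4 * (2 * norm (y - p))" using False \<epsilon>(1) by (intro mult_left_mono) auto
    finally show ?thesis by simp
  qed
  then show ?thesis unfolding bad_def using y \<delta>(1) by blast
qed

lemma no_bad_imp_secant_near:
  assumes y: "y \<in> Y" "2 * L * norm (y - x0) \<le> r" and p: "near y p"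
    and v: "v \<in> tangent_space Y y" "norm (y - p - v) \<le> \<epsilon> * norm (y - p)"
    and small: "G y \<le> \<epsilon>" "norm (y - x0) \<le> \<epsilon>"
  shows "\<exists>w\<in>T (f y). norm (f y - \<pi> (f y) - w) \<le> 3 * L * L * \<epsilon> * norm (f y - \<pi> (f y))"
proof -
  note nb = near_bounds[OF y p]
  have yU: "y \<in> U" and yb: "y \<in> cball x0 r" and pb: "p \<in> cball x0 r" using nb ball_U by auto
  define u where "u = y - p"
  define e where "e = \<pi> (f y) - f p"
  have "0 \<le> \<epsilon>" using small(2) norm_ge_zero[of "y - x0"] by linarith
  have eE: "e \<in> E" unfolding e_def by (rule subspace_diff[OF subspace_coord_plane coord_proj_in nb(8)])
  have "e = \<pi> (f y - f p)" unfolding e_def by (simp add: linear_diff[OF linear_coord_proj] coord_proj_id[OF nb(8)])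
  then have ne: "norm e \<le> L * norm u" using norm_coord_proj_le[of I "f y - f p"] nb(7) by (simp add: u_def)
  obtain w where w: "w \<in> T (f y)" "norm (e - w) \<le> G y * norm e" using plane_near_T[OF yU y(1) eE] by blast
  have Dv: "Df y v \<in> T (f y)" unfolding T_image[OF yU y(1)] using v(1) by blast
  have "norm (f p - f y - Df y (p - y)) \<le> L * norm (p - y) * norm (p - y)" by (rule f_taylor[OF pb yb])
  moreover have "f p - f y - Df y (p - y) = Df y u - (f y - f p)"
    using linear_Df[OF yU] unfolding u_def by (simp add: linear_diff)
  ultimately have 1: "norm (Df y u - (f y - f p)) \<le> L * norm u * norm u" by (simp add: u_def norm_minus_commute)
  have "f y - \<pi> (f y) - (Df y v - w) = - (Df y u - (f y - f p)) + Df y (u - v) - (e - w)"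
    using linear_Df[OF yU] unfolding e_def by (simp add: linear_diff)
  moreover have "norm (- a + b - c) \<le> norm a + norm b + norm c" for a b c :: "real ^ 'n"
    using norm_triangle_ineq4[of "- a + b" c] norm_triangle_ineq[of "- a" b] by simp
  ultimately have "norm (f y - \<pi> (f y) - (Df y v - w)) \<le> norm (Df y u - (f y - f p)) + norm (Df y (u - v)) + norm (e - w)"
    by metis
  also have "\<dots> \<le> L * norm u * \<epsilon> + L * (\<epsilon> * norm u) + \<epsilon> * (L * norm u)"
  proof (intro add_mono)
    have "norm u \<le> \<epsilon>" using near_le[OF p] small(2) by (simp add: u_def)
    then have "L * norm u * norm u \<le> L * norm u * \<epsilon>" using L by (intro mult_left_mono) auto
    then show "norm (Df y u - (f y - f p)) \<le> L * norm u * \<epsilon>" using 1 by simp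
    have "norm (Df y (u - v)) \<le> L * norm (u - v)" by (rule f_bound[OF yb])
    also have "\<dots> \<le> L * (\<epsilon> * norm u)" using v(2) L by (intro mult_left_mono) (auto simp: u_def)
    finally show "norm (Df y (u - v)) \<le> L * (\<epsilon> * norm u)" .
    have "G y * norm e \<le> \<epsilon> * (L * norm u)" using small(1) ne \<open>0 \<le> \<epsilon>\<close> by (intro mult_mono) auto
    then show "norm (e - w) \<le> \<epsilon> * (L * norm u)" using w(2) by simp
  qed
  also have "\<dots> = 3 * L * \<epsilon> * norm u" by simp
  also have "\<dots> \<le> 3 * L * \<epsilon> * (L * norm (f y - \<pi> (f y)))"
    using nb(6) L \<open>0 \<le> \<epsilon>\<close> by (intro mult_left_mono) (auto simp: u_def)
  finally have "norm (f y - \<pi> (f y) - (Df y v - w)) \<le> 3 * L * L * \<epsilon> * norm (f y - \<pi> (f y))" by (simp add: mult_ac)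
  moreover have "Df y v - w \<in> T (f y)" by (rule subspace_diff[OF subspace_T(1)[OF yU y(1)] Dv w(1)])
  ultimately show ?thesis by blast
qed

end

lemma continuous_on_frechet_apply:
  fixes h :: "'a::euclidean_space \<Rightarrow> 'b::real_normed_vector"
  assumes h: "C_k_on 1 h V" and "continuous_on A \<gamma>" "continuous_on A \<gamma>'" "\<And>s. s \<in> A ==> \<gamma> s \<in> V"
  shows "continuous_on A (\<lambda>s. frechet_derivative h (at (\<gamma> s)) (\<gamma>' s))"
proof -
  have eq: "frechet_derivative h (at (\<gamma> s)) (\<gamma>' s) =
      (\<Sum>b\<in>Basis. (\<gamma>' s \<bullet> b) *\<^sub>R frechet_derivative h (at (\<gamma> s)) b)" if "s \<in> A" for s
  proof -
    have "frechet_derivative h (at (\<gamma> s)) (\<gamma>' s) =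
        frechet_derivative h (at (\<gamma> s)) (\<Sum>b\<in>Basis. (\<gamma>' s \<bullet> b) *\<^sub>R b)" by (simp add: euclidean_representation)
    then show ?thesis using C_1_linear[OF h assms(4)[OF that]] by (simp add: linear_sum linear_scale)
  qed
  have "continuous_on A (\<lambda>s. frechet_derivative h (at (\<gamma> s)) b)" for b
    using h assms(4) unfolding C_1_on_iff
    by (intro continuous_on_compose2[OF _ assms(2), of V "\<lambda>y. frechet_derivative h (at y) b"]) auto
  then have "continuous_on A (\<lambda>s. \<Sum>b\<in>Basis. (\<gamma>' s \<bullet> b) *\<^sub>R frechet_derivative h (at (\<gamma> s)) b)"
    by (intro continuous_intros assms(3))
  then show ?thesis using eq by (simp cong: continuous_on_cong)
qed

lemma tangent_space_interior_point:
  assumes "\<And>t. t \<in> {a<..<b::real} ==> \<gamma> t \<in> M" "s \<in> {a<..<b}" "(\<gamma> has_vector_derivative v) (at s)"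
  shows "v \<in> tangent_space M (\<gamma> s)"
proof -
  have "((\<lambda>t. s + t) has_vector_derivative 1) (at 0)" by (auto intro!: derivative_eq_intros)
  moreover have "(\<gamma> has_vector_derivative v) (at (s + 0))" using assms(3) by simp
  ultimately have "((\<gamma> \<circ> (\<lambda>t. s + t)) has_vector_derivative 1 *\<^sub>R v) (at 0)"
    by (rule vector_diff_chain_at)
  then show ?thesis unfolding tangent_space_def
    using assms(1,2) by (intro CollectI exI[of _ "\<gamma> \<circ> (\<lambda>t. s + t)"] exI[of _ "min (s - a) (b - s)"]) auto
qed

context wing_chart
begin

lemma continuous_on_Df_apply:
  assumes "continuous_on A \<gamma>" "continuous_on A \<gamma>'" "\<And>s. s \<in> A ==> \<gamma> s \<in> U"
  shows "continuous_on A (\<lambda>s. Df (\<gamma> s) (\<gamma>' s))"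
proof -
  have "C_k_on 1 f U" using diffeo C_k_on_le[OF k1] by (auto simp: C_k_diffeo_def)
  from continuous_on_frechet_apply[OF this assms] show ?thesis .
qed

lemma Df_tendsto:
  assumes "(y \<longlongrightarrow> x0) F" "(v \<longlongrightarrow> w) F"
  shows "((\<lambda>s. Df (y s) (v s)) \<longlongrightarrow> Df x0 w) F"
proof -
  have "\<forall>\<^sub>F s in F. dist (y s) x0 < r" using tendstoD[OF assms(1) r(1)] .
  then have ev: "\<forall>\<^sub>F s in F. norm (Df (y s) (v s) - Df x0 w) \<le> L * norm (y s - x0) * norm (v s) + L * norm (v s - w)"
  proof eventually_elim
    case (elim s)
    have b: "y s \<in> cball x0 r" "x0 \<in> cball x0 r" using elim r(1) by (auto simp: dist_commute)
    have "Df (y s) (v s) - Df x0 w = (Df (y s) (v s) - Df x0 (v s)) + Df x0 (v s - w)"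
      using linear_Df[OF x0(2)] by (simp add: linear_diff)
    also have "norm \<dots> \<le> norm (Df (y s) (v s) - Df x0 (v s)) + norm (Df x0 (v s - w))" by (rule norm_triangle_ineq)
    also have "\<dots> \<le> L * norm (y s - x0) * norm (v s) + L * norm (v s - w)"
      by (intro add_mono Df_lipschitz f_bound b)
    finally show ?case .
  qed
  have "((\<lambda>s. L * norm (y s - x0) * norm (v s) + L * norm (v s - w)) \<longlongrightarrow>
      L * norm (x0 - x0) * norm w + L * norm (w - w)) F"
    by (intro tendsto_intros assms)
  then have "((\<lambda>s. L * norm (y s - x0) * norm (v s) + L * norm (v s - w)) \<longlongrightarrow> 0) F" by simp
  from Lim_null_comparison[OF ev this] show ?thesis by (rule LIM_zero_cancel)
qed

lemma gap_times_speed_ge: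
  assumes \<epsilon>: "\<epsilon> > 0" and s: "s > 0" "bad \<epsilon> y p" "norm (y - p) = s" "2 * L * norm (y - x0) \<le> r"
    and v: "v \<in> tangent_space Y y" "p' \<in> tangent_space X p"
    and small: "L * (L * norm ((y - p) /\<^sub>R s - (v - p')) + L * norm (s *\<^sub>R p')) \<le> \<epsilon> / 2"
  shows "\<epsilon> / (2 * L * L) \<le> G y * norm p'"
proof -
  have yY: "y \<in> Y" and np: "near y p" using s(2) by (auto simp: bad_def)
  note nb = near_bounds[OF yY s(4) np]
  have b: "y \<in> cball x0 r" "p \<in> cball x0 r" "y \<in> U" "p \<in> U" using nb(1,2) ball_U by auto
  have pX: "p \<in> X" using np by (simp add: near_def)
  have lin: "linear (Df y)" "linear (Dg (f y))" using linear_Df linear_Dg b by auto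
  define e where "e = Df p p'"
  have eE: "e \<in> E" using v(2) tangent_X[OF b(4) pX] by (simp add: e_def)
  obtain w where w: "w \<in> T (f y)" "norm (e - w) \<le> G y * norm e" using plane_near_T[OF b(3) yY eE] by blast
  have Gn: "0 \<le> G y" by (rule gap_nonneg[OF b(3) yY])
  have "G y * norm e \<le> G y * (L * norm p')" using Gn f_bound[OF b(2)] by (intro mult_left_mono) (simp_all add: e_def)
  then have ew: "norm (e - w) \<le> G y * (L * norm p')" using w(2) by simp
  have "s *\<^sub>R Df y v - s *\<^sub>R w \<in> T (f y)"
    by (intro subspace_diff subspace_scale subspace_T(1)[OF b(3) yY] w(1)) (use T_image[OF b(3) yY] v(1) in blast)
  then obtain v0 where v0: "v0 \<in> tangent_space Y y" "s *\<^sub>R Df y v - s *\<^sub>R w = Df y v0"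
    unfolding T_image[OF b(3) yY] by blast
  define u where "u = y - p"
  define h where "h = u /\<^sub>R s - (v - p')"
  have us: "u = s *\<^sub>R h + s *\<^sub>R v - s *\<^sub>R p'" using s(1) by (simp add: h_def scaleR_diff_right)
  have "Df y (u - v0) = Df y u - (s *\<^sub>R Df y v - s *\<^sub>R w)" using lin(1) v0(2) by (simp add: linear_diff)
  also have "\<dots> = s *\<^sub>R (Df y h + (e - Df y p') - (e - w))"
    unfolding us using lin(1) by (simp add: linear_diff linear_add linear_scale algebra_simps)
  finally have eq: "Df y (u - v0) = s *\<^sub>R (Df y h + (e - Df y p') - (e - w))" .
  have "\<epsilon> * s \<le> norm (u - v0)" using bad_tangent[OF s(2) v0(1)] s(3) by (simp add: u_def)
  also have "u - v0 = Dg (f y) (Df y (u - v0))" using Dfg(3)[OF b(3)] by simp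
  also have "norm \<dots> \<le> L * norm (Df y (u - v0))" by (rule g_bound) (use nb(3) in simp)
  also have "\<dots> = s * (L * norm (Df y h + (e - Df y p') - (e - w)))" unfolding eq using s(1) by simp
  finally have "\<epsilon> \<le> L * norm (Df y h + (e - Df y p') - (e - w))"
    using s(1) by (simp add: mult.commute)
  also have "\<dots> \<le> L * (L * norm h + L * norm (s *\<^sub>R p') + G y * (L * norm p'))"
  proof (rule mult_left_mono)
    have "norm (e - Df y p') \<le> L * norm (p - y) * norm p'" unfolding e_def by (rule Df_lipschitz[OF b(2,1)])
    also have "\<dots> = L * norm (s *\<^sub>R p')" using s(1,3) by (simp add: norm_minus_commute)
    finally have 1: "norm (e - Df y p') \<le> L * norm (s *\<^sub>R p')" .
    have "norm (Df y h + (e - Df y p') - (e - w)) \<le> norm (Df y h) + norm (e - Df y p') + norm (e - w)"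
      by (rule order_trans[OF norm_triangle_ineq4]) (intro add_right_mono norm_triangle_ineq)
    then show "norm (Df y h + (e - Df y p') - (e - w)) \<le> L * norm h + L * norm (s *\<^sub>R p') + G y * (L * norm p')"
      using 1 ew f_bound[OF b(1), of h] by linarith
  qed (use L in simp)
  also have "\<dots> = L * (L * norm h + L * norm (s *\<^sub>R p')) + L * L * (G y * norm p')" by (simp add: algebra_simps)
  also have "\<dots> \<le> \<epsilon> / 2 + L * L * (G y * norm p')" using small by (simp add: h_def u_def)
  finally have "\<epsilon> / 2 \<le> L * L * (G y * norm p')" by simp
  then show ?thesis using L by (simp add: divide_le_eq mult_ac)
qed

text \<open>Along a selected curve of bad points the gap is at least a constant over the speed of the
  projection to \<open>X\<close>, which makes the integral of the gap ratio diverge.\<close>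

lemma no_bad_near:
  assumes \<epsilon>: "\<epsilon> > 0"
  shows "\<exists>\<delta>>0. \<forall>y p. bad \<epsilon> y p --> \<delta> \<le> norm (y - x0)"
proof (rule ccontr)
  assume "\<not> ?thesis"
  then have Bx: "\<forall>\<delta>>0. \<exists>y p. bad \<epsilon> y p \<and> norm (y - x0) < \<delta>" by (metis not_le)
  have Bn: "\<forall>y p. bad \<epsilon> y p --> y \<noteq> p \<and> norm (y - p) \<le> norm (y - x0)"
    using near_le disjoint by (auto simp: bad_def near_def)
  obtain \<gamma> p where c: "definable_map \<gamma>" "definable_map p"
    "\<forall>\<^sub>F s in at_right 0. bad \<epsilon> (\<gamma> s) (p s) \<and> norm (\<gamma> s - p s) = s" "(\<gamma> \<longlongrightarrow> x0) (at_right 0)"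
    by (rule definable_curve_selection[OF definable_bad Bn Bx])
  have evn: "\<forall>\<^sub>F s in at_right 0. norm (\<gamma> s - p s) = s" using c(3) by eventually_elim simp
  obtain e \<gamma>' p' w q where e: "e > 0" and c\<gamma>': "continuous_on {0<..<e} \<gamma>'" and cp': "continuous_on {0<..<e} p'"
    and d\<gamma>: "\<forall>x\<in>{0<..<e}. (\<gamma> has_vector_derivative \<gamma>' x) (at x)"
    and dp: "\<forall>x\<in>{0<..<e}. (p has_vector_derivative p' x) (at x)"
    and uw: "((\<lambda>s. (\<gamma> s - p s) /\<^sub>R s) \<longlongrightarrow> w) (at_right 0)" and u'w: "((\<lambda>s. \<gamma>' s - p' s) \<longlongrightarrow> w) (at_right 0)"
    and sp: "((\<lambda>s. s *\<^sub>R p' s) \<longlongrightarrow> 0) (at_right 0)" and q: "((\<lambda>s. sgn (p' s)) \<longlongrightarrow> q) (at_right 0)"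
    by (rule definable_curve_asymptotics[OF c(1,2) evn c(4)])
  have pos: "\<forall>\<^sub>F s in at_right 0. (0::real) < s" by (rule eventually_at_right_less)
  have "((\<lambda>s. norm (\<gamma> s - p s)) \<longlongrightarrow> 0) (at_right 0)"
    by (rule tendsto_cong[OF evn, THEN iffD2]) (rule tendsto_ident_at)
  from tendsto_diff[OF c(4) tendsto_norm_zero_cancel[OF this]]
  have p0: "(p \<longlongrightarrow> x0) (at_right 0)" by simp
  have ev_near: "\<forall>\<^sub>F s in at_right 0. norm (\<gamma> s - x0) < \<delta>" if "\<delta> > 0" for \<delta>
    using tendstoD[OF c(4) that] by (simp add: dist_norm)
  have ev_r: "\<forall>\<^sub>F s in at_right 0. 2 * L * norm (\<gamma> s - x0) \<le> r"
  proof -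
    have "\<forall>\<^sub>F s in at_right 0. norm (\<gamma> s - x0) < r / (2 * L)" by (rule ev_near) (use r(1) L in simp)
    then show ?thesis by eventually_elim (use L in \<open>simp add: less_divide_eq mult.commute\<close>)
  qed
  have "((\<lambda>s. L * (L * norm ((\<gamma> s - p s) /\<^sub>R s - (\<gamma>' s - p' s)) + L * norm (s *\<^sub>R p' s))) \<longlongrightarrow>
      L * (L * norm (w - w) + L * norm (0 :: real ^ 'n))) (at_right 0)"
    by (intro tendsto_intros uw u'w sp)
  from order_tendstoD(2)[OF this, of "\<epsilon> / 2"] \<epsilon>
  have ev_small: "\<forall>\<^sub>F s in at_right 0. L * (L * norm ((\<gamma> s - p s) /\<^sub>R s - (\<gamma>' s - p' s)) + L * norm (s *\<^sub>R p' s)) < \<epsilon> / 2"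
    by simp
  have "\<forall>\<^sub>F s in at_right 0. (bad \<epsilon> (\<gamma> s) (p s) \<and> norm (\<gamma> s - p s) = s) \<and> 2 * L * norm (\<gamma> s - x0) \<le> r \<and>
      L * (L * norm ((\<gamma> s - p s) /\<^sub>R s - (\<gamma>' s - p' s)) + L * norm (s *\<^sub>R p' s)) < \<epsilon> / 2 \<and> s \<in> {0<..<e}"
    by (intro eventually_conj c(3) ev_r ev_small eventually_at_right_real e)
  then obtain e1 where e1: "e1 > 0" and h1: "\<And>s. s \<in> {0<..<e1} ==> (bad \<epsilon> (\<gamma> s) (p s) \<and> norm (\<gamma> s - p s) = s) \<and>
      2 * L * norm (\<gamma> s - x0) \<le> r \<and>
      L * (L * norm ((\<gamma> s - p s) /\<^sub>R s - (\<gamma>' s - p' s)) + L * norm (s *\<^sub>R p' s)) < \<epsilon> / 2 \<and> s \<in> {0<..<e}"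
    by (rule eventually_at_right_0E) blast
  have in_e: "s \<in> {0<..<e}" if "s \<in> {0<..<e1}" for s using h1[OF that] by (elim conjE)
  define c0 where "c0 = \<epsilon> / (2 * L * L)"
  have c0: "c0 > 0" using \<epsilon> L by (simp add: c0_def)
  have \<gamma>Y: "\<gamma> s \<in> Y" and pX: "p s \<in> X" and near_s: "near (\<gamma> s) (p s)" if "s \<in> {0<..<e1}" for s
    using h1[OF that] by (auto simp: bad_def near_def)
  note nb = near_bounds[OF \<gamma>Y _ near_s]
  have nr: "2 * L * norm (\<gamma> s - x0) \<le> r" if "s \<in> {0<..<e1}" for s using h1[OF that] by blast
  have \<gamma>U: "\<gamma> s \<in> U" "p s \<in> U" if "s \<in> {0<..<e1}" for s
    using nb(1,2)[OF that nr[OF that] that] ball_U(1) by auto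
  have t\<gamma>: "\<gamma>' s \<in> tangent_space Y (\<gamma> s)" if "s \<in> {0<..<e1}" for s
    by (rule tangent_space_interior_point[OF \<gamma>Y that bspec[OF d\<gamma> in_e[OF that]]])
  have tp: "p' s \<in> tangent_space X (p s)" if "s \<in> {0<..<e1}" for s
    by (rule tangent_space_interior_point[OF pX that bspec[OF dp in_e[OF that]]])
  have speed: "c0 \<le> G (\<gamma> s) * norm (p' s)" if s: "s \<in> {0<..<e1}" for s
    unfolding c0_def using h1[OF s] s by (intro gap_times_speed_ge[OF \<epsilon> _ _ _ _ t\<gamma>[OF s] tp[OF s]]) auto
  have ev_e1: "\<forall>\<^sub>F s in at_right 0. s \<in> {0<..<e1}" by (rule eventually_at_right_real[OF e1])
  have big: "\<forall>\<^sub>F s in at_right 0. M \<le> norm (p' s)" if "M > 0" for M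
  proof -
    have "c0 / M > 0" using c0 that by simp
    from gap_tendsto_0[OF this]
    obtain \<delta> where \<delta>: "\<delta> > 0" "\<And>y. y \<in> Y ==> norm (y - x0) < \<delta> ==> G y \<le> c0 / M" by blast
    show ?thesis using ev_near[OF \<delta>(1)] ev_e1
    proof eventually_elim
      case (elim s)
      have "c0 \<le> (c0 / M) * norm (p' s)"
        using speed[OF elim(2)] mult_right_mono[OF \<delta>(2)[OF \<gamma>Y[OF elim(2)] elim(1)] norm_ge_zero[of "p' s"]] by linarith
      then show ?case using c0 that by (simp add: le_divide_eq)
    qed
  qed
  have inv0: "((\<lambda>s. inverse (norm (p' s))) \<longlongrightarrow> 0) (at_right 0)"
  proof (rule tendsto_inverse_0_at_top)
    show "filterlim (\<lambda>s. norm (p' s)) at_top (at_right 0)"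
      unfolding filterlim_at_top_gt[of _ _ 0] using big by blast
  qed
  define k' where "k' s = sgn (p' s) + inverse (norm (p' s)) *\<^sub>R (\<gamma>' s - p' s)" for s
  have k': "(k' \<longlongrightarrow> q) (at_right 0)"
    using tendsto_add[OF q tendsto_scaleR[OF inv0 u'w]] unfolding k'_def[abs_def] by simp
  have nq: "norm q = 1"
  proof -
    have "\<forall>\<^sub>F s in at_right 0. norm (sgn (p' s)) = 1"
      using big[OF zero_less_one] by eventually_elim (auto simp: norm_sgn)
    then have "((\<lambda>s. norm (sgn (p' s))) \<longlongrightarrow> 1) (at_right 0)" by (rule tendsto_eventually)
    from tendsto_unique[OF _ tendsto_norm[OF q] this] show ?thesis by simp
  qed
  define Q where "Q = Df x0 q"
  have Q0: "Q \<noteq> 0"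
  proof
    assume "Q = 0"
    then have "q = Dg (f x0) 0" using Dfg(3)[OF x0(2), of q] by (simp add: Q_def)
    then have "q = 0" using linear_0[OF linear_Dg[OF x0(2)]] by simp
    then show False using nq by simp
  qed
  have QE: "Q \<in> E"
  proof (rule Lim_in_closed_set[OF closed_subspace[OF subspace_coord_plane]])
    show "((\<lambda>s. Df (p s) (sgn (p' s))) \<longlongrightarrow> Q) (at_right 0)" unfolding Q_def by (rule Df_tendsto[OF p0 q])
    show "\<forall>\<^sub>F s in at_right 0. Df (p s) (sgn (p' s)) \<in> E"
      using ev_e1
    proof eventually_elim
      case (elim s)
      have "sgn (p' s) \<in> tangent_space X (p s)" unfolding sgn_div_norm
        by (rule subspace_scale[OF tangent_space_submanifold(1)[OF submanifold_X k1 pX[OF elim]] tp[OF elim]])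
      then show ?case using tangent_X[OF \<gamma>U(2)[OF elim] pX[OF elim]] by simp
    qed
  qed simp
  define x where "x s = \<pi> (f (\<gamma> s))" for s
  define x' where "x' s = \<pi> (Df (\<gamma> s) (\<gamma>' s))" for s
  have "((\<lambda>s. \<pi> (Df (\<gamma> s) (k' s))) \<longlongrightarrow> \<pi> Q) (at_right 0)"
    unfolding Q_def by (rule bounded_linear.tendsto[OF bounded_linear_coord_proj Df_tendsto[OF c(4) k']])
  then have xk: "((\<lambda>s. \<pi> (Df (\<gamma> s) (k' s))) \<longlongrightarrow> Q) (at_right 0)" by (simp add: coord_proj_id[OF QE])
  have "norm Q / 8 > 0" using Q0 by simp
  from tendstoD[OF xk this]
  have "\<forall>\<^sub>F s in at_right 0. dist (\<pi> (Df (\<gamma> s) (k' s))) Q < norm Q / 8 \<and> 1 \<le> norm (p' s) \<and> s \<in> {0<..<e1}"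
    by (intro eventually_conj big ev_e1) auto
  then obtain e2 where e2: "e2 > 0" and h2: "\<And>s. s \<in> {0<..<e2} ==>
      dist (\<pi> (Df (\<gamma> s) (k' s))) Q < norm Q / 8 \<and> 1 \<le> norm (p' s) \<and> s \<in> {0<..<e1}"
    by (rule eventually_at_right_0E) blast
  have in_e1: "s \<in> {0<..<e1}" if "s \<in> {0<..<e2}" for s using h2[OF that] by (elim conjE)
  define m where "m s = norm (p' s)" for s
  have m0: "m s > 0" if "s \<in> {0<..<e2}" for s using h2[OF that] unfolding m_def by linarith
  have cone: "norm (x' s - m s *\<^sub>R Q) \<le> m s * norm Q / 8" if s: "s \<in> {0<..<e2}" for s
  proof -
    have mk: "m s *\<^sub>R k' s = \<gamma>' s" using m0[OF s] by (simp add: k'_def m_def sgn_div_norm scaleR_add_right scaleR_diff_right)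
    have "x' s = \<pi> (m s *\<^sub>R Df (\<gamma> s) (k' s))"
      unfolding x'_def mk[symmetric] linear_scale[OF linear_Df[OF \<gamma>U(1)[OF in_e1[OF s]]]] ..
    then have "x' s = m s *\<^sub>R \<pi> (Df (\<gamma> s) (k' s))"
      by (simp only: linear_scale[OF linear_coord_proj])
    then have "x' s - m s *\<^sub>R Q = m s *\<^sub>R (\<pi> (Df (\<gamma> s) (k' s)) - Q)" by (simp add: scaleR_diff_right)
    then have "norm (x' s - m s *\<^sub>R Q) = m s * dist (\<pi> (Df (\<gamma> s) (k' s))) Q" using m0[OF s] by (simp add: dist_norm)
    also have "\<dots> \<le> m s * (norm Q / 8)" using h2[OF s] m0[OF s] by (intro mult_left_mono) auto
    finally show ?thesis by simp
  qed
  have dx: "(x has_vector_derivative x' s) (at s)" if s: "s \<in> {0<..<e2}" for s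
  proof -
    have d1: "(\<gamma> has_vector_derivative \<gamma>' s) (at s)" by (rule bspec[OF d\<gamma> in_e[OF in_e1[OF s]]])
    have d2: "(f has_derivative Df (\<gamma> s)) (at (\<gamma> s) within range \<gamma>)"
      by (rule has_derivative_at_withinI[OF Dfg(1)[OF \<gamma>U(1)[OF in_e1[OF s]]]])
    from bounded_linear.has_vector_derivative[OF bounded_linear_coord_proj vector_derivative_diff_chain_within[OF d1 d2]]
    show ?thesis unfolding x_def[abs_def] x'_def by (simp add: o_def)
  qed
  have "isCont f x0" using Dfg(1)[OF x0(2)] has_derivative_continuous by blast
  from isCont_tendsto_compose[OF this c(4)]
  have "((\<lambda>s. f (\<gamma> s)) \<longlongrightarrow> 0) (at_right 0)" by (simp add: x0(3))
  from bounded_linear.tendsto[OF bounded_linear_coord_proj this]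
  have x_lim: "(x \<longlongrightarrow> 0) (at_right 0)" unfolding x_def[abs_def] by (simp add: linear_0[OF linear_coord_proj])
  have cc: "x s \<noteq> 0" "norm Q / 2 * m s * norm (x s) \<le> x s \<bullet> x' s" if s: "s \<in> {0<..<e2}" for s
    by (rule cone_curve[of e2 x x' Q m s], ((rule dx m0 cone, assumption) | rule x_lim Q0 s)+)+
  define \<tau> where "\<tau> s = norm (x s)" for s
  define \<tau>' where "\<tau>' s = (x s \<bullet> x' s) / norm (x s)" for s
  have \<tau>'_ge: "norm Q / 2 * m s \<le> \<tau>' s" if "s \<in> {0<..<e2}" for s
    using cc[OF that] by (simp add: \<tau>'_def le_divide_eq)
  have \<tau>'0: "0 < \<tau>' s" if "s \<in> {0<..<e2}" for s
  proof -
    have "0 < norm Q / 2 * m s" using m0[OF that] Q0 by simp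
    then show ?thesis using \<tau>'_ge[OF that] by linarith
  qed
  have d\<tau>: "(\<tau> has_real_derivative \<tau>' s) (at s)" if s: "s \<in> {0<..<e2}" for s
  proof -
    have "(norm has_derivative (\<lambda>h. h \<bullet> sgn (x s))) (at (x s) within range x)"
      using GDERIV_norm[OF cc(1)[OF s]] unfolding gderiv_def by (blast intro: has_derivative_at_withinI)
    from vector_derivative_diff_chain_within[OF dx[OF s] this]
    show ?thesis unfolding \<tau>_def[abs_def] \<tau>'_def has_real_derivative_iff_has_vector_derivative
      by (simp add: o_def sgn_div_norm inner_commute divide_inverse mult.commute)
  qed
  have sub: "{0<..<e2} \<subseteq> {0<..<e}" using in_e in_e1 by blast
  have cx: "continuous_on {0<..<e2} x"
    by (rule continuous_at_imp_continuous_on) (use dx in \<open>blast intro: has_vector_derivative_continuous\<close>)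
  have c\<gamma>: "continuous_on {0<..<e2} \<gamma>"
    by (rule continuous_at_imp_continuous_on) (use d\<gamma> sub in \<open>blast intro: has_vector_derivative_continuous\<close>)
  have "continuous_on {0<..<e2} x'" unfolding x'_def
    by (rule bounded_linear.continuous_on[OF bounded_linear_coord_proj
          continuous_on_Df_apply[OF c\<gamma> continuous_on_subset[OF c\<gamma>' sub] \<gamma>U(1)[OF in_e1]]])
  then have c\<tau>': "continuous_on {0<..<e2} \<tau>'" unfolding \<tau>'_def
    by (intro continuous_intros cx) (simp_all add: cc(1))
  have \<tau>_lim: "(\<tau> \<longlongrightarrow> 0) (at_right 0)" unfolding \<tau>_def[abs_def] using tendsto_norm[OF x_lim] by simp
  define C where "C = c0 * norm Q / (2 * L)"
  have C0: "C > 0" using c0 Q0 L by (simp add: C_def)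
  have R: "ennreal (C / (s * \<tau>' s)) \<le> gap_ratio I Z (\<tau> s)" if s: "s \<in> {0<..<e2}" for s
  proof -
    note s1 = in_e1[OF s]
    have zY: "f (\<gamma> s) \<in> Z" using \<gamma>Y[OF s1] \<gamma>U(1)[OF s1] by blast
    have zle: "norm (f (\<gamma> s) - \<pi> (f (\<gamma> s))) \<le> L * s" using nb(5)[OF s1 nr[OF s1] s1] h1[OF s1] by simp
    have "norm (\<gamma> s - p s) > 0" using nb(4)[OF s1 nr[OF s1] s1] by simp
    then have "0 < L * norm (f (\<gamma> s) - \<pi> (f (\<gamma> s)))" using nb(6)[OF s1 nr[OF s1] s1] by linarith
    then have z0: "0 < norm (f (\<gamma> s) - \<pi> (f (\<gamma> s)))" using L by (simp add: zero_less_mult_iff)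
    have s0: "s > 0" using s by simp
    have "s * (norm Q / 2 * m s) \<le> s * \<tau>' s" using \<tau>'_ge[OF s] s0 by (intro mult_left_mono) auto
    then have "C / (s * \<tau>' s) \<le> C / (s * (norm Q / 2 * m s))"
      using C0 s0 m0[OF s] Q0 by (intro divide_left_mono mult_pos_pos \<tau>'0[OF s]) auto
    also have "\<dots> = (c0 / m s) / (L * s)" using Q0 L s0 m0[OF s] by (simp add: C_def field_simps)
    also have "\<dots> \<le> G (\<gamma> s) / (L * s)"
      using speed[OF s1] m0[OF s] L s0 by (intro divide_right_mono) (simp_all add: divide_le_eq m_def)
    also have "\<dots> \<le> G (\<gamma> s) / norm (f (\<gamma> s) - \<pi> (f (\<gamma> s)))"
      using zle z0 gap_nonneg[OF \<gamma>U(1)[OF s1] \<gamma>Y[OF s1]] L s0 by (intro divide_left_mono) auto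
    finally have "ennreal (C / (s * \<tau>' s)) \<le> ennreal (G (\<gamma> s) / norm (f (\<gamma> s) - \<pi> (f (\<gamma> s))))"
      by (rule ennreal_leI)
    also have "\<dots> \<le> gap_ratio I Z (\<tau> s)"
      unfolding gap_ratio_def by (rule SUP_upper2[of "f (\<gamma> s)"]) (use zY in \<open>simp_all add: \<tau>_def x_def\<close>)
    finally show ?thesis .
  qed
  have "(\<integral>\<^sup>+ t \<in> {0..e'}. gap_ratio I Z t \<partial>lborel) = \<infinity>" if "e' > 0" for e'
    by (rule nn_integral_eq_infinity_along_curve[OF e2 d\<tau> c\<tau>' \<tau>'0 _ \<tau>_lim C0 R that])
       (use cc(1) in \<open>simp_all add: \<tau>_def\<close>)
  then show False using r_int by auto
qed

lemma secant_near_T: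
  assumes "\<epsilon> > 0"
  shows "\<exists>\<delta>>0. \<forall>y\<in>Y. norm (y - x0) < \<delta> -->
    (\<exists>w\<in>T (f y). norm (f y - \<pi> (f y) - w) \<le> \<epsilon> * norm (f y - \<pi> (f y)))"
proof -
  define \<eta> where "\<eta> = min 1 (\<epsilon> / (3 * L * L))"
  have \<eta>: "0 < \<eta>" "\<eta> \<le> 1" using assms L by (auto simp: \<eta>_def)
  have "3 * L * L * \<eta> \<le> 3 * L * L * (\<epsilon> / (3 * L * L))" using L by (intro mult_left_mono) (auto simp: \<eta>_def)
  then have \<eta>\<epsilon>: "3 * L * L * \<eta> \<le> \<epsilon>" using L by simp
  obtain \<delta>1 where \<delta>1: "\<delta>1 > 0" "\<And>y p. bad (\<eta> / 2) y p ==> \<delta>1 \<le> norm (y - x0)"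
  proof -
    have "\<eta> / 2 > 0" using \<eta>(1) by simp
    from no_bad_near[OF this] show thesis using that by blast
  qed
  obtain \<delta>2 where \<delta>2: "\<delta>2 > 0" "\<And>y. y \<in> Y ==> norm (y - x0) < \<delta>2 ==> G y \<le> \<eta>"
    using gap_tendsto_0[OF \<eta>(1)] by blast
  define \<delta> where "\<delta> = min (min \<delta>1 \<delta>2) (min \<eta> (r / (2 * L)))"
  have "\<delta> > 0" using \<delta>1(1) \<delta>2(1) \<eta>(1) r(1) L by (simp add: \<delta>_def)
  moreover have "\<exists>w\<in>T (f y). norm (f y - \<pi> (f y) - w) \<le> \<epsilon> * norm (f y - \<pi> (f y))"
    if y: "y \<in> Y" "norm (y - x0) < \<delta>" for y
  proof -
    have "norm (y - x0) < r / (2 * L)" using y(2) by (simp add: \<delta>_def)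
    then have rr: "2 * L * norm (y - x0) < r" using L by (simp add: less_divide_eq mult.commute)
    have "2 * 1 * norm (y - x0) \<le> 2 * L * norm (y - x0)" using L by (intro mult_right_mono) auto
    then have "2 * norm (y - x0) < r" using rr by simp
    then obtain p where p: "near y p" using near_exists by blast
    have "\<not> bad (\<eta> / 2) y p" using \<delta>1(2)[of y p] y(2) by (auto simp: \<delta>_def)
    then obtain v where v: "v \<in> tangent_space Y y" "norm (y - p - v) < \<eta> * norm (y - p)"
      using tangent_bad[OF y(1) p \<eta>] by (meson not_le)
    have "\<exists>w\<in>T (f y). norm (f y - \<pi> (f y) - w) \<le> 3 * L * L * \<eta> * norm (f y - \<pi> (f y))"
      by (rule no_bad_imp_secant_near[OF y(1) _ p v(1)])
         (use rr v(2) \<delta>2(2)[OF y(1)] y(2) in \<open>auto simp: \<delta>_def\<close>)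
    then show ?thesis using mult_right_mono[OF \<eta>\<epsilon> norm_ge_zero[of "f y - \<pi> (f y)"]] by (meson order_trans)
  qed
  ultimately show ?thesis by blast
qed

end

section \<open>Sheets of proper local diffeomorphisms\<close>

lemma proper_local_homeomorphism_covering_space:
  fixes q :: "'a::euclidean_space \<Rightarrow> 'b::euclidean_space"
  assumes contq: "continuous_on A q" and qA: "q ` A \<subseteq> H" and "A \<noteq> {}" and "connected H"
    and loc: "\<And>a. a \<in> A ==> \<exists>N M h. a \<in> N \<and> openin (top_of_set A) N \<and> openin (top_of_set H) M \<and> homeomorphism N M q h"
    and proper: "\<And>C. C \<subseteq> H ==> compact C ==> compact (A \<inter> q -` C)"
  shows "covering_space A q H"
proof -
  obtain N M h where N: "\<And>a. a \<in> A ==> a \<in> N a \<and> openin (top_of_set A) (N a) \<and> openin (top_of_set H) (M a) \<and>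
      homeomorphism (N a) (M a) q (h a)" using loc by metis
  have open_im: "openin (top_of_set H) (q ` P)" if "openin (top_of_set A) P" for P
  proof (subst openin_subopen, intro ballI)
    fix w assume "w \<in> q ` P"
    then obtain a where a: "a \<in> P" "w = q a" by blast
    have aA: "a \<in> A" using a(1) that openin_imp_subset by blast
    note Na = N[OF aA]
    have "openin (top_of_set (N a)) (P \<inter> N a)"
      using that Na by (metis openin_Int openin_subset_trans openin_imp_subset inf_le2 inf_commute)
    then have "openin (top_of_set (M a)) (q ` (P \<inter> N a))"
      using Na homeomorphism_imp_open_map by blast
    then have "openin (top_of_set H) (q ` (P \<inter> N a))" using Na openin_trans by blast
    then show "\<exists>T. openin (top_of_set H) T \<and> w \<in> T \<and> T \<subseteq> q ` P" using a Na by blast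
  qed
  have closed_im: "closedin (top_of_set H) (q ` P)" if "closedin (top_of_set A) P" for P
    by (rule proper_map[OF that _ qA]) (rule proper)
  have onto: "q ` A = H"
    using connected_clopen[of H] \<open>connected H\<close> open_im[of A] closed_im[of A] \<open>A \<noteq> {}\<close> by auto
  show ?thesis
  proof (rule covering_spaceI[OF contq onto])
    fix w assume w: "w \<in> H"
    define F where "F = A \<inter> q -` {w}"
    have "compact F" unfolding F_def using w by (intro proper) auto
    have isol: "b = a" if "a \<in> F" "b \<in> F" "b \<in> N a" for a b
    proof -
      have "a \<in> A" "q a = q b" using that by (auto simp: F_def)
      then show ?thesis using N[of a] that(3) by (metis homeomorphism_apply1)
    qed
    have "finite F"
    proof -
      have "\<exists>T. open T \<and> N a = A \<inter> T" if "a \<in> F" for a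
        using N[of a] that by (auto simp: F_def openin_open)
      then obtain T where T: "\<And>a. a \<in> F ==> open (T a) \<and> N a = A \<inter> T a" by metis
      have "F \<subseteq> (\<Union>a\<in>F. T a)" using T N by (fastforce simp: F_def)
      then obtain D where D: "D \<subseteq> F" "finite D" "F \<subseteq> (\<Union>a\<in>D. T a)"
        using compactE_image[OF \<open>compact F\<close>, of F T] T by blast
      have "F \<subseteq> D"
      proof
        fix b assume b: "b \<in> F"
        then obtain a where a: "a \<in> D" "b \<in> T a" using D(3) by blast
        have "b \<in> N a" using T[of a] a D(1) b by (auto simp: F_def)
        then show "b \<in> D" using isol[of a b] a(1) b D(1) by blast
      qed
      then show ?thesis using D(2) finite_subset by blast
    qed
    obtain \<epsilon> where \<epsilon>: "\<epsilon> > 0" "\<And>a b. a \<in> F ==> b \<in> F ==> a \<noteq> b ==> 2 * \<epsilon> \<le> dist a b"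
    proof -
      let ?D = "insert 1 ((\<lambda>(a, b). dist a b) ` {(a, b). a \<in> F \<and> b \<in> F \<and> a \<noteq> b})"
      have fin: "finite ?D"
        by (intro finite.insertI finite_imageI finite_subset[OF _ finite_cartesian_product[OF \<open>finite F\<close> \<open>finite F\<close>]]) auto
      have "Min ?D > 0" using fin by (subst Min_gr_iff) auto
      moreover have "Min ?D \<le> dist a b" if "a \<in> F" "b \<in> F" "a \<noteq> b" for a b
        by (rule Min_le[OF fin]) (use that in auto)
      ultimately show thesis using that[of "Min ?D / 2"] by auto
    qed
    define P where "P a = N a \<inter> ball a \<epsilon>" for a
    have P: "openin (top_of_set A) (P a)" "a \<in> P a" "P a \<subseteq> N a" if "a \<in> F" for a
      using N[of a] that \<epsilon>(1) unfolding P_def F_def by (auto intro: openin_Int_open)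
    have disj: "P a \<inter> P b = {}" if "a \<in> F" "b \<in> F" "a \<noteq> b" for a b
    proof (rule ccontr)
      assume "P a \<inter> P b \<noteq> {}"
      then obtain c where "dist a c < \<epsilon>" "dist b c < \<epsilon>" by (auto simp: P_def)
      then have "dist a b < 2 * \<epsilon>" using dist_triangle2[of a b c] by simp
      then show False using \<epsilon>(2)[OF that] by simp
    qed
    define R where "R = A - (\<Union>a\<in>F. P a)"
    have "closedin (top_of_set A) R" unfolding R_def
      by (intro closedin_diff openin_Union) (use P(1) in auto)
    from closed_im[OF this] have clR: "closedin (top_of_set H) (q ` R)" .
    define W where "W = (H - q ` R) \<inter> (\<Inter>a\<in>F. H \<inter> q ` P a)"
    have oI: "openin (top_of_set H) (H \<inter> (\<Inter>a\<in>F. H \<inter> q ` P a))"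
    proof (cases "F = {}")
      case False
      have "openin (top_of_set H) (\<Inter>a\<in>F. H \<inter> q ` P a)"
        using \<open>finite F\<close> False P(1) open_im by (intro openin_INT2 openin_Int) auto
      then show ?thesis by (intro openin_Int) auto
    qed simp
    have "openin (top_of_set H) ((H - q ` R) \<inter> (H \<inter> (\<Inter>a\<in>F. H \<inter> q ` P a)))"
      by (rule openin_Int[OF openin_diff[OF openin_subtopology_self clR] oI])
    moreover have "(H - q ` R) \<inter> (H \<inter> (\<Inter>a\<in>F. H \<inter> q ` P a)) = W" by (auto simp: W_def)
    ultimately have oW: "openin (top_of_set H) W" by simp
    have wF: "q a = w" if "a \<in> F" for a using that by (simp add: F_def)
    have "w \<notin> q ` R" using P(2) by (auto simp: R_def F_def)
    then have wW: "w \<in> W" using w P(2) wF by (auto simp: W_def)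
    let ?v = "(\<lambda>a. P a \<inter> q -` W) ` F"
    have PA: "P a \<subseteq> A" if "a \<in> F" for a using P(1)[OF that] openin_imp_subset by blast
    have Wsub: "W \<subseteq> q ` P a" if "a \<in> F" for a using that by (auto simp: W_def)
    have un: "\<Union>?v = A \<inter> q -` W"
    proof (intro equalityI subsetI)
      fix c assume c: "c \<in> A \<inter> q -` W"
      then have "c \<notin> R" by (auto simp: W_def)
      then show "c \<in> \<Union>?v" using c by (auto simp: R_def)
    qed (use PA in blast)
    have opv: "openin (top_of_set A) (P a \<inter> q -` W)" if "a \<in> F" for a
    proof -
      have "openin (top_of_set A) (A \<inter> q -` W)"
        using continuous_on_open_gen[of q A H] qA contq oW by (auto simp: image_subset_iff_funcset)
      then have "openin (top_of_set A) (P a \<inter> (A \<inter> q -` W))" using P(1)[OF that] by (rule openin_Int[rotated])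
      moreover have "P a \<inter> (A \<inter> q -` W) = P a \<inter> q -` W" using PA[OF that] by blast
      ultimately show ?thesis by simp
    qed
    have hom: "homeomorphism (P a \<inter> q -` W) W q (h a)" if aF: "a \<in> F" for a
    proof -
      have hN: "homeomorphism (N a) (M a) q (h a)" using N[of a] aF by (auto simp: F_def)
      have "q ` (P a \<inter> q -` W) = W" using Wsub[OF aF] by auto
      moreover have "q ` N a = M a" using hN by (simp add: homeomorphism_def)
      then have "W \<subseteq> M a" using Wsub[OF aF] P(3)[OF aF] by blast
      ultimately show ?thesis
        using P(3)[OF aF] by (intro homeomorphism_of_subsets[OF hN, of _ W]) auto
    qed
    show "\<exists>T. w \<in> T \<and> openin (top_of_set H) T \<and> (\<exists>v. \<Union>v = A \<inter> q -` T \<and>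
        (\<forall>u\<in>v. openin (top_of_set A) u) \<and> pairwise disjnt v \<and> (\<forall>u\<in>v. \<exists>q'. homeomorphism u T q q'))"
    proof (intro exI[of _ W] conjI exI[of _ ?v] wW oW un ballI)
      show "pairwise disjnt ?v" using disj by (auto simp: pairwise_def disjnt_def)
    qed (use opv hom in auto)
  qed
qed

lemma proper_local_homeomorphism_section:
  fixes q :: "'a::euclidean_space \<Rightarrow> 'b::euclidean_space"
  assumes contq: "continuous_on A q" and qA: "q ` A \<subseteq> H" and H: "convex H"
    and loc: "\<And>a. a \<in> A ==> \<exists>N M h. a \<in> N \<and> openin (top_of_set A) N \<and> openin (top_of_set H) M \<and> homeomorphism N M q h"
    and proper: "\<And>C. C \<subseteq> H ==> compact C ==> compact (A \<inter> q -` C)"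
    and C: "connected C" "C \<subseteq> A" "C \<noteq> {}"
  shows "\<exists>G. continuous_on H G \<and> G ` H \<subseteq> A \<and> (\<forall>w\<in>H. q (G w) = w) \<and> (\<forall>c\<in>C. G (q c) = c)"
proof -
  obtain a where a: "a \<in> C" "a \<in> A" using C by blast
  have cov: "covering_space A q H"
    by (rule proper_local_homeomorphism_covering_space[OF contq qA _ convex_connected[OF H] loc proper]) (use a in auto)
  have qa: "q a \<in> H" using qA a by blast
  obtain G where G: "continuous_on H G" "G \<in> H \<rightarrow> A" "G (q a) = a" "\<And>y. y \<in> H ==> q (G y) = y"
    by (rule covering_space_lift_strong[OF cov a(2) qa convex_imp_simply_connected[OF H]
          convex_imp_locally_path_connected[OF H] continuous_on_id]) auto
  have contC: "continuous_on C q" "q ` C \<subseteq> H" using continuous_on_subset[OF contq C(2)] qA C(2) by auto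
  have contGq: "continuous_on C (\<lambda>c. G (q c))"
    by (rule continuous_on_compose2[OF G(1) contC])
  have "G (q c) = c" if "c \<in> C" for c
    by (rule covering_space_lift_unique[OF cov, of "\<lambda>c. G (q c)" a "\<lambda>c. c" C q c])
       (use G a C that contC contGq in \<open>auto intro: continuous_on_id\<close>)
  then show ?thesis using G by (intro exI[of _ G]) auto
qed

lemma continuous_on_inv_blinfun_apply:
  fixes P :: "'b::topological_space \<Rightarrow> ('a::euclidean_space \<Rightarrow>\<^sub>L 'a)"
  assumes P: "continuous_on S P" and bij: "\<And>y. y \<in> S ==> bij (blinfun_apply (P y))"
  shows "continuous_on S (\<lambda>y. inv (blinfun_apply (P y)) v)"
  unfolding continuous_on_def
proof
  fix y0 assume y0: "y0 \<in> S"
  let ?u = "\<lambda>y. inv (blinfun_apply (P y)) v"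
  have Pu: "blinfun_apply (P y) (?u y) = v" if "y \<in> S" for y
    using bij[OF that] by (simp add: bij_is_surj surj_f_inv_f)
  have "linear (blinfun_apply (P y0))" using blinfun.bounded_linear_right by (rule bounded_linear.linear)
  then obtain B where B: "B > 0" "\<And>x. B * norm x \<le> norm (blinfun_apply (P y0) x)"
    using linear_inj_bounded_below_pos[of "blinfun_apply (P y0)"] bij_is_inj[OF bij[OF y0]] by blast
  have lim: "(P \<longlongrightarrow> P y0) (at y0 within S)" using P y0 by (simp add: continuous_on_def)
  have evS: "\<forall>\<^sub>F y in at y0 within S. y \<in> S" by (simp add: eventually_at_filter)
  have "\<forall>\<^sub>F y in at y0 within S. dist (P y) (P y0) < B/2" by (rule tendstoD[OF lim]) (use B(1) in simp)
  then have ev: "\<forall>\<^sub>F y in at y0 within S. norm (?u y - ?u y0) \<le> 2 / B * norm (v - blinfun_apply (P y) (?u y0))"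
    using evS
  proof eventually_elim
    case (elim y)
    let ?x = "?u y - ?u y0"
    have "norm (blinfun_apply (P y0 - P y) ?x) \<le> norm (P y0 - P y) * norm ?x" by (rule norm_blinfun)
    also have "\<dots> \<le> B/2 * norm ?x" using elim(1) by (intro mult_right_mono) (auto simp: dist_norm norm_minus_commute)
    finally have "norm (blinfun_apply (P y0) ?x - blinfun_apply (P y) ?x) \<le> B/2 * norm ?x" by (simp add: blinfun.diff_left)
    then have "B/2 * norm ?x \<le> norm (blinfun_apply (P y) ?x)"
      using B(2)[of ?x] norm_triangle_ineq2[of "blinfun_apply (P y0) ?x" "blinfun_apply (P y) ?x"] by linarith
    also have "blinfun_apply (P y) ?x = v - blinfun_apply (P y) (?u y0)"
      using Pu[OF elim(2)] by (simp add: blinfun.diff_right)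
    finally show ?case using B(1) by (simp add: field_simps)
  qed
  have "((\<lambda>y. 2 / B * norm (v - blinfun_apply (P y) (?u y0))) \<longlongrightarrow> 2 / B * norm (v - blinfun_apply (P y0) (?u y0))) (at y0 within S)"
    by (intro tendsto_intros lim)
  then have "((\<lambda>y. 2 / B * norm (v - blinfun_apply (P y) (?u y0))) \<longlongrightarrow> 0) (at y0 within S)" using Pu[OF y0] by simp
  from Lim_null_comparison[OF ev this] show "(?u \<longlongrightarrow> ?u y0) (at y0 within S)" by (rule LIM_zero_cancel)
qed

lemma local_graph_chart:
  fixes Z :: "(real ^ 'n) set" and q :: "real ^ 'n \<Rightarrow> real ^ 'n"
  assumes Z: "submanifold 1 m Z" "a \<in> Z" and K: "card K = m" and \<Omega>: "open \<Omega>" "a \<in> \<Omega>"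
    and q: "\<And>b. b \<in> \<Omega> ==> (q has_derivative q' b) (at b)" "\<And>v. continuous_on \<Omega> (\<lambda>b. q' b v)" "q ` \<Omega> \<subseteq> coord_plane K"
    and inj: "\<And>v. v \<in> tangent_space Z a ==> q' a v = 0 ==> v = 0"
  shows "\<exists>N W h h'. open N \<and> a \<in> N \<and> N \<subseteq> \<Omega> \<and> open W \<and> homeomorphism (N \<inter> Z) (W \<inter> coord_plane K) q h \<and>
    h ` W \<subseteq> N \<and> (\<forall>w\<in>W. (h has_derivative h' w) (at w)) \<and> (\<forall>v. continuous_on W (\<lambda>w. h' w v))"
proof -
  obtain J U1 V1 F Fi where J: "card J = m" and aU: "a \<in> U1" and fl: "flattens 1 Z (coord_plane J) U1 V1 F Fi"
    using Z unfolding submanifold_def by blast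
  have cd: "C_k_diffeo 1 U1 V1 F Fi" and oU: "open U1" and C1F: "C_k_on 1 F U1"
    using fl unfolding flattens_def C_k_diffeo_def by auto
  let ?DF = "\<lambda>b. frechet_derivative F (at b)"
  have "card (- K) = card (- J)" using K J by (simp add: Compl_eq_Diff_UNIV card_Diff_subset)
  then obtain \<sigma> where \<sigma>: "bij_betw \<sigma> (- K) (- J)" using finite_same_card_bij[of "- K" "- J"] by auto
  define \<Lambda> :: "real ^ 'n \<Rightarrow> real ^ 'n" where "\<Lambda> w = (\<chi> i. if i \<in> K then 0 else w $ \<sigma> i)" for w
  have lin\<Lambda>: "linear \<Lambda>" by (rule linearI) (auto simp: \<Lambda>_def vec_eq_iff)
  then have bl\<Lambda>: "bounded_linear \<Lambda>" by (simp add: linear_conv_bounded_linear)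
  have \<Lambda>0: "\<Lambda> w = 0 \<longleftrightarrow> w \<in> coord_plane J" for w
  proof -
    have "\<Lambda> w = 0 \<longleftrightarrow> (\<forall>i\<in>- K. w $ \<sigma> i = 0)" by (auto simp: \<Lambda>_def vec_eq_iff)
    also have "\<dots> \<longleftrightarrow> (\<forall>i\<in>- J. w $ i = 0)" using bij_betw_imp_surj_on[OF \<sigma>] by (metis (no_types, lifting) image_iff)
    finally show ?thesis by (auto simp: coord_plane_def)
  qed
  have sum0: "u = 0 \<and> \<Lambda> w = 0" if "u \<in> coord_plane K" "u + \<Lambda> w = 0" for u w
  proof -
    have "u $ i = 0 \<and> \<Lambda> w $ i = 0" for i
      using that by (cases "i \<in> K") (auto simp: coord_plane_def \<Lambda>_def vec_eq_iff dest: spec[of _ i])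
    then show ?thesis by (simp add: vec_eq_iff)
  qed
  have sumK: "u + \<Lambda> w \<in> coord_plane K \<longleftrightarrow> \<Lambda> w = 0" if "u \<in> coord_plane K" for u w
    using that by (auto simp: coord_plane_def \<Lambda>_def vec_eq_iff)
  define O1 where "O1 = \<Omega> \<inter> U1"
  have O1: "open O1" "a \<in> O1" using \<Omega> aU oU by (auto simp: O1_def)
  define \<Psi> where "\<Psi> b = q b + \<Lambda> (F b)" for b
  define D where "D b v = q' b v + \<Lambda> (?DF b v)" for b v
  have dF: "(F has_derivative ?DF b) (at b)" if "b \<in> O1" for b
    using C_1_has_derivative[OF C1F] that by (simp add: O1_def)
  have dq: "(q has_derivative q' b) (at b)" if "b \<in> O1" for b using q(1) that by (simp add: O1_def)
  have d\<Psi>: "(\<Psi> has_derivative D b) (at b)" if "b \<in> O1" for b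
    unfolding \<Psi>_def[abs_def] D_def
    by (rule has_derivative_add[OF dq[OF that] bounded_linear.has_derivative[OF bl\<Lambda> dF[OF that]]])
  have blD: "bounded_linear (D b)" if "b \<in> O1" for b using d\<Psi>[OF that] by (rule has_derivative_bounded_linear)
  define \<Psi>' where "\<Psi>' b = Blinfun (D b)" for b
  have \<Psi>': "blinfun_apply (\<Psi>' b) = D b" if "b \<in> O1" for b
    unfolding \<Psi>'_def by (rule bounded_linear_Blinfun_apply[OF blD[OF that]])
  have "continuous_on O1 (\<lambda>b. D b v)" for v
    unfolding D_def
    by (intro continuous_intros continuous_on_subset[OF q(2)] bounded_linear.continuous_on[OF bl\<Lambda>])
       (use C1F in \<open>auto simp: O1_def C_1_on_iff simp del: One_nat_def intro: continuous_on_subset\<close>)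
  then have "continuous_on O1 (\<lambda>b. blinfun_apply (\<Psi>' b) v)" for v
    by (rule continuous_on_cong[THEN iffD1, rotated -1]) (simp_all add: \<Psi>')
  then have cont\<Psi>': "continuous_on O1 \<Psi>'" by (intro continuous_on_blinfun_componentwise)
  have "inj (D a)"
  proof (rule linear_injective_0[THEN iffD2, rule_format])
    show "linear (D a)" using blD[OF O1(2)] by (rule bounded_linear.linear)
    fix v assume "D a v = 0"
    moreover have "q' a v \<in> coord_plane K"
    proof -
      have "v \<in> tangent_space UNIV a"
        unfolding tangent_space_def
        by (intro CollectI exI[of _ "\<lambda>t. a + t *\<^sub>R v"] exI[of _ 1]) (auto intro!: derivative_eq_intros)
      from tangent_space_image[OF \<Omega>(1,2) q(1)[OF \<Omega>(2)] _ this, of "coord_plane K"] q(3)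
      show ?thesis using tangent_space_coord_plane_subset by blast
    qed
    ultimately have "q' a v = 0" "\<Lambda> (?DF a v) = 0" using sum0 unfolding D_def by blast+
    moreover from this have "v \<in> tangent_space Z a"
      unfolding tangent_space_flattens[OF fl order_refl aU Z(2)] using \<Lambda>0 by simp
    ultimately show "v = 0" using inj by blast
  qed
  then obtain invD where invD: "linear invD" "invD \<circ> D a = id"
    using linear_injective_left_inverse[of "D a"] blD[OF O1(2)] bounded_linear.linear by blast
  have "Blinfun invD o\<^sub>L \<Psi>' a = id_blinfun"
  proof (rule blinfun_eqI)
    fix i
    have "bounded_linear invD" using invD(1) by (simp add: linear_conv_bounded_linear)
    then show "blinfun_apply (Blinfun invD o\<^sub>L \<Psi>' a) i = blinfun_apply id_blinfun i"
      using invD(2) by (simp add: \<Psi>'[OF O1(2)] bounded_linear_Blinfun_apply fun_eq_iff)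
  qed
  then obtain N W h h' where N: "open N" "N \<subseteq> O1" "a \<in> N" "open W" "homeomorphism N W \<Psi> h"
    and h': "\<And>y. y \<in> W ==> (h has_derivative (h' y)) (at y)"
      "\<And>y. y \<in> W ==> h' y = inv (blinfun_apply (\<Psi>' (h y)))"
      "\<And>y. y \<in> W ==> bij (blinfun_apply (\<Psi>' (h y)))"
    using inverse_function_theorem[OF O1(1) _ cont\<Psi>' O1(2), of \<Psi> "Blinfun invD"] d\<Psi> \<Psi>' by metis
  have hW: "h ` W = N" and conth: "continuous_on W h" using N(5) by (auto simp: homeomorphism_def)
  have "continuous_on W (\<lambda>y. \<Psi>' (h y))"
    by (rule continuous_on_compose2[OF cont\<Psi>' conth]) (use hW N(2) in simp)
  from continuous_on_inv_blinfun_apply[OF this h'(3)]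
  have "continuous_on W (\<lambda>y. inv (blinfun_apply (\<Psi>' (h y))) v)" for v .
  then have conth': "continuous_on W (\<lambda>y. h' y v)" for v
    by (rule continuous_on_cong[THEN iffD1, rotated -1]) (simp_all add: h'(2))
  have qK: "q b \<in> coord_plane K" if "b \<in> N" for b using q(3) N(2) that by (auto simp: O1_def)
  have ZN: "b \<in> Z \<longleftrightarrow> \<Lambda> (F b) = 0" if "b \<in> N" for b
    using flattens_memD(1)[OF fl, of b] N(2) that \<Lambda>0 by (auto simp: O1_def)
  have \<Psi>Z: "\<Psi> b \<in> coord_plane K \<longleftrightarrow> b \<in> Z" if "b \<in> N" for b
    unfolding \<Psi>_def sumK[OF qK[OF that]] ZN[OF that] ..
  have \<Psi>q: "\<Psi> b = q b" if "b \<in> N \<inter> Z" for b using ZN[of b] that by (simp add: \<Psi>_def)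
  have "\<Psi> ` (N \<inter> Z) = W \<inter> coord_plane K"
  proof (intro equalityI subsetI)
    fix w assume w: "w \<in> W \<inter> coord_plane K"
    then have "h w \<in> N" "\<Psi> (h w) = w" using N(5) by (auto simp: homeomorphism_def)
    then show "w \<in> \<Psi> ` (N \<inter> Z)" using \<Psi>Z[of "h w"] w by (metis IntI IntD2 image_eqI)
  qed (use \<Psi>Z N(5) in \<open>auto simp: homeomorphism_def\<close>)
  moreover have "h ` (W \<inter> coord_plane K) \<subseteq> N \<inter> Z"
  proof
    fix b assume "b \<in> h ` (W \<inter> coord_plane K)"
    then obtain w where w: "w \<in> W" "w \<in> coord_plane K" "b = h w" by blast
    then have "h w \<in> N" "\<Psi> (h w) = w" using N(5) by (auto simp: homeomorphism_def)
    then show "b \<in> N \<inter> Z" using \<Psi>Z[of "h w"] w by simp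
  qed
  ultimately have hom: "homeomorphism (N \<inter> Z) (W \<inter> coord_plane K) \<Psi> h"
    by (intro homeomorphism_of_subsets[OF N(5), of _ "W \<inter> coord_plane K"]) auto
  have "homeomorphism (N \<inter> Z) (W \<inter> coord_plane K) q h"
    by (rule homeomorphism_cong[OF hom]) (use \<Psi>q in auto)
  then show ?thesis using N h'(1) conth' hW by (intro exI[of _ N] exI[of _ W] exI[of _ h] exI[of _ h']) (auto simp: O1_def)
qed

lemma sheet_section:
  fixes Z :: "(real ^ 'n) set" and q :: "real ^ 'n \<Rightarrow> real ^ 'n"
  assumes Z: "submanifold 1 m Z" and K: "card K = m" and \<Omega>: "open \<Omega>"
    and q: "\<And>b. b \<in> \<Omega> ==> (q has_derivative q' b) (at b)" "\<And>v. continuous_on \<Omega> (\<lambda>b. q' b v)" "q ` \<Omega> \<subseteq> coord_plane K"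
    and inj: "\<And>a v. a \<in> Z \<inter> \<Omega> ==> v \<in> tangent_space Z a ==> q' a v = 0 ==> v = 0"
    and B: "open B" "convex B" "q ` (Z \<inter> \<Omega>) \<subseteq> B"
    and proper: "\<And>C. C \<subseteq> B \<inter> coord_plane K ==> compact C ==> compact (Z \<inter> \<Omega> \<inter> q -` C)"
    and C: "connected C" "C \<subseteq> Z \<inter> \<Omega>" "C \<noteq> {}"
  shows "\<exists>G G'. (\<forall>w\<in>B \<inter> coord_plane K. G w \<in> Z \<inter> \<Omega> \<and> q (G w) = w) \<and> (\<forall>c\<in>C. G (q c) = c) \<and>
    (\<forall>w. coord_proj K w \<in> B --> ((\<lambda>w. G (coord_proj K w)) has_derivative G' w) (at w)) \<and>
    (\<forall>v. continuous_on {w. coord_proj K w \<in> B} (\<lambda>w. G' w v))"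
proof -
  let ?H = "B \<inter> coord_plane K" and ?p = "coord_proj K"
  have qH: "q ` (Z \<inter> \<Omega>) \<subseteq> ?H" using q(3) B(3) by blast
  have chart: "\<exists>N W h h'. open N \<and> a \<in> N \<and> N \<subseteq> \<Omega> \<and> open W \<and> homeomorphism (N \<inter> Z) (W \<inter> coord_plane K) q h \<and>
    h ` W \<subseteq> N \<and> (\<forall>w\<in>W. (h has_derivative h' w) (at w)) \<and> (\<forall>v. continuous_on W (\<lambda>w. h' w v))"
    if a: "a \<in> Z \<inter> \<Omega>" for a
    by (rule local_graph_chart[OF Z _ K \<Omega> _ q]) (use a inj in auto)
  have loc: "\<exists>N M h. a \<in> N \<and> openin (top_of_set (Z \<inter> \<Omega>)) N \<and> openin (top_of_set ?H) M \<and> homeomorphism N M q h"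
    if a: "a \<in> Z \<inter> \<Omega>" for a
  proof -
    obtain N W h where N: "open N" "a \<in> N" "N \<subseteq> \<Omega>" "open W" "homeomorphism (N \<inter> Z) (W \<inter> coord_plane K) q h"
      using chart[OF a] by blast
    have "W \<inter> coord_plane K = q ` (N \<inter> Z)" using N(5) by (simp add: homeomorphism_def)
    then have "W \<inter> coord_plane K = ?H \<inter> W" using qH N(3) by blast
    then have "openin (top_of_set ?H) (W \<inter> coord_plane K)" using N(4) by (simp add: openin_open_Int)
    moreover have "N \<inter> Z = (Z \<inter> \<Omega>) \<inter> N" using N(3) by blast
    then have "openin (top_of_set (Z \<inter> \<Omega>)) (N \<inter> Z)" using N(1) by (simp add: openin_open_Int)
    ultimately show ?thesis using N(2,5) a by blast
  qed
  have contq: "continuous_on (Z \<inter> \<Omega>) q"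
    by (rule continuous_at_imp_continuous_on) (use q(1) in \<open>blast intro: has_derivative_continuous\<close>)
  have convH: "convex ?H" by (intro convex_Int B(2) subspace_imp_convex subspace_coord_plane)
  obtain G where G: "continuous_on ?H G" "G ` ?H \<subseteq> Z \<inter> \<Omega>" "\<And>w. w \<in> ?H ==> q (G w) = w" "\<And>c. c \<in> C ==> G (q c) = c"
    using proper_local_homeomorphism_section[OF contq qH convH loc proper C] by blast
  have "open (?p -` B)"
    by (rule continuous_open_vimage[OF B(1)]) (rule linear_continuous_at, rule bounded_linear_coord_proj)
  then have oB: "open {w. ?p w \<in> B}" by (simp add: vimage_def)
  have local: "\<exists>P D. open P \<and> w \<in> P \<and> P \<subseteq> {w. ?p w \<in> B} \<and>
      (\<forall>x\<in>P. ((\<lambda>w. G (?p w)) has_derivative D x) (at x)) \<and> (\<forall>v. continuous_on P (\<lambda>x. D x v))"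
    if w: "?p w \<in> B" for w
  proof -
    have wH: "?p w \<in> ?H" using w by simp
    then have a: "G (?p w) \<in> Z \<inter> \<Omega>" using G(2) by blast
    obtain N W h h' where N: "open N" "G (?p w) \<in> N" "N \<subseteq> \<Omega>" "open W"
      "homeomorphism (N \<inter> Z) (W \<inter> coord_plane K) q h"
      and h': "\<forall>w\<in>W. (h has_derivative h' w) (at w)" "\<forall>v. continuous_on W (\<lambda>w. h' w v)"
      using chart[OF a] by blast
    have "openin (top_of_set ?H) (?H \<inter> G -` N)" using continuous_openin_preimage_gen[OF G(1) N(1)] .
    then obtain Q where Q: "open Q" "?H \<inter> G -` N = ?H \<inter> Q" by (auto simp: openin_open)
    define P where "P = {w. ?p w \<in> B} \<inter> ?p -` Q"
    have "open (?p -` Q)"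
      by (rule continuous_open_vimage[OF Q(1)]) (rule linear_continuous_at, rule bounded_linear_coord_proj)
    then have oP: "open P" using oB by (auto simp: P_def)
    have "?p w \<in> ?H \<inter> G -` N" using wH N(2) by simp
    then have "?p w \<in> Q" unfolding Q(2) by simp
    then have wP: "w \<in> P" using w by (simp add: P_def)
    have PW: "?p x \<in> W" "G (?p x) = h (?p x)" if "x \<in> P" for x
    proof -
      have xH: "?p x \<in> ?H" and "?p x \<in> ?H \<inter> Q" using that by (simp_all add: P_def)
      then have "?p x \<in> ?H \<inter> G -` N" unfolding Q(2) by simp
      then have "G (?p x) \<in> N \<inter> Z" using G(2) by blast
      then have "q (G (?p x)) \<in> W \<inter> coord_plane K" "h (q (G (?p x))) = G (?p x)"
        using N(5) by (auto simp: homeomorphism_def)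
      then show "?p x \<in> W" "G (?p x) = h (?p x)" using G(3)[OF xH] by auto
    qed
    have d: "((\<lambda>w. G (?p w)) has_derivative (\<lambda>v. h' (?p x) (?p v))) (at x)" if x: "x \<in> P" for x
    proof -
      have "(?p has_derivative ?p) (at x)" by (rule bounded_linear_imp_has_derivative[OF bounded_linear_coord_proj])
      moreover have "(h has_derivative h' (?p x)) (at (?p x))" using h'(1) PW(1)[OF x] by blast
      ultimately have "((\<lambda>x. h (?p x)) has_derivative (\<lambda>v. h' (?p x) (?p v))) (at x)"
        by (rule has_derivative_compose)
      then show ?thesis
        by (rule has_derivative_transform_within_open[OF _ oP x]) (simp add: PW(2))
    qed
    have "continuous_on P (\<lambda>x. h' (?p x) (?p v))" for v
      by (rule continuous_on_compose2[of W "\<lambda>y. h' y (?p v)"])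
         (use h'(2) PW(1) in \<open>auto intro: linear_continuous_on bounded_linear_coord_proj\<close>)
    then show ?thesis using oP wP d by (intro exI[of _ P] exI[of _ "\<lambda>x v. h' (?p x) (?p v)"]) (auto simp: P_def)
  qed
  define G' where "G' w = frechet_derivative (\<lambda>w. G (?p w)) (at w)" for w
  have d: "((\<lambda>w. G (?p w)) has_derivative G' w) (at w)" if w: "?p w \<in> B" for w
  proof -
    obtain D where "((\<lambda>w. G (?p w)) has_derivative D w) (at w)" using local[OF w] by blast
    then show ?thesis unfolding G'_def using frechet_derivative_at by metis
  qed
  have "continuous_on {w. ?p w \<in> B} (\<lambda>w. G' w v)" for v
  proof (rule continuous_at_imp_continuous_on, intro ballI)
    fix w assume "w \<in> {w. ?p w \<in> B}"
    then have "?p w \<in> B" by simp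
    from local[OF this] obtain P D where P: "open P" "w \<in> P" "P \<subseteq> {w. ?p w \<in> B}"
      "\<forall>x\<in>P. ((\<lambda>w. G (?p w)) has_derivative D x) (at x)" "\<forall>v. continuous_on P (\<lambda>x. D x v)" by blast
    have "G' x v = D x v" if x: "x \<in> P" for x
    proof -
      have "?p x \<in> B" using P(3) x by blast
      from has_derivative_unique[OF d[OF this] bspec[OF P(4) x]] show ?thesis by simp
    qed
    then have "continuous_on P (\<lambda>x. G' x v) \<longleftrightarrow> continuous_on P (\<lambda>x. D x v)" by (intro continuous_on_cong) auto
    then have "continuous_on P (\<lambda>x. G' x v)" using P(5) by blast
    then show "isCont (\<lambda>x. G' x v) w" using P(1,2) by (simp add: continuous_on_eq_continuous_at)
  qed
  then show ?thesis using G d by (intro exI[of _ G] exI[of _ G']) blast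
qed

section \<open>Graphs of linear maps\<close>

lemma subspace_graph_coords:
  fixes F :: "(real ^ 'n) set" and p \<Lambda> :: "real ^ 'n \<Rightarrow> real ^ 'n"
  assumes F: "subspace F" "dim F = card K" and \<Lambda>: "linear \<Lambda>" "\<Lambda> ` coord_plane K \<subseteq> F"
    and p: "\<And>c. c \<in> coord_plane K ==> norm (p (\<Lambda> c) - c) \<le> norm c / 2" and m: "m \<in> F"
  shows "\<exists>c\<in>coord_plane K. m = \<Lambda> c \<and> norm c \<le> 2 * norm (p m)"
proof -
  have bound: "norm c \<le> 2 * norm (p (\<Lambda> c))" if "c \<in> coord_plane K" for c
    using p[OF that] norm_triangle_ineq3[of "p (\<Lambda> c)" c] by linarith
  have inj: "inj_on \<Lambda> (coord_plane K)"
  proof (rule inj_onI)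
    fix x y assume xy: "x \<in> coord_plane K" "y \<in> coord_plane K" "\<Lambda> x = \<Lambda> y"
    have mem: "x - y \<in> coord_plane K" "0 \<in> coord_plane K"
      using xy subspace_coord_plane subspace_diff subspace_0 by blast+
    have "\<Lambda> (x - y) = 0" "\<Lambda> 0 = 0" using xy(3) \<Lambda>(1) by (simp_all add: linear_diff linear_0)
    then have "norm (p 0 - (x - y)) \<le> norm (x - y) / 2" "p 0 = 0" using p[OF mem(1)] p[OF mem(2)] by auto
    then show "x = y" using norm_ge_zero[of "x - y"] by (simp add: norm_minus_commute)
  qed
  have "inj_on \<Lambda> (span (coord_plane K))" unfolding span_eq_iff[THEN iffD2, OF subspace_coord_plane] by (rule inj)
  from dim_image_eq[OF \<Lambda>(1) this] have "dim (\<Lambda> ` coord_plane K) = dim F" using F(2) dim_coord_plane[of K] by simp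
  then have "\<Lambda> ` coord_plane K = F"
    by (intro subspace_dim_equal linear_subspace_image \<Lambda> subspace_coord_plane F(1)) simp
  then show ?thesis using m bound by blast
qed

lemma sum_coords_near:
  fixes u v :: "'n::finite \<Rightarrow> real ^ 'n" and \<epsilon> :: real
  assumes "\<And>i. i \<in> K ==> norm (v i - u i) \<le> \<epsilon>" "0 \<le> \<epsilon>"
  shows "norm ((\<Sum>i\<in>K. c $ i *\<^sub>R v i) - (\<Sum>i\<in>K. c $ i *\<^sub>R u i)) \<le> CARD('n) * \<epsilon> * norm c"
proof -
  have "norm ((\<Sum>i\<in>K. c $ i *\<^sub>R v i) - (\<Sum>i\<in>K. c $ i *\<^sub>R u i)) = norm (\<Sum>i\<in>K. c $ i *\<^sub>R (v i - u i))"
    by (simp add: sum_subtractf scaleR_diff_right)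
  also have "\<dots> \<le> (\<Sum>i\<in>K. norm c * \<epsilon>)"
    by (rule sum_norm_le) (auto intro!: mult_mono assms component_le_norm_cart)
  also have "\<dots> = card K * (norm c * \<epsilon>)" by simp
  also have "\<dots> \<le> CARD('n) * (norm c * \<epsilon>)"
    using assms(2) by (intro mult_right_mono) (auto intro: card_mono)
  finally show ?thesis by (simp add: mult_ac)
qed

section \<open>Integrals of possibly non-measurable functions\<close>

text \<open>The integral of a non-measurable function is the supremum over the measurable functions below it,
  so a measurable minorant with almost the same integral controls all other measurable minorants.\<close>

lemma nn_integral_minorants_small:
  fixes R :: "real \<Rightarrow> ennreal"
  assumes R: "(\<integral>\<^sup>+ t \<in> {0..e}. R t \<partial>lborel) < \<infinity>" and "e > 0" "\<eta> > 0"
  shows "\<exists>\<tau>0. 0 < \<tau>0 \<and> \<tau>0 \<le> e \<and> (\<forall>h. h \<in> borel_measurable lborel -->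
    (\<forall>t. h t \<le> R t * indicator {0..\<tau>0} t) --> (\<integral>\<^sup>+ t. h t \<partial>lborel) \<le> ennreal \<eta>)"
proof -
  let ?f = "\<lambda>t. R t * indicator {0..e} t"
  let ?I = "\<integral>\<^sup>+ t. ?f t \<partial>lborel"
  have fin: "?I \<noteq> \<infinity>" using R by simp
  have "\<exists>g. g \<in> borel_measurable lborel \<and> (\<forall>t. g t \<le> ?f t) \<and> ?I \<le> (\<integral>\<^sup>+ t. g t \<partial>lborel) + ennreal (\<eta>/2)"
  proof (cases "?I \<le> ennreal (\<eta>/2)")
    case True
    then show ?thesis by (intro exI[of _ "\<lambda>_. 0"]) simp
  next
    case False
    then have le: "ennreal (\<eta>/2) \<le> ?I" using linear[of ?I "ennreal (\<eta>/2)"] by blast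
    from False have "?I - ennreal (\<eta>/2) < ?I"
      using R \<open>\<eta> > 0\<close> by (intro ennreal_between) (auto simp: top_unique not_le intro: order_le_less_trans[OF zero_le])
    then obtain g where g: "simple_function lborel g" "g \<le> ?f" "?I - ennreal (\<eta>/2) < integral\<^sup>S lborel g"
      unfolding nn_integral_def[of lborel ?f] less_SUP_iff by blast
    have "?I \<le> (?I - ennreal (\<eta>/2)) + ennreal (\<eta>/2)" using le by (simp add: diff_add_self_ennreal)
    also have "\<dots> \<le> (\<integral>\<^sup>+ t. g t \<partial>lborel) + ennreal (\<eta>/2)"
      using g(3) nn_integral_eq_simple_integral[OF g(1)] by (intro add_right_mono) simp
    finally have 1: "?I \<le> (\<integral>\<^sup>+ t. g t \<partial>lborel) + ennreal (\<eta>/2)" .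
    have "g \<in> borel_measurable lborel" by (rule borel_measurable_simple_function[OF g(1)])
    then show ?thesis using g(2) 1 unfolding le_fun_def by blast
  qed
  then obtain g where g: "g \<in> borel_measurable lborel" "\<And>t. g t \<le> ?f t"
    "?I \<le> (\<integral>\<^sup>+ t. g t \<partial>lborel) + ennreal (\<eta>/2)" by blast
  have gfin: "(\<integral>\<^sup>+ t. g t \<partial>lborel) < \<infinity>"
    using nn_integral_mono[of lborel g ?f] g(2) R by (metis order_le_less_trans)
  let ?gn = "\<lambda>n t. g t * indicator {0..e / real (Suc n)} t"
  have dec: "decseq ?gn"
  proof (rule decseq_SucI, rule le_funI)
    fix n t
    have "e / real (Suc (Suc n)) \<le> e / real (Suc n)" using \<open>e > 0\<close> by (intro divide_left_mono) auto
    then show "?gn (Suc n) t \<le> ?gn n t" by (auto split: split_indicator)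
  qed
  have inf0: "(INF n. ?gn n t) = g t * indicator {0} t" for t
  proof (cases "t = 0")
    case True
    then show ?thesis using \<open>e > 0\<close> by simp
  next
    case False
    have "\<exists>n. t \<notin> {0..e / real (Suc n)}"
    proof (cases "t > 0")
      case True
      then obtain n where "e / t < real (Suc n)" using reals_Archimedean2[of "e / t"] by (meson lessI less_trans of_nat_less_iff)
      then show ?thesis using True by (intro exI[of _ n]) (simp add: field_simps)
    qed (use False in auto)
    then obtain n where n: "t \<notin> {0..e / real (Suc n)}" by blast
    have gn: "?gn n t = 0" by (simp only: indicator_simps(2)[OF n] mult_zero_right)
    have "(INF n. ?gn n t) \<le> ?gn n t" by (rule INF_lower) simp
    then have "(INF n. ?gn n t) \<le> 0" unfolding gn .
    then show ?thesis using False by simp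
  qed
  have "(INF n. \<integral>\<^sup>+ t. ?gn n t \<partial>lborel) = (\<integral>\<^sup>+ t. (INF n. ?gn n t) \<partial>lborel)"
  proof (rule nn_integral_monotone_convergence_INF_decseq[symmetric, OF dec])
    show "?gn i \<in> borel_measurable lborel" for i using g(1) by measurable
    have "(\<integral>\<^sup>+ t. ?gn 0 t \<partial>lborel) \<le> (\<integral>\<^sup>+ t. g t \<partial>lborel)"
      by (rule nn_integral_mono) (auto split: split_indicator)
    then show "(\<integral>\<^sup>+ t. ?gn 0 t \<partial>lborel) < \<infinity>" using gfin by (rule order_le_less_trans)
  qed
  also have "\<dots> = (\<integral>\<^sup>+ t. g t * indicator {0} t \<partial>lborel)" unfolding inf0 ..
  also have "\<dots> = 0"
    by (subst nn_integral_0_iff_AE) (use g(1) AE_lborel_singleton[of 0] in \<open>auto elim: eventually_mono simp: indicator_def\<close>)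
  finally have "(INF n. \<integral>\<^sup>+ t. ?gn n t \<partial>lborel) < ennreal (\<eta>/2)" using \<open>\<eta> > 0\<close> by simp
  then obtain n where n: "(\<integral>\<^sup>+ t. ?gn n t \<partial>lborel) < ennreal (\<eta>/2)" unfolding INF_less_iff by blast
  define \<tau>0 where "\<tau>0 = e / real (Suc n)"
  have \<tau>0: "0 < \<tau>0" "\<tau>0 \<le> e" using \<open>e > 0\<close> by (auto simp: \<tau>0_def divide_le_eq)
  have "(\<integral>\<^sup>+ t. h t \<partial>lborel) \<le> ennreal \<eta>"
    if h: "h \<in> borel_measurable lborel" "\<forall>t. h t \<le> R t * indicator {0..\<tau>0} t" for h
  proof -
    let ?d = "\<lambda>t. max (g t) (h t) - g t"
    have m: "?d \<in> borel_measurable lborel" using g(1) h(1) by measurable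
    have hf: "h t \<le> ?f t" for t
    proof -
      have "R t * indicator {0..\<tau>0} t \<le> ?f t" using \<tau>0(2) by (auto split: split_indicator)
      then show ?thesis using h(2) order_trans by blast
    qed
    have eq: "g t + ?d t = max (g t) (h t)" for t by (simp add: add_diff_self_ennreal)
    have "(\<integral>\<^sup>+ t. g t \<partial>lborel) + (\<integral>\<^sup>+ t. ?d t \<partial>lborel) = (\<integral>\<^sup>+ t. g t + ?d t \<partial>lborel)"
      by (rule nn_integral_add[symmetric]) (use g(1) m in auto)
    also have "\<dots> = (\<integral>\<^sup>+ t. max (g t) (h t) \<partial>lborel)" by (simp only: eq)
    also have "\<dots> \<le> ?I" by (rule nn_integral_mono) (use g(2) hf in simp)
    also have "\<dots> \<le> (\<integral>\<^sup>+ t. g t \<partial>lborel) + ennreal (\<eta>/2)" by (rule g(3))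
    finally have d: "(\<integral>\<^sup>+ t. ?d t \<partial>lborel) \<le> ennreal (\<eta>/2)"
      using gfin by (auto simp: ennreal_add_left_cancel_le)
    have "h t \<le> ?gn n t + ?d t" for t
    proof (cases "t \<in> {0..\<tau>0}")
      case True
      then have ind: "t \<in> {0..e / real (Suc n)}" unfolding \<tau>0_def .
      have "?gn n t + ?d t = max (g t) (h t)" by (simp only: indicator_simps(1)[OF ind] mult_1_right eq)
      then show ?thesis by simp
    next
      case False
      then have "h t = 0" using h(2)[rule_format, of t] by simp
      then show ?thesis by simp
    qed
    then have "(\<integral>\<^sup>+ t. h t \<partial>lborel) \<le> (\<integral>\<^sup>+ t. ?gn n t + ?d t \<partial>lborel)" by (intro nn_integral_mono)
    also have "\<dots> = (\<integral>\<^sup>+ t. ?gn n t \<partial>lborel) + (\<integral>\<^sup>+ t. ?d t \<partial>lborel)"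
      by (rule nn_integral_add) (use g(1) m in auto)
    also have "\<dots> \<le> ennreal (\<eta>/2) + ennreal (\<eta>/2)" using n d by (intro add_mono) auto
    also have "\<dots> = ennreal \<eta>" using \<open>\<eta> > 0\<close> ennreal_plus[of "\<eta>/2" "\<eta>/2"] by simp
    finally show ?thesis .
  qed
  then show ?thesis using \<tau>0 by blast
qed

lemma increment_small_of_speed_le:
  fixes R :: "real \<Rightarrow> ennreal"
  assumes R: "(\<integral>\<^sup>+ t \<in> {0..e}. R t \<partial>lborel) < \<infinity>" and "e > 0" "\<eta> > 0"
  shows "\<exists>\<tau>0>0. \<forall>\<tau> \<kappa>. \<forall>(h :: real \<Rightarrow> 'a::euclidean_space) h'. 0 \<le> \<tau> --> \<tau> \<le> \<tau>0 --> \<kappa> > 0 -->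
    (\<forall>t\<in>{0..\<tau>}. (h has_vector_derivative h' t) (at t within {0..\<tau>})) --> continuous_on {0..\<tau>} h' -->
    (\<forall>t\<in>{0..\<tau>}. ennreal (norm (h' t) / \<kappa>) \<le> R t) --> norm (h \<tau> - h 0) \<le> \<kappa> * \<eta>"
proof -
  obtain \<tau>0 where \<tau>0: "0 < \<tau>0" and small: "\<And>h. h \<in> borel_measurable lborel ==>
    (\<forall>t. h t \<le> R t * indicator {0..\<tau>0} t) ==> (\<integral>\<^sup>+ t. h t \<partial>lborel) \<le> ennreal \<eta>"
    using nn_integral_minorants_small[OF assms] by blast
  have key: "norm (h \<tau> - h 0) \<le> \<kappa> * \<eta>"
    if \<tau>: "0 \<le> \<tau>" "\<tau> \<le> \<tau>0" and \<kappa>: "\<kappa> > 0" and h: "\<And>t. t \<in> {0..\<tau>} ==> (h has_vector_derivative h' t) (at t within {0..\<tau>})"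
      and c: "continuous_on {0..\<tau>} h'" and le: "\<And>t. t \<in> {0..\<tau>} ==> ennreal (norm (h' t) / \<kappa>) \<le> R t"
    for \<tau> \<kappa> and h h' :: "real \<Rightarrow> 'a"
  proof -
    let ?i = "\<lambda>t. indicator {0..\<tau>} t *\<^sub>R h' t"
    have int: "integrable lborel ?i" by (rule borel_integrable_compact[OF compact_Icc c])
    have m: "(\<lambda>t. ennreal (norm (?i t) / \<kappa>)) \<in> borel_measurable lborel"
      using borel_measurable_integrable[OF int] by measurable
    have "(\<integral>\<^sup>+ t. ennreal (norm (?i t) / \<kappa>) \<partial>lborel) \<le> ennreal \<eta>"
    proof (rule small[OF m], intro allI)
      fix t show "ennreal (norm (?i t) / \<kappa>) \<le> R t * indicator {0..\<tau>0} t"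
        using le[of t] \<tau>(2) by (auto split: split_indicator)
    qed
    moreover have "(\<integral>\<^sup>+ t. ennreal (norm (?i t)) \<partial>lborel) = ennreal \<kappa> * (\<integral>\<^sup>+ t. ennreal (norm (?i t) / \<kappa>) \<partial>lborel)"
      using \<kappa> m by (subst nn_integral_cmult[symmetric]) (auto simp: ennreal_mult'[symmetric] intro!: nn_integral_cong)
    ultimately have "(\<integral>\<^sup>+ t. ennreal (norm (?i t)) \<partial>lborel) \<le> ennreal \<kappa> * ennreal \<eta>"
      by (simp add: mult_left_mono)
    moreover have "h \<tau> - h 0 = (\<integral>t. ?i t \<partial>lborel)" using integral_FTC_Icc[OF \<tau>(1) h c] by simp
    ultimately have le: "(\<integral>\<^sup>+ t. ennreal (norm (?i t)) \<partial>lborel) \<le> ennreal \<kappa> * ennreal \<eta>"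
      and eq: "h \<tau> - h 0 = (\<integral>t. ?i t \<partial>lborel)" by blast+
    have "ennreal (norm (h \<tau> - h 0)) \<le> (\<integral>\<^sup>+ t. ennreal (norm (?i t)) \<partial>lborel)"
      unfolding eq by (rule integral_norm_bound_ennreal[OF int])
    also note le
    also have "ennreal \<kappa> * ennreal \<eta> = ennreal (\<kappa> * \<eta>)" using \<kappa> by (simp add: ennreal_mult'[symmetric])
    finally show ?thesis by (rule ennreal_le_iff[THEN iffD1, rotated]) (use \<kappa> \<open>\<eta> > 0\<close> in simp)
  qed
  show ?thesis
  proof (intro exI[of _ \<tau>0] conjI \<tau>0 allI impI)
    fix \<tau> \<kappa> and h h' :: "real \<Rightarrow> 'a"
    assume "0 \<le> \<tau>" "\<tau> \<le> \<tau>0" "\<kappa> > 0" "\<forall>t\<in>{0..\<tau>}. (h has_vector_derivative h' t) (at t within {0..\<tau>})"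
      "continuous_on {0..\<tau>} h'" "\<forall>t\<in>{0..\<tau>}. ennreal (norm (h' t) / \<kappa>) \<le> R t"
    then show "norm (h \<tau> - h 0) \<le> \<kappa> * \<eta>" by (intro key[of \<tau> \<kappa> h h']) blast+
  qed
qed

section \<open>Composition of charts\<close>

lemma C_1_continuous_on: "C_k_on 1 f U ==> continuous_on U f"
  using C_k_on_le[of 0 1 f U] by simp

lemma C_1_on_subset: "C_k_on 1 f U ==> U' \<subseteq> U ==> C_k_on 1 f U'"
  unfolding C_1_on_iff using continuous_on_subset by blast

lemma C_1_on_compose:
  fixes f :: "'a::euclidean_space \<Rightarrow> 'b::euclidean_space" and h :: "'b \<Rightarrow> 'c::real_normed_vector"
  assumes f: "C_k_on 1 f U" and h: "C_k_on 1 h V" and UV: "f ` U \<subseteq> V"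
  shows "C_k_on 1 (h \<circ> f) U"
proof (rule C_1_onI)
  fix x assume x: "x \<in> U"
  then have fx: "f x \<in> V" using UV by blast
  show "((h \<circ> f) has_derivative (frechet_derivative h (at (f x)) \<circ> frechet_derivative f (at x))) (at x)"
    by (rule diff_chain_at[OF C_1_has_derivative[OF f x] C_1_has_derivative[OF h fx]])
next
  fix v
  have "continuous_on U (\<lambda>x. frechet_derivative f (at x) v)" using f unfolding C_1_on_iff by blast
  then have "continuous_on U (\<lambda>x. frechet_derivative h (at (f x)) (frechet_derivative f (at x) v))"
    by (rule continuous_on_frechet_apply[OF h C_1_continuous_on[OF f]]) (use UV in blast)
  then show "continuous_on U (\<lambda>x. (frechet_derivative h (at (f x)) \<circ> frechet_derivative f (at x)) v)"
    by (simp add: o_def)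
qed

lemma C_k_diffeo_sym: "C_k_diffeo k U V f g ==> C_k_diffeo k V U g f"
  unfolding C_k_diffeo_def using homeomorphism_symD[of U V f g] by simp

lemma C_k_diffeo_le: "C_k_diffeo k U V f g ==> j \<le> k ==> C_k_diffeo j U V f g"
  unfolding C_k_diffeo_def using C_k_on_le[of j k f U] C_k_on_le[of j k g V] by simp

lemma C_1_diffeo_compose:
  fixes f :: "'a::euclidean_space \<Rightarrow> 'b::euclidean_space" and \<phi> :: "'b \<Rightarrow> 'c::euclidean_space"
  assumes f: "C_k_diffeo 1 U V f g" and \<phi>: "C_k_diffeo 1 U' V' \<phi> \<psi>"
  shows "C_k_diffeo 1 (U \<inter> f -` U') (V' \<inter> \<psi> -` V) (\<phi> \<circ> f) (g \<circ> \<psi>)"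
proof -
  have o: "open U" "open V" "open U'" "open V'" using f \<phi> by (auto simp: C_k_diffeo_def)
  have h: "homeomorphism U V f g" "homeomorphism U' V' \<phi> \<psi>" using f \<phi> by (auto simp: C_k_diffeo_def)
  have c: "continuous_on U f" "continuous_on V' \<psi>" using h by (auto simp: homeomorphism_def)
  have C: "C_k_on 1 f U" "C_k_on 1 g V" "C_k_on 1 \<phi> U'" "C_k_on 1 \<psi> V'" using f \<phi> by (auto simp: C_k_diffeo_def)
  have m: "\<And>x. x \<in> U ==> f x \<in> V" "\<And>x. x \<in> U ==> g (f x) = x" "\<And>x. x \<in> V ==> g x \<in> U" "\<And>x. x \<in> V ==> f (g x) = x"
    "\<And>x. x \<in> U' ==> \<phi> x \<in> V'" "\<And>x. x \<in> U' ==> \<psi> (\<phi> x) = x" "\<And>x. x \<in> V' ==> \<psi> x \<in> U'" "\<And>x. x \<in> V' ==> \<phi> (\<psi> x) = x"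
    using h by (auto simp: homeomorphism_def)
  have 1: "C_k_on 1 (\<phi> \<circ> f) (U \<inter> f -` U')"
    by (rule C_1_on_compose[OF C_1_on_subset[OF C(1)] C(3)]) auto
  have 2: "C_k_on 1 (g \<circ> \<psi>) (V' \<inter> \<psi> -` V)"
    by (rule C_1_on_compose[OF C_1_on_subset[OF C(4)] C(2)]) auto
  have "homeomorphism (U \<inter> f -` U') (V' \<inter> \<psi> -` V) (\<phi> \<circ> f) (g \<circ> \<psi>)"
    by (rule homeomorphismI[OF C_1_continuous_on[OF 1] C_1_continuous_on[OF 2]]) (auto simp: m)
  then show ?thesis unfolding C_k_diffeo_def using 1 2
      continuous_open_preimage[OF c(1) o(1) o(3)] continuous_open_preimage[OF c(2) o(4) o(2)] by blast
qed

lemma submanifold_le: "submanifold k d M ==> j \<le> k ==> submanifold j d M"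
  unfolding submanifold_def flattens_def using C_k_diffeo_le by meson

lemma submanifold_image:
  fixes f :: "real ^ 'n \<Rightarrow> real ^ 'n"
  assumes M: "submanifold 1 m M" and f: "C_k_diffeo 1 U V f g"
  shows "submanifold 1 m (f ` (U \<inter> M))"
  unfolding submanifold_def
proof
  fix p assume "p \<in> f ` (U \<inter> M)"
  then obtain y where y: "y \<in> U" "y \<in> M" "p = f y" by blast
  obtain J U' V' \<phi> \<psi> where J: "card J = m" "y \<in> U'" and fl: "flattens 1 M (coord_plane J) U' V' \<phi> \<psi>"
    using M y(2) unfolding submanifold_def by blast
  have m: "\<And>x. x \<in> U ==> f x \<in> V" "\<And>x. x \<in> U ==> g (f x) = x"
    using f unfolding C_k_diffeo_def homeomorphism_def by auto
  have d: "C_k_diffeo 1 (V \<inter> g -` U') (V' \<inter> \<psi> -` U) (\<phi> \<circ> g) (f \<circ> \<psi>)"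
    by (rule C_1_diffeo_compose[OF C_k_diffeo_sym[OF f]]) (use fl in \<open>simp add: flattens_def\<close>)
  have "(\<phi> \<circ> g) ` (V \<inter> g -` U' \<inter> f ` (U \<inter> M)) = V' \<inter> \<psi> -` U \<inter> coord_plane J"
  proof (intro equalityI subsetI)
    fix c assume "c \<in> (\<phi> \<circ> g) ` (V \<inter> g -` U' \<inter> f ` (U \<inter> M))"
    then obtain x where x: "x \<in> U" "x \<in> M" "x \<in> U'" "c = \<phi> x" using m by auto
    then show "c \<in> V' \<inter> \<psi> -` U \<inter> coord_plane J" using flattens_memD[OF fl x(3)] by simp
  next
    fix c assume "c \<in> V' \<inter> \<psi> -` U \<inter> coord_plane J"
    then have c: "c \<in> V'" "\<psi> c \<in> U" "c \<in> coord_plane J" by auto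
    have "\<psi> c \<in> M" "\<psi> c \<in> U'" "\<phi> (\<psi> c) = c" using flattens_inverse[OF fl c(1)] c(3) by auto
    then show "c \<in> (\<phi> \<circ> g) ` (V \<inter> g -` U' \<inter> f ` (U \<inter> M))"
      using c m by (intro image_eqI[of _ _ "f (\<psi> c)"]) auto
  qed
  then have "flattens 1 (f ` (U \<inter> M)) (coord_plane J) (V \<inter> g -` U') (V' \<inter> \<psi> -` U) (\<phi> \<circ> g) (f \<circ> \<psi>)"
    using d by (simp add: flattens_def)
  moreover have "p \<in> V \<inter> g -` U'" using y J(2) m by simp
  ultimately show "\<exists>J U1 V1 f1 g1. card J = m \<and> p \<in> U1 \<and> flattens 1 (f ` (U \<inter> M)) (coord_plane J) U1 V1 f1 g1"
    using J(1) by blast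
qed

section \<open>The large stratum in a chart\<close>

context wing_chart
begin

lemma g_0: "g 0 = x0" using fg(2)[OF x0(2)] x0(3) by simp

lemma Z_preimage:
  assumes "a \<in> Z" shows "g a \<in> U" "g a \<in> Y" "f (g a) = a" "a \<in> V"
  using assms fg by auto

lemma g_near: "norm a \<le> r ==> norm (g a - x0) \<le> L * norm a"
  using g_lipschitz[of a 0] r(1) g_0 by simp

lemma subspace_TZ: "a \<in> Z ==> subspace (T a)" and dim_TZ: "a \<in> Z ==> dim (T a) = d + 1"
  using subspace_T by blast+

lemma Z_off_plane: "a \<in> Z ==> a \<notin> E"
  using f_plane disjoint by blast

lemma Z_height: assumes "a \<in> Z" shows "a - \<pi> a \<noteq> 0"
proof
  assume "a - \<pi> a = 0"
  then have "\<pi> a = a" by simp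
  then show False using Z_off_plane[OF assms] coord_proj_in[of I a] by simp
qed

lemma Z_near:
  assumes "\<epsilon> > 0"
  shows "\<exists>\<delta>>0. \<delta> \<le> r \<and> (\<forall>a\<in>Z. norm a < \<delta> --> gap E (T a) \<le> \<epsilon> \<and>
    (\<exists>w\<in>T a. norm (a - \<pi> a - w) \<le> \<epsilon> * norm (a - \<pi> a)))"
proof -
  obtain \<delta>1 where \<delta>1: "\<delta>1 > 0" "\<And>y. y \<in> Y ==> norm (y - x0) < \<delta>1 ==> G y \<le> \<epsilon>" using gap_tendsto_0[OF assms] by blast
  obtain \<delta>2 where \<delta>2: "\<delta>2 > 0" "\<And>y. y \<in> Y ==> norm (y - x0) < \<delta>2 ==>
    \<exists>w\<in>T (f y). norm (f y - \<pi> (f y) - w) \<le> \<epsilon> * norm (f y - \<pi> (f y))" using secant_near_T[OF assms] by blast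
  define \<delta> where "\<delta> = min r (min \<delta>1 \<delta>2 / L)"
  have "\<delta> > 0" "\<delta> \<le> r" using r(1) \<delta>1(1) \<delta>2(1) L by (auto simp: \<delta>_def)
  moreover have "gap E (T a) \<le> \<epsilon> \<and> (\<exists>w\<in>T a. norm (a - \<pi> a - w) \<le> \<epsilon> * norm (a - \<pi> a))"
    if a: "a \<in> Z" "norm a < \<delta>" for a
  proof -
    have "norm a \<le> r" "norm a < min \<delta>1 \<delta>2 / L" using a(2) by (auto simp: \<delta>_def)
    then have "L * norm a < min \<delta>1 \<delta>2" using L by (simp add: field_simps)
    then have "norm (g a - x0) < \<delta>1" "norm (g a - x0) < \<delta>2" using g_near[OF \<open>norm a \<le> r\<close>] by auto
    from \<delta>1(2)[OF Z_preimage(2)[OF a(1)] this(1)] \<delta>2(2)[OF Z_preimage(2)[OF a(1)] this(2)]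
    show ?thesis unfolding Z_preimage(3)[OF a(1)] by blast
  qed
  ultimately show ?thesis by blast
qed

lemma g_continuous: "continuous_on V g"
  using diffeo by (simp add: C_k_diffeo_def homeomorphism_def)

lemma f_continuous: "continuous_on U f"
  using diffeo by (simp add: C_k_diffeo_def homeomorphism_def)

lemma closure_Z:
  assumes a: "a \<in> closure Z" "norm a \<le> r / L" "a \<notin> E" shows "a \<in> Z"
proof -
  have "r * 1 \<le> r * L" using r(1) L by (intro mult_left_mono) auto
  then have "r / L \<le> r" using L by (simp add: divide_le_eq)
  then have ar: "norm a \<le> r" using a(2) by linarith
  then have aV: "a \<in> V" using r(3) by auto
  obtain b where b: "\<And>n. b n \<in> Z" "b \<longlonglongrightarrow> a" using a(1) unfolding closure_sequential by blast
  have "isCont g a" using g_continuous opens(2) aV by (simp add: continuous_on_eq_continuous_at)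
  then have "(\<lambda>n. g (b n)) \<longlonglongrightarrow> g a" using b(2) by (rule isCont_tendsto_compose)
  then have "g a \<in> closure Y" unfolding closure_sequential
    using Z_preimage(2)[OF b(1)] by (intro exI[of _ "\<lambda>n. g (b n)"]) auto
  moreover have "norm (g a - x0) \<le> r"
  proof -
    have "L * norm a \<le> r" using a(2) L by (simp add: field_simps)
    then show ?thesis using g_near[OF ar] by linarith
  qed
  ultimately have "g a \<in> X \<union> Y" by (rule near_closure)
  then have "g a \<in> Y" using g_plane[OF aV] a(3) by blast
  then show ?thesis using fg(3,4)[OF aV] by (intro image_eqI[of _ _ "g a"]) auto
qed

lemma submanifold_Z: "submanifold 1 (d + 1) Z"
  by (rule submanifold_image[OF submanifold_le[OF submanifold_Y k1] C_k_diffeo_le[OF diffeo k1]])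

lemma connected_germ_Z:
  assumes "\<rho> > 0"
  shows "\<exists>C \<rho>'. connected C \<and> C \<noteq> {} \<and> C \<subseteq> Z \<and> (\<forall>a\<in>C. norm a < \<rho>) \<and> \<rho>' > 0 \<and> (\<forall>a\<in>Z. norm a < \<rho>' --> a \<in> C)"
proof -
  have "open (U \<inter> f -` ball 0 \<rho>)" by (rule continuous_open_preimage[OF f_continuous opens(1) open_ball])
  moreover have "x0 \<in> U \<inter> f -` ball 0 \<rho>" using x0 assms by simp
  ultimately obtain W where W: "open W" "x0 \<in> W" "W \<subseteq> U \<inter> f -` ball 0 \<rho>" "connected (W \<inter> Y)"
    using connected_germ by meson
  have "connected (f ` (W \<inter> Y))"
    by (rule connected_continuous_image[OF continuous_on_subset[OF f_continuous] W(4)]) (use W(3) in blast)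
  moreover have "W \<inter> Y \<noteq> {}" using x0_closure W(1,2) unfolding closure_iff_nhds_not_empty by blast
  moreover have "f ` (W \<inter> Y) \<subseteq> Z" "\<forall>a\<in>f ` (W \<inter> Y). norm a < \<rho>" using W(3) by auto
  moreover have "\<exists>\<rho>'>0. \<forall>a\<in>Z. norm a < \<rho>' --> a \<in> f ` (W \<inter> Y)"
  proof -
    have "0 \<in> V" using r(1,3) by auto
    then have "isCont g 0" using g_continuous opens(2) by (simp add: continuous_on_eq_continuous_at)
    moreover have "open W" "g 0 \<in> W" using W(1,2) g_0 by auto
    ultimately obtain A where A: "open A" "0 \<in> A" "\<forall>a\<in>A. g a \<in> W" unfolding continuous_at_open by blast
    then obtain \<rho>' where \<rho>': "\<rho>' > 0" "ball 0 \<rho>' \<subseteq> A" using open_contains_ball by blast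
    have "a \<in> f ` (W \<inter> Y)" if "a \<in> Z" "norm a < \<rho>'" for a
    proof -
      have "g a \<in> W" using A(3) \<rho>'(2) that(2) by auto
      then show ?thesis using Z_preimage(2,3)[OF that(1)] by (metis IntI image_eqI)
    qed
    then show ?thesis using \<rho>'(1) by blast
  qed
  ultimately show ?thesis by (metis image_is_empty)
qed

lemma ex_direction: "\<exists>j. j \<notin> I"
proof (rule ccontr)
  assume "\<nexists>j. j \<notin> I"
  then have "I = UNIV" by blast
  obtain C where "C \<noteq> {}" "C \<subseteq> Z" using connected_germ_Z[of 1] by auto
  then obtain a where "a \<in> Z" by blast
  have "dim (T a) \<le> DIM(real ^ 'n)" by (rule dim_subset_UNIV)
  then show False using dim_TZ[OF \<open>a \<in> Z\<close>] card_I \<open>I = UNIV\<close> by simp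
qed

lemma frame:
  fixes \<epsilon> P :: real
  assumes j: "j \<notin> I" and a: "a \<in> Z" and \<epsilon>: "0 \<le> \<epsilon>" "gap E (T a) \<le> \<epsilon>"
    and w: "w \<in> T a" "norm (a - \<pi> a - w) \<le> \<epsilon> * norm (a - \<pi> a)"
    and p: "linear p" "\<And>v. norm (p v) \<le> P * norm v" "\<And>e. e \<in> E ==> p e = e" "P * (CARD('n) * \<epsilon>) \<le> 1 / 4"
    and \<sigma>: "\<sigma> = (a - \<pi> a) /\<^sub>R norm (a - \<pi> a)" "norm (p \<sigma> - axis j 1) \<le> 1 / 4" and m: "m \<in> T a"
  shows "\<exists>c\<in>coord_plane (insert j I). norm (m - (\<pi> c + c $ j *\<^sub>R \<sigma>)) \<le> CARD('n) * \<epsilon> * norm c \<and> norm c \<le> 2 * norm (p m)"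
proof -
  let ?K = "insert j I"
  have s0: "norm (a - \<pi> a) > 0" using Z_height[OF a] by simp
  have "\<exists>v\<in>T a. norm (v - u) \<le> \<epsilon>" if u: "u \<in> E" "norm u = 1" for u
  proof -
    obtain v where "v \<in> T a" "norm (u - v) \<le> gap E (T a) * norm u"
      using gap_near[OF subspace_coord_plane subspace_TZ[OF a] u(1)] by blast
    then show ?thesis using u(2) \<epsilon>(2) by (intro bexI[of _ v]) (auto simp: norm_minus_commute)
  qed
  moreover have "axis i 1 \<in> E \<and> norm (axis i (1::real)) = 1" if "i \<in> I" for i
    using that by (auto simp: coord_plane_def axis_def norm_axis_1[unfolded axis_def])
  ultimately have "\<forall>i\<in>I. \<exists>v\<in>T a. norm (v - axis i 1) \<le> \<epsilon>" by blast
  then obtain v0 where v0: "\<And>i. i \<in> I ==> v0 i \<in> T a \<and> norm (v0 i - axis i 1) \<le> \<epsilon>" by metis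
  define u where "u = (\<lambda>i. if i = j then \<sigma> else axis i 1)"
  define v where "v = (\<lambda>i. if i = j then w /\<^sub>R norm (a - \<pi> a) else v0 i)"
  have vT: "v i \<in> T a" if "i \<in> ?K" for i
    using that v0 subspace_scale[OF subspace_TZ[OF a] w(1)] by (auto simp: v_def)
  have vu: "norm (v i - u i) \<le> \<epsilon>" if "i \<in> ?K" for i
  proof (cases "i = j")
    case True
    then have "v i - u i = - ((a - \<pi> a - w) /\<^sub>R norm (a - \<pi> a))"
      by (simp add: v_def u_def \<sigma>(1) scaleR_diff_right)
    then have "norm (v i - u i) = norm (a - \<pi> a - w) / norm (a - \<pi> a)" by (simp add: divide_inverse mult.commute)
    then show ?thesis using w(2) s0 by (simp add: divide_le_eq)
  next
    case False
    then show ?thesis using that v0 by (simp add: v_def u_def)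
  qed
  define \<Lambda> where "\<Lambda> = (\<lambda>c :: real ^ 'n. \<Sum>i\<in>?K. c $ i *\<^sub>R v i)"
  have lin: "linear \<Lambda>" unfolding \<Lambda>_def
    by (rule linearI) (auto simp: scaleR_add_left sum.distrib scaleR_sum_right)
  have im: "\<Lambda> ` coord_plane ?K \<subseteq> T a" unfolding \<Lambda>_def
    using vT by (auto intro!: subspace_sum[OF subspace_TZ[OF a]] subspace_scale[OF subspace_TZ[OF a]])
  have Uc: "(\<Sum>i\<in>?K. c $ i *\<^sub>R u i) = \<pi> c + c $ j *\<^sub>R \<sigma>" for c :: "real ^ 'n"
  proof -
    have "(\<Sum>i\<in>I. c $ i *\<^sub>R u i) = (\<Sum>i\<in>I. c $ i *\<^sub>R axis i 1)"
      using j by (intro sum.cong) (auto simp: u_def)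
    also have "\<dots> = \<pi> c" by (simp add: vec_eq_iff coord_proj_def axis_def if_distrib if_distribR cong: if_cong)
    finally show ?thesis using j by (simp add: u_def)
  qed
  have near: "norm (\<Lambda> c - (\<pi> c + c $ j *\<^sub>R \<sigma>)) \<le> CARD('n) * \<epsilon> * norm c" for c
    unfolding \<Lambda>_def Uc[symmetric] by (rule sum_coords_near[OF vu \<epsilon>(1)])
  have pc: "norm (p (\<Lambda> c) - c) \<le> norm c / 2" if c: "c \<in> coord_plane ?K" for c
  proof -
    have ceq: "c = \<pi> c + c $ j *\<^sub>R axis j 1" using c j
      by (auto simp: vec_eq_iff coord_proj_def axis_def coord_plane_def)
    have "p (\<Lambda> c) - c = p (\<Lambda> c - (\<pi> c + c $ j *\<^sub>R \<sigma>)) + (p (\<pi> c) + c $ j *\<^sub>R p \<sigma> - c)"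
      using p(1) by (simp add: linear_diff linear_add linear_scale)
    also have "p (\<pi> c) + c $ j *\<^sub>R p \<sigma> - c = c $ j *\<^sub>R (p \<sigma> - axis j 1)"
      using p(3)[OF coord_proj_in[of I c]] by (subst (3) ceq) (simp add: scaleR_diff_right)
    finally have "norm (p (\<Lambda> c) - c) \<le> norm (p (\<Lambda> c - (\<pi> c + c $ j *\<^sub>R \<sigma>))) + \<bar>c $ j\<bar> * norm (p \<sigma> - axis j 1)"
      using norm_triangle_ineq[of "p (\<Lambda> c - (\<pi> c + c $ j *\<^sub>R \<sigma>))" "c $ j *\<^sub>R (p \<sigma> - axis j 1)"] by simp
    also have "\<dots> \<le> 1 / 4 * norm c + norm c * (1 / 4)"
    proof (intro add_mono mult_mono \<sigma>(2))
      have "0 \<le> P * norm \<sigma>" using p(2)[of \<sigma>] norm_ge_zero[of "p \<sigma>"] by linarith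
      moreover have "norm \<sigma> = 1" using s0 by (simp add: \<sigma>(1))
      ultimately have "0 \<le> P" by simp
      have "norm (p (\<Lambda> c - (\<pi> c + c $ j *\<^sub>R \<sigma>))) \<le> P * norm (\<Lambda> c - (\<pi> c + c $ j *\<^sub>R \<sigma>))" by (rule p(2))
      also have "\<dots> \<le> P * (CARD('n) * \<epsilon> * norm c)" by (rule mult_left_mono[OF near \<open>0 \<le> P\<close>])
      also have "\<dots> = P * (CARD('n) * \<epsilon>) * norm c" by simp
      also have "\<dots> \<le> 1 / 4 * norm c" by (rule mult_right_mono[OF p(4)]) simp
      finally show "norm (p (\<Lambda> c - (\<pi> c + c $ j *\<^sub>R \<sigma>))) \<le> 1 / 4 * norm c" .
    qed (auto simp: component_le_norm_cart)
    finally show ?thesis by simp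
  qed
  have "dim (T a) = card ?K" using dim_TZ[OF a] card_I j by simp
  from subspace_graph_coords[OF subspace_TZ[OF a] this lin im pc m]
  show ?thesis using near by blast
qed

lemma sheet_over:
  fixes \<phi> :: "real ^ 'n \<Rightarrow> real" and \<phi>' :: "real ^ 'n \<Rightarrow> real ^ 'n \<Rightarrow> real"
  assumes j: "j \<notin> I" and \<phi>: "\<forall>z. z \<noteq> 0 --> (\<phi> has_derivative \<phi>' z) (at z)" "\<forall>v. continuous_on (- {0}) (\<lambda>z. \<phi>' z v)"
    "continuous_on UNIV \<phi>" "\<phi> 0 = 0" and \<delta>0: "\<delta>0 > 0" and M: "M > 0"
    and pos: "\<forall>a\<in>Z. norm a < \<delta>0 --> norm (a - \<pi> a) \<le> M * \<phi> (a - \<pi> a)"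
    and inj: "\<forall>a\<in>Z. \<forall>v\<in>T a. norm a < \<delta>0 --> \<pi> v + \<phi>' (a - \<pi> a) (v - \<pi> v) *\<^sub>R axis j 1 = 0 --> v = 0"
  shows "\<exists>\<delta> \<rho> H H'. 0 < \<delta> \<and> 0 < \<rho> \<and>
    (\<forall>w\<in>coord_plane (insert j I). norm (\<pi> w) < \<delta> --> 0 < w $ j --> w $ j < \<delta> -->
       H w \<in> Z \<and> norm (H w) < \<delta>0 \<and> \<pi> (H w) = \<pi> w \<and> \<phi> (H w - \<pi> w) = w $ j \<and>
       (\<forall>\<xi>\<in>coord_plane (insert j I). H' w \<xi> \<in> T (H w) \<and>
          \<pi> (H' w \<xi>) + \<phi>' (H w - \<pi> w) (H' w \<xi> - \<pi> (H' w \<xi>)) *\<^sub>R axis j 1 = \<xi>)) \<and>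
    (\<forall>a\<in>Z. norm a < \<rho> --> norm (\<pi> a) < \<delta> \<and> 0 < \<phi> (a - \<pi> a) \<and> \<phi> (a - \<pi> a) < \<delta> \<and> H (\<pi> a + \<phi> (a - \<pi> a) *\<^sub>R axis j 1) = a) \<and>
    (\<forall>w. norm (\<pi> w) < \<delta> --> 0 < w $ j --> w $ j < \<delta> -->
       ((\<lambda>w. H (coord_proj (insert j I) w)) has_derivative H' w) (at w)) \<and>
    (\<forall>v. continuous_on {w. norm (\<pi> w) < \<delta> \<and> 0 < w $ j \<and> w $ j < \<delta>} (\<lambda>w. H' w v))"
proof -
  let ?K = "insert j I" and ?e = "axis j 1 :: real ^ 'n"
  define \<delta> where "\<delta> = min \<delta>0 (r / L) / (2 * (M + 2))"
  define \<eta> where "\<eta> = (M + 1) * \<delta>"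
  have rL: "r / L > 0" using r(1) L by simp
  have \<delta>: "\<delta> > 0" using \<delta>0 rL M by (simp add: \<delta>_def)
  moreover have "M * \<delta> > 0" using M \<delta> by simp
  ultimately have \<eta>: "\<eta> > 0" "M * \<delta> < \<eta>" by (auto simp: \<eta>_def algebra_simps)
  have "\<delta> + \<eta> = (M + 2) * \<delta>" by (simp add: \<eta>_def algebra_simps)
  also have "\<dots> = min \<delta>0 (r / L) / 2" using M by (simp add: \<delta>_def field_simps)
  also have "\<dots> < min \<delta>0 (r / L)"
  proof -
    have half: "x / 2 < x" if "0 < x" for x :: real using that by simp
    show ?thesis by (rule half) (use \<delta>0 rL in simp)
  qed
  finally have \<delta>\<eta>: "\<delta> + \<eta> < \<delta>0" "\<delta> + \<eta> < r / L" by auto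
  define q where "q = (\<lambda>b. \<pi> b + \<phi> (b - \<pi> b) *\<^sub>R ?e)"
  define q' where "q' = (\<lambda>b v. \<pi> v + \<phi>' (b - \<pi> b) (v - \<pi> v) *\<^sub>R ?e)"
  define B where "B = {w. norm (\<pi> w) < \<delta> \<and> 0 < w $ j \<and> w $ j < \<delta>}"
  define O' where "O' = {b. norm (\<pi> b) < \<delta> \<and> b - \<pi> b \<noteq> 0 \<and> norm (b - \<pi> b) < \<eta> \<and> 0 < \<phi> (b - \<pi> b) \<and> \<phi> (b - \<pi> b) < \<delta>}"
  have c\<pi>: "continuous_on A \<pi>" for A
    by (rule linear_continuous_on[OF bounded_linear_coord_proj])
  have c\<phi>: "continuous_on A (\<lambda>b. \<phi> (b - \<pi> b))" for A
    by (rule continuous_on_compose2[OF \<phi>(3)]) (auto intro!: continuous_intros c\<pi>)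
  have cq: "continuous_on A q" for A unfolding q_def by (intro continuous_intros c\<pi> c\<phi>)
  have oO: "open O'" unfolding O'_def
    by (intro open_Collect_conj open_Collect_less open_Collect_neq continuous_intros c\<pi> c\<phi>)
  have oB: "open B" unfolding B_def
    by (intro open_Collect_conj open_Collect_less continuous_intros c\<pi>)
  have cvB: "convex B"
  proof -
    have 1: "{w. norm (\<pi> w) < \<delta>} = \<pi> -` ball 0 \<delta>" by auto
    have "convex {w. norm (\<pi> w) < \<delta>}" unfolding 1 by (rule convex_linear_vimage[OF linear_coord_proj convex_ball])
    moreover have 2: "{w::real^'n. 0 < w $ j \<and> w $ j < \<delta>} = (\<lambda>w. w $ j) -` {0<..<\<delta>}" by auto
    have "convex {w::real^'n. 0 < w $ j \<and> w $ j < \<delta>}" unfolding 2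
      by (rule convex_linear_vimage[OF bounded_linear.linear[OF bounded_linear_vec_nth]]) simp
    ultimately have "convex ({w. norm (\<pi> w) < \<delta>} \<inter> {w. 0 < w $ j \<and> w $ j < \<delta>})" by (rule convex_Int)
    moreover have "B = {w. norm (\<pi> w) < \<delta>} \<inter> {w. 0 < w $ j \<and> w $ j < \<delta>}" by (auto simp: B_def)
    ultimately show ?thesis by simp
  qed
  have \<pi>e: "\<pi> ?e = 0" using j by (auto simp: vec_eq_iff coord_proj_def axis_def)
  have ej: "?e $ j = 1" by (simp add: axis_def)
  have \<pi>j: "\<pi> v $ j = 0" for v using j by (simp add: coord_proj_def)
  have \<pi>\<pi>: "\<pi> (\<pi> v) = \<pi> v" for v by (rule coord_proj_id[OF coord_proj_in])
  have \<pi>q: "\<pi> (\<pi> v + t *\<^sub>R ?e) = \<pi> v" and jq: "(\<pi> v + t *\<^sub>R ?e) $ j = t" for v t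
    using linear_coord_proj[of I] by (auto simp: linear_add linear_scale \<pi>e \<pi>\<pi> \<pi>j ej)
  have inK: "\<pi> v + t *\<^sub>R ?e \<in> coord_plane ?K" for v t
    by (auto simp: coord_plane_def coord_proj_def axis_def)
  have Keq: "w = \<pi> w + w $ j *\<^sub>R ?e" if "w \<in> coord_plane ?K" for w
    using that j by (auto simp: vec_eq_iff coord_proj_def axis_def coord_plane_def)
  have pK: "\<pi> (coord_proj ?K w) = \<pi> w" "coord_proj ?K w $ j = w $ j" for w
    by (auto simp: vec_eq_iff coord_proj_def)
  have pB: "coord_proj ?K w \<in> B \<longleftrightarrow> w \<in> B" for w by (simp add: B_def pK)
  have dq: "(q has_derivative q' b) (at b)" if "b \<in> O'" for b
  proof -
    have d\<pi>: "(\<pi> has_derivative \<pi>) (at b)" by (rule bounded_linear_imp_has_derivative[OF bounded_linear_coord_proj])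
    have "((\<lambda>b. b - \<pi> b) has_derivative (\<lambda>v. v - \<pi> v)) (at b)" by (intro has_derivative_diff has_derivative_ident d\<pi>)
    moreover have "(\<phi> has_derivative \<phi>' (b - \<pi> b)) (at (b - \<pi> b))" using that by (intro \<phi>(1)[rule_format]) (simp add: O'_def)
    ultimately have "((\<lambda>b. \<phi> (b - \<pi> b)) has_derivative (\<lambda>v. \<phi>' (b - \<pi> b) (v - \<pi> v))) (at b)"
      by (rule has_derivative_compose)
    then show ?thesis unfolding q_def q'_def by (intro has_derivative_add d\<pi> has_derivative_scaleR_left)
  qed
  have cq': "continuous_on O' (\<lambda>b. q' b v)" for v unfolding q'_def
    by (intro continuous_intros continuous_on_compose2[OF \<phi>(2)[rule_format]] c\<pi>) (auto simp: O'_def)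
  have ZO: "norm b < \<delta>0" if "b \<in> O'" for b
  proof -
    have "norm b \<le> norm (\<pi> b) + norm (b - \<pi> b)" using norm_triangle_ineq[of "\<pi> b" "b - \<pi> b"] by simp
    then show ?thesis using that \<delta>\<eta>(1) by (simp add: O'_def)
  qed
  have proper: "compact (Z \<inter> O' \<inter> q -` C)" if C: "C \<subseteq> B \<inter> coord_plane ?K" "compact C" for C
  proof -
    have bnd: "norm b \<le> \<delta> + \<eta> \<and> norm (b - \<pi> b) \<le> \<eta>" if b: "b \<in> closure (Z \<inter> O')" for b
    proof -
      have "closed {b. norm b \<le> \<delta> + \<eta> \<and> norm (b - \<pi> b) \<le> \<eta>}"
        by (intro closed_Collect_conj closed_Collect_le continuous_intros c\<pi>)
      moreover have "Z \<inter> O' \<subseteq> {b. norm b \<le> \<delta> + \<eta> \<and> norm (b - \<pi> b) \<le> \<eta>}"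
      proof
        fix b assume "b \<in> Z \<inter> O'"
        then have b: "norm (\<pi> b) < \<delta>" "norm (b - \<pi> b) < \<eta>" by (auto simp: O'_def)
        have "norm b \<le> norm (\<pi> b) + norm (b - \<pi> b)" using norm_triangle_ineq[of "\<pi> b" "b - \<pi> b"] by simp
        then show "b \<in> {b. norm b \<le> \<delta> + \<eta> \<and> norm (b - \<pi> b) \<le> \<eta>}" using b by simp
      qed
      ultimately have "closure (Z \<inter> O') \<subseteq> {b. norm b \<le> \<delta> + \<eta> \<and> norm (b - \<pi> b) \<le> \<eta>}" by (rule closure_minimal[rotated])
      then show ?thesis using b by blast
    qed
    have "Z \<inter> O' \<inter> q -` C = closure (Z \<inter> O') \<inter> q -` C"
    proof (intro equalityI subsetI)
      fix b assume b: "b \<in> closure (Z \<inter> O') \<inter> q -` C"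
      then have "q b \<in> B" using C(1) by auto
      then have qb: "norm (\<pi> b) < \<delta>" "0 < \<phi> (b - \<pi> b)" "\<phi> (b - \<pi> b) < \<delta>" by (auto simp: B_def q_def \<pi>q \<pi>j ej)
      then have z: "b - \<pi> b \<noteq> 0" using \<phi>(4) by auto
      have "b \<notin> E" using z coord_proj_id[of b I] by auto
      moreover have "b \<in> closure Z" using b closure_mono[of "Z \<inter> O'" Z] by auto
      ultimately have bZ: "b \<in> Z" using bnd[of b] b \<delta>\<eta>(2) by (intro closure_Z) auto
      have "norm (b - \<pi> b) \<le> M * \<phi> (b - \<pi> b)" using bnd[of b] b \<delta>\<eta>(1) by (intro pos[rule_format] bZ) auto
      also have "\<dots> < M * \<delta>" using qb(3) M by simp
      finally have "norm (b - \<pi> b) < \<eta>" using \<eta>(2) by linarith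
      then have "b \<in> O'" using qb z by (simp add: O'_def)
      then show "b \<in> Z \<inter> O' \<inter> q -` C" using bZ b by blast
    next
      fix b assume "b \<in> Z \<inter> O' \<inter> q -` C"
      then show "b \<in> closure (Z \<inter> O') \<inter> q -` C" using subsetD[OF closure_subset, of b "Z \<inter> O'"] by simp
    qed
    moreover have "bounded (closure (Z \<inter> O') \<inter> q -` C)"
      using bnd by (intro boundedI[of _ "\<delta> + \<eta>"]) auto
    moreover have "closed (closure (Z \<inter> O') \<inter> q -` C)"
      by (rule continuous_closed_preimage[OF cq closed_closure compact_imp_closed[OF C(2)]])
    ultimately show ?thesis by (simp add: compact_eq_bounded_closed)
  qed
  obtain \<rho>1 where \<rho>1: "\<rho>1 > 0" "\<And>b. norm b < \<rho>1 ==> \<phi> (b - \<pi> b) < \<delta>"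
  proof -
    have "isCont (\<lambda>b. \<phi> (b - \<pi> b)) 0" using c\<phi>[of UNIV] by (simp add: continuous_on_eq_continuous_at)
    moreover have "\<phi> (0 - \<pi> 0) = 0" using linear_0[OF linear_coord_proj[of I]] \<phi>(4) by simp
    ultimately obtain s where "s > 0" "\<And>b. dist b 0 < s ==> dist (\<phi> (b - \<pi> b)) 0 < \<delta>"
      using \<delta> unfolding continuous_at_eps_delta by (metis dist_norm)
    then show thesis by (intro that[of s]) (auto simp: dist_real_def abs_less_iff)
  qed
  define \<rho>2 where "\<rho>2 = min \<rho>1 (min \<delta> (min \<eta> \<delta>0))"
  have "\<rho>2 > 0" using \<rho>1 \<delta> \<eta> \<delta>0 by (simp add: \<rho>2_def)
  have inO: "a \<in> O'" if a: "a \<in> Z" "norm a < \<rho>2" for a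
  proof -
    have "norm (a - \<pi> a) \<le> norm (a - 0)" by (rule norm_minus_coord_proj_le[OF subspace_0[OF subspace_coord_plane]])
    moreover have "norm (\<pi> a) \<le> norm a" by (rule norm_coord_proj_le)
    moreover have "0 < M * \<phi> (a - \<pi> a)" using pos[rule_format, OF a(1)] a(2) Z_height[OF a(1)]
      by (smt (verit) \<rho>2_def norm_le_zero_iff)
    ultimately show ?thesis using a(2) \<rho>1(2)[of a] Z_height[OF a(1)] M
      by (auto simp: O'_def \<rho>2_def zero_less_mult_iff)
  qed
  obtain C \<rho> where C: "connected C" "C \<noteq> {}" "C \<subseteq> Z" "\<forall>a\<in>C. norm a < \<rho>2" "\<rho> > 0" "\<forall>a\<in>Z. norm a < \<rho> --> a \<in> C"
    using connected_germ_Z[OF \<open>\<rho>2 > 0\<close>] by blast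
  have CO: "C \<subseteq> Z \<inter> O'" using C(3,4) inO by blast
  have cardK: "card ?K = d + 1" using card_I j by simp
  have qK: "q ` O' \<subseteq> coord_plane ?K" unfolding q_def using inK by blast
  have qB: "q b \<in> B" if "b \<in> O'" for b using that by (auto simp: B_def O'_def q_def \<pi>q \<pi>j ej)
  then have qB': "q ` (Z \<inter> O') \<subseteq> B" by blast
  have inj': "v = 0" if "a \<in> Z \<inter> O'" "v \<in> T a" "q' a v = 0" for a v
    using inj that ZO[of a] by (auto simp: q'_def)
  have "\<exists>G G'. (\<forall>w\<in>B \<inter> coord_plane ?K. G w \<in> Z \<inter> O' \<and> q (G w) = w) \<and> (\<forall>c\<in>C. G (q c) = c) \<and>
    (\<forall>w. coord_proj ?K w \<in> B --> ((\<lambda>w. G (coord_proj ?K w)) has_derivative G' w) (at w)) \<and>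
    (\<forall>v. continuous_on {w. coord_proj ?K w \<in> B} (\<lambda>w. G' w v))"
    by (rule sheet_section[OF submanifold_Z cardK oO _ _ qK _ oB cvB qB' _ C(1) CO C(2), where q' = q'])
      ((rule dq, assumption) | (rule cq') | (rule inj', assumption+) | (rule proper, assumption+))+
  then obtain H H' where H: "\<forall>w\<in>B \<inter> coord_plane ?K. H w \<in> Z \<inter> O' \<and> q (H w) = w" "\<forall>c\<in>C. H (q c) = c"
    "\<forall>w. coord_proj ?K w \<in> B --> ((\<lambda>w. H (coord_proj ?K w)) has_derivative H' w) (at w)"
    "\<forall>v. continuous_on {w. coord_proj ?K w \<in> B} (\<lambda>w. H' w v)" by blast
  have H3: "((\<lambda>w. H (coord_proj ?K w)) has_derivative H' w) (at w)" if "w \<in> B" for w using H(3) that pB by blast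
  have H1: "H w \<in> Z" "norm (H w) < \<delta>0" "\<pi> (H w) = \<pi> w" "\<phi> (H w - \<pi> w) = w $ j" "H w \<in> O'" "q (H w) = w"
    if "w \<in> B" "w \<in> coord_plane ?K" for w
  proof -
    show h: "H w \<in> Z" "H w \<in> O'" "q (H w) = w" using H(1) that by auto
    show "norm (H w) < \<delta>0" by (rule ZO[OF h(2)])
    show p: "\<pi> (H w) = \<pi> w" using h(3) \<pi>q[of "H w"] unfolding q_def by metis
    show "\<phi> (H w - \<pi> w) = w $ j" using h(3) jq[of "H w"] unfolding q_def p by metis
  qed
  have H4: "H' w \<xi> \<in> T (H w) \<and> \<pi> (H' w \<xi>) + \<phi>' (H w - \<pi> w) (H' w \<xi> - \<pi> (H' w \<xi>)) *\<^sub>R ?e = \<xi>"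
    if w: "w \<in> B" "w \<in> coord_plane ?K" and \<xi>: "\<xi> \<in> coord_plane ?K" for w \<xi>
  proof
    have pw: "coord_proj ?K w = w" by (rule coord_proj_id[OF w(2)])
    have "\<xi> \<in> tangent_space (UNIV \<inter> coord_plane ?K) w"
      by (rule coord_plane_subset_tangent_space[OF open_UNIV UNIV_I w(2) \<xi>])
    then have \<xi>T: "\<xi> \<in> tangent_space (coord_plane ?K) w" by simp
    have "(\<lambda>w. H (coord_proj ?K w)) ` (B \<inter> coord_plane ?K) \<subseteq> Z"
      using H(1) coord_proj_id[of _ ?K] by auto
    from tangent_space_image[OF oB w(1) H3[OF w(1)] this \<xi>T] show "H' w \<xi> \<in> T (H w)" by (simp add: pw)
    have "(q has_derivative q' (H w)) (at (H (coord_proj ?K w)))" using dq[OF H1(5)[OF w]] pw by simp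
    from has_derivative_compose[OF H3[OF w(1)] this]
    have 1: "((\<lambda>w. q (H (coord_proj ?K w))) has_derivative (\<lambda>v. q' (H w) (H' w v))) (at w)" .
    have "((\<lambda>w. q (H (coord_proj ?K w))) has_derivative coord_proj ?K) (at w)"
    proof (rule has_derivative_transform_within_open[OF bounded_linear_imp_has_derivative[OF bounded_linear_coord_proj] oB w(1)])
      fix v assume "v \<in> B"
      then show "coord_proj ?K v = q (H (coord_proj ?K v))" using H(1) pB by simp
    qed
    from has_derivative_unique[OF 1 this] have "q' (H w) (H' w \<xi>) = \<xi>" using coord_proj_id[OF \<xi>] by metis
    then show "\<pi> (H' w \<xi>) + \<phi>' (H w - \<pi> w) (H' w \<xi> - \<pi> (H' w \<xi>)) *\<^sub>R ?e = \<xi>" unfolding q'_def H1(3)[OF w] .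
  qed
  have H2: "norm (\<pi> a) < \<delta> \<and> 0 < \<phi> (a - \<pi> a) \<and> \<phi> (a - \<pi> a) < \<delta> \<and> H (\<pi> a + \<phi> (a - \<pi> a) *\<^sub>R ?e) = a"
    if "a \<in> Z" "norm a < \<rho>" for a
  proof -
    have "a \<in> C" using C(6) that by blast
    then have "a \<in> O'" "H (q a) = a" using CO H(2) by auto
    then show ?thesis by (simp add: O'_def q_def)
  qed
  have "continuous_on B (\<lambda>w. H' w v)" for v using H(4) by (simp add: pB)
  then have H5: "\<forall>v. continuous_on {w. norm (\<pi> w) < \<delta> \<and> 0 < w $ j \<and> w $ j < \<delta>} (\<lambda>w. H' w v)" by (simp add: B_def)
  have inB: "w \<in> B" if "norm (\<pi> w) < \<delta>" "0 < w $ j" "w $ j < \<delta>" for w using that by (simp add: B_def)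
  have 1: "\<forall>w\<in>coord_plane ?K. norm (\<pi> w) < \<delta> --> 0 < w $ j --> w $ j < \<delta> -->
       H w \<in> Z \<and> norm (H w) < \<delta>0 \<and> \<pi> (H w) = \<pi> w \<and> \<phi> (H w - \<pi> w) = w $ j \<and>
       (\<forall>\<xi>\<in>coord_plane ?K. H' w \<xi> \<in> T (H w) \<and>
          \<pi> (H' w \<xi>) + \<phi>' (H w - \<pi> w) (H' w \<xi> - \<pi> (H' w \<xi>)) *\<^sub>R ?e = \<xi>)"
  proof (intro ballI impI)
    fix w assume w: "w \<in> coord_plane ?K" and "norm (\<pi> w) < \<delta>" "0 < w $ j" "w $ j < \<delta>"
    then have wB: "w \<in> B" by (intro inB)
    show "H w \<in> Z \<and> norm (H w) < \<delta>0 \<and> \<pi> (H w) = \<pi> w \<and> \<phi> (H w - \<pi> w) = w $ j \<and>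
       (\<forall>\<xi>\<in>coord_plane ?K. H' w \<xi> \<in> T (H w) \<and>
          \<pi> (H' w \<xi>) + \<phi>' (H w - \<pi> w) (H' w \<xi> - \<pi> (H' w \<xi>)) *\<^sub>R ?e = \<xi>)"
      by (intro conjI ballI H1(1-4)[OF wB w] H4[OF wB w, THEN conjunct1] H4[OF wB w, THEN conjunct2])
  qed
  have 2: "\<forall>a\<in>Z. norm a < \<rho> --> norm (\<pi> a) < \<delta> \<and> 0 < \<phi> (a - \<pi> a) \<and> \<phi> (a - \<pi> a) < \<delta> \<and>
      H (\<pi> a + \<phi> (a - \<pi> a) *\<^sub>R ?e) = a"
    by (intro ballI impI H2)
  have 3: "\<forall>w. norm (\<pi> w) < \<delta> --> 0 < w $ j --> w $ j < \<delta> -->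
       ((\<lambda>w. H (coord_proj ?K w)) has_derivative H' w) (at w)"
    by (intro allI impI H3 inB)
  show ?thesis
    by (intro exI[of _ \<delta>] exI[of _ \<rho>] exI[of _ H] exI[of _ H'] conjI \<delta> C(5) 1 2 3 H5)
qed

end

section \<open>The limit direction and the limit tangent space\<close>

context wing_chart
begin

lemma frame_bound:
  fixes \<epsilon> P :: real
  assumes j: "j \<notin> I" and a: "a \<in> Z" and \<epsilon>: "0 \<le> \<epsilon>" "gap E (T a) \<le> \<epsilon>" "CARD('n) * \<epsilon> \<le> 1"
    and w: "\<exists>w\<in>T a. norm (a - \<pi> a - w) \<le> \<epsilon> * norm (a - \<pi> a)"
    and p: "linear p" "\<And>v. norm (p v) \<le> P * norm v" "\<And>e. e \<in> E ==> p e = e" "P * (CARD('n) * \<epsilon>) \<le> 1 / 4"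
    and \<sigma>: "norm (p (sgn (a - \<pi> a)) - axis j 1) \<le> 1 / 4" and m: "m \<in> T a"
  shows "norm m \<le> 6 * norm (p m)"
proof -
  obtain w where w: "w \<in> T a" "norm (a - \<pi> a - w) \<le> \<epsilon> * norm (a - \<pi> a)" using w by blast
  have s: "sgn (a - \<pi> a) = (a - \<pi> a) /\<^sub>R norm (a - \<pi> a)" by (rule sgn_div_norm)
  obtain c where c: "norm (m - (\<pi> c + c $ j *\<^sub>R sgn (a - \<pi> a))) \<le> CARD('n) * \<epsilon> * norm c" "norm c \<le> 2 * norm (p m)"
    using frame[OF j a \<epsilon>(1,2) w p s \<sigma> m] by blast
  have "norm (c $ j *\<^sub>R sgn (a - \<pi> a)) \<le> norm c * 1"
    unfolding norm_scaleR real_norm_def by (intro mult_mono component_le_norm_cart) (auto simp: norm_sgn)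
  moreover have "norm (\<pi> c) \<le> norm c" by (rule norm_coord_proj_le)
  moreover have "norm (\<pi> c + c $ j *\<^sub>R sgn (a - \<pi> a)) \<le> norm (\<pi> c) + norm (c $ j *\<^sub>R sgn (a - \<pi> a))" by (rule norm_triangle_ineq)
  moreover have "norm m \<le> norm (m - (\<pi> c + c $ j *\<^sub>R sgn (a - \<pi> a))) + norm (\<pi> c + c $ j *\<^sub>R sgn (a - \<pi> a))"
    using norm_triangle_ineq[of "m - (\<pi> c + c $ j *\<^sub>R sgn (a - \<pi> a))" "\<pi> c + c $ j *\<^sub>R sgn (a - \<pi> a)"] by simp
  moreover have "CARD('n) * \<epsilon> * norm c \<le> 1 * norm c" by (rule mult_right_mono[OF \<epsilon>(3)]) simp
  ultimately show ?thesis using c by linarith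
qed

lemma proj_height: "\<pi> (a - \<pi> a) = 0"
  unfolding linear_diff[OF linear_coord_proj] coord_proj_id[OF coord_proj_in] by simp

lemma proj_sgn_height: "\<pi> (sgn (a - \<pi> a)) = 0"
  by (simp add: sgn_div_norm linear_scale[OF linear_coord_proj] proj_height)

lemma radial_frame:
  assumes j: "j \<notin> I"
  shows "\<exists>\<delta>>0. \<forall>a\<in>Z. norm a < \<delta> --> (\<forall>m\<in>T a. norm m \<le> 6 * norm (\<pi> m + ((m - \<pi> m) \<bullet> sgn (a - \<pi> a)) *\<^sub>R axis j 1))"
proof -
  define \<epsilon> where "\<epsilon> = 1 / (8 * real CARD('n))"
  have \<epsilon>: "\<epsilon> > 0" "CARD('n) * \<epsilon> = 1 / 8" by (simp_all add: \<epsilon>_def)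
  obtain \<delta> where \<delta>: "\<delta> > 0" "\<And>a. a \<in> Z ==> norm a < \<delta> ==> gap E (T a) \<le> \<epsilon>"
    "\<And>a. a \<in> Z ==> norm a < \<delta> ==> \<exists>w\<in>T a. norm (a - \<pi> a - w) \<le> \<epsilon> * norm (a - \<pi> a)"
    using Z_near[OF \<epsilon>(1)] by blast
  have "norm m \<le> 6 * norm (\<pi> m + ((m - \<pi> m) \<bullet> sgn (a - \<pi> a)) *\<^sub>R axis j 1)"
    if a: "a \<in> Z" "norm a < \<delta>" and m: "m \<in> T a" for a m
  proof -
    let ?s = "sgn (a - \<pi> a)"
    let ?p = "\<lambda>m. \<pi> m + ((m - \<pi> m) \<bullet> ?s) *\<^sub>R axis j 1 :: real ^ 'n"
    have ns: "norm ?s = 1" using Z_height[OF a(1)] by (simp add: norm_sgn)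
    have lin: "linear ?p"
      by (rule linearI) (auto simp: linear_add[OF linear_coord_proj] linear_scale[OF linear_coord_proj]
          inner_add_left inner_diff_left algebra_simps)
    have b: "norm (?p v) \<le> 2 * norm v" for v
    proof -
      have "norm (?p v) \<le> norm (\<pi> v) + \<bar>(v - \<pi> v) \<bullet> ?s\<bar>"
        using norm_triangle_ineq[of "\<pi> v" "((v - \<pi> v) \<bullet> ?s) *\<^sub>R axis j 1"] by simp
      moreover have "\<bar>(v - \<pi> v) \<bullet> ?s\<bar> \<le> norm (v - \<pi> v) * norm ?s" by (rule Cauchy_Schwarz_ineq2)
      moreover have "norm (v - \<pi> v) \<le> norm (v - 0)" by (rule norm_minus_coord_proj_le[OF subspace_0[OF subspace_coord_plane]])
      moreover have "norm (\<pi> v) \<le> norm v" by (rule norm_coord_proj_le)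
      ultimately show ?thesis using ns by simp
    qed
    have pe: "?p e = e" if "e \<in> E" for e using coord_proj_id[OF that] by simp
    have "?s \<bullet> ?s = 1" using ns by (simp add: norm_eq_1)
    then have ps: "norm (?p ?s - axis j 1) \<le> 1 / 4" by (simp add: proj_sgn_height)
    show ?thesis
      by (rule frame_bound[OF j a(1) _ \<delta>(2)[OF a] _ \<delta>(3)[OF a] lin b pe _ ps m]) (use \<epsilon> in auto)
  qed
  then show ?thesis using \<delta>(1) by blast
qed

text \<open>Moving radially over \<open>X\<close> at constant height \<open>s\<close>, the speed of the height vector is at most
  \<open>13 s r(t)\<close>, so that integrability of \<open>r\<close> bounds its total variation by \<open>o(s)\<close>.\<close>

lemma heights_close:
  assumes "\<eta> > 0"
  shows "\<exists>\<rho>>0. \<forall>a\<in>Z. \<forall>b\<in>Z. norm a < \<rho> --> norm b < \<rho> --> norm (a - \<pi> a) = norm (b - \<pi> b) -->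
    norm ((a - \<pi> a) - (b - \<pi> b)) \<le> \<eta> * norm (a - \<pi> a)"
proof -
  obtain j where j: "j \<notin> I" using ex_direction by blast
  let ?K = "insert j I" and ?e = "axis j 1 :: real ^ 'n"
  obtain \<delta>0 where \<delta>0: "\<delta>0 > 0" "\<And>a m. a \<in> Z ==> norm a < \<delta>0 ==> m \<in> T a ==>
      norm m \<le> 6 * norm (\<pi> m + ((m - \<pi> m) \<bullet> sgn (a - \<pi> a)) *\<^sub>R ?e)"
    using radial_frame[OF j] by blast
  have dn: "\<forall>z::real ^ 'n. z \<noteq> 0 --> (norm has_derivative (\<lambda>v. v \<bullet> sgn z)) (at z)"
    by (simp add: has_derivative_norm)
  have cn: "\<forall>v. continuous_on (- {0}) (\<lambda>z::real ^ 'n. v \<bullet> sgn z)" by (intro allI continuous_intros) auto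
  have c1: "continuous_on UNIV (norm :: real ^ 'n \<Rightarrow> real)" by (intro continuous_intros)
  have pos: "\<forall>a\<in>Z. norm a < \<delta>0 --> norm (a - \<pi> a) \<le> 1 * norm (a - \<pi> a)" by simp
  have inj: "\<forall>a\<in>Z. \<forall>v\<in>T a. norm a < \<delta>0 --> \<pi> v + ((v - \<pi> v) \<bullet> sgn (a - \<pi> a)) *\<^sub>R ?e = 0 --> v = 0"
    using \<delta>0(2) by fastforce
  obtain \<delta> \<rho> H H' where \<delta>: "0 < \<delta>" "0 < \<rho>"
    and H1: "\<forall>w\<in>coord_plane ?K. norm (\<pi> w) < \<delta> --> 0 < w $ j --> w $ j < \<delta> -->
       H w \<in> Z \<and> norm (H w) < \<delta>0 \<and> \<pi> (H w) = \<pi> w \<and> norm (H w - \<pi> w) = w $ j \<and>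
       (\<forall>\<xi>\<in>coord_plane ?K. H' w \<xi> \<in> T (H w) \<and>
          \<pi> (H' w \<xi>) + ((H' w \<xi> - \<pi> (H' w \<xi>)) \<bullet> sgn (H w - \<pi> w)) *\<^sub>R ?e = \<xi>)"
    and H2: "\<forall>a\<in>Z. norm a < \<rho> --> norm (\<pi> a) < \<delta> \<and> 0 < norm (a - \<pi> a) \<and> norm (a - \<pi> a) < \<delta> \<and>
       H (\<pi> a + norm (a - \<pi> a) *\<^sub>R ?e) = a"
    and H3: "\<forall>w. norm (\<pi> w) < \<delta> --> 0 < w $ j --> w $ j < \<delta> -->
       ((\<lambda>w. H (coord_proj ?K w)) has_derivative H' w) (at w)"
    and H4: "\<forall>v. continuous_on {w. norm (\<pi> w) < \<delta> \<and> 0 < w $ j \<and> w $ j < \<delta>} (\<lambda>w. H' w v)"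
    using sheet_over[OF j dn cn c1 norm_zero \<delta>0(1) zero_less_one pos inj] by (elim exE conjE) (rule that; assumption)
  obtain e where e: "e > 0" "(\<integral>\<^sup>+ t \<in> {0..e}. gap_ratio I Z t \<partial>lborel) < \<infinity>" using r_int by blast
  have "\<eta> / 26 > 0" using assms by simp
  from increment_small_of_speed_le[where ?'a = "real ^ 'n", OF e(2,1) this]
  obtain \<tau>0 where \<tau>0: "\<tau>0 > 0" "\<forall>\<tau> \<kappa>. \<forall>(h :: real \<Rightarrow> real ^ 'n) h'. 0 \<le> \<tau> --> \<tau> \<le> \<tau>0 --> \<kappa> > 0 -->
    (\<forall>t\<in>{0..\<tau>}. (h has_vector_derivative h' t) (at t within {0..\<tau>})) --> continuous_on {0..\<tau>} h' -->
    (\<forall>t\<in>{0..\<tau>}. ennreal (norm (h' t) / \<kappa>) \<le> gap_ratio I Z t) --> norm (h \<tau> - h 0) \<le> \<kappa> * (\<eta> / 26)"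
    by (elim exE conjE) (rule that; assumption)
  have \<pi>e: "\<pi> ?e = 0" using j by (auto simp: vec_eq_iff coord_proj_def axis_def)
  have key: "norm ((a - \<pi> a) - H (norm (a - \<pi> a) *\<^sub>R ?e)) \<le> \<eta> / 2 * norm (a - \<pi> a)"
    if a: "a \<in> Z" "norm a < min \<rho> \<tau>0" for a
  proof (cases "\<pi> a = 0")
    case True
    have "H (norm (a - \<pi> a) *\<^sub>R ?e) = a" using H2[rule_format, OF a(1)] a(2) True by simp
    then show ?thesis using True assms by simp
  next
    case False
    define s where "s = norm (a - \<pi> a)"
    define \<tau> where "\<tau> = norm (\<pi> a)"
    define u where "u = \<pi> a /\<^sub>R \<tau>"
    define W where "W = (\<lambda>t. t *\<^sub>R u + s *\<^sub>R ?e)"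
    have ha: "\<tau> < \<delta>" "0 < s" "s < \<delta>" "H (\<pi> a + s *\<^sub>R ?e) = a" using H2 a by (auto simp: s_def \<tau>_def)
    have \<tau>: "0 < \<tau>" "\<tau> \<le> \<tau>0" using False a(2) norm_coord_proj_le[of I a] by (auto simp: \<tau>_def)
    have nu: "norm u = 1" and \<tau>u: "\<tau> *\<^sub>R u = \<pi> a" using \<tau>(1) by (auto simp: u_def \<tau>_def)
    have uE: "u \<in> E" unfolding u_def by (intro subspace_scale subspace_coord_plane coord_proj_in)
    then have uK: "u \<in> coord_plane ?K" and uj: "u $ j = 0" using j by (auto simp: coord_plane_def)
    have \<pi>W: "\<pi> (W t) = t *\<^sub>R u" for t
      using linear_coord_proj[of I] by (simp add: W_def linear_add linear_scale \<pi>e coord_proj_id[OF uE])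
    have Wj: "W t $ j = s" for t by (simp add: W_def uj axis_def)
    have WK: "W t \<in> coord_plane ?K" for t using uK by (auto simp: W_def coord_plane_def axis_def)
    have W: "norm (\<pi> (W t)) < \<delta>" "0 < W t $ j" "W t $ j < \<delta>" "norm (\<pi> (W t)) = t" if "t \<in> {0..\<tau>}" for t
      using that ha nu by (auto simp: \<pi>W Wj)
    define h where "h = (\<lambda>t. H (W t) - t *\<^sub>R u)"
    define h' where "h' = (\<lambda>t. H' (W t) u - u)"
    have dW: "(W has_derivative (\<lambda>k. k *\<^sub>R u)) (at t within A)" for t A
      unfolding W_def by (auto intro!: derivative_eq_intros)
    have dh: "(h has_vector_derivative h' t) (at t within {0..\<tau>})" if t: "t \<in> {0..\<tau>}" for t
    proof -
      have d: "((\<lambda>w. H (coord_proj ?K w)) has_derivative H' (W t)) (at (W t))" using H3 W[OF t] by blast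
      have "((\<lambda>t. H (coord_proj ?K (W t))) has_derivative (\<lambda>k. H' (W t) (k *\<^sub>R u))) (at t within {0..\<tau>})"
        by (rule has_derivative_compose[OF dW d])
      then have "((\<lambda>t. H (W t)) has_vector_derivative H' (W t) u) (at t within {0..\<tau>})"
        unfolding has_vector_derivative_def coord_proj_id[OF WK] linear_scale[OF has_derivative_linear[OF d]] .
      moreover have "((\<lambda>t. t *\<^sub>R u) has_vector_derivative u) (at t within {0..\<tau>})"
        unfolding has_vector_derivative_def by (auto intro!: derivative_eq_intros)
      ultimately show ?thesis unfolding h_def h'_def by (rule has_vector_derivative_diff)
    qed
    have ch: "continuous_on {0..\<tau>} h'" unfolding h'_def
    proof (intro continuous_intros)
      have cW: "continuous_on {0..\<tau>} W" unfolding W_def by (intro continuous_intros)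
      have WS: "W ` {0..\<tau>} \<subseteq> {w. norm (\<pi> w) < \<delta> \<and> 0 < w $ j \<and> w $ j < \<delta>}" using W(1-3) by auto
      have cH: "continuous_on {w. norm (\<pi> w) < \<delta> \<and> 0 < w $ j \<and> w $ j < \<delta>} (\<lambda>w. H' w u)" using H4 by blast
      show "continuous_on {0..\<tau>} (\<lambda>t. H' (W t) u)" by (rule continuous_on_compose2[OF cH cW WS])
    qed
    have le: "ennreal (norm (h' t) / (13 * s)) \<le> gap_ratio I Z t" if t: "t \<in> {0..\<tau>}" for t
    proof -
      let ?b = "H (W t)" and ?m = "H' (W t) u"
      have b: "?b \<in> Z" "norm ?b < \<delta>0" "\<pi> ?b = \<pi> (W t)" "norm (?b - \<pi> ?b) = s"
        and mT: "?m \<in> T ?b" and pm: "\<pi> ?m + ((?m - \<pi> ?m) \<bullet> sgn (?b - \<pi> ?b)) *\<^sub>R ?e = u"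
        using H1[rule_format, OF WK W(1-3)[OF t]] Wj[of t] uK by auto
      obtain w where w: "w \<in> T ?b" "norm (u - w) \<le> gap E (T ?b) * norm u"
        using gap_near[OF subspace_coord_plane subspace_TZ[OF b(1)] uE] by blast
      let ?n = "?m - w" and ?s = "sgn (?b - \<pi> ?b)"
      have "\<pi> ?n + ((?n - \<pi> ?n) \<bullet> ?s) *\<^sub>R ?e = u - (\<pi> w + ((w - \<pi> w) \<bullet> ?s) *\<^sub>R ?e)"
        by (subst pm[symmetric]) (simp add: linear_diff[OF linear_coord_proj] inner_diff_left algebra_simps)
      also have "\<dots> = \<pi> (u - w) + (((u - w) - \<pi> (u - w)) \<bullet> ?s) *\<^sub>R ?e"
        using coord_proj_id[OF uE] by (simp add: linear_diff[OF linear_coord_proj] inner_diff_left algebra_simps)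
      finally have eq: "\<pi> ?n + ((?n - \<pi> ?n) \<bullet> ?s) *\<^sub>R ?e = \<pi> (u - w) + (((u - w) - \<pi> (u - w)) \<bullet> ?s) *\<^sub>R ?e" .
      have "norm (\<pi> (u - w) + (((u - w) - \<pi> (u - w)) \<bullet> ?s) *\<^sub>R ?e) \<le> 2 * norm (u - w)"
      proof -
        have "norm (\<pi> (u - w) + (((u - w) - \<pi> (u - w)) \<bullet> ?s) *\<^sub>R ?e) \<le> norm (\<pi> (u - w)) + \<bar>((u - w) - \<pi> (u - w)) \<bullet> ?s\<bar>"
          using norm_triangle_ineq[of "\<pi> (u - w)" "(((u - w) - \<pi> (u - w)) \<bullet> ?s) *\<^sub>R ?e"] by simp
        moreover have "\<bar>((u - w) - \<pi> (u - w)) \<bullet> ?s\<bar> \<le> norm ((u - w) - \<pi> (u - w)) * norm ?s" by (rule Cauchy_Schwarz_ineq2)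
        moreover have "norm ((u - w) - \<pi> (u - w)) * norm ?s \<le> norm ((u - w) - \<pi> (u - w)) * 1"
          by (intro mult_left_mono) (auto simp: norm_sgn)
        moreover have "norm ((u - w) - \<pi> (u - w)) \<le> norm ((u - w) - 0)"
          by (rule norm_minus_coord_proj_le[OF subspace_0[OF subspace_coord_plane]])
        moreover have "norm (\<pi> (u - w)) \<le> norm (u - w)" by (rule norm_coord_proj_le)
        ultimately show ?thesis by simp
      qed
      moreover have "?n \<in> T ?b" by (rule subspace_diff[OF subspace_TZ[OF b(1)] mT w(1)])
      ultimately have "norm ?n \<le> 12 * norm (u - w)" using \<delta>0(2)[OF b(1,2), of ?n] eq by simp
      moreover have "norm (h' t) \<le> norm ?n + norm (u - w)"
        using norm_triangle_ineq4[of ?n "u - w"] by (simp add: h'_def)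
      ultimately have "norm (h' t) \<le> 13 * gap E (T ?b)" using w(2) nu by simp
      then have "norm (h' t) / (13 * s) \<le> gap E (T ?b) / norm (?b - \<pi> ?b)"
        using ha(2) b(4) by (simp add: field_simps)
      then have "ennreal (norm (h' t) / (13 * s)) \<le> ennreal (gap E (T ?b) / norm (?b - \<pi> ?b))" by (rule ennreal_leI)
      also have "\<dots> \<le> gap_ratio I Z t" unfolding gap_ratio_def
        by (rule SUP_upper) (use b(1,3) W(4)[OF t] in simp)
      finally show ?thesis .
    qed
    have "norm (h \<tau> - h 0) \<le> 13 * s * (\<eta> / 26)"
      by (rule \<tau>0(2)[rule_format, of \<tau> "13 * s" h h']) (use \<tau> ha(2) dh ch le in auto)
    moreover have "W \<tau> = \<pi> a + s *\<^sub>R ?e" "W 0 = s *\<^sub>R ?e" by (simp_all add: W_def \<tau>u)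
    ultimately show ?thesis using ha(4) by (simp add: h_def \<tau>u s_def[symmetric])
  qed
  have "norm ((a - \<pi> a) - (b - \<pi> b)) \<le> \<eta> * norm (a - \<pi> a)"
    if "a \<in> Z" "b \<in> Z" "norm a < min \<rho> \<tau>0" "norm b < min \<rho> \<tau>0" "norm (a - \<pi> a) = norm (b - \<pi> b)" for a b
    using key[OF that(1,3)] key[OF that(2,4)] unfolding that(5)
    using dist_triangle2[of "a - \<pi> a" "b - \<pi> b" "H (norm (b - \<pi> b) *\<^sub>R ?e)"] unfolding dist_norm by linarith
  then show ?thesis using \<delta>(2) \<tau>0(1) by (intro exI[of _ "min \<rho> \<tau>0"]) auto
qed

lemma limit_direction:
  shows "\<exists>\<nu>. norm \<nu> = 1 \<and> \<pi> \<nu> = 0 \<and> (\<forall>\<epsilon>>0. \<exists>\<delta>>0. \<forall>a\<in>Z. norm a < \<delta> --> norm (sgn (a - \<pi> a) - \<nu>) \<le> \<epsilon>)"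
proof -
  define B where "B = (\<lambda>y p. y \<in> Y \<and> near y p)"
  have definable_B: "definable_pred (\<lambda>z. B (fst z) (snd z))"
    unfolding B_def near_def
    by (intro definable_intros definable_pred_compose[OF definable_imp_definable_pred[OF definable_X]]
        definable_pred_compose[OF definable_imp_definable_pred[OF definable_Y]])
  have Bn: "\<forall>y p. B y p --> y \<noteq> p \<and> norm (y - p) \<le> norm (y - x0)"
    using near_le disjoint by (auto simp: B_def near_def)
  have Bx: "\<forall>\<epsilon>>0. \<exists>y p. B y p \<and> norm (y - x0) < \<epsilon>"
  proof (intro allI impI)
    fix \<epsilon> :: real assume "\<epsilon> > 0"
    then have "min \<epsilon> (r / 2) > 0" using r(1) by simp
    then obtain y where y: "y \<in> Y" "dist y x0 < min \<epsilon> (r / 2)"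
      using x0_closure unfolding closure_approachable by blast
    have "2 * norm (y - x0) < r" using y(2) by (simp add: dist_norm)
    then obtain p where "near y p" using near_exists by blast
    then show "\<exists>y p. B y p \<and> norm (y - x0) < \<epsilon>" using y by (auto simp: B_def dist_norm)
  qed
  obtain \<gamma> p where c: "definable_map \<gamma>" "definable_map p"
    "\<forall>\<^sub>F s in at_right 0. B (\<gamma> s) (p s) \<and> norm (\<gamma> s - p s) = s" "(\<gamma> \<longlongrightarrow> x0) (at_right 0)"
    by (rule definable_curve_selection[OF definable_B Bn Bx])
  have evn: "\<forall>\<^sub>F s in at_right 0. norm (\<gamma> s - p s) = s" using c(3) by eventually_elim simp
  obtain e \<gamma>' p' w q where e: "e > 0" and "continuous_on {0<..<e} \<gamma>'" and "continuous_on {0<..<e} p'"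
    and d\<gamma>: "\<forall>x\<in>{0<..<e}. (\<gamma> has_vector_derivative \<gamma>' x) (at x)"
    and "\<forall>x\<in>{0<..<e}. (p has_vector_derivative p' x) (at x)"
    and uw: "((\<lambda>s. (\<gamma> s - p s) /\<^sub>R s) \<longlongrightarrow> w) (at_right 0)" and "((\<lambda>s. \<gamma>' s - p' s) \<longlongrightarrow> w) (at_right 0)"
    and "((\<lambda>s. s *\<^sub>R p' s) \<longlongrightarrow> 0) (at_right 0)" and "((\<lambda>s. sgn (p' s)) \<longlongrightarrow> q) (at_right 0)"
    by (rule definable_curve_asymptotics[OF c(1,2) evn c(4)])
  have pos: "\<forall>\<^sub>F s in at_right 0. (0::real) < s" by (rule eventually_at_right_less)
  have "((\<lambda>s. norm (\<gamma> s - p s)) \<longlongrightarrow> 0) (at_right 0)"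
    by (rule tendsto_cong[OF evn, THEN iffD2]) (rule tendsto_ident_at)
  from tendsto_diff[OF c(4) tendsto_norm_zero_cancel[OF this]]
  have p0: "(p \<longlongrightarrow> x0) (at_right 0)" by simp
  have ev_near: "\<forall>\<^sub>F s in at_right 0. norm (\<gamma> s - x0) < \<delta>" if "\<delta> > 0" for \<delta>
    using tendstoD[OF c(4) that] by (simp add: dist_norm)
  have ev_r: "\<forall>\<^sub>F s in at_right 0. 2 * L * norm (\<gamma> s - x0) \<le> r"
  proof -
    have "\<forall>\<^sub>F s in at_right 0. norm (\<gamma> s - x0) < r / (2 * L)" by (rule ev_near) (use r(1) L in simp)
    then show ?thesis by eventually_elim (use L in \<open>simp add: less_divide_eq mult.commute\<close>)
  qed
  define z where "z = (\<lambda>s. f (\<gamma> s) - \<pi> (f (\<gamma> s)))"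
  define \<nu>0 where "\<nu>0 = Df x0 w - \<pi> (Df x0 w)"
  have ev: "\<forall>\<^sub>F s in at_right 0. 0 < s \<and> \<gamma> s \<in> Y \<and> near (\<gamma> s) (p s) \<and> norm (\<gamma> s - p s) = s \<and> 2 * L * norm (\<gamma> s - x0) \<le> r"
    using pos c(3) ev_r by eventually_elim (simp add: B_def)
  have lim: "((\<lambda>s. z s /\<^sub>R s) \<longlongrightarrow> \<nu>0) (at_right 0)"
  proof -
    have "((\<lambda>s. Df (p s) ((\<gamma> s - p s) /\<^sub>R s)) \<longlongrightarrow> Df x0 w) (at_right 0)" by (rule Df_tendsto[OF p0 uw])
    then have 1: "((\<lambda>s. Df (p s) ((\<gamma> s - p s) /\<^sub>R s) - \<pi> (Df (p s) ((\<gamma> s - p s) /\<^sub>R s))) \<longlongrightarrow> \<nu>0) (at_right 0)"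
      unfolding \<nu>0_def by (intro tendsto_diff bounded_linear.tendsto[OF bounded_linear_coord_proj])
    have "((\<lambda>s. z s /\<^sub>R s - (Df (p s) ((\<gamma> s - p s) /\<^sub>R s) - \<pi> (Df (p s) ((\<gamma> s - p s) /\<^sub>R s)))) \<longlongrightarrow> 0) (at_right 0)"
    proof (rule Lim_null_comparison)
      show "((\<lambda>s. L * s) \<longlongrightarrow> 0) (at_right 0)" by (auto intro!: tendsto_eq_intros)
      show "\<forall>\<^sub>F s in at_right 0. norm (z s /\<^sub>R s - (Df (p s) ((\<gamma> s - p s) /\<^sub>R s) - \<pi> (Df (p s) ((\<gamma> s - p s) /\<^sub>R s)))) \<le> L * s"
        using ev
      proof eventually_elim
        case (elim s)
        then have s: "0 < s" and n: "norm (\<gamma> s - p s) = s" by auto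
        note nb = near_bounds[of "\<gamma> s" "p s"]
        have b: "\<gamma> s \<in> cball x0 r" "p s \<in> cball x0 r" "p s \<in> U" "f (p s) \<in> E" using nb elim ball_U by auto
        have lin: "linear (Df (p s))" by (rule linear_Df[OF b(3)])
        define R where "R = f (\<gamma> s) - f (p s) - Df (p s) (\<gamma> s - p s)"
        have R: "norm R \<le> L * s * s" using f_taylor[OF b(1,2)] n by (simp add: R_def)
        have "z s = (f (\<gamma> s) - f (p s)) - \<pi> (f (\<gamma> s) - f (p s))"
          unfolding z_def by (simp add: linear_diff[OF linear_coord_proj] coord_proj_id[OF b(4)])
        also have "f (\<gamma> s) - f (p s) = Df (p s) (\<gamma> s - p s) + R" by (simp add: R_def)
        finally have zs: "z s = (Df (p s) (\<gamma> s - p s) - \<pi> (Df (p s) (\<gamma> s - p s))) + (R - \<pi> R)"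
          by (simp add: linear_add[OF linear_coord_proj])
        have "z s /\<^sub>R s - (Df (p s) ((\<gamma> s - p s) /\<^sub>R s) - \<pi> (Df (p s) ((\<gamma> s - p s) /\<^sub>R s))) = (R - \<pi> R) /\<^sub>R s"
          unfolding zs linear_scale[OF lin] linear_scale[OF linear_coord_proj] by (simp add: algebra_simps)
        also have "norm \<dots> = norm (R - \<pi> R) / s" using s by (simp add: divide_inverse mult.commute)
        also have "\<dots> \<le> (L * s * s) / s"
        proof (rule divide_right_mono)
          have "norm (R - \<pi> R) \<le> norm (R - 0)" by (rule norm_minus_coord_proj_le[OF subspace_0[OF subspace_coord_plane]])
          then show "norm (R - \<pi> R) \<le> L * s * s" using R by simp
        qed (use s in simp)
        also have "\<dots> = L * s" using s by simp
        finally show ?case .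
      qed
    qed
    from tendsto_add[OF this 1] show ?thesis by simp
  qed
  have "1 / L \<le> norm \<nu>0"
  proof (rule tendsto_lowerbound[OF tendsto_norm[OF lim]])
    show "\<forall>\<^sub>F s in at_right 0. 1 / L \<le> norm (z s /\<^sub>R s)" using ev
    proof eventually_elim
      case (elim s)
      then have "s \<le> L * norm (z s)" using near_bounds(6)[of "\<gamma> s" "p s"] by (simp add: z_def)
      then show ?case using elim L by (simp add: field_simps)
    qed
  qed simp
  then have \<nu>0: "\<nu>0 \<noteq> 0" using L by auto
  have lsgn: "((\<lambda>s. sgn (z s)) \<longlongrightarrow> sgn \<nu>0) (at_right 0)"
  proof (rule Lim_transform_eventually[OF tendsto_sgn[OF lim \<nu>0]])
    show "\<forall>\<^sub>F s in at_right 0. sgn (z s /\<^sub>R s) = sgn (z s)" using pos by eventually_elim (simp add: sgn_scaleR)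
  qed
  have lf: "((\<lambda>s. f (\<gamma> s)) \<longlongrightarrow> 0) (at_right 0)"
  proof -
    have "isCont f x0" using f_continuous opens(1) x0(2) by (simp add: continuous_on_eq_continuous_at)
    from isCont_tendsto_compose[OF this c(4)] show ?thesis by (simp add: x0(3))
  qed
  have lz: "((\<lambda>s. norm (z s)) \<longlongrightarrow> 0) (at_right 0)"
  proof -
    have "((\<lambda>s. norm (f (\<gamma> s) - \<pi> (f (\<gamma> s)))) \<longlongrightarrow> norm (0 - \<pi> 0)) (at_right 0)"
      by (intro tendsto_norm tendsto_diff lf bounded_linear.tendsto[OF bounded_linear_coord_proj])
    then show ?thesis by (simp add: z_def linear_0[OF linear_coord_proj])
  qed
  have "\<exists>\<delta>>0. \<forall>a\<in>Z. norm a < \<delta> --> norm (sgn (a - \<pi> a) - sgn \<nu>0) \<le> \<epsilon>" if \<epsilon>: "\<epsilon> > 0" for \<epsilon>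
  proof -
    have "\<epsilon> / 2 > 0" using \<epsilon> by simp
    then obtain \<rho> where \<rho>: "\<rho> > 0" "\<And>a b. a \<in> Z ==> b \<in> Z ==> norm a < \<rho> ==> norm b < \<rho> ==>
      norm (a - \<pi> a) = norm (b - \<pi> b) ==> norm ((a - \<pi> a) - (b - \<pi> b)) \<le> \<epsilon> / 2 * norm (a - \<pi> a)"
      using heights_close by meson
    have "\<forall>\<^sub>F s in at_right 0. (\<gamma> s \<in> Y \<and> norm (\<gamma> s - x0) < r) \<and> norm (f (\<gamma> s)) < \<rho> \<and> norm (sgn (z s) - sgn \<nu>0) < \<epsilon> / 2 \<and> s \<in> {0<..<e}"
    proof (intro eventually_conj eventually_at_right_real e ev_near r(1))
      show "\<forall>\<^sub>F s in at_right 0. \<gamma> s \<in> Y" using ev by eventually_elim simp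
      show "\<forall>\<^sub>F s in at_right 0. norm (f (\<gamma> s)) < \<rho>" using tendstoD[OF lf \<rho>(1)] by simp
      show "\<forall>\<^sub>F s in at_right 0. norm (sgn (z s) - sgn \<nu>0) < \<epsilon> / 2" using tendstoD[OF lsgn \<open>\<epsilon> / 2 > 0\<close>] by (simp add: dist_norm)
    qed
    then obtain t1' where t1': "t1' > 0" "\<And>s. 0 < s ==> s < t1' ==> (\<gamma> s \<in> Y \<and> norm (\<gamma> s - x0) < r) \<and> norm (f (\<gamma> s)) < \<rho> \<and>
        norm (sgn (z s) - sgn \<nu>0) < \<epsilon> / 2 \<and> s \<in> {0<..<e}"
      unfolding eventually_at_right_field by auto
    define t1 where "t1 = t1' / 2"
    have t1: "t1 > 0" "t1 < t1'" using t1'(1) by (auto simp: t1_def)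
    have fZ: "f (\<gamma> s) \<in> Z" "\<gamma> s \<in> U" if "0 < s" "s < t1'" for s
    proof -
      have "norm (\<gamma> s - x0) \<le> r" using t1'(2)[OF that] by simp
      then show "\<gamma> s \<in> U" by (rule ball_U)
      then show "f (\<gamma> s) \<in> Z" using t1'(2)[OF that] by blast
    qed
    have zp: "norm (z s) > 0" if "0 < s" "s < t1'" for s using Z_height[OF fZ(1)[OF that]] by (simp add: z_def)
    have "norm (sgn (b - \<pi> b) - sgn \<nu>0) \<le> \<epsilon>" if b: "b \<in> Z" "norm b < min \<rho> (norm (z t1))" for b
    proof -
      define s where "s = norm (b - \<pi> b)"
      have s0: "s > 0" using Z_height[OF b(1)] by (simp add: s_def)
      have "norm (b - \<pi> b) \<le> norm (b - 0)" by (rule norm_minus_coord_proj_le[OF subspace_0[OF subspace_coord_plane]])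
      then have s1: "s < norm (z t1)" using b(2) by (simp add: s_def)
      have "\<forall>\<^sub>F t in at_right 0. norm (z t) < s \<and> t \<in> {0<..<t1}"
        using order_tendstoD(2)[OF lz s0] eventually_at_right_real[OF t1(1)] by eventually_elim simp
      then obtain t2 where t2: "norm (z t2) < s" "0 < t2" "t2 < t1"
        using eventually_happens[of _ "at_right (0::real)"] trivial_limit_at_right_real by fastforce
      have "continuous_on {t2..t1} \<gamma>"
      proof (rule continuous_at_imp_continuous_on, intro ballI)
        fix t assume "t \<in> {t2..t1}"
        then have "0 < t" "t < t1'" using t2 t1 by auto
        then have "t \<in> {0<..<e}" using t1'(2) by blast
        then show "isCont \<gamma> t" using d\<gamma> has_vector_derivative_continuous by blast
      qed
      then have "continuous_on {t2..t1} (\<lambda>t. f (\<gamma> t))"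
        by (rule continuous_on_compose2[OF f_continuous]) (use fZ(2) t2 t1 in auto)
      then have "continuous_on {t2..t1} (\<lambda>t. norm (z t))" unfolding z_def
        by (intro continuous_intros continuous_on_compose2[OF linear_continuous_on[OF bounded_linear_coord_proj, of UNIV]]) auto
      then obtain t where t: "t2 \<le> t" "t \<le> t1" "norm (z t) = s"
        using IVT'[of "\<lambda>t. norm (z t)" t2 s t1] t2 s1 by auto
      have tt: "0 < t" "t < t1'" using t t2 t1 by auto
      have "norm (z t - (b - \<pi> b)) \<le> \<epsilon> / 2 * s"
        using \<rho>(2)[OF fZ(1)[OF tt] b(1)] t1'(2)[OF tt] b(2) t(3) by (simp add: z_def s_def)
      then have "norm (z t - (b - \<pi> b)) / s \<le> \<epsilon> / 2" using s0 by (simp add: divide_le_eq)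
      moreover have eq: "sgn (z t) - sgn (b - \<pi> b) = (z t - (b - \<pi> b)) /\<^sub>R s"
        using t(3) by (simp add: sgn_div_norm s_def scaleR_diff_right)
      moreover have "norm (sgn (z t) - sgn (b - \<pi> b)) = norm (z t - (b - \<pi> b)) / s"
        unfolding eq using s0 by (simp add: divide_inverse mult.commute)
      ultimately have "norm (sgn (z t) - sgn (b - \<pi> b)) \<le> \<epsilon> / 2" by linarith
      moreover have "norm (sgn (z t) - sgn \<nu>0) < \<epsilon> / 2" using t1'(2)[OF tt] by blast
      ultimately show ?thesis
        using norm_triangle_ineq4[of "sgn (z t) - sgn \<nu>0" "sgn (z t) - sgn (b - \<pi> b)"] by simp
    qed
    then show ?thesis using \<rho>(1) zp[OF t1] by (intro exI[of _ "min \<rho> (norm (z t1))"]) auto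
  qed
  moreover have "norm (sgn \<nu>0) = 1" using \<nu>0 by (simp add: norm_sgn)
  moreover have "\<pi> (sgn \<nu>0) = 0" unfolding \<nu>0_def by (rule proj_sgn_height)
  ultimately show ?thesis by blast
qed

lemma limit_tangent:
  shows "\<exists>F. subspace F \<and> dim F = d + 1 \<and> (\<forall>v\<in>F. \<forall>\<epsilon>>0. \<exists>\<delta>>0. \<forall>y\<in>Y. norm (y - x0) < \<delta> -->
    (\<exists>w\<in>tangent_space Y y. norm (v - w) \<le> \<epsilon>))"
proof -
  obtain \<nu> where \<nu>: "norm \<nu> = 1" "\<pi> \<nu> = 0"
    "\<And>\<epsilon>. \<epsilon> > 0 ==> \<exists>\<delta>>0. \<forall>a\<in>Z. norm a < \<delta> --> norm (sgn (a - \<pi> a) - \<nu>) \<le> \<epsilon>"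
    using limit_direction by blast
  have sE: "span E = E" by (rule span_eq_iff[THEN iffD2, OF subspace_coord_plane])
  have "\<nu> \<notin> E" using \<nu>(1,2) coord_proj_id[of \<nu> I] by auto
  then have dimF: "dim (span (insert \<nu> E)) = d + 1"
    by (simp add: dim_insert sE dim_coord_plane card_I)
  let ?F = "Dg 0 ` span (insert \<nu> E)"
  have lin: "linear (Dg 0)" using linear_Dg[OF x0(2)] x0(3) by simp
  have "inj_on (Dg 0) (span (span (insert \<nu> E)))"
    by (rule inj_on_inverseI[of _ "Df x0"]) (use Dfg(4)[OF x0(2)] x0(3) in simp)
  from dim_image_eq[OF lin this] have "dim ?F = d + 1" using dimF by simp
  moreover have "subspace ?F" by (rule linear_subspace_image[OF lin subspace_span])
  moreover have "\<exists>\<delta>>0. \<forall>y\<in>Y. norm (y - x0) < \<delta> --> (\<exists>w\<in>tangent_space Y y. norm (v - w) \<le> \<epsilon>)"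
    if v: "v \<in> ?F" and \<epsilon>: "\<epsilon> > 0" for v \<epsilon>
  proof -
    obtain u where u: "u \<in> span (insert \<nu> E)" "v = Dg 0 u" using v by blast
    obtain c where c: "u - c *\<^sub>R \<nu> \<in> E" using u(1) unfolding span_breakdown_eq sE by blast
    define M where "M = norm (u - c *\<^sub>R \<nu>) + 2 * \<bar>c\<bar> + L * norm v + 1"
    have M: "M > 0" using L by (simp add: M_def add_nonneg_pos)
    define \<epsilon>1 where "\<epsilon>1 = \<epsilon> / (L * M)"
    have \<epsilon>1: "\<epsilon>1 > 0" "L * (\<epsilon>1 * M) = \<epsilon>" using \<epsilon> L M by (auto simp: \<epsilon>1_def)
    obtain \<delta>1 where \<delta>1: "\<delta>1 > 0" "\<delta>1 \<le> r" "\<And>a. a \<in> Z ==> norm a < \<delta>1 ==> gap E (T a) \<le> \<epsilon>1 \<and>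
      (\<exists>w\<in>T a. norm (a - \<pi> a - w) \<le> \<epsilon>1 * norm (a - \<pi> a))" using Z_near[OF \<epsilon>1(1)] by blast
    obtain \<delta>2 where \<delta>2: "\<delta>2 > 0" "\<And>a. a \<in> Z ==> norm a < \<delta>2 ==> norm (sgn (a - \<pi> a) - \<nu>) \<le> \<epsilon>1" using \<nu>(3)[OF \<epsilon>1(1)] by blast
    define \<delta> where "\<delta> = min (min \<epsilon>1 r) (min \<delta>1 \<delta>2 / L)"
    have "\<delta> > 0" using \<epsilon>1(1) r(1) \<delta>1(1) \<delta>2(1) L by (simp add: \<delta>_def)
    moreover have "\<exists>w\<in>tangent_space Y y. norm (v - w) \<le> \<epsilon>" if y: "y \<in> Y" "norm (y - x0) < \<delta>" for y
    proof -
      have yr: "norm (y - x0) \<le> r" and y\<epsilon>: "norm (y - x0) \<le> \<epsilon>1" and "norm (y - x0) < min \<delta>1 \<delta>2 / L"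
        using y(2) by (auto simp: \<delta>_def)
      then have "L * norm (y - x0) < min \<delta>1 \<delta>2" using L by (simp add: field_simps)
      then have fy: "norm (f y) < \<delta>1" "norm (f y) < \<delta>2" using f_small[OF yr] by auto
      have yU: "y \<in> U" and yb: "y \<in> cball x0 r" and x0b: "x0 \<in> cball x0 r" using ball_U[OF yr] r(1) by auto
      have a: "f y \<in> Z" using yU y(1) by blast
      let ?z = "f y - \<pi> (f y)"
      obtain w1 where w1: "w1 \<in> T (f y)" "norm ((u - c *\<^sub>R \<nu>) - w1) \<le> gap E (T (f y)) * norm (u - c *\<^sub>R \<nu>)"
        using gap_near[OF subspace_coord_plane subspace_TZ[OF a] c] by blast
      have "gap E (T (f y)) * norm (u - c *\<^sub>R \<nu>) \<le> \<epsilon>1 * norm (u - c *\<^sub>R \<nu>)"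
        using \<delta>1(3)[OF a fy(1)] by (intro mult_right_mono) auto
      then have w1': "norm ((u - c *\<^sub>R \<nu>) - w1) \<le> \<epsilon>1 * norm (u - c *\<^sub>R \<nu>)" using w1(2) by linarith
      obtain w2 where w2: "w2 \<in> T (f y)" "norm (?z - w2) \<le> \<epsilon>1 * norm ?z" using \<delta>1(3)[OF a fy(1)] by blast
      have z0: "norm ?z > 0" using Z_height[OF a] by simp
      have eq: "sgn ?z - w2 /\<^sub>R norm ?z = (?z - w2) /\<^sub>R norm ?z" by (simp add: sgn_div_norm scaleR_diff_right)
      have "norm (sgn ?z - w2 /\<^sub>R norm ?z) = norm (?z - w2) / norm ?z" unfolding eq by (simp add: divide_inverse mult.commute)
      also have "\<dots> \<le> \<epsilon>1" using w2(2) z0 by (simp add: divide_le_eq)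
      finally have "norm (sgn ?z - w2 /\<^sub>R norm ?z) \<le> \<epsilon>1" .
      then have "norm (\<nu> - w2 /\<^sub>R norm ?z) \<le> 2 * \<epsilon>1"
        using \<delta>2(2)[OF a fy(2)] norm_triangle_ineq4[of "sgn ?z - w2 /\<^sub>R norm ?z" "sgn ?z - \<nu>"] by simp
      then have w2': "norm (c *\<^sub>R (\<nu> - w2 /\<^sub>R norm ?z)) \<le> \<bar>c\<bar> * (2 * \<epsilon>1)"
        unfolding norm_scaleR by (rule mult_left_mono) simp
      define w where "w = w1 + c *\<^sub>R (w2 /\<^sub>R norm ?z)"
      have wT: "w \<in> T (f y)" unfolding w_def by (intro subspace_add subspace_scale subspace_TZ[OF a] w1(1) w2(1))
      have eq: "u - w = ((u - c *\<^sub>R \<nu>) - w1) + c *\<^sub>R (\<nu> - w2 /\<^sub>R norm ?z)" by (simp add: w_def algebra_simps)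
      have uw: "norm (u - w) \<le> \<epsilon>1 * norm (u - c *\<^sub>R \<nu>) + \<bar>c\<bar> * (2 * \<epsilon>1)"
        unfolding eq
        using w1' w2' norm_triangle_ineq[of "(u - c *\<^sub>R \<nu>) - w1" "c *\<^sub>R (\<nu> - w2 /\<^sub>R norm ?z)"] by linarith
      obtain w' where w': "w' \<in> tangent_space Y y" "w = Df y w'" using wT T_image[OF yU y(1)] by blast
      have fyr: "f y \<in> cball 0 r" using fy(1) \<delta>1(2) by simp
      have "Df x0 v = u" using Dfg(4)[OF x0(2)] x0(3) u(2) by simp
      then have "Df y (v - w') = (Df y v - Df x0 v) + (u - w)" using linear_Df[OF yU] w'(2) by (simp add: linear_diff)
      then have "norm (Df y (v - w')) \<le> norm (Df y v - Df x0 v) + norm (u - w)" by (metis norm_triangle_ineq)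
      also have "\<dots> \<le> L * norm (y - x0) * norm v + (\<epsilon>1 * norm (u - c *\<^sub>R \<nu>) + \<bar>c\<bar> * (2 * \<epsilon>1))"
        by (intro add_mono Df_lipschitz yb x0b uw)
      also have "\<dots> \<le> L * \<epsilon>1 * norm v + (\<epsilon>1 * norm (u - c *\<^sub>R \<nu>) + \<bar>c\<bar> * (2 * \<epsilon>1))"
        using y\<epsilon> L by (intro add_right_mono mult_right_mono mult_left_mono) auto
      also have "\<dots> \<le> \<epsilon>1 * M" using \<epsilon>1(1) by (simp add: M_def algebra_simps)
      finally have "norm (Df y (v - w')) \<le> \<epsilon>1 * M" .
      then have "L * norm (Df y (v - w')) \<le> L * (\<epsilon>1 * M)" using L by (intro mult_left_mono) auto
      moreover have "norm (Dg (f y) (Df y (v - w'))) \<le> L * norm (Df y (v - w'))" by (rule g_bound[OF fyr])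
      ultimately have "norm (v - w') \<le> \<epsilon>" unfolding Dfg(3)[OF yU] \<epsilon>1(2) by linarith
      then show ?thesis using w'(1) by blast
    qed
    ultimately show ?thesis by blast
  qed
  ultimately show ?thesis by blast
qed

end

section \<open>Odd extension across a hyperplane\<close>

lemma mean_value_linear:
  fixes f :: "'a::euclidean_space \<Rightarrow> 'b::euclidean_space" and \<epsilon> :: real
  assumes S: "convex S" and f: "\<And>x. x \<in> S ==> (f has_derivative f' x) (at x)" and D: "linear D"
    and le: "\<And>x b. x \<in> S ==> b \<in> Basis ==> norm (f' x b - D b) \<le> \<epsilon>" and xy: "x \<in> S" "y \<in> S"
  shows "norm (f x - f y - D (x - y)) \<le> DIM('a) * \<epsilon> * norm (x - y)"
proof -
  have bl: "bounded_linear D" using D by (simp add: linear_conv_bounded_linear)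
  have d: "((\<lambda>x. f x - D x) has_derivative (\<lambda>v. f' x v - D v)) (at x within S)" if "x \<in> S" for x
    by (intro has_derivative_diff has_derivative_at_withinI[OF f[OF that]] bounded_linear_imp_has_derivative[OF bl])
  have on: "onorm (\<lambda>v. f' x v - D v) \<le> DIM('a) * \<epsilon>" if x: "x \<in> S" for x
  proof (rule onorm_le)
    fix v
    have "linear (\<lambda>v. f' x v - D v)" using has_derivative_linear[OF d[OF x]] .
    from linear_bound_Basis[OF this, of "\<lambda>_. \<epsilon>" v] le[OF x]
    show "norm (f' x v - D v) \<le> DIM('a) * \<epsilon> * norm v" by simp
  qed
  have "norm ((\<lambda>x. f x - D x) x - (\<lambda>x. f x - D x) y) \<le> DIM('a) * \<epsilon> * norm (x - y)"
    by (rule differentiable_bound[OF S _ _ xy, where f' = "\<lambda>x v. f' x v - D v"]) ((rule d, assumption) | (rule on, assumption))+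
  then show ?thesis using D by (simp add: linear_diff algebra_simps)
qed

definition strict_derivative :: "('a::real_normed_vector \<Rightarrow> 'b::real_normed_vector) \<Rightarrow> ('a \<Rightarrow> 'b) \<Rightarrow> 'a \<Rightarrow> bool" where
  "strict_derivative f D x \<longleftrightarrow> linear D \<and> (\<forall>\<epsilon>>0. \<exists>\<delta>>0. \<forall>u v. norm (u - x) < \<delta> --> norm (v - x) < \<delta> -->
     norm (f u - f v - D (u - v)) \<le> \<epsilon> * norm (u - v))"

lemma C_1_on_strict:
  fixes f :: "'a::euclidean_space \<Rightarrow> 'b::euclidean_space"
  assumes A: "open A" and s: "\<And>x. x \<in> A ==> \<exists>D. strict_derivative f D x"
  shows "C_k_on 1 f A"
proof -
  have "\<forall>x\<in>A. \<exists>D. strict_derivative f D x" using s by blast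
  then obtain D where D: "\<forall>x\<in>A. strict_derivative f (D x) x" by (rule bchoice[THEN exE])
  have lin: "linear (D x)" if "x \<in> A" for x using D that by (simp add: strict_derivative_def)
  have sd: "\<exists>\<delta>>0. \<forall>u v. norm (u - x) < \<delta> --> norm (v - x) < \<delta> --> norm (f u - f v - D x (u - v)) \<le> \<epsilon> * norm (u - v)"
    if "x \<in> A" "\<epsilon> > 0" for x \<epsilon> using D that by (simp add: strict_derivative_def)
  show ?thesis
  proof (rule C_1_onI)
    fix x assume x: "x \<in> A"
    show "(f has_derivative D x) (at x)" unfolding has_derivative_at_alt
    proof (intro conjI allI impI)
      show "bounded_linear (D x)" using lin[OF x] by (simp add: linear_conv_bounded_linear)
      fix e :: real assume "e > 0"
      then obtain \<delta> where \<delta>: "\<delta> > 0" "\<forall>u v. norm (u - x) < \<delta> --> norm (v - x) < \<delta> --> norm (f u - f v - D x (u - v)) \<le> e * norm (u - v)"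
        using sd[OF x] by blast
      show "\<exists>d>0. \<forall>y. norm (y - x) < d --> norm (f y - f x - D x (y - x)) \<le> e * norm (y - x)"
        using \<delta>(1) \<delta>(2)[rule_format, of _ x] by (intro exI[of _ \<delta>]) simp
    qed
  next
    fix v :: 'a
    show "continuous_on A (\<lambda>x. D x v)" unfolding continuous_on_iff
    proof (intro ballI allI impI)
      fix x and e :: real assume x: "x \<in> A" and e: "e > 0"
      define \<epsilon> where "\<epsilon> = e / (4 * (norm v + 1))"
      have nv: "norm v + 1 > 0" by (simp add: add_nonneg_pos)
      have \<epsilon>: "\<epsilon> > 0" using e nv by (simp add: \<epsilon>_def)
      have "2 * \<epsilon> * norm v \<le> 2 * \<epsilon> * (norm v + 1)" using \<epsilon> by (intro mult_left_mono) auto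
      also have "\<dots> = e / 2" using nv by (simp add: \<epsilon>_def field_simps)
      also have "\<dots> < e" using e by simp
      finally have small: "2 * \<epsilon> * norm v < e" .
      obtain \<delta> where \<delta>: "\<delta> > 0" "\<forall>u v. norm (u - x) < \<delta> --> norm (v - x) < \<delta> --> norm (f u - f v - D x (u - v)) \<le> \<epsilon> * norm (u - v)"
        using sd[OF x \<epsilon>] by blast
      have "dist (D y v) (D x v) < e" if y: "y \<in> A" "dist y x < \<delta>" for y
      proof -
        obtain \<delta>' where \<delta>': "\<delta>' > 0" "\<forall>u v. norm (u - y) < \<delta>' --> norm (v - y) < \<delta>' --> norm (f u - f v - D y (u - v)) \<le> \<epsilon> * norm (u - v)"
          using sd[OF y(1) \<epsilon>] by blast
        have yx: "norm (y - x) < \<delta>" using y(2) by (simp add: dist_norm)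
        define m where "m = min \<delta>' (\<delta> - norm (y - x))"
        have m: "m > 0" using \<delta>'(1) yx by (simp add: m_def)
        define s where "s = m / (2 * (norm v + 1))"
        have s: "s > 0" using m nv by (simp add: s_def)
        have "norm (s *\<^sub>R v) \<le> s * (norm v + 1)" using s by simp
        also have "\<dots> = m / 2" using nv by (simp add: s_def field_simps)
        also have "\<dots> < m" using m by simp
        finally have sv: "norm (s *\<^sub>R v) < \<delta>'" "norm (s *\<^sub>R v) < \<delta> - norm (y - x)" by (auto simp: m_def)
        have "norm (y + s *\<^sub>R v - x) \<le> norm (y - x) + norm (s *\<^sub>R v)"
          using norm_triangle_ineq[of "y - x" "s *\<^sub>R v"] by (simp add: algebra_simps)
        then have "norm (y + s *\<^sub>R v - x) < \<delta>" using sv(2) by linarith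
        from \<delta>(2)[rule_format, OF this yx]
        have 1: "norm (f (y + s *\<^sub>R v) - f y - D x (s *\<^sub>R v)) \<le> \<epsilon> * norm (s *\<^sub>R v)" by simp
        have 2: "norm (f (y + s *\<^sub>R v) - f y - D y (s *\<^sub>R v)) \<le> \<epsilon> * norm (s *\<^sub>R v)"
          using \<delta>'(2)[rule_format, of "y + s *\<^sub>R v" y] sv(1) \<delta>'(1) by simp
        have "norm (D y (s *\<^sub>R v) - D x (s *\<^sub>R v)) \<le> 2 * \<epsilon> * norm (s *\<^sub>R v)"
          using norm_triangle_ineq4[of "f (y + s *\<^sub>R v) - f y - D x (s *\<^sub>R v)" "f (y + s *\<^sub>R v) - f y - D y (s *\<^sub>R v)"] 1 2
          by simp
        also have "D y (s *\<^sub>R v) - D x (s *\<^sub>R v) = s *\<^sub>R (D y v - D x v)"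
          by (simp add: linear_scale[OF lin[OF x]] linear_scale[OF lin[OF y(1)]] scaleR_diff_right)
        finally have "s * norm (D y v - D x v) \<le> s * (2 * \<epsilon> * norm v)" using s by (simp add: mult_ac)
        then have "norm (D y v - D x v) \<le> 2 * \<epsilon> * norm v" using s by simp
        then show ?thesis using small by (simp add: dist_norm)
      qed
      then show "\<exists>d>0. \<forall>x'\<in>A. dist x' x < d --> dist (D x' v) (D x v) < e" using \<delta>(1) by blast
    qed
  qed
qed

lemma strict_derivative_C_1:
  fixes f :: "'a::euclidean_space \<Rightarrow> 'b::euclidean_space"
  assumes A: "open A" "x \<in> A" and d: "\<And>y. y \<in> A ==> (f has_derivative f' y) (at y)"
    and c: "\<And>v. continuous_on A (\<lambda>y. f' y v)"
  shows "strict_derivative f (f' x) x"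
  unfolding strict_derivative_def
proof (intro conjI allI impI)
  show lin: "linear (f' x)" by (rule has_derivative_linear[OF d[OF A(2)]])
  fix \<epsilon> :: real assume \<epsilon>: "\<epsilon> > 0"
  define \<epsilon>' where "\<epsilon>' = \<epsilon> / DIM('a)"
  have \<epsilon>': "\<epsilon>' > 0" "DIM('a) * \<epsilon>' = \<epsilon>" using \<epsilon> by (auto simp: \<epsilon>'_def)
  have "\<forall>\<^sub>F y in nhds x. norm (f' y b - f' x b) < \<epsilon>'" for b
  proof -
    have "isCont (\<lambda>y. f' y b) x" using c A by (simp add: continuous_on_eq_continuous_at)
    then have "((\<lambda>y. f' y b) \<longlongrightarrow> f' x b) (nhds x)" unfolding isCont_def by (simp only: tendsto_at_iff_tendsto_nhds[where g = "\<lambda>y. f' y b"])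
    from tendstoD[OF this \<epsilon>'(1)] show ?thesis by (simp add: dist_norm)
  qed
  then have "\<forall>\<^sub>F y in nhds x. y \<in> A \<and> (\<forall>b\<in>Basis. norm (f' y b - f' x b) < \<epsilon>')"
    by (intro eventually_conj eventually_nhds_in_open A eventually_ball_finite) auto
  then obtain \<delta> where \<delta>: "\<delta> > 0" "\<And>y. dist y x < \<delta> ==> y \<in> A \<and> (\<forall>b\<in>Basis. norm (f' y b - f' x b) < \<epsilon>')"
    unfolding eventually_nhds_metric by blast
  have "norm (f u - f v - f' x (u - v)) \<le> \<epsilon> * norm (u - v)" if "norm (u - x) < \<delta>" "norm (v - x) < \<delta>" for u v
    unfolding \<epsilon>'(2)[symmetric]
  proof (rule mean_value_linear[OF convex_ball[of x \<delta>] _ lin])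
    fix y assume "y \<in> ball x \<delta>"
    then have y: "y \<in> A" "\<forall>b\<in>Basis. norm (f' y b - f' x b) < \<epsilon>'" using \<delta>(2)[of y] by (auto simp: dist_commute)
    show "(f has_derivative f' y) (at y)" by (rule d[OF y(1)])
    show "norm (f' y b - f' x b) \<le> \<epsilon>'" if "b \<in> Basis" for b using y(2) that by (simp add: less_imp_le)
  qed (use that in \<open>auto simp: dist_norm norm_minus_commute\<close>)
  then show "\<exists>\<delta>>0. \<forall>u v. norm (u - x) < \<delta> --> norm (v - x) < \<delta> --> norm (f u - f v - f' x (u - v)) \<le> \<epsilon> * norm (u - v)"
    using \<delta>(1) by blast
qed

definition reflect :: "'n \<Rightarrow> real ^ 'n \<Rightarrow> real ^ 'n" where
  "reflect j w = w - (2 * w $ j) *\<^sub>R axis j 1"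

lemma reflect_nth: "reflect j w $ j = - (w $ j)"
  by (simp add: reflect_def axis_def)

lemma reflect_reflect: "reflect j (reflect j w) = w"
  by (simp add: vec_eq_iff reflect_def axis_def)

lemma linear_reflect: "linear (reflect j)"
  by (rule linearI) (auto simp: vec_eq_iff reflect_def algebra_simps)

lemma reflect_diff: "reflect j (u - v) = reflect j u - reflect j v"
  by (rule linear_diff[OF linear_reflect])

lemma reflect_id: "w $ j = 0 ==> reflect j w = w"
  by (simp add: reflect_def)

lemma norm_reflect: "norm (reflect j w) = norm w"
proof -
  have "reflect j w \<bullet> reflect j w = w \<bullet> w"
    by (simp add: reflect_def inner_diff_left inner_diff_right inner_axis inner_axis' algebra_simps)
  then show ?thesis by (simp add: norm_eq)
qed

definition odd_extension :: "'n \<Rightarrow> (real ^ 'n \<Rightarrow> 'b::real_normed_vector) \<Rightarrow> real ^ 'n \<Rightarrow> 'b" where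
  "odd_extension j \<zeta> w = (if 0 < w $ j then \<zeta> w else if w $ j = 0 then 0 else - \<zeta> (reflect j w))"

lemma odd_extension_reflect: "odd_extension j \<zeta> (reflect j w) = - odd_extension j \<zeta> w"
  by (auto simp: odd_extension_def reflect_nth reflect_reflect)

lemma strict_derivative_reflect:
  assumes "strict_derivative (odd_extension j \<zeta>) D x"
  shows "strict_derivative (odd_extension j \<zeta>) (\<lambda>v. - D (reflect j v)) (reflect j x)"
  unfolding strict_derivative_def
proof (intro conjI allI impI)
  have lin: "linear D" using assms by (simp add: strict_derivative_def)
  show "linear (\<lambda>v. - D (reflect j v))"
    by (rule linearI) (auto simp: linear_add[OF linear_reflect] linear_scale[OF linear_reflect] linear_add[OF lin] linear_scale[OF lin])
  let ?F = "odd_extension j \<zeta>"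
  fix \<epsilon> :: real assume "\<epsilon> > 0"
  then obtain \<delta> where \<delta>: "\<delta> > 0" "\<forall>u v. norm (u - x) < \<delta> --> norm (v - x) < \<delta> --> norm (?F u - ?F v - D (u - v)) \<le> \<epsilon> * norm (u - v)"
    using assms unfolding strict_derivative_def by blast
  have "norm (?F u - ?F v - - D (reflect j (u - v))) \<le> \<epsilon> * norm (u - v)"
    if "norm (u - reflect j x) < \<delta>" "norm (v - reflect j x) < \<delta>" for u v
  proof -
    have n: "norm (reflect j a - x) = norm (a - reflect j x)" for a
      using norm_reflect[of j "a - reflect j x"] by (simp add: reflect_diff reflect_reflect)
    have "norm (?F (reflect j u) - ?F (reflect j v) - D (reflect j u - reflect j v)) \<le> \<epsilon> * norm (reflect j u - reflect j v)"
      using \<delta>(2) that by (simp add: n)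
    moreover have "?F (reflect j u) - ?F (reflect j v) - D (reflect j u - reflect j v) = - (?F u - ?F v - - D (reflect j (u - v)))"
      by (simp add: odd_extension_reflect reflect_diff)
    ultimately have "norm (?F u - ?F v - - D (reflect j (u - v))) \<le> \<epsilon> * norm (reflect j (u - v))"
      by (metis norm_minus_cancel reflect_diff)
    then show ?thesis by (simp add: norm_reflect)
  qed
  then show "\<exists>\<delta>>0. \<forall>u v. norm (u - reflect j x) < \<delta> --> norm (v - reflect j x) < \<delta> -->
      norm (?F u - ?F v - - D (reflect j (u - v))) \<le> \<epsilon> * norm (u - v)" using \<delta>(1) by blast
qed

lemma strict_derivative_odd_extension_boundary:
  fixes \<zeta> :: "real ^ 'n \<Rightarrow> 'b::euclidean_space"
  assumes A: "open A" "x \<in> A" "x $ j = 0"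
    and d: "\<And>w. w \<in> A ==> 0 < w $ j ==> (\<zeta> has_derivative \<zeta>' w) (at w)"
    and M: "\<And>w. w \<in> A ==> 0 < w $ j ==> norm (\<zeta> w) \<le> M * w $ j"
    and lim: "\<forall>b\<in>Basis. \<exists>l. \<forall>\<epsilon>>0. \<exists>\<delta>>0. \<forall>w\<in>A. 0 < w $ j --> norm (w - x) < \<delta> --> norm (\<zeta>' w b - l) \<le> \<epsilon>"
  shows "\<exists>D. strict_derivative (odd_extension j \<zeta>) D x"
proof -
  let ?F = "odd_extension j \<zeta>" and ?e = "axis j 1 :: real ^ 'n"
  obtain l where l: "\<forall>b\<in>Basis. \<forall>\<epsilon>>0. \<exists>\<delta>>0. \<forall>w\<in>A. 0 < w $ j --> norm (w - x) < \<delta> --> norm (\<zeta>' w b - l b) \<le> \<epsilon>"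
    by (rule bchoice[OF lim, THEN exE])
  define D where "D = (\<lambda>v. \<Sum>b\<in>Basis. (v \<bullet> b) *\<^sub>R l b)"
  have lin: "linear D" unfolding D_def
    by (rule linearI) (auto simp: inner_add_left scaleR_add_left sum.distrib scaleR_sum_right)
  have Db: "D b = l b" if "b \<in> Basis" for b
    using that by (simp add: D_def inner_Basis if_distrib if_distribR sum.delta' cong: if_cong)
  have upper: "\<exists>\<delta>>0. \<forall>u v. norm (u - x) < \<delta> --> norm (v - x) < \<delta> --> 0 \<le> u $ j --> 0 \<le> v $ j -->
      norm (?F u - ?F v - D (u - v)) \<le> \<epsilon> * norm (u - v)" if \<epsilon>: "\<epsilon> > 0" for \<epsilon>
  proof -
    define \<epsilon>' where "\<epsilon>' = \<epsilon> / DIM(real ^ 'n)"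
    have \<epsilon>': "\<epsilon>' > 0" "DIM(real ^ 'n) * \<epsilon>' = \<epsilon>" using \<epsilon> by (auto simp: \<epsilon>'_def)
    have "\<forall>b\<in>Basis. \<exists>\<delta>>0. \<forall>w\<in>A. 0 < w $ j --> norm (w - x) < \<delta> --> norm (\<zeta>' w b - l b) \<le> \<epsilon>'" using l \<epsilon>'(1) by blast
    then obtain s where s: "\<forall>b\<in>Basis. s b > 0 \<and> (\<forall>w\<in>A. 0 < w $ j --> norm (w - x) < s b --> norm (\<zeta>' w b - l b) \<le> \<epsilon>')"
      by (rule bchoice[THEN exE])
    obtain \<delta>1 where \<delta>1: "\<delta>1 > 0" "ball x \<delta>1 \<subseteq> A" using A(1,2) open_contains_ball by blast
    define \<delta> where "\<delta> = min \<delta>1 (Min (s ` Basis))"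
    have \<delta>0: "\<delta> > 0" using \<delta>1(1) s by (simp add: \<delta>_def)
    have \<delta>b: "\<delta> \<le> s b" if "b \<in> Basis" for b using that by (auto simp: \<delta>_def intro!: min.coboundedI2 Min_le)
    have \<delta>A: "w \<in> A" if "norm (w - x) < \<delta>" for w using that \<delta>1(2) by (auto simp: \<delta>_def dist_norm norm_minus_commute)
    have step1: "norm (\<zeta> u - \<zeta> v - D (u - v)) \<le> \<epsilon> * norm (u - v)"
      if "norm (u - x) < \<delta>" "norm (v - x) < \<delta>" "0 < u $ j" "0 < v $ j" for u v
      unfolding \<epsilon>'(2)[symmetric]
    proof (rule mean_value_linear[of "ball x \<delta> \<inter> {w. 0 < w $ j}" \<zeta> \<zeta>' D, OF _ _ lin])
      have "{w :: real ^ 'n. 0 < w $ j} = (\<lambda>w. w $ j) -` {0<..}" by auto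
      moreover have "convex ((\<lambda>w :: real ^ 'n. w $ j) -` {0<..})"
        by (rule convex_linear_vimage[OF bounded_linear.linear[OF bounded_linear_vec_nth]]) (rule convex_real_interval)
      ultimately have "convex {w :: real ^ 'n. 0 < w $ j}" by simp
      then show "convex (ball x \<delta> \<inter> {w. 0 < w $ j})" by (rule convex_Int[OF convex_ball])
      fix y assume "y \<in> ball x \<delta> \<inter> {w. 0 < w $ j}"
      then have y: "norm (y - x) < \<delta>" "0 < y $ j" by (auto simp: dist_norm norm_minus_commute)
      show "(\<zeta> has_derivative \<zeta>' y) (at y)" by (rule d[OF \<delta>A[OF y(1)] y(2)])
      show "norm (\<zeta>' y b - D b) \<le> \<epsilon>'" if b: "b \<in> Basis" for b
        unfolding Db[OF b] using s b \<delta>A[OF y(1)] y \<delta>b[OF b] by (meson less_le_trans)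
    qed (use that in \<open>auto simp: dist_norm norm_minus_commute\<close>)
    have limF: "((\<lambda>t. \<zeta> (u + t *\<^sub>R ?e)) \<longlongrightarrow> ?F u) (at_right 0)"
      and evu: "\<forall>\<^sub>F t in at_right 0. norm (u + t *\<^sub>R ?e - x) < \<delta> \<and> 0 < (u + t *\<^sub>R ?e) $ j"
      if u: "norm (u - x) < \<delta>" "0 \<le> u $ j" for u
    proof -
      have lu: "((\<lambda>t::real. u + t *\<^sub>R ?e) \<longlongrightarrow> u) (at_right 0)" by (auto intro!: tendsto_eq_intros)
      have "((\<lambda>t::real. norm (u + t *\<^sub>R ?e - x)) \<longlongrightarrow> norm (u - x)) (at_right 0)" by (intro tendsto_intros lu)
      from order_tendstoD(2)[OF this u(1)] have e1: "\<forall>\<^sub>F t in at_right 0. norm (u + t *\<^sub>R ?e - x) < \<delta>" .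
      have e2: "\<forall>\<^sub>F t in at_right (0::real). 0 < t" by (rule eventually_at_right_less)
      show ev: "\<forall>\<^sub>F t in at_right 0. norm (u + t *\<^sub>R ?e - x) < \<delta> \<and> 0 < (u + t *\<^sub>R ?e) $ j"
        using e1 e2 by eventually_elim (use u(2) in \<open>simp add: axis_def\<close>)
      show "((\<lambda>t. \<zeta> (u + t *\<^sub>R ?e)) \<longlongrightarrow> ?F u) (at_right 0)"
      proof (cases "u $ j = 0")
        case True
        have "((\<lambda>t. \<zeta> (u + t *\<^sub>R ?e)) \<longlongrightarrow> 0) (at_right 0)"
        proof (rule Lim_null_comparison)
          show "((\<lambda>t. M * t) \<longlongrightarrow> 0) (at_right 0)" by (auto intro!: tendsto_eq_intros)
          show "\<forall>\<^sub>F t in at_right 0. norm (\<zeta> (u + t *\<^sub>R ?e)) \<le> M * t" using ev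
          proof eventually_elim
            case (elim t)
            have "(u + t *\<^sub>R ?e) $ j = t" using True by (simp add: axis_def)
            then show ?case using M[of "u + t *\<^sub>R ?e"] \<delta>A[of "u + t *\<^sub>R ?e"] elim by simp
          qed
        qed
        then show ?thesis using True by (simp add: odd_extension_def)
      next
        case False
        then have uj: "0 < u $ j" using u(2) by simp
        have "isCont \<zeta> u" using has_derivative_continuous[OF d[OF \<delta>A[OF u(1)] uj]] .
        from isCont_tendsto_compose[OF this lu] show ?thesis using uj by (simp add: odd_extension_def)
      qed
    qed
    have "norm (?F u - ?F v - D (u - v)) \<le> \<epsilon> * norm (u - v)"
      if u: "norm (u - x) < \<delta>" "0 \<le> u $ j" and v: "norm (v - x) < \<delta>" "0 \<le> v $ j" for u v
    proof (rule tendsto_upperbound)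
      show "((\<lambda>t. norm (\<zeta> (u + t *\<^sub>R ?e) - \<zeta> (v + t *\<^sub>R ?e) - D (u - v))) \<longlongrightarrow> norm (?F u - ?F v - D (u - v))) (at_right 0)"
        by (intro tendsto_intros limF u v)
      show "\<forall>\<^sub>F t in at_right 0. norm (\<zeta> (u + t *\<^sub>R ?e) - \<zeta> (v + t *\<^sub>R ?e) - D (u - v)) \<le> \<epsilon> * norm (u - v)"
        using evu[OF u] evu[OF v]
      proof eventually_elim
        case (elim t)
        then show ?case using step1[of "u + t *\<^sub>R ?e" "v + t *\<^sub>R ?e"] by simp
      qed
    qed simp
    then show ?thesis using \<delta>0 by blast
  qed
  have D0: "D h = 0" if h: "h $ j = 0" for h
  proof -
    have "norm (D h) \<le> \<epsilon> * (norm h + 1)" if \<epsilon>: "\<epsilon> > 0" for \<epsilon>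
    proof -
      obtain \<delta> where \<delta>: "\<delta> > 0" "\<forall>u v. norm (u - x) < \<delta> --> norm (v - x) < \<delta> --> 0 \<le> u $ j --> 0 \<le> v $ j -->
        norm (?F u - ?F v - D (u - v)) \<le> \<epsilon> * norm (u - v)" using upper[OF \<epsilon>] by blast
      have nh: "norm h + 1 > 0" by (simp add: add_nonneg_pos)
      define s where "s = \<delta> / (2 * (norm h + 1))"
      have s: "s > 0" using \<delta>(1) nh by (simp add: s_def)
      have "norm (s *\<^sub>R h) \<le> s * (norm h + 1)" using s by simp
      also have "\<dots> = \<delta> / 2" using nh by (simp add: s_def field_simps)
      also have "\<dots> < \<delta>" using \<delta>(1) by simp
      finally have "norm (?F (x + s *\<^sub>R h) - ?F x - D (x + s *\<^sub>R h - x)) \<le> \<epsilon> * norm (x + s *\<^sub>R h - x)"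
        using \<delta> A(3) h by (intro \<delta>(2)[rule_format]) auto
      then have "s * norm (D h) \<le> s * (\<epsilon> * norm h)" using s h A(3)
        by (simp add: odd_extension_def linear_scale[OF lin] mult_ac)
      then have "norm (D h) \<le> \<epsilon> * norm h" using s by simp
      also have "\<dots> \<le> \<epsilon> * (norm h + 1)" using \<epsilon> by simp
      finally show ?thesis .
    qed
    then have "norm (D h) \<le> 0 + \<epsilon>" if "\<epsilon> > 0" for \<epsilon>
      using that by (metis add_0 add_nonneg_pos divide_pos_pos less_irrefl nonzero_eq_divide_eq norm_ge_zero zero_less_one)
    from field_le_epsilon[OF this] show ?thesis by simp
  qed
  have Dr: "D (reflect j h) = - D h" for h
  proof -
    have 0: "D (h - (h $ j) *\<^sub>R ?e) = 0" by (rule D0) (simp add: axis_def)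
    then have 1: "D h = (h $ j) *\<^sub>R D ?e" by (simp add: linear_diff[OF lin] linear_scale[OF lin])
    have 2: "(2 * h $ j) *\<^sub>R D ?e = (h $ j) *\<^sub>R D ?e + (h $ j) *\<^sub>R D ?e" by (simp flip: scaleR_add_left)
    show ?thesis unfolding reflect_def linear_diff[OF lin] linear_scale[OF lin] 1 2 by simp
  qed
  have "\<exists>\<delta>>0. \<forall>u v. norm (u - x) < \<delta> --> norm (v - x) < \<delta> --> norm (?F u - ?F v - D (u - v)) \<le> \<epsilon> * norm (u - v)"
    if \<epsilon>: "\<epsilon> > 0" for \<epsilon>
  proof -
    obtain \<delta> where \<delta>: "\<delta> > 0" "\<forall>u v. norm (u - x) < \<delta> --> norm (v - x) < \<delta> --> 0 \<le> u $ j --> 0 \<le> v $ j -->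
      norm (?F u - ?F v - D (u - v)) \<le> \<epsilon> * norm (u - v)" using upper[OF \<epsilon>] by blast
    have up: "norm (?F u - ?F v - D (u - v)) \<le> \<epsilon> * norm (u - v)"
      if "norm (u - x) < \<delta>" "norm (v - x) < \<delta>" "0 \<le> u $ j" "0 \<le> v $ j" for u v using \<delta>(2) that by blast
    have rx: "norm (reflect j a - x) = norm (a - x)" for a
      using norm_reflect[of j "a - x"] by (simp add: reflect_diff reflect_id[of x j] A(3))
    have down: "norm (?F u - ?F v - D (u - v)) \<le> \<epsilon> * norm (u - v)"
      if "norm (u - x) < \<delta>" "norm (v - x) < \<delta>" "u $ j \<le> 0" "v $ j \<le> 0" for u v
    proof -
      have "norm (?F (reflect j u) - ?F (reflect j v) - D (reflect j u - reflect j v)) \<le> \<epsilon> * norm (reflect j u - reflect j v)"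
        by (rule up) (use that in \<open>auto simp: rx reflect_nth\<close>)
      moreover have "?F (reflect j u) - ?F (reflect j v) - D (reflect j u - reflect j v) = - (?F u - ?F v - D (u - v))"
        unfolding reflect_diff[symmetric] Dr by (simp add: odd_extension_reflect)
      ultimately show ?thesis by (metis norm_minus_cancel norm_reflect reflect_diff)
    qed
    have mixed: "norm (?F u - ?F v - D (u - v)) \<le> \<epsilon> * norm (u - v)"
      if u: "norm (u - x) < \<delta>" "0 < u $ j" and v: "norm (v - x) < \<delta>" "v $ j < 0" for u v
    proof -
      define \<theta> where "\<theta> = u $ j / (u $ j - v $ j)"
      have \<theta>: "0 \<le> \<theta>" "\<theta> \<le> 1" "\<theta> * (u $ j - v $ j) = u $ j" using u v by (auto simp: \<theta>_def divide_le_eq)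
      define m where "m = (1 - \<theta>) *\<^sub>R u + \<theta> *\<^sub>R v"
      have mj: "m $ j = 0" using \<theta>(3) by (simp add: m_def algebra_simps)
      have "m \<in> ball x \<delta>" unfolding m_def
        by (rule convexD[OF convex_ball]) (use u v \<theta> in \<open>auto simp: dist_norm norm_minus_commute\<close>)
      then have mb: "norm (m - x) < \<delta>" by (simp add: dist_norm norm_minus_commute)
      have "u - m = \<theta> *\<^sub>R (u - v)" "m - v = (1 - \<theta>) *\<^sub>R (u - v)" by (auto simp: m_def algebra_simps)
      then have n: "norm (u - m) = \<theta> * norm (u - v)" "norm (m - v) = (1 - \<theta>) * norm (u - v)" using \<theta> by auto
      have "?F u - ?F v - D (u - v) = (?F u - ?F m - D (u - m)) + (?F m - ?F v - D (m - v))"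
        by (simp add: linear_diff[OF lin])
      then have "norm (?F u - ?F v - D (u - v)) \<le> norm (?F u - ?F m - D (u - m)) + norm (?F m - ?F v - D (m - v))"
        by (metis norm_triangle_ineq)
      also have "\<dots> \<le> \<epsilon> * norm (u - m) + \<epsilon> * norm (m - v)"
        by (intro add_mono up down u(1) v(1) mb) (use u v mj in auto)
      also have "\<dots> = \<epsilon> * norm (u - v)" unfolding n by (simp add: algebra_simps)
      finally show ?thesis .
    qed
    have "norm (?F u - ?F v - D (u - v)) \<le> \<epsilon> * norm (u - v)" if "norm (u - x) < \<delta>" "norm (v - x) < \<delta>" for u v
    proof -
      consider "0 \<le> u $ j \<and> 0 \<le> v $ j" | "u $ j \<le> 0 \<and> v $ j \<le> 0" | "0 < u $ j \<and> v $ j < 0" | "u $ j < 0 \<and> 0 < v $ j" by linarith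
      then show ?thesis
      proof cases
        case 4
        have "?F u - ?F v - D (u - v) = - (?F v - ?F u - D (v - u))" by (simp add: linear_diff[OF lin])
        then have "norm (?F u - ?F v - D (u - v)) = norm (?F v - ?F u - D (v - u))" by (metis norm_minus_cancel)
        then show ?thesis using mixed[of v u] 4 that by (simp add: norm_minus_commute)
      qed (use up down mixed that in auto)
    qed
    then show ?thesis using \<delta>(1) by blast
  qed
  then show ?thesis using lin unfolding strict_derivative_def by blast
qed

lemma C_1_on_odd_extension:
  fixes \<zeta> :: "real ^ 'n \<Rightarrow> 'b::euclidean_space"
  assumes A: "open A" "\<And>w. w \<in> A ==> reflect j w \<in> A"
    and d: "\<And>w. w \<in> A ==> 0 < w $ j ==> (\<zeta> has_derivative \<zeta>' w) (at w)"
    and c: "\<And>v. continuous_on {w \<in> A. 0 < w $ j} (\<lambda>w. \<zeta>' w v)"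
    and M: "\<And>w. w \<in> A ==> 0 < w $ j ==> norm (\<zeta> w) \<le> M * w $ j"
    and lim: "\<And>x. x \<in> A ==> x $ j = 0 ==>
      \<forall>b\<in>Basis. \<exists>l. \<forall>\<epsilon>>0. \<exists>\<delta>>0. \<forall>w\<in>A. 0 < w $ j --> norm (w - x) < \<delta> --> norm (\<zeta>' w b - l) \<le> \<epsilon>"
  shows "C_k_on 1 (odd_extension j \<zeta>) A"
proof (rule C_1_on_strict[OF A(1)])
  let ?A = "{w \<in> A. 0 < w $ j}"
  have "?A = A \<inter> {w. 0 < w $ j}" by auto
  moreover have "open {w :: real ^ 'n. 0 < w $ j}" by (intro open_Collect_less continuous_intros)
  ultimately have oA: "open ?A" using A(1) by auto
  have pos: "strict_derivative (odd_extension j \<zeta>) (\<zeta>' x) x" if x: "x \<in> ?A" for x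
  proof (rule strict_derivative_C_1[OF oA x _ c])
    fix y assume y: "y \<in> ?A"
    show "(odd_extension j \<zeta> has_derivative \<zeta>' y) (at y)"
      by (rule has_derivative_transform_within_open[OF d oA y]) (use y in \<open>auto simp: odd_extension_def\<close>)
  qed
  fix x assume x: "x \<in> A"
  consider "0 < x $ j" | "x $ j < 0" | "x $ j = 0" by linarith
  then show "\<exists>D. strict_derivative (odd_extension j \<zeta>) D x"
  proof cases
    case 1
    then show ?thesis using pos x by blast
  next
    case 2
    then have "strict_derivative (odd_extension j \<zeta>) (\<zeta>' (reflect j x)) (reflect j x)"
      using A(2)[OF x] by (intro pos) (simp add: reflect_nth)
    from strict_derivative_reflect[OF this] show ?thesis unfolding reflect_reflect by blast
  next
    case 3
    show ?thesis by (rule strict_derivative_odd_extension_boundary[OF A(1) x 3 d M lim[OF x 3]])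
  qed
qed

lemma C_1_on_linear_perturbation:
  fixes l q :: "'a::euclidean_space \<Rightarrow> 'b::euclidean_space" and h :: "'b \<Rightarrow> 'b" and k :: "'b \<Rightarrow> 'b"
  assumes l: "linear l" "linear q" "linear k" and h: "C_k_on 1 h A"
  shows "C_k_on 1 (\<lambda>a. l a + k (h (q a))) {a. q a \<in> A}"
proof (rule C_1_onI)
  have bl: "bounded_linear l" "bounded_linear q" "bounded_linear k" using l by (simp_all add: linear_conv_bounded_linear)
  let ?D = "\<lambda>a. frechet_derivative h (at (q a))"
  show "((\<lambda>a. l a + k (h (q a))) has_derivative (\<lambda>v. l v + k (?D a (q v)))) (at a)" if "a \<in> {a. q a \<in> A}" for a
  proof -
    have "((\<lambda>a. h (q a)) has_derivative (\<lambda>v. ?D a (q v))) (at a)"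
      by (rule has_derivative_compose[OF bounded_linear_imp_has_derivative[OF bl(2)] C_1_has_derivative[OF h]]) (use that in simp)
    then show ?thesis
      by (intro has_derivative_add bounded_linear_imp_has_derivative[OF bl(1)] bounded_linear.has_derivative[OF bl(3)])
  qed
  show "continuous_on {a. q a \<in> A} (\<lambda>a. l v + k (?D a (q v)))" for v
    by (intro continuous_intros bounded_linear.continuous_on[OF bl(3)] continuous_on_frechet_apply[OF h]
        linear_continuous_on[OF bl(2)]) auto
qed

lemma C_1_diffeo_restrict:
  fixes f :: "'a::euclidean_space \<Rightarrow> 'b::euclidean_space"
  assumes "C_k_diffeo 1 U V f g" "open N"
  shows "C_k_diffeo 1 (U \<inter> f -` N) (V \<inter> N) f g"
proof -
  have C: "C_k_on 1 (\<lambda>x. x) N"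
    by (rule C_1_onI[of N _ "\<lambda>_ v. v"]) (auto intro!: continuous_intros)
  have "homeomorphism N N (\<lambda>x. x) (\<lambda>x. x)" by (rule homeomorphismI) auto
  then have "C_k_diffeo 1 N N (\<lambda>x. x) (\<lambda>x. x)" unfolding C_k_diffeo_def using assms(2) C by blast
  from C_1_diffeo_compose[OF assms(1) this]
  have "C_k_diffeo 1 (U \<inter> f -` N) (N \<inter> (\<lambda>x. x) -` V) ((\<lambda>x. x) \<circ> f) (g \<circ> (\<lambda>x. x))" .
  moreover have "N \<inter> (\<lambda>x. x) -` V = V \<inter> N" by auto
  ultimately show ?thesis by (simp add: o_def)
qed

section \<open>The boundary chart\<close>

lemma flattensI:
  assumes d: "C_k_diffeo k U V f g" and mem: "\<And>y. y \<in> U ==> y \<in> M \<longleftrightarrow> f y \<in> E"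
  shows "flattens k M E U V f g"
proof -
  have m: "\<And>x. x \<in> U ==> f x \<in> V" "\<And>c. c \<in> V ==> g c \<in> U" "\<And>c. c \<in> V ==> f (g c) = c"
    using d unfolding C_k_diffeo_def homeomorphism_def by auto
  have "f ` (U \<inter> M) = V \<inter> E"
  proof (intro equalityI subsetI)
    fix c assume "c \<in> f ` (U \<inter> M)"
    then show "c \<in> V \<inter> E" using m mem by auto
  next
    fix c assume c: "c \<in> V \<inter> E"
    then have "g c \<in> U \<inter> M" "f (g c) = c" using m[of c] mem[of "g c"] by auto
    then show "c \<in> f ` (U \<inter> M)" by (metis imageI)
  qed
  then show ?thesis using d by (simp add: flattens_def)
qed

context wing_chart
begin

lemma limit_tangent_chart:
  assumes x: "x \<in> X" "2 * L * norm (x - x0) \<le> r"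
    and F: "subspace F" "dim F = d + 1" "\<forall>v\<in>F. \<forall>\<epsilon>>0. \<exists>\<delta>>0. \<forall>y\<in>Y. norm (y - x) < \<delta> -->
      (\<exists>w\<in>tangent_space Y y. norm (v - w) \<le> \<epsilon>)"
  shows "\<exists>F'. subspace F' \<and> dim F' = d + 1 \<and> (\<forall>u\<in>F'. \<forall>\<epsilon>>0. \<exists>\<delta>>0. \<forall>a\<in>Z. norm a \<le> r --> norm (a - f x) < \<delta> -->
    (\<exists>w\<in>T a. norm (u - w) \<le> \<epsilon>))"
proof -
  have Lx: "L * norm (x - x0) \<le> r / 2" using x(2) by simp
  have "1 * norm (x - x0) \<le> L * norm (x - x0)" using L by (intro mult_right_mono) auto
  then have x2: "norm (x - x0) \<le> r / 2" using Lx by linarith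
  then have xr: "norm (x - x0) \<le> r" using r(1) by linarith
  have xU: "x \<in> U" and xb: "x \<in> cball x0 r" using ball_U[OF xr] by auto
  have fx: "f x \<in> cball 0 r" using f_small[OF xr] Lx r(1) by simp
  have lin: "linear (Df x)" by (rule linear_Df[OF xU])
  have "inj_on (Df x) (span F)" by (rule inj_on_inverseI[of _ "Dg (f x)"]) (rule Dfg(3)[OF xU])
  from dim_image_eq[OF lin this] have "dim (Df x ` F) = d + 1" using F(2) by simp
  moreover have "subspace (Df x ` F)" by (rule linear_subspace_image[OF lin F(1)])
  moreover have "\<exists>\<delta>>0. \<forall>a\<in>Z. norm a \<le> r --> norm (a - f x) < \<delta> --> (\<exists>w\<in>T a. norm (u - w) \<le> \<epsilon>)"
    if u: "u \<in> Df x ` F" and \<epsilon>: "\<epsilon> > 0" for u \<epsilon>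
  proof -
    obtain v where v: "v \<in> F" "u = Df x v" using u by blast
    define M where "M = L * norm v + L"
    have M: "M > 0" using L by (simp add: M_def add_nonneg_pos)
    define \<epsilon>1 where "\<epsilon>1 = \<epsilon> / M"
    have \<epsilon>1: "\<epsilon>1 > 0" "\<epsilon>1 * M = \<epsilon>" using \<epsilon> M by (auto simp: \<epsilon>1_def)
    obtain \<delta>1 where \<delta>1: "\<delta>1 > 0" "\<forall>y\<in>Y. norm (y - x) < \<delta>1 --> (\<exists>w\<in>tangent_space Y y. norm (v - w) \<le> \<epsilon>1)"
      using F(3) v(1) \<epsilon>1(1) by blast
    define m where "m = min \<delta>1 (min \<epsilon>1 (r / 2))"
    have m: "m > 0" using \<delta>1(1) \<epsilon>1(1) r(1) by (simp add: m_def)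
    have "\<exists>w\<in>T a. norm (u - w) \<le> \<epsilon>" if a: "a \<in> Z" "norm a \<le> r" "norm (a - f x) < m / L" for a
    proof -
      have "L * norm (a - f x) < m" using a(3) L by (simp add: field_simps)
      moreover have "norm (g a - g (f x)) \<le> L * norm (a - f x)" using a(2) fx by (intro g_lipschitz) auto
      ultimately have ga: "norm (g a - x) < m" using fg(2)[OF xU] by simp
      then have ga': "norm (g a - x) < \<delta>1" "norm (g a - x) \<le> \<epsilon>1" "norm (g a - x) < r / 2" by (auto simp: m_def)
      have "norm (g a - x0) \<le> norm (g a - x) + norm (x - x0)" using norm_triangle_ineq[of "g a - x" "x - x0"] by simp
      then have "norm (g a - x0) \<le> r" using ga'(3) x2 by linarith
      then have gb: "g a \<in> cball x0 r" "g a \<in> U" using ball_U by auto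
      obtain w where w: "w \<in> tangent_space Y (g a)" "norm (v - w) \<le> \<epsilon>1"
        using \<delta>1(2) Z_preimage(2)[OF a(1)] ga'(1) by blast
      have "Df (g a) w \<in> T a" using T_image[OF gb(2) Z_preimage(2)[OF a(1)]] w(1) Z_preimage(3)[OF a(1)] by auto
      moreover have "u - Df (g a) w = (Df x v - Df (g a) v) + Df (g a) (v - w)"
        using linear_Df[OF gb(2)] v(2) by (simp add: linear_diff)
      then have "norm (u - Df (g a) w) \<le> norm (Df x v - Df (g a) v) + norm (Df (g a) (v - w))"
        by (metis norm_triangle_ineq)
      moreover have "norm (Df x v - Df (g a) v) \<le> L * norm (x - g a) * norm v" by (rule Df_lipschitz[OF xb gb(1)])
      moreover have "L * norm (x - g a) * norm v \<le> L * \<epsilon>1 * norm v"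
        using ga'(2) L by (intro mult_right_mono mult_left_mono) (auto simp: norm_minus_commute)
      moreover have "norm (Df (g a) (v - w)) \<le> L * norm (v - w)" by (rule f_bound[OF gb(1)])
      moreover have "L * norm (v - w) \<le> L * \<epsilon>1" using w(2) L by (intro mult_left_mono) auto
      moreover have "L * \<epsilon>1 * norm v + L * \<epsilon>1 = \<epsilon>" using \<epsilon>1(2) by (simp add: M_def algebra_simps)
      ultimately show ?thesis by (intro bexI[of _ "Df (g a) w"]) auto
    qed
    moreover have "m / L > 0" using m L by simp
    ultimately show ?thesis by blast
  qed
  ultimately show ?thesis by (intro exI[of _ "Df x ` F"]) blast
qed

lemma transversal_frame:
  assumes \<nu>: "norm \<nu> = 1" "\<forall>\<epsilon>>0. \<exists>\<delta>>0. \<forall>a\<in>Z. norm a < \<delta> --> norm (sgn (a - \<pi> a) - \<nu>) \<le> \<epsilon>" and j: "j \<notin> I" "\<nu> $ j \<noteq> 0"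
  shows "\<exists>\<delta>>0. \<forall>a\<in>Z. norm a < \<delta> --> norm (a - \<pi> a) \<le> 2 * ((a - \<pi> a) $ j / \<nu> $ j) \<and>
    (\<forall>m\<in>T a. norm m \<le> 6 * norm (\<pi> m + ((m - \<pi> m) $ j / \<nu> $ j) *\<^sub>R axis j 1))"
proof -
  define \<beta> where "\<beta> = \<bar>\<nu> $ j\<bar>"
  have \<beta>: "\<beta> > 0" using j(2) by (simp add: \<beta>_def)
  define P where "P = 1 + 1 / \<beta>"
  have P: "P \<ge> 1" using \<beta> by (simp add: P_def)
  define \<epsilon> where "\<epsilon> = 1 / (4 * P * real CARD('n))"
  have \<epsilon>0: "\<epsilon> > 0" using P by (simp add: \<epsilon>_def)
  have N\<epsilon>: "CARD('n) * \<epsilon> = 1 / (4 * P)" by (simp add: \<epsilon>_def)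
  have \<epsilon>: "CARD('n) * \<epsilon> \<le> 1" "P * (CARD('n) * \<epsilon>) \<le> 1 / 4" using P by (auto simp: N\<epsilon> divide_le_eq)
  obtain \<delta>1 where \<delta>1: "\<delta>1 > 0" "\<And>a. a \<in> Z ==> norm a < \<delta>1 ==> gap E (T a) \<le> \<epsilon>"
    "\<And>a. a \<in> Z ==> norm a < \<delta>1 ==> \<exists>w\<in>T a. norm (a - \<pi> a - w) \<le> \<epsilon> * norm (a - \<pi> a)"
    using Z_near[OF \<epsilon>0] by blast
  have "\<beta> / 4 > 0" using \<beta> by simp
  then obtain \<delta>2 where \<delta>2: "\<delta>2 > 0" "\<And>a. a \<in> Z ==> norm a < \<delta>2 ==> norm (sgn (a - \<pi> a) - \<nu>) \<le> \<beta> / 4" using \<nu>(2) by blast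
  have "norm (a - \<pi> a) \<le> 2 * ((a - \<pi> a) $ j / \<nu> $ j) \<and>
      (\<forall>m\<in>T a. norm m \<le> 6 * norm (\<pi> m + ((m - \<pi> m) $ j / \<nu> $ j) *\<^sub>R axis j 1))"
    if a: "a \<in> Z" "norm a < min \<delta>1 \<delta>2" for a
  proof -
    have a1: "norm a < \<delta>1" and a2: "norm a < \<delta>2" using a(2) by auto
    let ?z = "a - \<pi> a" and ?s = "sgn (a - \<pi> a)"
    let ?p = "\<lambda>m. \<pi> m + ((m - \<pi> m) $ j / \<nu> $ j) *\<^sub>R axis j 1 :: real ^ 'n"
    have zs: "?z = norm ?z *\<^sub>R ?s" using Z_height[OF a(1)] by (simp add: sgn_div_norm)
    have "\<bar>(?s - \<nu>) $ j\<bar> \<le> \<beta> / 4" using \<delta>2(2)[OF a(1) a2] component_le_norm_cart[of "?s - \<nu>" j] by linarith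
    moreover have "?s $ j / \<nu> $ j - 1 = (?s - \<nu>) $ j / \<nu> $ j" using j(2) by (simp add: diff_divide_distrib)
    ultimately have sj: "\<bar>?s $ j / \<nu> $ j - 1\<bar> \<le> 1 / 4"
      using \<beta> by (simp add: abs_divide \<beta>_def[symmetric] divide_le_eq)
    have zj: "?z $ j / \<nu> $ j = norm ?z * (?s $ j / \<nu> $ j)" by (subst zs) simp
    have "1 / 2 \<le> ?s $ j / \<nu> $ j" using abs_le_D2[OF sj] by linarith
    from mult_left_mono[OF this norm_ge_zero[of ?z]] have 1: "norm ?z \<le> 2 * (?z $ j / \<nu> $ j)"
      using zj by linarith
    have lin: "linear ?p"
      by (rule linearI) (auto simp: linear_add[OF linear_coord_proj] linear_scale[OF linear_coord_proj]
          algebra_simps add_divide_distrib diff_divide_distrib)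
    have b: "norm (?p v) \<le> P * norm v" for v
    proof -
      have "norm (?p v) \<le> norm (\<pi> v) + \<bar>(v - \<pi> v) $ j\<bar> / \<beta>"
        using norm_triangle_ineq[of "\<pi> v" "((v - \<pi> v) $ j / \<nu> $ j) *\<^sub>R axis j 1"] by (simp add: \<beta>_def abs_divide)
      moreover have "(v - \<pi> v) $ j = v $ j" using j(1) by (simp add: coord_proj_def)
      moreover have "\<bar>v $ j\<bar> / \<beta> \<le> norm v / \<beta>" using \<beta> by (intro divide_right_mono component_le_norm_cart) auto
      moreover have "norm (\<pi> v) \<le> norm v" by (rule norm_coord_proj_le)
      ultimately show ?thesis by (simp add: P_def algebra_simps)
    qed
    have pe: "?p e = e" if "e \<in> E" for e using coord_proj_id[OF that] by simp
    have "?p ?s - axis j 1 = (?s $ j / \<nu> $ j - 1) *\<^sub>R axis j 1" by (simp add: proj_sgn_height algebra_simps)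
    then have ps: "norm (?p ?s - axis j 1) \<le> 1 / 4" using sj by simp
    have "norm m \<le> 6 * norm (?p m)" if "m \<in> T a" for m
      by (rule frame_bound[OF j(1) a(1) _ \<delta>1(2)[OF a(1) a1] \<epsilon>(1) \<delta>1(3)[OF a(1) a1] lin b pe \<epsilon>(2) ps that]) (use \<epsilon>0 in auto)
    then show ?thesis using 1 by blast
  qed
  then show ?thesis using \<delta>1(1) \<delta>2(1) by (intro exI[of _ "min \<delta>1 \<delta>2"]) auto
qed

lemma boundary_chart:
  assumes "r1 > 0" and TL: "\<And>x. x \<in> X ==> norm (x - x0) < r1 ==> \<exists>F. subspace F \<and> dim F = d + 1 \<and>
    (\<forall>v\<in>F. \<forall>\<epsilon>>0. \<exists>\<delta>>0. \<forall>y\<in>Y. norm (y - x) < \<delta> --> (\<exists>w\<in>tangent_space Y y. norm (v - w) \<le> \<epsilon>))"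
  shows "\<exists>I j U V f g. card I = d + 1 \<and> j \<in> I \<and> x0 \<in> U \<and> flattens 1 (X \<union> Y) (coord_half_plane I j) U V f g"
proof -
  obtain \<nu> where \<nu>: "norm \<nu> = 1" "\<pi> \<nu> = 0"
    "\<forall>\<epsilon>>0. \<exists>\<delta>>0. \<forall>a\<in>Z. norm a < \<delta> --> norm (sgn (a - \<pi> a) - \<nu>) \<le> \<epsilon>"
    using limit_direction by blast
  have "\<nu> \<noteq> 0" using \<nu>(1) by auto
  then obtain j where \<nu>j: "\<nu> $ j \<noteq> 0" by (auto simp: vec_eq_iff)
  have "\<pi> \<nu> $ j = 0" using \<nu>(2) by simp
  then have j: "j \<notin> I" using \<nu>j by (auto simp: coord_proj_def split: if_splits)
  let ?K = "insert j I" and ?e = "axis j 1 :: real ^ 'n"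
  let ?pK = "coord_proj ?K :: real ^ 'n \<Rightarrow> real ^ 'n" and ?PK = "coord_plane ?K :: (real ^ 'n) set"
  define p where "p = (\<lambda>m. \<pi> m + ((m - \<pi> m) $ j / \<nu> $ j) *\<^sub>R ?e)"
  obtain \<delta>0' where \<delta>0': "\<delta>0' > 0" "\<And>a. a \<in> Z ==> norm a < \<delta>0' ==> norm (a - \<pi> a) \<le> 2 * ((a - \<pi> a) $ j / \<nu> $ j)"
    "\<And>a m. a \<in> Z ==> norm a < \<delta>0' ==> m \<in> T a ==> norm m \<le> 6 * norm (p m)"
    using transversal_frame[OF \<nu>(1,3) j \<nu>j] unfolding p_def by blast
  define \<delta>0 where "\<delta>0 = min \<delta>0' r"
  have \<delta>0: "\<delta>0 > 0" "\<delta>0 \<le> \<delta>0'" "\<delta>0 \<le> r" using \<delta>0'(1) r(1) by (auto simp: \<delta>0_def)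
  define \<phi> where "\<phi> = (\<lambda>z::real ^ 'n. z $ j / \<nu> $ j)"
  have linp: "linear p" unfolding p_def
    by (rule linearI) (auto simp: linear_add[OF linear_coord_proj] linear_scale[OF linear_coord_proj]
          algebra_simps add_divide_distrib diff_divide_distrib)
  have bl\<phi>: "bounded_linear \<phi>" unfolding \<phi>_def
    by (rule bounded_linear_compose[OF bounded_linear_divide bounded_linear_vec_nth])
  have d\<phi>: "\<forall>z. z \<noteq> 0 --> (\<phi> has_derivative \<phi>) (at z)" using bounded_linear_imp_has_derivative[OF bl\<phi>] by blast
  have c\<phi>: "\<forall>v. continuous_on (- {0::real ^ 'n}) (\<lambda>z. \<phi> v)" by (intro allI continuous_on_const)
  have c\<phi>': "continuous_on UNIV \<phi>" by (rule linear_continuous_on[OF bl\<phi>])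
  have \<phi>0: "\<phi> 0 = 0" by (simp add: \<phi>_def)
  have pos: "\<forall>a\<in>Z. norm a < \<delta>0 --> norm (a - \<pi> a) \<le> 2 * \<phi> (a - \<pi> a)" using \<delta>0'(2) \<delta>0(2) by (simp add: \<phi>_def)
  have fr: "norm m \<le> 6 * norm (p m)" if "a \<in> Z" "norm a < \<delta>0" "m \<in> T a" for a m using \<delta>0'(3)[OF that(1) _ that(3)] that(2) \<delta>0(2) by linarith
  have inj: "\<forall>a\<in>Z. \<forall>v\<in>T a. norm a < \<delta>0 --> \<pi> v + \<phi> (v - \<pi> v) *\<^sub>R ?e = 0 --> v = 0"
  proof (intro ballI impI)
    fix a v assume v: "a \<in> Z" "v \<in> T a" "norm a < \<delta>0" "\<pi> v + \<phi> (v - \<pi> v) *\<^sub>R ?e = 0"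
    have "norm v \<le> 6 * norm (p v)" by (rule fr[OF v(1,3,2)])
    moreover have "p v = 0" using v(4) by (simp only: p_def \<phi>_def)
    ultimately
    show "v = 0" by simp
  qed
  obtain \<delta> \<rho> H H' where \<delta>: "0 < \<delta>" "0 < \<rho>"
    and H1: "\<forall>w\<in>?PK. norm (\<pi> w) < \<delta> --> 0 < w $ j --> w $ j < \<delta> -->
       H w \<in> Z \<and> norm (H w) < \<delta>0 \<and> \<pi> (H w) = \<pi> w \<and> \<phi> (H w - \<pi> w) = w $ j \<and>
       (\<forall>\<xi>\<in>?PK. H' w \<xi> \<in> T (H w) \<and> \<pi> (H' w \<xi>) + \<phi> (H' w \<xi> - \<pi> (H' w \<xi>)) *\<^sub>R ?e = \<xi>)"
    and H2: "\<forall>a\<in>Z. norm a < \<rho> --> norm (\<pi> a) < \<delta> \<and> 0 < \<phi> (a - \<pi> a) \<and> \<phi> (a - \<pi> a) < \<delta> \<and>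
       H (\<pi> a + \<phi> (a - \<pi> a) *\<^sub>R ?e) = a"
    and H3: "\<forall>w. norm (\<pi> w) < \<delta> --> 0 < w $ j --> w $ j < \<delta> --> ((\<lambda>w. H (?pK w)) has_derivative H' w) (at w)"
    and H4: "\<forall>v. continuous_on {w. norm (\<pi> w) < \<delta> \<and> 0 < w $ j \<and> w $ j < \<delta>} (\<lambda>w. H' w v)"
    using sheet_over[where \<phi>' = "\<lambda>_. \<phi>", OF j d\<phi> c\<phi> c\<phi>' \<phi>0 \<delta>0(1) zero_less_numeral pos inj]
    by (elim exE conjE) (rule that; assumption)
  have \<pi>e: "\<pi> ?e = 0" using j by (auto simp: vec_eq_iff coord_proj_def axis_def)
  have ej: "?e $ j = 1" by (simp add: axis_def)
  have \<pi>j: "\<pi> v $ j = 0" for v using j by (simp add: coord_proj_def)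
  have \<pi>\<pi>: "\<pi> (\<pi> v) = \<pi> v" for v by (rule coord_proj_id[OF coord_proj_in])
  have pKeq: "?pK v = \<pi> v + v $ j *\<^sub>R ?e" for v using j by (auto simp: vec_eq_iff coord_proj_def axis_def)
  have pK: "\<pi> (?pK w) = \<pi> w" "?pK w $ j = w $ j" "?pK (?pK w) = ?pK w" for w by (auto simp: vec_eq_iff coord_proj_def)
  have l\<pi>: "\<pi> (u + v) = \<pi> u + \<pi> v" "\<pi> (u - v) = \<pi> u - \<pi> v" "\<pi> (c *\<^sub>R v) = c *\<^sub>R \<pi> v" for u v c
    using linear_coord_proj[of I] by (auto simp: linear_add linear_diff linear_scale)
  have lK: "?pK (u + v) = ?pK u + ?pK v" "?pK (u - v) = ?pK u - ?pK v" for u v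
    using linear_coord_proj[of ?K] by (auto simp: linear_add linear_diff)
  have c\<pi>: "continuous_on A \<pi>" for A by (rule linear_continuous_on[OF bounded_linear_coord_proj])
  have peq: "p m = \<pi> m + \<phi> (m - \<pi> m) *\<^sub>R ?e" for m by (simp add: p_def \<phi>_def)
  define \<delta>1 where "\<delta>1 = min \<delta> (min (r / (2 * L * L)) (r1 / L))"
  have \<delta>1: "\<delta>1 > 0" "\<delta>1 \<le> \<delta>" "2 * L * (L * \<delta>1) \<le> r" "L * \<delta>1 \<le> r1" "\<delta>1 \<le> r"
  proof -
    show "\<delta>1 > 0" "\<delta>1 \<le> \<delta>" using \<delta> r(1) L assms(1) by (auto simp: \<delta>1_def)
    have "2 * L * L * \<delta>1 \<le> 2 * L * L * (r / (2 * L * L))" using L by (intro mult_left_mono) (auto simp: \<delta>1_def)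
    then show 1: "2 * L * (L * \<delta>1) \<le> r" using L by simp
    have "L * \<delta>1 \<le> L * (r1 / L)" using L by (intro mult_left_mono) (auto simp: \<delta>1_def)
    then show "L * \<delta>1 \<le> r1" using L by simp
    have "1 * \<delta>1 \<le> (2 * L * L) * \<delta>1"
    proof (intro mult_right_mono)
      have "1 * 1 \<le> L * L" using L by (intro mult_mono) auto
      then show "1 \<le> 2 * L * L" by simp
    qed (use \<open>\<delta>1 > 0\<close> in simp)
    then show "\<delta>1 \<le> r" using 1 by simp
  qed
  define A where "A = {w. norm (\<pi> w) < \<delta>1 \<and> \<bar>w $ j\<bar> < \<delta>}"
  have oA: "open A" unfolding A_def by (intro open_Collect_conj open_Collect_less continuous_intros c\<pi>)
  have \<pi>R: "\<pi> (reflect j w) = \<pi> w" for w by (simp add: reflect_def l\<pi> \<pi>e)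
  have RA: "reflect j w \<in> A" if "w \<in> A" for w using that by (simp add: A_def \<pi>R reflect_nth)
  have Aup: "norm (\<pi> w) < \<delta>" "w $ j < \<delta>" if "w \<in> A" for w using that \<delta>1(2) by (auto simp: A_def)
  have KA: "?pK w \<in> A \<longleftrightarrow> w \<in> A" for w by (simp add: A_def pK)
  have Hk: "H (?pK w) \<in> Z" "norm (H (?pK w)) < \<delta>0" "\<pi> (H (?pK w)) = \<pi> w" "\<phi> (H (?pK w) - \<pi> w) = w $ j"
    "norm (H (?pK w) - \<pi> w) \<le> 2 * w $ j" if "w \<in> A" "0 < w $ j" for w
  proof -
    show 1: "H (?pK w) \<in> Z" "norm (H (?pK w)) < \<delta>0" "\<pi> (H (?pK w)) = \<pi> w" "\<phi> (H (?pK w) - \<pi> w) = w $ j"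
      using H1[rule_format, OF coord_proj_in, of w] Aup[OF that(1)] that(2) by (auto simp: pK)
    show "norm (H (?pK w) - \<pi> w) \<le> 2 * w $ j" using pos[rule_format, OF 1(1,2)] 1(3,4) by simp
  qed
  define D where "D = (\<lambda>w v. H' (?pK w) (?pK v))"
  have DT: "D w v \<in> T (H (?pK w))" "p (D w v) = ?pK v" if "w \<in> A" "0 < w $ j" for w v
    using H1[rule_format, OF coord_proj_in, of w] Aup[OF that(1)] that(2) by (auto simp: pK D_def peq)
  define \<zeta> where "\<zeta> = (\<lambda>w. H (?pK w) - \<pi> w)"
  define \<zeta>' where "\<zeta>' = (\<lambda>w v. D w v - \<pi> v)"
  have d\<zeta>: "(\<zeta> has_derivative \<zeta>' w) (at w)" if w: "w \<in> A" "0 < w $ j" for w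
  proof -
    have 1: "((\<lambda>w. H (?pK w)) has_derivative H' (?pK w)) (at (?pK w))" using H3 Aup[OF w(1)] w(2) by (simp add: pK)
    have "((\<lambda>w. H (?pK (?pK w))) has_derivative (\<lambda>v. H' (?pK w) (?pK v))) (at w)"
      by (rule has_derivative_compose[OF bounded_linear_imp_has_derivative[OF bounded_linear_coord_proj] 1])
    then have "((\<lambda>w. H (?pK w)) has_derivative D w) (at w)" by (simp add: pK D_def)
    then show ?thesis unfolding \<zeta>_def \<zeta>'_def
      by (intro has_derivative_diff bounded_linear_imp_has_derivative[OF bounded_linear_coord_proj])
  qed
  have c\<zeta>: "continuous_on {w \<in> A. 0 < w $ j} (\<lambda>w. \<zeta>' w v)" for v
    unfolding \<zeta>'_def D_def
  proof (intro continuous_on_diff continuous_on_const)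
    have "continuous_on {w. norm (\<pi> w) < \<delta> \<and> 0 < w $ j \<and> w $ j < \<delta>} (\<lambda>w. H' w (?pK v))" using H4 by blast
    then show "continuous_on {w \<in> A. 0 < w $ j} (\<lambda>w. H' (?pK w) (?pK v))"
      by (rule continuous_on_compose2[OF _ linear_continuous_on[OF bounded_linear_coord_proj]]) (use Aup in \<open>auto simp: pK\<close>)
  qed
  have M\<zeta>: "norm (\<zeta> w) \<le> 2 * w $ j" if "w \<in> A" "0 < w $ j" for w using Hk(5)[OF that] by (simp add: \<zeta>_def)
  obtain P where P: "P > 0" "\<And>v. norm (p v) \<le> norm v * P"
    using bounded_linear.pos_bounded linp unfolding linear_conv_bounded_linear by blast
  have lim: "\<forall>b\<in>Basis. \<exists>l. \<forall>\<epsilon>>0. \<exists>\<delta>>0. \<forall>w\<in>A. 0 < w $ j --> norm (w - w0) < \<delta> --> norm (\<zeta>' w b - l) \<le> \<epsilon>"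
    if w0: "w0 \<in> A" "w0 $ j = 0" for w0
  proof
    fix b :: "real ^ 'n"
    define e0 where "e0 = \<pi> w0"
    have e0: "norm e0 < \<delta>1" "e0 \<in> E" using w0 by (auto simp: A_def e0_def)
    have e0r: "norm e0 \<le> r" using e0(1) \<delta>1(5) by linarith
    then have e0V: "e0 \<in> V" using r(3) by auto
    have gX: "g e0 \<in> X" using g_plane[OF e0V] e0(2) by blast
    have fge: "f (g e0) = e0" by (rule fg(4)[OF e0V])
    have "L * norm e0 < L * \<delta>1" using e0(1) L by simp
    then have gn: "norm (g e0 - x0) < L * \<delta>1" using g_near[OF e0r] by linarith
    have "norm (g e0 - x0) < r1" using gn \<delta>1(4) by linarith
    then obtain F0 where F0: "subspace F0" "dim F0 = d + 1" "\<forall>v\<in>F0. \<forall>\<epsilon>>0. \<exists>\<delta>>0. \<forall>y\<in>Y. norm (y - g e0) < \<delta> -->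
      (\<exists>w\<in>tangent_space Y y. norm (v - w) \<le> \<epsilon>)" using TL[OF gX] by blast
    have "2 * L * norm (g e0 - x0) \<le> 2 * L * (L * \<delta>1)" using gn L by (intro mult_left_mono) auto
    then have "2 * L * norm (g e0 - x0) \<le> r" using \<delta>1(3) by linarith
    from limit_tangent_chart[OF gX this F0] obtain F where F: "subspace F" "dim F = d + 1"
      "\<forall>u\<in>F. \<forall>\<epsilon>>0. \<exists>\<delta>>0. \<forall>a\<in>Z. norm a \<le> r --> norm (a - e0) < \<delta> --> (\<exists>w\<in>T a. norm (u - w) \<le> \<epsilon>)"
      unfolding fge by blast
    have close: "norm (H (?pK w) - e0) \<le> 3 * norm (w - w0)" if "w \<in> A" "0 < w $ j" for w
    proof -
      have "w $ j \<le> norm (w - w0)" using component_le_norm_cart[of "w - w0" j] w0(2) by simp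
      moreover have "norm (\<pi> w - e0) \<le> norm (w - w0)" using norm_coord_proj_le[of I "w - w0"] by (simp add: l\<pi> e0_def)
      moreover have "norm (H (?pK w) - e0) \<le> norm (H (?pK w) - \<pi> w) + norm (\<pi> w - e0)"
        using norm_triangle_ineq[of "H (?pK w) - \<pi> w" "\<pi> w - e0"] by simp
      ultimately show ?thesis using Hk(5)[OF that] by linarith
    qed
    have nearF: "\<exists>\<delta>2>0. \<forall>w\<in>A. 0 < w $ j --> norm (w - w0) < \<delta>2 --> (\<exists>m\<in>T (H (?pK w)). norm (u - m) \<le> \<epsilon>)"
      if u: "u \<in> F" "\<epsilon> > 0" for u \<epsilon>
    proof -
      obtain s where s: "s > 0" "\<And>a. a \<in> Z ==> norm a \<le> r ==> norm (a - e0) < s ==> \<exists>w\<in>T a. norm (u - w) \<le> \<epsilon>" using F(3) u by blast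
      have "\<exists>m\<in>T (H (?pK w)). norm (u - m) \<le> \<epsilon>" if w: "w \<in> A" "0 < w $ j" "norm (w - w0) < s / 3" for w
        using s(2)[OF Hk(1)[OF w(1,2)]] Hk(2)[OF w(1,2)] \<delta>0(3) close[OF w(1,2)] w(3) by linarith
      then show ?thesis using s(1) by (intro exI[of _ "s / 3"]) auto
    qed
    have uF: "norm u \<le> 6 * norm (p u)" if u: "u \<in> F" for u
    proof (rule field_le_epsilon)
      fix \<epsilon> :: real assume \<epsilon>: "\<epsilon> > 0"
      define \<epsilon>1 where "\<epsilon>1 = \<epsilon> / (6 * P + 1)"
      have \<epsilon>1: "\<epsilon>1 > 0" "6 * (\<epsilon>1 * P) + \<epsilon>1 = \<epsilon>"
      proof -
        have "6 * P + 1 > 0" using P(1) by simp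
        then show "\<epsilon>1 > 0" using \<epsilon> by (simp add: \<epsilon>1_def)
        have "6 * (\<epsilon>1 * P) + \<epsilon>1 = \<epsilon>1 * (6 * P + 1)" by (simp add: algebra_simps)
        then show "6 * (\<epsilon>1 * P) + \<epsilon>1 = \<epsilon>" using \<open>6 * P + 1 > 0\<close> by (simp add: \<epsilon>1_def)
      qed
      obtain s where s: "s > 0" "\<And>w. w \<in> A ==> 0 < w $ j ==> norm (w - w0) < s ==> \<exists>m\<in>T (H (?pK w)). norm (u - m) \<le> \<epsilon>1"
        using nearF[OF u \<epsilon>1(1)] by blast
      define t where "t = min s \<delta> / 2"
      have t: "0 < t" "t < s" "t < \<delta>" using s(1) \<delta>(1) by (auto simp: t_def min_def)
      define w where "w = w0 + t *\<^sub>R ?e"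
      have w: "w \<in> A" "0 < w $ j" "norm (w - w0) < s" using w0 t by (auto simp: w_def A_def l\<pi> \<pi>e ej)
      obtain m where m: "m \<in> T (H (?pK w))" "norm (u - m) \<le> \<epsilon>1" using s(2)[OF w] by blast
      have "norm m \<le> 6 * norm (p m)" by (rule fr[OF Hk(1,2)[OF w(1,2)] m(1)])
      moreover have "p m = p u - p (u - m)" using linp by (simp add: linear_diff)
      then have "norm (p m) \<le> norm (p u) + norm (p (u - m))" using norm_triangle_ineq4 by metis
      moreover have "norm (p (u - m)) \<le> \<epsilon>1 * P" using P(2)[of "u - m"] mult_right_mono[OF m(2), of P] P(1) by linarith
      moreover have "norm u \<le> norm m + norm (u - m)" using norm_triangle_ineq[of m "u - m"] by simp
      ultimately show "norm u \<le> 6 * norm (p u) + \<epsilon>" using m(2) \<epsilon>1(2) by linarith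
    qed
    have "p ` F = ?PK"
    proof (rule subspace_dim_equal)
      show "subspace (p ` F)" by (rule linear_subspace_image[OF linp F(1)])
      show "subspace ?PK" by (rule subspace_coord_plane)
      show "p ` F \<subseteq> ?PK" unfolding p_def by (auto simp: coord_plane_def coord_proj_def axis_def)
      have "inj_on p F"
      proof (rule inj_onI)
        fix u v assume uv: "u \<in> F" "v \<in> F" "p u = p v"
        have "norm (u - v) \<le> 6 * norm (p (u - v))" by (rule uF[OF subspace_diff[OF F(1) uv(1,2)]])
        then show "u = v" using uv(3) linp by (simp add: linear_diff)
      qed
      then have "inj_on p (span F)" using F(1) by (simp add: span_eq_iff[THEN iffD2])
      from dim_image_eq[OF linp this] show "dim ?PK \<le> dim (p ` F)" using F(2) card_I j by (simp add: dim_coord_plane)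
    qed
    then obtain u where u: "u \<in> F" "p u = ?pK b" by (metis coord_proj_in imageE)
    show "\<exists>l. \<forall>\<epsilon>>0. \<exists>\<delta>>0. \<forall>w\<in>A. 0 < w $ j --> norm (w - w0) < \<delta> --> norm (\<zeta>' w b - l) \<le> \<epsilon>"
    proof (intro exI[of _ "u - \<pi> b"] allI impI)
      fix \<epsilon> :: real assume \<epsilon>: "\<epsilon> > 0"
      have P1: "6 * P + 1 > 0" using P(1) by simp
      define \<epsilon>1 where "\<epsilon>1 = \<epsilon> / (6 * P + 1)"
      have "6 * (\<epsilon>1 * P) + \<epsilon>1 = \<epsilon>1 * (6 * P + 1)" by (simp add: algebra_simps)
      then have \<epsilon>1: "\<epsilon>1 > 0" "6 * (\<epsilon>1 * P) + \<epsilon>1 = \<epsilon>" using \<epsilon> P1 by (auto simp: \<epsilon>1_def)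
      obtain s where s: "s > 0" "\<And>w. w \<in> A ==> 0 < w $ j ==> norm (w - w0) < s ==> \<exists>m\<in>T (H (?pK w)). norm (u - m) \<le> \<epsilon>1"
        using nearF[OF u(1) \<epsilon>1(1)] by blast
      have "norm (\<zeta>' w b - (u - \<pi> b)) \<le> \<epsilon>" if w: "w \<in> A" "0 < w $ j" "norm (w - w0) < s" for w
      proof -
        obtain m where m: "m \<in> T (H (?pK w))" "norm (u - m) \<le> \<epsilon>1" using s(2)[OF w] by blast
        have "D w b - m \<in> T (H (?pK w))"
          by (rule subspace_diff[OF subspace_TZ[OF Hk(1)[OF w(1,2)]] DT(1)[OF w(1,2)] m(1)])
        from fr[OF Hk(1,2)[OF w(1,2)] this] have "norm (D w b - m) \<le> 6 * norm (p (D w b - m))" .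
        also have "p (D w b - m) = p (u - m)" using linp DT(2)[OF w(1,2)] u(2) by (simp add: linear_diff)
        finally have "norm (D w b - m) \<le> 6 * norm (p (u - m))" .
        moreover have "norm (p (u - m)) \<le> \<epsilon>1 * P" using P(2)[of "u - m"] mult_right_mono[OF m(2), of P] P(1) by linarith
        moreover have "norm (\<zeta>' w b - (u - \<pi> b)) \<le> norm (D w b - m) + norm (u - m)"
          using norm_triangle_ineq4[of "D w b - m" "u - m"] by (simp add: \<zeta>'_def)
        ultimately show ?thesis using m(2) \<epsilon>1(2) by linarith
      qed
      then show "\<exists>\<delta>>0. \<forall>w\<in>A. 0 < w $ j --> norm (w - w0) < \<delta> --> norm (\<zeta>' w b - (u - \<pi> b)) \<le> \<epsilon>" using s(1) by blast
    qed
  qed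
  define Q where "Q = odd_extension j \<zeta>"
  have CQ: "C_k_on 1 Q A" unfolding Q_def by (rule C_1_on_odd_extension[OF oA RA d\<zeta> c\<zeta> M\<zeta> lim])
  have \<pi>\<zeta>: "\<pi> (\<zeta> w) = 0" "\<zeta> w $ j = \<nu> $ j * w $ j" if w: "w \<in> A" "0 < w $ j" for w
  proof -
    show "\<pi> (\<zeta> w) = 0" using Hk(3)[OF w] by (simp add: \<zeta>_def l\<pi> \<pi>\<pi>)
    show "\<zeta> w $ j = \<nu> $ j * w $ j" using Hk(4)[OF w] \<nu>j by (simp add: \<zeta>_def \<phi>_def field_simps)
  qed
  have \<pi>Q: "\<pi> (Q w) = 0" "Q w $ j = \<nu> $ j * w $ j" if w: "w \<in> A" for w
  proof -
    have l0: "\<pi> 0 = 0" "\<pi> (- v) = - \<pi> v" for v using linear_coord_proj[of I] by (auto simp: linear_0 linear_neg)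
    consider "0 < w $ j" | "w $ j = 0" | "w $ j < 0" by linarith
    then have "\<pi> (Q w) = 0 \<and> Q w $ j = \<nu> $ j * w $ j"
    proof cases
      case 3
      then show ?thesis using \<pi>\<zeta>[OF RA[OF w]] by (simp add: Q_def odd_extension_def reflect_nth l0)
    qed (use \<pi>\<zeta>[OF w] in \<open>auto simp: Q_def odd_extension_def l0\<close>)
    then show "\<pi> (Q w) = 0" "Q w $ j = \<nu> $ j * w $ j" by auto
  qed
  define q where "q = (\<lambda>a. \<pi> a + (a $ j / \<nu> $ j) *\<^sub>R ?e)"
  have linq: "linear q" unfolding q_def
    by (rule linearI) (auto simp: l\<pi> algebra_simps add_divide_distrib)
  have \<pi>q: "\<pi> (q a) = \<pi> a" and qj: "q a $ j = a $ j / \<nu> $ j" and Kq: "?pK (q a) = q a" for a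
    by (simp_all add: q_def pKeq l\<pi> \<pi>\<pi> \<pi>e \<pi>j ej)
  define \<Theta> where "\<Theta> = (\<lambda>a. (q a + (a - ?pK a)) + (?pK (Q (q a)) - Q (q a)))"
  define \<Xi> where "\<Xi> = (\<lambda>w. (\<pi> w + (w - ?pK w)) + Q (?pK w))"
  let ?N = "{a. q a \<in> A}" and ?W = "{w. ?pK w \<in> A}"
  have C\<Theta>: "C_k_on 1 \<Theta> ?N" unfolding \<Theta>_def
  proof (rule C_1_on_linear_perturbation[OF _ linq _ CQ])
    show "linear (\<lambda>a. q a + (a - ?pK a))"
      by (rule linearI) (auto simp: linear_add[OF linq] linear_scale[OF linq] linear_add[OF linear_coord_proj] linear_scale[OF linear_coord_proj] algebra_simps)
    show "linear (\<lambda>v. ?pK v - v)"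
      by (rule linearI) (auto simp: linear_add[OF linear_coord_proj] linear_scale[OF linear_coord_proj] algebra_simps)
  qed
  have C\<Xi>: "C_k_on 1 \<Xi> ?W" unfolding \<Xi>_def
  proof (rule C_1_on_linear_perturbation[OF _ linear_coord_proj _ CQ, of _ "\<lambda>v. v"])
    show "linear (\<lambda>w. \<pi> w + (w - ?pK w))"
      by (rule linearI) (auto simp: linear_add[OF linear_coord_proj] linear_scale[OF linear_coord_proj] algebra_simps)
    show "linear (\<lambda>v::real ^ 'n. v)" by (rule linearI) auto
  qed
  have K\<Theta>: "?pK (\<Theta> a) = q a" for a by (simp add: \<Theta>_def lK Kq pK(3))
  have \<Theta>j: "\<Theta> a $ j = a $ j / \<nu> $ j" for a using pK(2)[of "\<Theta> a"] by (simp add: K\<Theta> qj)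
  have \<pi>\<Theta>: "\<pi> (\<Theta> a) = \<pi> a" for a using pK(1)[of "\<Theta> a"] by (simp add: K\<Theta> \<pi>q)
  have \<Xi>\<Theta>: "\<Xi> (\<Theta> a) = a" if a: "q a \<in> A" for a
  proof -
    have "?pK (Q (q a)) = a $ j *\<^sub>R ?e" using \<pi>Q[OF a] \<nu>j by (simp add: pKeq qj)
    then have "\<Theta> a = q a + (a - \<pi> a) - Q (q a)" by (simp add: \<Theta>_def pKeq[of a])
    then show ?thesis unfolding \<Xi>_def K\<Theta> \<pi>\<Theta> by simp
  qed
  have \<Theta>\<Xi>: "\<Theta> (\<Xi> w) = w" "q (\<Xi> w) = ?pK w" if w: "?pK w \<in> A" for w
  proof -
    have "\<pi> (\<Xi> w) = \<pi> w" using \<pi>Q(1)[OF w] by (simp add: \<Xi>_def l\<pi> \<pi>\<pi> pK(1))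
    moreover have "\<Xi> w $ j = \<nu> $ j * w $ j" using \<pi>Q(2)[OF w] by (simp add: \<Xi>_def pK(2) \<pi>j)
    ultimately show q: "q (\<Xi> w) = ?pK w" using \<nu>j by (simp add: q_def pKeq)
    have "\<Xi> w - ?pK (\<Xi> w) = (w - ?pK w) + (Q (?pK w) - ?pK (Q (?pK w)))"
      by (simp add: \<Xi>_def lK pK(3) pKeq[of "\<pi> w"] \<pi>j \<pi>\<pi>)
    then show "\<Theta> (\<Xi> w) = w" unfolding \<Theta>_def q by simp
  qed
  have "homeomorphism ?N ?W \<Theta> \<Xi>"
    by (rule homeomorphismI[OF C_1_continuous_on[OF C\<Theta>] C_1_continuous_on[OF C\<Xi>]]) (auto simp: K\<Theta> \<Xi>\<Theta> \<Theta>\<Xi>)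
  moreover have "open ?N" "open ?W"
    using open_vimage[OF oA linear_continuous_on[of q UNIV]] open_vimage[OF oA linear_continuous_on[OF bounded_linear_coord_proj, of UNIV]] linq
    by (auto simp: vimage_def linear_conv_bounded_linear)
  ultimately have d\<Theta>: "C_k_diffeo 1 ?N ?W \<Theta> \<Xi>" unfolding C_k_diffeo_def using C\<Theta> C\<Xi> by blast
  let ?U = "U \<inter> f -` ball 0 \<rho> \<inter> f -` ?N" and ?V = "?W \<inter> \<Xi> -` (V \<inter> ball 0 \<rho>)"
  have diff: "C_k_diffeo 1 ?U ?V (\<Theta> \<circ> f) (g \<circ> \<Xi>)"
    by (rule C_1_diffeo_compose[OF C_1_diffeo_restrict[OF C_k_diffeo_le[OF diffeo k1] open_ball] d\<Theta>])
  have mem: "y \<in> X \<union> Y \<longleftrightarrow> \<Theta> (f y) \<in> coord_half_plane ?K j" if y: "y \<in> ?U" for y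
  proof -
    define a where "a = f y"
    have yU: "y \<in> U" and an: "norm a < \<rho>" and aN: "q a \<in> A" using y by (auto simp: a_def)
    have yX: "y \<in> X \<longleftrightarrow> a \<in> E" using f_plane[OF yU] by (simp add: a_def)
    have yY: "y \<in> Y \<longleftrightarrow> a \<in> Z" using yU fg(2)[OF yU] Z_preimage(2)[of a] by (auto simp: a_def)
    show ?thesis unfolding a_def[symmetric]
    proof
      assume "y \<in> X \<union> Y"
      then consider "a \<in> E" | "a \<in> Z" using yX yY by blast
      then show "\<Theta> a \<in> coord_half_plane ?K j"
      proof cases
        case 1
        then have aj: "a $ j = 0" and \<pi>a: "\<pi> a = a" using j coord_proj_id by (auto simp: coord_plane_def)
        have "q a = a" by (simp add: q_def aj \<pi>a)
        moreover have "?pK a = a" by (simp add: pKeq aj \<pi>a)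
        moreover have "Q a = 0" by (simp add: Q_def odd_extension_def aj)
        moreover have "?pK 0 = 0" by (rule linear_0[OF linear_coord_proj])
        ultimately have "\<Theta> a = a" by (simp add: \<Theta>_def)
        then show ?thesis using 1 aj by (auto simp: coord_half_plane_def coord_plane_def)
      next
        case 2
        have "\<phi> (a - \<pi> a) = q a $ j" by (simp add: \<phi>_def qj \<pi>j)
        moreover have "\<pi> a + \<phi> (a - \<pi> a) *\<^sub>R ?e = q a" by (simp add: \<phi>_def q_def \<pi>j)
        ultimately have qa: "0 < q a $ j" "H (q a) = a" using H2[rule_format, OF 2 an] by auto
        then have "Q (q a) = a - \<pi> a" by (simp add: Q_def odd_extension_def \<zeta>_def Kq \<pi>q)
        then have "\<Theta> a = q a" by (simp add: \<Theta>_def lK pKeq[of "\<pi> a"] \<pi>j \<pi>\<pi>)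
        moreover have "q a \<in> ?PK" using coord_proj_in[of ?K "q a"] by (simp add: Kq)
        ultimately show ?thesis using qa(1) by (simp add: coord_half_plane_def)
      qed
    next
      assume h: "\<Theta> a \<in> coord_half_plane ?K j"
      then have \<Theta>a: "\<Theta> a = q a" using coord_proj_id[of "\<Theta> a" ?K] K\<Theta>[of a] by (simp add: coord_half_plane_def)
      have "0 \<le> q a $ j" using h unfolding \<Theta>a by (simp add: coord_half_plane_def)
      then consider "q a $ j = 0" | "0 < q a $ j" by linarith
      then show "y \<in> X \<union> Y"
      proof cases
        case 1
        have "a = \<pi> (q a) + (q a - ?pK (q a)) + Q (?pK (q a))" using \<Xi>\<Theta>[OF aN] by (simp add: \<Theta>a \<Xi>_def)
        moreover have "Q (q a) = 0" using 1 by (simp add: Q_def odd_extension_def)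
        ultimately have "a = \<pi> a" by (simp add: Kq \<pi>q)
        then show ?thesis using yX coord_proj_in[of I a] by simp
      next
        case 2
        have "a = \<pi> (q a) + (q a - ?pK (q a)) + Q (?pK (q a))" using \<Xi>\<Theta>[OF aN] by (simp add: \<Theta>a \<Xi>_def)
        moreover have "Q (q a) = H (q a) - \<pi> a" using 2 by (simp add: Q_def odd_extension_def \<zeta>_def Kq \<pi>q)
        ultimately have "a = H (q a)" by (simp add: Kq \<pi>q)
        then have "a \<in> Z" using Hk(1)[OF aN 2] by (simp add: Kq)
        then show ?thesis using yY by blast
      qed
    qed
  qed
  have fl: "flattens 1 (X \<union> Y) (coord_half_plane ?K j) ?U ?V (\<Theta> \<circ> f) (g \<circ> \<Xi>)"
    by (rule flattensI[OF diff]) (use mem in simp)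
  have x0U: "x0 \<in> ?U"
  proof -
    have "q 0 = 0" by (rule linear_0[OF linq])
    moreover have "0 \<in> A" using \<delta>1(1) \<delta>(1) linear_0[OF linear_coord_proj[of I]] by (simp add: A_def)
    ultimately show ?thesis using x0 \<delta>(2) by simp
  qed
  have cK: "card ?K = d + 1" using card_I j by simp
  show ?thesis
    by (rule exI[of _ ?K], rule exI[of _ j], rule exI[of _ ?U], rule exI[of _ ?V], rule exI[of _ "\<Theta> \<circ> f"],
        rule exI[of _ "g \<circ> \<Xi>"], intro conjI cK insertI1 x0U fl)
qed

end

lemma ex_wing_chart:
  fixes S :: "nat \<Rightarrow> real list set set" and X Y :: "(real ^ 'n) set" and k d :: nat
  assumes S: "o_minimal_structure S" "definable S X" "definable S Y" and k2: "2 \<le> k"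
    and sub: "submanifold k d X" "submanifold k (d + 1) Y" and con: "connected_along X Y"
    and cl: "X \<subseteq> closure Y - Y" "openin (top_of_set (closure Y - Y)) X"
    and cond: "cond_a Y X" "cond_r_int k Y X" and x0: "x0 \<in> X"
  shows "\<exists>I U V f g L r. wing_chart S X Y k d x0 I U V f g L r"
proof -
  have "cond_r_int_at k Y X x0" using cond(2) x0 by (simp add: cond_r_int_def)
  then obtain I U V f g where x0U: "x0 \<in> U" and fx0: "f x0 = 0" and flat: "flattens k X (coord_plane I) U V f g"
    and rint: "\<exists>e>0. (\<integral>\<^sup>+ t \<in> {0..e}. gap_ratio I (f ` (U \<inter> Y)) t \<partial>lborel) < \<infinity>"
    unfolding cond_r_int_at_def by blast
  have cd: "C_k_diffeo k U V f g" using flat by (simp add: flattens_def)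
  then have o: "open U" "open V" and C: "C_k_on k f U" "C_k_on k g V" by (auto simp: C_k_diffeo_def)
  have V0: "0 \<in> V" using flattens_memD(2)[OF flat x0U] fx0 by simp
  obtain L1 r1 where 1: "r1 > 0" "L1 > 0" "cball x0 r1 \<subseteq> U"
    "\<forall>x\<in>cball x0 r1. \<forall>v. norm (frechet_derivative f (at x) v) \<le> L1 * norm v"
    "\<forall>x\<in>cball x0 r1. \<forall>y\<in>cball x0 r1. norm (f x - f y) \<le> L1 * norm (x - y)"
    "\<forall>x\<in>cball x0 r1. \<forall>y\<in>cball x0 r1. \<forall>v.
       norm (frechet_derivative f (at x) v - frechet_derivative f (at y) v) \<le> L1 * norm (x - y) * norm v"
    "\<forall>x\<in>cball x0 r1. \<forall>y\<in>cball x0 r1.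
       norm (f x - f y - frechet_derivative f (at y) (x - y)) \<le> L1 * norm (x - y) * norm (x - y)"
    using C_2_local_bounds[OF o(1) C_k_on_le[OF k2 C(1)] x0U] by (elim exE conjE) (rule that; assumption)
  obtain L2 r2 where 2: "r2 > 0" "L2 > 0" "cball 0 r2 \<subseteq> V"
    "\<forall>x\<in>cball 0 r2. \<forall>v. norm (frechet_derivative g (at x) v) \<le> L2 * norm v"
    "\<forall>x\<in>cball 0 r2. \<forall>y\<in>cball 0 r2. norm (g x - g y) \<le> L2 * norm (x - y)"
    using C_2_local_bounds[OF o(2) C_k_on_le[OF k2 C(2)] V0] by (elim exE conjE) (rule that; assumption)
  obtain W where W: "open W" "X = (closure Y - Y) \<inter> W" using cl(2) unfolding openin_open by blast
  then obtain r3 where r3: "r3 > 0" "cball x0 r3 \<subseteq> W" using x0 open_contains_cball by blast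
  define r where "r = min r1 (min r2 r3)"
  define L where "L = max 1 (max L1 L2)"
  have r: "r > 0" "r \<le> r1" "r \<le> r2" "r \<le> r3" using 1 2 r3 by (auto simp: r_def)
  have L: "1 \<le> L" "L1 \<le> L" "L2 \<le> L" by (auto simp: L_def)
  have b: "cball x0 r \<subseteq> cball x0 r1" "cball (0 :: real ^ 'n) r \<subseteq> cball 0 r2" using r by auto
  have m: "c \<le> L1 * a ==> 0 \<le> a ==> c \<le> L * a" "c \<le> L2 * a ==> 0 \<le> a ==> c \<le> L * a" for a c :: real
    using L mult_right_mono[of L1 L a] mult_right_mono[of L2 L a] by linarith+
  have "wing_chart S X Y k d x0 I U V f g L r"
  proof (rule wing_chart.intro[OF S(1)], rule wing_chart_axioms.intro)
    show "definable S X" "definable S Y" "2 \<le> k" "submanifold k d X" "submanifold k (d + 1) Y"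
      "x0 \<in> X" "x0 \<in> U" "f x0 = 0" "flattens k X (coord_plane I) U V f g" "0 < r" "1 \<le> L"
      "\<exists>e>0. (\<integral>\<^sup>+ t \<in> {0..e}. gap_ratio I (f ` (U \<inter> Y)) t \<partial>lborel) < \<infinity>" by fact+
    show "X \<inter> Y = {}" "x0 \<in> closure Y" "cond_a_at Y X x0" using cl(1) x0 cond(1) by (auto simp: cond_a_def)
    show "cball x0 r \<subseteq> U" "cball 0 r \<subseteq> V" using b 1(3) 2(3) by blast+
    fix x y v assume x: "x \<in> cball x0 r"
    show "norm (frechet_derivative f (at x) v) \<le> L * norm v" by (rule m(1)) (use 1(4) b(1) x in auto)
    assume y: "y \<in> cball x0 r"
    have xy: "x \<in> cball x0 r1" "y \<in> cball x0 r1" using x y b(1) by blast+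
    show "norm (f x - f y) \<le> L * norm (x - y)" by (rule m(1)[OF 1(5)[rule_format, OF xy]]) simp
    have "norm (frechet_derivative f (at x) v - frechet_derivative f (at y) v) \<le> L1 * (norm (x - y) * norm v)"
      using 1(6) xy by (simp add: mult.assoc)
    then have "norm (frechet_derivative f (at x) v - frechet_derivative f (at y) v) \<le> L * (norm (x - y) * norm v)"
      by (rule m(1)) simp
    then show "norm (frechet_derivative f (at x) v - frechet_derivative f (at y) v) \<le> L * norm (x - y) * norm v"
      by (simp add: mult.assoc)
    have "norm (f x - f y - frechet_derivative f (at y) (x - y)) \<le> L1 * (norm (x - y) * norm (x - y))"
      using 1(7) xy by (simp add: mult.assoc)
    then have "norm (f x - f y - frechet_derivative f (at y) (x - y)) \<le> L * (norm (x - y) * norm (x - y))"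
      by (rule m(1)) simp
    then show "norm (f x - f y - frechet_derivative f (at y) (x - y)) \<le> L * norm (x - y) * norm (x - y)"
      by (simp add: mult.assoc)
  next
    fix a b' v assume a: "a \<in> cball (0 :: real ^ 'n) r"
    show "norm (frechet_derivative g (at a) v) \<le> L * norm v" by (rule m(2)) (use 2(4) b(2) a in auto)
    assume b': "b' \<in> cball (0 :: real ^ 'n) r"
    have ab: "a \<in> cball 0 r2" "b' \<in> cball 0 r2" using a b' b(2) by blast+
    show "norm (g a - g b') \<le> L * norm (a - b')" by (rule m(2)[OF 2(5)[rule_format, OF ab]]) simp
  next
    fix y assume y: "y \<in> closure Y" "norm (y - x0) \<le> r"
    have "dist x0 y \<le> r3" using y(2) r(4) by (simp add: dist_norm norm_minus_commute)
    then have "y \<in> W" using r3(2) by auto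
    then show "y \<in> X \<union> Y" using y(1) W(2) by blast
  next
    fix W :: "(real ^ 'n) set" assume "open W" "x0 \<in> W"
    then show "\<exists>W'. open W' \<and> x0 \<in> W' \<and> W' \<subseteq> W \<and> connected (W' \<inter> Y)"
      using con x0 unfolding connected_along_def by blast
  qed
  then show ?thesis by blast
qed

lemma submanifold_interior_chart:
  fixes M N :: "(real ^ 'n) set"
  assumes M: "submanifold 1 m M" "0 < m" and p: "p \<in> M" and N: "N \<subseteq> closure M - M"
  shows "\<exists>I j U V f g. card I = m \<and> j \<in> I \<and> p \<in> U \<and> flattens 1 (N \<union> M) (coord_half_plane I j) U V f g"
proof -
  obtain I U V f g where I: "card I = m" "p \<in> U" and fl: "flattens 1 M (coord_plane I) U V f g"
    using M(1) p unfolding submanifold_def by blast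
  have "I \<noteq> {}" using I(1) M(2) by auto
  then obtain j where j: "j \<in> I" by blast
  have cd: "C_k_diffeo 1 U V f g" using fl by (simp add: flattens_def)
  then have o: "open U" and cf: "continuous_on U f" by (auto simp: C_k_diffeo_def homeomorphism_def)
  have closed: "x \<in> M" if x: "x \<in> U" "x \<in> closure M" for x
  proof -
    obtain s where s: "\<And>n. s n \<in> M" "s \<longlonglongrightarrow> x" using x(2) unfolding closure_sequential by blast
    have "isCont f x" using cf o x(1) by (simp add: continuous_on_eq_continuous_at)
    then have lim: "(\<lambda>n. f (s n)) \<longlonglongrightarrow> f x" using s(2) by (rule isCont_tendsto_compose)
    have "\<forall>\<^sub>F n in sequentially. s n \<in> U" using s(2) o x(1) by (rule topological_tendstoD)
    then have ev: "\<forall>\<^sub>F n in sequentially. f (s n) \<in> coord_plane I"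
      by eventually_elim (use flattens_memD(1)[OF fl] s(1) in blast)
    have "f x \<in> coord_plane I"
      by (rule Lim_in_closed_set[OF closed_subspace[OF subspace_coord_plane] ev _ lim]) simp
    then show ?thesis using flattens_memD(1)[OF fl x(1)] by blast
  qed
  define c where "c = 2 *\<^sub>R axis j 1 - f p"
  have fp: "f p \<in> coord_plane I" using flattens_memD(1)[OF fl I(2)] p by blast
  have cP: "c \<in> coord_plane I" using fp j by (auto simp: c_def coord_plane_def axis_def)
  have C: "C_k_on 1 (\<lambda>a. a + v) UNIV" for v :: "real ^ 'n"
    by (rule C_1_onI[of UNIV _ "\<lambda>_ v. v"]) (auto intro!: derivative_eq_intros continuous_intros)
  have "homeomorphism UNIV UNIV (\<lambda>a. a + c) (\<lambda>a. a + - c)"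
    by (rule homeomorphismI) (auto intro!: continuous_intros)
  then have "C_k_diffeo 1 UNIV UNIV (\<lambda>a. a + c) (\<lambda>a. a + - c)"
    unfolding C_k_diffeo_def using C[of c] C[of "- c"] by blast
  from C_1_diffeo_compose[OF C_1_diffeo_restrict[OF cd open_ball[of "f p" 1]] this]
  have d: "C_k_diffeo 1 (U \<inter> f -` ball (f p) 1 \<inter> f -` UNIV) (UNIV \<inter> (\<lambda>a. a + - c) -` (V \<inter> ball (f p) 1))
    ((\<lambda>a. a + c) \<circ> f) (g \<circ> (\<lambda>a. a + - c))" .
  have "flattens 1 (N \<union> M) (coord_half_plane I j) (U \<inter> f -` ball (f p) 1 \<inter> f -` UNIV)
    (UNIV \<inter> (\<lambda>a. a + - c) -` (V \<inter> ball (f p) 1)) ((\<lambda>a. a + c) \<circ> f) (g \<circ> (\<lambda>a. a + - c))"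
  proof (rule flattensI[OF d])
    fix y assume "y \<in> U \<inter> f -` ball (f p) 1 \<inter> f -` UNIV"
    then have y: "y \<in> U" "norm (f y - f p) < 1" by (auto simp: dist_norm norm_minus_commute)
    have "\<bar>(f y - f p) $ j\<bar> < 1" using y(2) component_le_norm_cart[of "f y - f p" j] by linarith
    then have "0 \<le> (f y + c) $ j" by (simp add: c_def axis_def)
    moreover have "f y + c \<in> coord_plane I \<longleftrightarrow> f y \<in> coord_plane I"
      using subspace_add[OF subspace_coord_plane _ cP, of "f y"] subspace_diff[OF subspace_coord_plane _ cP, of "f y + c"] by auto
    moreover have "y \<in> N \<union> M \<longleftrightarrow> y \<in> M" using closed[OF y(1)] N by blast
    ultimately show "y \<in> N \<union> M \<longleftrightarrow> ((\<lambda>a. a + c) \<circ> f) y \<in> coord_half_plane I j"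
      using flattens_memD(1)[OF fl y(1)] by (simp add: coord_half_plane_def)
  qed
  moreover have "p \<in> U \<inter> f -` ball (f p) 1 \<inter> f -` UNIV" using I(2) by simp
  ultimately show ?thesis using I(1) j by (intro exI conjI)
qed

theorem corollary3p10:
  fixes S :: "nat \<Rightarrow> real list set set"
    and X Y :: "(real ^ 'n) set"
    and k d :: nat
  assumes "o_minimal_structure S"
    and "definable S X" and "definable S Y"
    and "2 \<le> k"
    and "submanifold k d X" and "submanifold k (d + 1) Y"
    and "connected X" and "connected Y" and "connected_along X Y"
    and "X \<subseteq> closure Y - Y"
    and "openin (top_of_set (closure Y - Y)) X"
    and "cond_a Y X" and "cond_r_int k Y X"
  shows "submanifold_with_boundary 1 (d + 1) (X \<union> Y)"
  unfolding submanifold_with_boundary_def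
proof
  note chart = ex_wing_chart[OF assms(1-6,9-13)]
  have TL: "\<exists>F. subspace F \<and> dim F = d + 1 \<and> (\<forall>v\<in>F. \<forall>\<epsilon>>0. \<exists>\<delta>>0. \<forall>y\<in>Y. norm (y - x) < \<delta> -->
    (\<exists>w\<in>tangent_space Y y. norm (v - w) \<le> \<epsilon>))" if "x \<in> X" for x
    using chart[OF that] wing_chart.limit_tangent by blast
  fix p assume "p \<in> X \<union> Y"
  then consider "p \<in> X" | "p \<in> Y" by blast
  then show "\<exists>I j U V f g. card I = d + 1 \<and> j \<in> I \<and> p \<in> U \<and> flattens 1 (X \<union> Y) (coord_half_plane I j) U V f g"
  proof cases
    case 1
    obtain I U V f g L r where "wing_chart S X Y k d p I U V f g L r" using chart[OF 1] by blast
    from wing_chart.boundary_chart[OF this zero_less_one TL] show ?thesis .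
  next
    case 2
    have "1 \<le> k" using assms(4) by simp
    show ?thesis
      by (rule submanifold_interior_chart[OF submanifold_le[OF assms(6) \<open>1 \<le> k\<close>] _ 2 assms(10)]) simp
  qed
qed

end
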